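(* There exist absolute constants $c>1$ and $C>0$ such that the following holds. Let $n,d,k\ge 1$ be integers, $\Omega=[-1,1]^d$, $\varepsilon\in(n^{-1},1)$, $\delta\in(0,1)$, and assume $$\frac{\varepsilon n}{\sqrt{\log(1.25/\delta)}}\ \ge\ (ck)^{\max\{d,k\}}.$$ Then there exists a polynomial-time (i.e. with running time polynomial in $n$ for fixed $k,d$) $(\varepsilon,\delta)$-differentially private algorithm which, for every input dataset $X\in\Omega^n$, outputs a synthetic dataset $Y\subseteq\Omega$ such that $$\mathbb{E}\, d_k(p_X,p_Y)\ \le\ \begin{cases} C_{d,k}\left(\dfrac{\sqrt{\log(1.25/\delta)}}{\varepsilon n}\right)^{k/d} & \text{if } k<d,\\[2mm] \dfrac{C_{d,k}\sqrt{\log(1.25/\delta)}\,\log(\varepsilon n)}{\varepsilon n} & \text{if } k=d,\\[2mm] \dfrac{C_{d,k}\sqrt{\log(1.25/\delta)}}{\varepsilon n} & \text{if } k>d,\end{cases}$$ where the constant $C_{d,k}$ depends only on $d,k$ and satisfies $C_{d,k}\le (Ck)^k d^{\max\{1,k/2\}}$. The expectation is over the randomness of the algorithm.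
   Context: A synthetic dataset $Y\subseteq \Omega$ is a (random) nonempty finite multiset of points of $\Omega$; its size need not be $n$. For a finite dataset $X=(x_1,\dots,x_N)$ of points of $\Omega$, its empirical distribution is $p_X=\frac1N\sum_{j=1}^N\delta_{x_j}$. A randomized algorithm $\mathcal M:\Omega^n\to\mathcal Z$ is $(\varepsilon,\delta)$-differentially private if for all $X,X'\in\Omega^n$ that differ in at most one entry and all measurable $S\subseteq\mathcal Z$, $\mathbb P(\mathcal M(X)\in S)\le e^{\varepsilon}\,\mathbb P(\mathcal M(X')\in S)+\delta$. For an integer $k\ge1$, $$\mathcal F_k=\Bigl\{f\in C^k([-1,1]^d;\mathbb R):\ \max_{0\le|\alpha|\le k}\|\partial^\alpha f\|_\infty\le 1\Bigr\},$$ where $\alpha\in\{0,1,2,\dots\}^d$ is a multi-index with $|\alpha|=\sum_i\alpha_i$, and for probability distributions $p,q$ on $[-1,1]^d$, $$d_k(p,q)=\sup_{f\in\mathcal F_k}\left|\int f\,dp-\int f\,dq\right|.$$ *)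

theory Defs
  imports "HOL-Probability.Probability" "HOL-Computational_Algebra.Polynomial"
begin

section \<open>The cube and smooth functions on it\<close>

text \<open>
  A point of \<open>[-1,1]^d\<close> is an extensional function on \<open>{..<d}\<close>, because the dimension \<open>d\<close> is
  quantified inside the theorem. The values of a function outside \<open>cube d\<close> are irrelevant to all
  notions below.
\<close>

definition cube :: "nat \<Rightarrow> (nat \<Rightarrow> real) set" where
  "cube d = ({..<d} \<rightarrow>\<^sub>E {-1..1})"

definition pdiff :: "nat \<Rightarrow> ((nat \<Rightarrow> real) \<Rightarrow> real) \<Rightarrow> (nat \<Rightarrow> real) \<Rightarrow> real" where
  "pdiff i f x = vector_derivative (\<lambda>t. f (x(i := t))) (at (x i) within {-1..1})"

text \<open>
  Smoothness up to the boundary: partial derivatives are one-sided on the faces of the cube, and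
  all partial derivatives of order at most \<open>k\<close> exist and are continuous on the closed cube.
\<close>

primrec Ck_on_cube :: "nat \<Rightarrow> nat \<Rightarrow> ((nat \<Rightarrow> real) \<Rightarrow> real) \<Rightarrow> bool" where
  "Ck_on_cube d 0 f \<longleftrightarrow> continuous_on (cube d) f"
| "Ck_on_cube d (Suc k) f \<longleftrightarrow> continuous_on (cube d) f \<and>
     (\<forall>i<d. (\<forall>x\<in>cube d. (\<lambda>t. f (x(i := t))) differentiable (at (x i) within {-1..1})) \<and>
            Ck_on_cube d k (pdiff i f))"

definition mdiff :: "nat \<Rightarrow> (nat \<Rightarrow> nat) \<Rightarrow> ((nat \<Rightarrow> real) \<Rightarrow> real) \<Rightarrow> (nat \<Rightarrow> real) \<Rightarrow> real" where
  "mdiff d \<alpha> f = fold (\<lambda>i. pdiff i ^^ \<alpha> i) [0..<d] f"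

definition smooth_ball :: "nat \<Rightarrow> nat \<Rightarrow> ((nat \<Rightarrow> real) \<Rightarrow> real) set" where
  "smooth_ball d k = {f. Ck_on_cube d k f \<and>
     (\<forall>\<alpha>. (\<Sum>i<d. \<alpha> i) \<le> k \<longrightarrow> (\<forall>x\<in>cube d. \<bar>mdiff d \<alpha> f x\<bar> \<le> 1))}"

definition dk :: "nat \<Rightarrow> nat \<Rightarrow> (nat \<Rightarrow> real) measure \<Rightarrow> (nat \<Rightarrow> real) measure \<Rightarrow> real" where
  "dk d k p q = (SUP f\<in>smooth_ball d k. \<bar>(\<integral>x. f x \<partial>p) - (\<integral>x. f x \<partial>q)\<bar>)"

definition empirical :: "'a multiset \<Rightarrow> 'a measure" where
  "empirical Y = measure_pmf (pmf_of_multiset Y)"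


section \<open>Datasets and differential privacy\<close>

definition datasets :: "nat \<Rightarrow> 'a set \<Rightarrow> 'a list set" where
  "datasets n \<Omega> = {X. length X = n \<and> set X \<subseteq> \<Omega>}"

definition differentially_private ::
    "'a set \<Rightarrow> nat \<Rightarrow> 'z measure \<Rightarrow> real \<Rightarrow> real \<Rightarrow> ('a list \<Rightarrow> 'z measure) \<Rightarrow> bool" where
  "differentially_private \<Omega> n Z \<epsilon> \<delta> M \<longleftrightarrow>
     (\<forall>X\<in>datasets n \<Omega>. prob_space (M X) \<and> sets (M X) = sets Z) \<and>
     (\<forall>X\<in>datasets n \<Omega>. \<forall>X'\<in>datasets n \<Omega>. card {i. i < n \<and> X ! i \<noteq> X' ! i} \<le> 1 \<longrightarrow>
        (\<forall>S\<in>sets Z. measure (M X) S \<le> exp \<epsilon> * measure (M X') S + \<delta>))"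

definition cube_space :: "nat \<Rightarrow> (nat \<Rightarrow> real) measure" where
  "cube_space d = (\<Pi>\<^sub>M i\<in>{..<d}. restrict_space borel {-1..1})"

text \<open>
  Nonempty finite multisets of points of the cube, with the finest \<open>\<sigma>\<close>-algebra that makes the
  maps \<open>(x\<^sub>0,\<dots>,x\<^sub>m\<^sub>-\<^sub>1) \<mapsto> {#x\<^sub>0,\<dots>,x\<^sub>m\<^sub>-\<^sub>1#}\<close>, for \<open>m \<ge> 1\<close>, measurable.
\<close>

definition synthetic_datasets :: "nat \<Rightarrow> (nat \<Rightarrow> real) multiset set" where
  "synthetic_datasets d = {Y. Y \<noteq> {#} \<and> set_mset Y \<subseteq> cube d}"

definition dataset_space :: "nat \<Rightarrow> (nat \<Rightarrow> real) multiset measure" where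
  "dataset_space d = sigma (synthetic_datasets d)
     {S. S \<subseteq> synthetic_datasets d \<and>
         (\<forall>m. (\<lambda>x. mset (map x [0..<m])) -` S \<inter> space (\<Pi>\<^sub>M j\<in>{..<m}. cube_space d)
              \<in> sets (\<Pi>\<^sub>M j\<in>{..<m}. cube_space d))}"

lemma cube_space_space: "space (cube_space d) = cube d"
  by (simp add: cube_space_def cube_def space_PiM space_restrict_space)

lemma sigma_algebra_final:
  assumes "\<And>m. h m -` D \<inter> space (M m) \<in> sets (M m)"
  shows "sigma_algebra D {S. S \<subseteq> D \<and> (\<forall>m. h m -` S \<inter> space (M m) \<in> sets (M m))}"
proof (rule sigma_algebra_iff2[THEN iffD2], intro conjI ballI allI impI)
  fix S assume S: "S \<in> {S. S \<subseteq> D \<and> (\<forall>m. h m -` S \<inter> space (M m) \<in> sets (M m))}"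
  have "h m -` (D - S) \<inter> space (M m) \<in> sets (M m)" for m
  proof -
    have "h m -` (D - S) \<inter> space (M m) = (h m -` D \<inter> space (M m)) - (h m -` S \<inter> space (M m))"
      by blast
    then show ?thesis
      using S assms[of m] by (simp add: sets.Diff)
  qed
  then show "D - S \<in> {S. S \<subseteq> D \<and> (\<forall>m. h m -` S \<inter> space (M m) \<in> sets (M m))}"
    by blast
next
  fix F :: "nat \<Rightarrow> _"
  assume F: "range F \<subseteq> {S. S \<subseteq> D \<and> (\<forall>m. h m -` S \<inter> space (M m) \<in> sets (M m))}"
  have "h m -` (\<Union>i. F i) \<inter> space (M m) \<in> sets (M m)" for m
  proof -
    have *: "h m -` (\<Union>i. F i) \<inter> space (M m) = (\<Union>i. h m -` F i \<inter> space (M m))"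
      by blast
    show ?thesis
      unfolding * using F by (intro sets.countable_UN) blast
  qed
  moreover have "(\<Union>i. F i) \<subseteq> D"
    using F by blast
  ultimately show "(\<Union>i. F i) \<in> {S. S \<subseteq> D \<and> (\<forall>m. h m -` S \<inter> space (M m) \<in> sets (M m))}"
    by blast
qed auto

lemma sets_dataset_space:
  "sets (dataset_space d) =
     {S. S \<subseteq> synthetic_datasets d \<and>
         (\<forall>m. (\<lambda>x. mset (map x [0..<m])) -` S \<inter> space (\<Pi>\<^sub>M j\<in>{..<m}. cube_space d)
              \<in> sets (\<Pi>\<^sub>M j\<in>{..<m}. cube_space d))}"
  unfolding dataset_space_def
proof (intro sigma_algebra.sets_measure_of_eq sigma_algebra_final)
  fix m :: nat
  let ?M = "\<Pi>\<^sub>M j\<in>{..<m}. cube_space d"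
  let ?V = "(\<lambda>x. mset (map x [0..<m])) -` synthetic_datasets d \<inter> space ?M"
  have *: "mset (map x [0..<m]) \<in> synthetic_datasets d \<longleftrightarrow> m \<noteq> 0" if "x \<in> space ?M" for x
  proof -
    have "x i \<in> cube d" if "i < m" for i
      using PiE_mem[of x "{..<m}" "\<lambda>_. cube d" i] \<open>x \<in> space ?M\<close> that
      by (simp add: space_PiM cube_space_space)
    then have "set (map x [0..<m]) \<subseteq> cube d"
      by auto
    then show ?thesis
      unfolding synthetic_datasets_def mem_Collect_eq set_mset_mset mset_zero_iff
      by (simp del: set_map)
  qed
  show "?V \<in> sets ?M"
  proof (cases "m = 0")
    case True
    then have "?V = {}"
      by (simp add: synthetic_datasets_def)
    then show ?thesis
      by (simp only: sets.empty_sets)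
  next
    case False
    then have "?V = space ?M"
      using * by blast
    then show ?thesis
      by (simp only: sets.top)
  qed
qed

lemma space_dataset_space: "space (dataset_space d) = synthetic_datasets d"
  unfolding dataset_space_def by (intro space_measure_of) auto


section \<open>Randomized real-RAM programs\<close>

text \<open>
  The model of computation is a real RAM with random draws, programmed in a WHILE language. The
  memory consists of one-dimensional arrays of natural numbers and two-dimensional arrays of real
  numbers. Natural numbers can be added and subtracted (truncated) and serve as
  indices. On real numbers there are exact field operations, square root, logarithm and
  comparison. There is deliberately no rounding of reals to integers, no multiplication of
  indices and no real constant other than those a program can compute: at unit cost these would
  make the machine unreasonably strong or give it advice. As in the library, the partial
  operations are totalized (such as \<open>x / 0 = 0\<close>).
\<close>

datatype nexp =
    NConst nat
  | NGet string nexp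
  | NAdd nexp nexp
  | NSub nexp nexp

datatype rexp =
    ROf nexp
  | RGet string nexp nexp
  | RAdd rexp rexp
  | RSub rexp rexp
  | RMul rexp rexp
  | RDiv rexp rexp
  | RSqrt rexp
  | RLn rexp

datatype bexp =
    NLess nexp nexp
  | RLess rexp rexp
  | BNot bexp
  | BAnd bexp bexp

datatype com =
    Skip
  | NSet string nexp nexp
  | RSet string nexp nexp rexp
  | DrawUniform string nexp nexp
  | DrawNormal string nexp nexp
  | Seq com com
  | Cond bexp com com
  | While bexp com

text \<open>The field \<open>draws\<close> counts the random draws made so far.\<close>

record state =
  nmem :: "string \<Rightarrow> nat \<Rightarrow> nat"
  rmem :: "string \<Rightarrow> nat \<Rightarrow> nat \<Rightarrow> real"
  draws :: nat

primrec nval :: "nexp \<Rightarrow> state \<Rightarrow> nat" where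
  "nval (NConst m) s = m"
| "nval (NGet a e) s = nmem s a (nval e s)"
| "nval (NAdd e e') s = nval e s + nval e' s"
| "nval (NSub e e') s = nval e s - nval e' s"

primrec rval :: "rexp \<Rightarrow> state \<Rightarrow> real" where
  "rval (ROf e) s = real (nval e s)"
| "rval (RGet a e e') s = rmem s a (nval e s) (nval e' s)"
| "rval (RAdd r r') s = rval r s + rval r' s"
| "rval (RSub r r') s = rval r s - rval r' s"
| "rval (RMul r r') s = rval r s * rval r' s"
| "rval (RDiv r r') s = rval r s / rval r' s"
| "rval (RSqrt r) s = sqrt (rval r s)"
| "rval (RLn r) s = ln (rval r s)"

primrec bval :: "bexp \<Rightarrow> state \<Rightarrow> bool" where
  "bval (NLess e e') s \<longleftrightarrow> nval e s < nval e' s"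
| "bval (RLess r r') s \<longleftrightarrow> rval r s < rval r' s"
| "bval (BNot b) s \<longleftrightarrow> \<not> bval b s"
| "bval (BAnd b b') s \<longleftrightarrow> bval b s \<and> bval b' s"

definition nset :: "string \<Rightarrow> nat \<Rightarrow> nat \<Rightarrow> state \<Rightarrow> state" where
  "nset a i v s = s\<lparr>nmem := (nmem s)(a := (nmem s a)(i := v))\<rparr>"

definition rset :: "string \<Rightarrow> nat \<Rightarrow> nat \<Rightarrow> real \<Rightarrow> state \<Rightarrow> state" where
  "rset a i j v s = s\<lparr>rmem := (rmem s)(a := (rmem s a)(i := (rmem s a i)(j := v)))\<rparr>"

definition drawn :: "state \<Rightarrow> state" where
  "drawn s = s\<lparr>draws := Suc (draws s)\<rparr>"

text \<open>
  \<open>exec \<omega> c s t s'\<close>: with random tape \<open>\<omega>\<close>, command \<open>c\<close> started in \<open>s\<close> halts in \<open>s'\<close> after \<open>t\<close>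
  steps. Every assignment, draw and test costs one step; since the expressions of a fixed program
  have bounded size, charging for each arithmetic operation would change \<open>t\<close> by at most a constant
  factor.
\<close>

inductive exec :: "(nat \<Rightarrow> real \<times> real) \<Rightarrow> com \<Rightarrow> state \<Rightarrow> nat \<Rightarrow> state \<Rightarrow> bool"
  for \<omega> :: "nat \<Rightarrow> real \<times> real" where
  Skip: "exec \<omega> Skip s 1 s"
| NSet: "exec \<omega> (NSet a e r) s 1 (nset a (nval e s) (nval r s) s)"
| RSet: "exec \<omega> (RSet a e e' r) s 1 (rset a (nval e s) (nval e' s) (rval r s) s)"
| DrawUniform:
    "exec \<omega> (DrawUniform a e e') s 1 (drawn (rset a (nval e s) (nval e' s) (fst (\<omega> (draws s))) s))"
| DrawNormal:
    "exec \<omega> (DrawNormal a e e') s 1 (drawn (rset a (nval e s) (nval e' s) (snd (\<omega> (draws s))) s))"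
| Seq: "exec \<omega> c s t s' \<Longrightarrow> exec \<omega> c' s' t' s'' \<Longrightarrow> exec \<omega> (Seq c c') s (t + t') s''"
| CondTrue: "bval b s \<Longrightarrow> exec \<omega> c s t s' \<Longrightarrow> exec \<omega> (Cond b c c') s (Suc t) s'"
| CondFalse: "\<not> bval b s \<Longrightarrow> exec \<omega> c' s t s' \<Longrightarrow> exec \<omega> (Cond b c c') s (Suc t) s'"
| WhileFalse: "\<not> bval b s \<Longrightarrow> exec \<omega> (While b c) s 1 s"
| WhileTrue: "bval b s \<Longrightarrow> exec \<omega> c s t s' \<Longrightarrow> exec \<omega> (While b c) s' t' s'' \<Longrightarrow>
    exec \<omega> (While b c) s (Suc (t + t')) s''"

inductive_cases exec_SkipE: "exec \<omega> Skip s t s'"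
  and exec_NSetE: "exec \<omega> (NSet a e r) s t s'"
  and exec_RSetE: "exec \<omega> (RSet a e e' r) s t s'"
  and exec_DrawUniformE: "exec \<omega> (DrawUniform a e e') s t s'"
  and exec_DrawNormalE: "exec \<omega> (DrawNormal a e e') s t s'"
  and exec_SeqE: "exec \<omega> (Seq c c') s t s'"
  and exec_CondE: "exec \<omega> (Cond b c c') s t s'"
  and exec_WhileE: "exec \<omega> (While b c) s t s'"

lemma exec_deterministic:
  "exec \<omega> c s t s' \<Longrightarrow> exec \<omega> c s u s'' \<Longrightarrow> t = u \<and> s' = s''"
proof (induction arbitrary: u s'' rule: exec.induct)
  case (Seq c s t s' c' t' s2)
  from Seq.prems show ?case by (rule exec_SeqE) (metis Seq.IH)
next
  case (CondTrue b s c t s' c')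
  from CondTrue.prems show ?case by (rule exec_CondE) (metis CondTrue.IH CondTrue.hyps)+
next
  case (CondFalse b s c' t s' c)
  from CondFalse.prems show ?case by (rule exec_CondE) (metis CondFalse.IH CondFalse.hyps)+
next
  case (WhileFalse b s c)
  from WhileFalse.prems show ?case by (rule exec_WhileE) (use WhileFalse.hyps in simp_all)
next
  case (WhileTrue b s c t s' t' s2)
  from WhileTrue.prems show ?case by (rule exec_WhileE) (metis WhileTrue.IH WhileTrue.hyps)+
qed (auto elim: exec_SkipE exec_NSetE exec_RSetE exec_DrawUniformE exec_DrawNormalE)

definition halts_within :: "nat \<Rightarrow> (nat \<Rightarrow> real \<times> real) \<Rightarrow> com \<Rightarrow> state \<Rightarrow> bool" where
  "halts_within T \<omega> c s \<longleftrightarrow> (\<exists>t s'. t \<le> T \<and> exec \<omega> c s t s')"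

definition final_state :: "(nat \<Rightarrow> real \<times> real) \<Rightarrow> com \<Rightarrow> state \<Rightarrow> state" where
  "final_state \<omega> c s = (THE s'. \<exists>t. exec \<omega> c s t s')"

lemma final_state_eq: "exec \<omega> c s t s' \<Longrightarrow> final_state \<omega> c s = s'"
  unfolding final_state_def by (rule the_equality) (auto dest: exec_deterministic)

text \<open>
  The tape: independent pairs of independent draws, one uniform on \<open>[0,1]\<close> and one standard normal.
\<close>

definition tape :: "(nat \<Rightarrow> real \<times> real) measure" where
  "tape = (\<Pi>\<^sub>M i\<in>UNIV. uniform_measure lborel {0..1} \<Otimes>\<^sub>M density lborel std_normal_density)"

text \<open>
  Input and output conventions: the numbers are passed in entry \<open>0\<close> (or \<open>(0,0)\<close>) of the arrays
  named below, point \<open>i\<close> of the input dataset is row \<open>i\<close> of \<open>''X''\<close>, and the output consists of the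
  first \<open>nmem s ''N'' 0\<close> rows of \<open>''Y''\<close>, each truncated to \<open>d\<close> coordinates. All other memory is
  initially \<open>0\<close>.
\<close>

definition init_state :: "nat \<Rightarrow> nat \<Rightarrow> real \<Rightarrow> real \<Rightarrow> (nat \<Rightarrow> real) list \<Rightarrow> state" where
  "init_state d k \<epsilon> \<delta> X =
     \<lparr>nmem = (\<lambda>_ _. 0)(''n'' := (\<lambda>_. 0)(0 := length X), ''d'' := (\<lambda>_. 0)(0 := d),
                       ''k'' := (\<lambda>_. 0)(0 := k)),
      rmem = (\<lambda>_ _ _. 0)
        (''eps'' := (\<lambda>i j. if i = 0 \<and> j = 0 then \<epsilon> else 0),
         ''delta'' := (\<lambda>i j. if i = 0 \<and> j = 0 then \<delta> else 0),
         ''X'' := (\<lambda>i j. if i < length X \<and> j < d then (X ! i) j else 0)),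
      draws = 0\<rparr>"

definition output_dataset :: "nat \<Rightarrow> state \<Rightarrow> (nat \<Rightarrow> real) multiset" where
  "output_dataset d s = mset (map (\<lambda>i. restrict (rmem s ''Y'' i) {..<d}) [0..<nmem s ''N'' 0])"

definition synthesize ::
    "com \<Rightarrow> nat \<Rightarrow> nat \<Rightarrow> real \<Rightarrow> real \<Rightarrow> (nat \<Rightarrow> real) list \<Rightarrow> (nat \<Rightarrow> real \<times> real) \<Rightarrow>
     (nat \<Rightarrow> real) multiset" where
  "synthesize A d k \<epsilon> \<delta> X \<omega> = output_dataset d (final_state \<omega> A (init_state d k \<epsilon> \<delta> X))"

definition mechanism ::
    "com \<Rightarrow> nat \<Rightarrow> nat \<Rightarrow> real \<Rightarrow> real \<Rightarrow> (nat \<Rightarrow> real) list \<Rightarrow> (nat \<Rightarrow> real) multiset measure" where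
  "mechanism A d k \<epsilon> \<delta> X = distr tape (dataset_space d) (synthesize A d k \<epsilon> \<delta> X)"

end

theory Submission
  imports Defs
begin

text \<open>
  The algorithm releases the Chebyshev moments of \<open>p\<^sub>X\<close> of degree at most \<open>R\<close> in each variable, where
  \<open>(8 R)\<^sup>d\<close> is about \<open>\<epsilon> n / \<surd>(log (1.25/\<delta>))\<close>, with Gaussian noise. The moment of index \<open>j\<close> gets standard
  deviation proportional to \<open>r\<^sup>k\<^sup>/\<^sup>2\<close> with \<open>r = max\<^sub>i j\<^sub>i\<close>, and the sensitivity is controlled by
  \<open>\<Sum>\<^sub>j r\<^sup>-\<^sup>k\<close>; the three regimes come from this sum. The synthetic dataset is found by herding: grid points
  are chosen greedily so that the moments of the chosen points track the noisy ones. This takes time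
  polynomial in \<open>n\<close> and costs an error of smaller order.

  A function \<open>f\<close> of the smooth ball is compared with a Chebyshev polynomial of degree \<open>R\<close>, obtained by
  averaging the even function \<open>\<theta> \<mapsto> f (cos \<theta>)\<close> against a discrete kernel in each variable. The kernel has
  norm \<open>1 + O(1/d)\<close>, so that the error grows only polynomially with \<open>d\<close>. By Parseval, the
  coefficients \<open>a\<^sub>j\<close> of the polynomial satisfy a bound on \<open>\<Sum>\<^sub>j r\<^sup>2\<^sup>k a\<^sub>j\<^sup>2\<close>; pairing them with the moment
  errors by Cauchy-Schwarz bounds \<open>d\<^sub>k\<close> uniformly over the ball.
\<close>

section \<open>Averaging kernels on a cyclic grid\<close>

text \<open>The difficulty is the dependence on \<open>d\<close>. The final constant must stay
  polynomial in \<open>d\<close> for fixed \<open>k\<close>, while Parseval and the count of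
  multi-indices each cost \<open>2 ^ d\<close>. The factor 8 in the degree pays for this: for
  \<open>k < d\<close> the noise term gains \<open>1 / 8 ^ d\<close>, and for \<open>d <= k\<close>
  the factor \<open>4 ^ d\<close> fits into \<open>(C k) ^ k\<close>. The 16 in the hypothesis then
  ensures \<open>R >= 1\<close>.

  The noise exponent \<open>k/2\<close> is the optimal one. For standard deviations
  \<open>s_J\<close>, privacy bounds the sum of \<open>1 / s_J^2\<close>, while the error is
  governed by the sum of \<open>s_J^2 / r^(2k)\<close>. Minimizing the latter under the former gives
  \<open>s_J^2\<close> proportional to \<open>r^k\<close>, and both sums become multiples of the sum
  of \<open>r^(-k)\<close>.

  Fourier analysis is done with finite sums over \<open>2H + 1\<close> equispaced angles instead of
  integrals. The coefficients found depend on \<open>H\<close>, their bounds do not, so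
  \<open>H\<close> can be taken large at the end to pass from grid angles to all angles at an
  arbitrarily small cost.\<close>

lemma jordan_sin:
  fixes y :: real
  assumes "0 \<le> y" "y \<le> pi / 2"
  shows "2 / pi * y \<le> sin y"
proof -
  have "convex_on {0..pi/2} (\<lambda>x::real. - sin x)"
    by (rule f''_ge0_imp_convex[where f' = "\<lambda>x. - cos x" and f'' = "\<lambda>x. sin x"])
       (auto intro!: derivative_eq_intros sin_ge_zero)
  from convex_onD[OF this, of "2/pi*y" 0 "pi/2"] assms
  show ?thesis by (simp add: field_simps)
qed

text \<open>This bound serves twice: it turns a deficit in the first Fourier coefficient of a
  positive kernel into a bound on its second moment, and it bounds the eigenvalues of differences
  from below in the coefficient estimate.\<close>

lemma one_minus_cos_ge:
  fixes x :: real
  assumes "\<bar>x\<bar> \<le> pi"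
  shows "2 / pi\<^sup>2 * x\<^sup>2 \<le> 1 - cos x"
proof -
  have "2 / pi * (\<bar>x\<bar> / 2) \<le> sin (\<bar>x\<bar> / 2)"
    using assms by (intro jordan_sin) auto
  then have "(2 / pi * (\<bar>x\<bar> / 2))\<^sup>2 \<le> (sin (\<bar>x\<bar> / 2))\<^sup>2"
    by (intro power_mono) auto
  moreover have "1 - cos x = 2 * (sin (\<bar>x\<bar> / 2))\<^sup>2"
    using cos_double_sin[of "\<bar>x\<bar> / 2"] by simp
  ultimately show ?thesis
    by (simp add: power_mult_distrib power_divide)
qed

lemma one_minus_cos_le:
  fixes x :: real
  shows "1 - cos x \<le> x\<^sup>2 / 2"
proof -
  have "\<bar>sin (x / 2)\<bar> \<le> \<bar>x / 2\<bar>" by (rule abs_sin_x_le_abs_x)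
  then have "(sin (x / 2))\<^sup>2 \<le> (x / 2)\<^sup>2"
    by (simp only: abs_le_square_iff)
  then show ?thesis
    using cos_double_sin[of "x / 2"] by (simp add: power_divide)
qed

section \<open>Discrete Fourier analysis on a cyclic grid\<close>

locale cyclic_grid =
  fixes H :: nat
begin

text \<open>An odd number of nodes makes the index range symmetric about 0, so that odd summands
  cancel with no unpaired node. \<open>lam\<close> is the mesh of the angles.\<close>

definition "M = 2 * real H + 1"
definition "lam = 2 * pi / M"
definition "rng = {- int H..int H}"

lemma M_pos [simp]: "0 < M" by (simp add: M_def)
lemma M_nz [simp]: "M \<noteq> 0" using M_pos by linarith
lemma lam_pos [simp]: "0 < lam" by (simp add: lam_def)
lemma finite_rng [simp]: "finite rng" by (simp add: rng_def)
lemma card_rng: "real (card rng) = M" by (simp add: rng_def M_def)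
lemma lam_M: "lam * M = 2 * pi" by (simp add: lam_def)

lemma sum_rng_uminus: "(\<Sum>s\<in>rng. f (- s)) = (\<Sum>s\<in>rng. f s)"
  by (rule sum.reindex_bij_witness[where i = uminus and j = uminus]) (auto simp: rng_def)

text \<open>Functions on the cyclic group are modelled as periodic functions on all of
  \<open>int\<close>: a translate is plain addition, without reduction modulo the number of
  nodes.\<close>

definition "periodic f \<longleftrightarrow> (\<forall>s::int. f (s + (2 * int H + 1)) = f s)"

lemma periodicD: "periodic f \<Longrightarrow> f (s + (2 * int H + 1)) = f s"
  by (auto simp: periodic_def)

lemma sum_rng_shift1:
  fixes f :: "int \<Rightarrow> 'a::ab_group_add"
  assumes "periodic f"
  shows "(\<Sum>s\<in>rng. f (s + 1)) = (\<Sum>s\<in>rng. f s)"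
proof -
  have "(\<Sum>s\<in>rng. f (s + 1)) = (\<Sum>s\<in>{- int H + 1..int H + 1}. f s)"
    by (rule sum.reindex_bij_witness[where i = "\<lambda>s. s - 1" and j = "\<lambda>s. s + 1"]) (auto simp: rng_def)
  also have "{- int H + 1..int H + 1} = insert (int H + 1) {- int H + 1..int H}" by auto
  also have "(\<Sum>s\<in>\<dots>. f s) = f (int H + 1) + (\<Sum>s\<in>{- int H + 1..int H}. f s)"
    by (subst sum.insert) auto
  also have "f (int H + 1) = f (- int H)"
    using periodicD[OF assms, of "- int H"] by (simp add: algebra_simps)
  also have "f (- int H) + (\<Sum>s\<in>{- int H + 1..int H}. f s) = (\<Sum>s\<in>insert (- int H) {- int H +
      1..int H}. f s)"
    by (subst sum.insert) auto
  also have "insert (- int H) {- int H + 1..int H} = rng" by (auto simp: rng_def)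
  finally show ?thesis .
qed

lemma periodic_shift: "periodic f \<Longrightarrow> periodic (\<lambda>s. f (s + t))"
  unfolding periodic_def by (metis add.assoc add.commute)

lemma sum_rng_shift:
  fixes f :: "int \<Rightarrow> 'a::ab_group_add"
  assumes "periodic f"
  shows "(\<Sum>s\<in>rng. f (s + t)) = (\<Sum>s\<in>rng. f s)"
proof (induction t rule: int_induct[where k = 0])
  case (step1 i)
  then show ?case
    using sum_rng_shift1[OF periodic_shift[OF assms, of i]] by (simp add: algebra_simps)
next
  case (step2 i)
  then show ?case
    using sum_rng_shift1[OF periodic_shift[OF assms, of "i - 1"]] by (simp add: algebra_simps)
qed auto

lemma cis_periodic: "periodic (\<lambda>s. cis (of_int j * lam * of_int s))"
  unfolding periodic_def
proof
  fix s
  have "of_int j * lam * of_int (s + (2 * int H + 1)) = of_int j * lam * of_int s + 2 * pi * of_int j"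
  proof -
    have "of_int j * lam * of_int (s + (2 * int H + 1)) = of_int j * lam * of_int s + of_int j * (lam * M)"
      by (simp add: M_def algebra_simps)
    then show ?thesis by (simp add: lam_M)
  qed
  then show "cis (of_int j * lam * of_int (s + (2 * int H + 1))) = cis (of_int j * lam * of_int s)"
    by (simp add: cis_mult[symmetric])
qed

lemma cos_periodic: "periodic (\<lambda>s. cos (of_int j * lam * of_int s))"
  using cis_periodic[of j] unfolding periodic_def by (metis cis.simps(1))

text \<open>Multiplying the sum by \<open>cis (j * lam)\<close> only translates the grid, so the sum
  vanishes unless that factor is 1. The bound on \<open>j\<close> excludes aliasing: apart from 0,
  no multiple of \<open>M\<close> is that small.\<close>

lemma cis_sum:
  assumes "\<bar>real_of_int j\<bar> < M"
  shows "(\<Sum>s\<in>rng. cis (of_int j * lam * of_int s)) = (if j = 0 then of_real M else 0)"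
proof (cases "j = 0")
  case True
  have "complex_of_real (real (card rng)) = of_real M" by (simp only: card_rng)
  with True show ?thesis by simp
next
  case False
  let ?S = "\<Sum>s\<in>rng. cis (of_int j * lam * of_int s)"
  have "cis (of_int j * lam) * ?S = (\<Sum>s\<in>rng. cis (of_int j * lam * of_int (s + 1)))"
    by (simp add: sum_distrib_left cis_mult algebra_simps)
  also have "\<dots> = ?S" by (rule sum_rng_shift1[OF cis_periodic])
  finally have *: "(cis (of_int j * lam) - 1) * ?S = 0" by (simp add: algebra_simps)
  have "cis (of_int j * lam) \<noteq> 1"
  proof
    assume "cis (of_int j * lam) = 1"
    then have "cos (of_int j * lam) = 1" by (metis cis.simps(1) one_complex.simps(1))
    then obtain m :: int where "of_int j * lam = of_int m * 2 * pi"
      by (auto simp: cos_one_2pi_int)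
    then have "real_of_int j = of_int m * M" by (simp add: lam_def field_simps)
    with assms False have "\<bar>of_int m * M\<bar> < M" "m \<noteq> 0" by auto
    then have "\<bar>real_of_int m\<bar> < 1" by (simp add: abs_mult abs_of_pos[OF M_pos])
    with \<open>m \<noteq> 0\<close> show False by linarith
  qed
  with * False show ?thesis by simp
qed

lemma cos_sum:
  assumes "\<bar>real_of_int j\<bar> < M"
  shows "(\<Sum>s\<in>rng. cos (of_int j * lam * of_int s)) = (if j = 0 then M else 0)"
proof -
  have "(\<Sum>s\<in>rng. cos (of_int j * lam * of_int s)) = Re (\<Sum>s\<in>rng. cis (of_int j * lam * of_int s))"
    by simp
  then show ?thesis by (simp add: cis_sum[OF assms])
qed

text \<open>For \<open>a = b = 0\<close> both indicators count: the constant has twice the squared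
  norm of the other cosines. This is the source of the factor \<open>2 ^ d\<close> in the
  coefficient bound.\<close>

lemma cos_cos_sum:
  assumes "\<bar>real_of_int a\<bar> + \<bar>real_of_int b\<bar> < M"
  shows "(\<Sum>s\<in>rng. cos (of_int a * lam * of_int s) * cos (of_int b * lam * of_int s))
    = M / 2 * ((if a = b then 1 else 0) + (if a = - b then 1 else 0))"
proof -
  have "cos (of_int a * lam * of_int s) * cos (of_int b * lam * of_int s) =
     (cos (of_int (a - b) * lam * of_int s) + cos (of_int (a + b) * lam * of_int s)) / 2" for s :: int
    by (simp add: cos_times_cos algebra_simps)
  then have "(\<Sum>s\<in>rng. cos (of_int a * lam * of_int s) * cos (of_int b * lam * of_int s))
    = ((\<Sum>s\<in>rng. cos (of_int (a - b) * lam * of_int s)) + (\<Sum>s\<in>rng. cos (of_int (a + b) * lam *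
        of_int s))) / 2"
    by (simp only: sum_divide_distrib[symmetric] sum.distrib)
  also have "\<dots> = M / 2 * ((if a = b then 1 else 0) + (if a = - b then 1 else 0))"
  proof -
    have "\<bar>real_of_int (a - b)\<bar> < M" "\<bar>real_of_int (a + b)\<bar> < M"
      using assms by (simp_all add: abs_real_def split: if_splits)
    from cos_sum[OF this(1)] cos_sum[OF this(2)] show ?thesis
      by (auto simp: add_divide_distrib)
  qed
  finally show ?thesis .
qed

definition trig :: "(nat \<Rightarrow> complex) \<Rightarrow> nat \<Rightarrow> int \<Rightarrow> complex" where
  "trig c n s = (\<Sum>j<n. c j * cis (of_nat j * lam * of_int s))"

lemma parseval_trig:
  assumes "real n \<le> M"
  shows "(\<Sum>s\<in>rng. (cmod (trig c n s))\<^sup>2) = M * (\<Sum>j<n. (cmod (c j))\<^sup>2)"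
proof -
  have e: "complex_of_real ((cmod (trig c n s))\<^sup>2) =
      (\<Sum>a<n. \<Sum>b<n. c a * cnj (c b) * cis (of_int (int a - int b) * lam * of_int s))" for s
    unfolding complex_norm_square trig_def cnj_sum sum_product
  proof (intro sum.cong refl)
    fix a b
    have *: "cis (real a * lam * of_int s) * cnj (cis (real b * lam * of_int s)) = cis (of_int (int a - int b) *
        lam * of_int s)"
      by (simp add: cis_cnj cis_mult left_diff_distrib)
    have "c a * cis (real a * lam * of_int s) * cnj (c b * cis (real b * lam * of_int s)) =
      c a * cnj (c b) * (cis (real a * lam * of_int s) * cnj (cis (real b * lam * of_int s)))"
      by (simp only: complex_cnj_mult mult_ac)
    then show "c a * cis (real a * lam * of_int s) * cnj (c b * cis (real b * lam * of_int s)) =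
      c a * cnj (c b) * cis (of_int (int a - int b) * lam * of_int s)"
      unfolding * .
  qed
  have "complex_of_real (\<Sum>s\<in>rng. (cmod (trig c n s))\<^sup>2) =
     (\<Sum>s\<in>rng. \<Sum>a<n. \<Sum>b<n. c a * cnj (c b) * cis (of_int (int a - int b) * lam * of_int s))"
    unfolding of_real_sum by (intro sum.cong refl e)
  also have "\<dots> = (\<Sum>a<n. \<Sum>s\<in>rng. \<Sum>b<n. c a * cnj (c b) * cis (of_int (int a - int b) * lam
      * of_int s))"
    by (rule sum.swap)
  also have "\<dots> = (\<Sum>a<n. \<Sum>b<n. \<Sum>s\<in>rng. c a * cnj (c b) * cis (of_int (int a - int b) * lam
      * of_int s))"
    by (intro sum.cong refl sum.swap)
  also have "\<dots> = (\<Sum>a<n. \<Sum>b<n. c a * cnj (c b) * (if a = b then of_real M else 0))"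
  proof (intro sum.cong refl)
    fix a b assume "a \<in> {..<n}" "b \<in> {..<n}"
    then have "\<bar>real_of_int (int a - int b)\<bar> < M" using assms by auto
    from cis_sum[OF this] show "(\<Sum>s\<in>rng. c a * cnj (c b) * cis (of_int (int a - int b) * lam * of_int s)) =
      c a * cnj (c b) * (if a = b then of_real M else 0)"
      by (simp add: sum_distrib_left[symmetric])
  qed
  also have "\<dots> = (\<Sum>a<n. c a * cnj (c a) * of_real M)"
    by (intro sum.cong refl) (simp add: if_distrib sum.delta cong: if_cong)
  also have "\<dots> = complex_of_real (M * (\<Sum>j<n. (cmod (c j))\<^sup>2))"
    by (simp add: sum_distrib_left sum_distrib_right complex_norm_square[symmetric] algebra_simps del: of_real_power)
  finally show ?thesis by (simp only: of_real_eq_iff)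
qed

text \<open>Squared moduli of trigonometric sums with real coefficients are at once nonnegative and
  cosine polynomials. Both positive kernels below are built in this way.\<close>

lemma cmod_trig_real:
  "(cmod (trig (\<lambda>j. of_real (a j)) n s))\<^sup>2 =
    (\<Sum>i<n. \<Sum>j<n. a i * a j * cos (of_int (int i - int j) * lam * of_int s))"
proof -
  have "(cmod (trig (\<lambda>j. of_real (a j)) n s))\<^sup>2 =
     (\<Sum>i<n. a i * cos (of_nat i * lam * of_int s)) * (\<Sum>i<n. a i * cos (of_nat i * lam * of_int s)) +
     (\<Sum>i<n. a i * sin (of_nat i * lam * of_int s)) * (\<Sum>i<n. a i * sin (of_nat i * lam * of_int s))"
    unfolding cmod_power2 trig_def by (simp add: power2_eq_square)
  also have "\<dots> = (\<Sum>i<n. \<Sum>j<n. a i * a j * cos (of_int (int i - int j) * lam * of_int s))"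
    unfolding sum_product sum.distrib[symmetric]
    by (intro sum.cong refl) (simp add: algebra_simps cos_diff)
  finally show ?thesis .
qed

text \<open>The degree of the kernel is what bounds the Chebyshev degree later: averaging against a
  kernel with this property yields, at the nodes, a cosine polynomial of degree at most
  \<open>R\<close>.\<close>

definition cospoly :: "nat \<Rightarrow> (int \<Rightarrow> real) \<Rightarrow> bool" where
  "cospoly R f \<longleftrightarrow> (\<exists>m. \<forall>s. f s = (\<Sum>j\<le>R. m j * cos (of_nat j * lam *
      of_int s)))"

lemma cospoly_cos: "j \<le> R \<Longrightarrow> cospoly R (\<lambda>s. cos (of_nat j * lam * of_int s))"
  unfolding cospoly_def
  by (rule exI[of _ "\<lambda>i. if i = j then 1 else 0"]) (simp add: if_distrib[of "\<lambda>x. x * _"] sum.delta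
      cong: if_cong)

lemma cospoly_add: "cospoly R f \<Longrightarrow> cospoly R g \<Longrightarrow> cospoly R (\<lambda>s. f s + g s)"
  unfolding cospoly_def
proof (elim exE)
  fix m m' assume "\<forall>s. f s = (\<Sum>j\<le>R. m j * cos (of_nat j * lam * of_int s))"
    "\<forall>s. g s = (\<Sum>j\<le>R. m' j * cos (of_nat j * lam * of_int s))"
  then show "\<exists>m. \<forall>s. f s + g s = (\<Sum>j\<le>R. m j * cos (of_nat j * lam * of_int s))"
    by (intro exI[of _ "\<lambda>j. m j + m' j"]) (simp add: algebra_simps sum.distrib)
qed

lemma cospoly_cmult: "cospoly R f \<Longrightarrow> cospoly R (\<lambda>s. c * f s)"
  unfolding cospoly_def
proof (elim exE)
  fix m assume "\<forall>s. f s = (\<Sum>j\<le>R. m j * cos (of_nat j * lam * of_int s))"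
  then show "\<exists>m. \<forall>s. c * f s = (\<Sum>j\<le>R. m j * cos (of_nat j * lam * of_int s))"
    by (intro exI[of _ "\<lambda>j. c * m j"]) (simp add: algebra_simps sum_distrib_left)
qed

lemma cospoly_zero: "cospoly R (\<lambda>s. 0)"
  unfolding cospoly_def by (rule exI[of _ "\<lambda>_. 0"]) simp

lemma cospoly_sum: "(\<And>i. i \<in> I \<Longrightarrow> cospoly R (f i)) \<Longrightarrow> cospoly R (\<lambda>s.
    \<Sum>i\<in>I. f i s)"
  by (induction I rule: infinite_finite_induct) (auto intro: cospoly_zero cospoly_add)

lemma cospoly_mono: "cospoly R f \<Longrightarrow> R \<le> R' \<Longrightarrow> cospoly R' f"
proof -
  assume "cospoly R f" and le: "R \<le> R'"
  then obtain m where m: "f s = (\<Sum>j\<le>R. m j * cos (of_nat j * lam * of_int s))" for s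
    unfolding cospoly_def by blast
  have e: "f = (\<lambda>s. \<Sum>j\<in>{..R}. m j * cos (of_nat j * lam * of_int s))" using m by blast
  show ?thesis unfolding e
    using le by (intro cospoly_sum cospoly_cmult cospoly_cos) auto
qed

lemma cospoly_even: "cospoly R f \<Longrightarrow> f (- s) = f s"
  unfolding cospoly_def by auto

lemma cospoly_periodic: "cospoly R f \<Longrightarrow> periodic f"
proof -
  assume "cospoly R f"
  then obtain m where m: "f s = (\<Sum>j\<le>R. m j * cos (of_nat j * lam * of_int s))" for s
    unfolding cospoly_def by blast
  show ?thesis unfolding periodic_def m
    by (intro allI sum.cong refl) (use cos_periodic[of "int _"] in \<open>simp add: periodic_def\<close>)
qed

lemma cospoly_cmod_trig:
  assumes "0 < n"
  shows "cospoly (n - 1) (\<lambda>s. (cmod (trig (\<lambda>j. of_real (a j)) n s))\<^sup>2)"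
  unfolding cmod_trig_real
proof (intro cospoly_sum cospoly_cmult)
  fix i j assume ij: "i \<in> {..<n}" "j \<in> {..<n}"
  have "cos (of_int (int i - int j) * lam * of_int s) = cos (of_nat (nat \<bar>int i - int j\<bar>) * lam * of_int
      s)" for s :: int
  proof (cases "j \<le> i")
    case True
    then show ?thesis by (simp add: of_nat_diff)
  next
    case False
    have "cos (of_int (int i - int j) * lam * of_int s) = cos (- (of_int (int i - int j) * lam * of_int s))"
      by (simp only: cos_minus)
    then show ?thesis using False by (simp add: algebra_simps of_nat_diff)
  qed
  moreover have "nat \<bar>int i - int j\<bar> \<le> n - 1" using ij by auto
  ultimately show "cospoly (n - 1) (\<lambda>s. cos (of_int (int i - int j) * lam * of_int s))"
    using cospoly_cos by presburger
qed

section \<open>The positive Fejer-Korovkin kernel\<close>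

definition korov :: "nat \<Rightarrow> nat \<Rightarrow> real" where
  "korov n j = sin (real (Suc j) * (pi / real (Suc n)))"

text \<open>Among squared moduli of degree \<open>n - 1\<close> this choice of weights puts the
  first Fourier coefficient within \<open>O(1 / n^2)\<close> of 1. The Fejer kernel only reaches
  \<open>1 - 1 / n\<close>, which would lose one order of approximation.\<close>

definition poskern :: "nat \<Rightarrow> int \<Rightarrow> real" where
  "poskern n s = (cmod (trig (\<lambda>j. of_real (korov n j)) n s))\<^sup>2 / (M * (\<Sum>j<n. (korov n j)\<^sup>2))"

lemma korov_sum_pos: "0 < n \<Longrightarrow> 0 < (\<Sum>j<n. (korov n j)\<^sup>2)"
proof -
  assume n: "0 < n"
  have "0 < korov n 0" unfolding korov_def using n
    by (intro sin_gt_zero) (auto simp: field_simps)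
  then have "0 < (korov n 0)\<^sup>2" by simp
  then show ?thesis
    using n by (intro sum_pos2[where i = 0]) auto
qed

lemma poskern_nonneg: "0 \<le> poskern n s"
  unfolding poskern_def by (intro divide_nonneg_nonneg mult_nonneg_nonneg sum_nonneg) (use M_pos in \<open>auto
      simp: less_imp_le\<close>)

lemma poskern_cospoly: "0 < n \<Longrightarrow> cospoly (n - 1) (poskern n)"
  using cospoly_cmult[OF cospoly_cmod_trig[of n "korov n"], of "1 / (M * (\<Sum>j<n. (korov n j)\<^sup>2))"]
  unfolding poskern_def[abs_def] by simp

lemma poskern_sum:
  assumes "0 < n" "real n \<le> M"
  shows "(\<Sum>s\<in>rng. poskern n s) = 1"
  using parseval_trig[OF assms(2), of "\<lambda>j. of_real (korov n j)"] korov_sum_pos[OF assms(1)]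
  unfolding poskern_def sum_divide_distrib[symmetric] by simp

text \<open>The weights are an eigenvector of the path Laplacian, which makes the first Fourier coefficient of the kernel exactly \<open>cos (\<pi>/(n+1))\<close>.\<close>

lemma korov_neighbours:
  "(\<Sum>i<n. \<Sum>j<n. korov n i * korov n j * ((if int i - int j = 1 then 1 else 0) + (if int i - int j = -1
      then 1 else 0)))
   = 2 * cos (pi / real (Suc n)) * (\<Sum>j<n. (korov n j)\<^sup>2)"
proof -
  let ?b = "pi / real (Suc n)"
  have "(\<Sum>j<n. korov n i * korov n j * ((if int i - int j = 1 then 1 else 0) + (if int i - int j = -1 then 1
      else 0)))
    = 2 * cos ?b * (korov n i)\<^sup>2" if "i < n" for i
  proof -
    have "(\<Sum>j<n. korov n i * korov n j * ((if int i - int j = 1 then 1 else 0) + (if int i - int j = -1 then 1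
        else 0)))
      = korov n i * ((\<Sum>j<n. if int i - int j = 1 then korov n j else 0) + (\<Sum>j<n. if j = Suc i then korov
          n j else 0))"
      unfolding sum.distrib[symmetric] sum_distrib_left
      by (intro sum.cong refl) (auto simp: algebra_simps)
    \<comment> \<open>Both ends extend by zeros of the sine, at angle \<open>pi\<close> on the right
      and at angle 0 on the left, so the missing neighbours contribute nothing.\<close>
    also have "(\<Sum>j<n. if j = Suc i then korov n j else 0) = sin (real (Suc i) * ?b + ?b)"
    proof (cases "Suc i < n")
      case True
      have "real (Suc i) * ?b + ?b = real (Suc (Suc i)) * ?b"
        by (simp only: of_nat_Suc[of "Suc i"] distrib_right mult_1 add.commute)
      then show ?thesis using True by (simp only: korov_def sum.delta finite_lessThan lessThan_iff if_True)
    next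
      case False
      then have "Suc i = n" using that by simp
      have "real (Suc i) * ?b + ?b = real (Suc n) * ?b"
        unfolding \<open>Suc i = n\<close> of_nat_Suc[of n] by (simp only: distrib_right mult_1 add.commute)
      also have "\<dots> = pi" by (simp del: of_nat_Suc)
      finally have "real (Suc i) * ?b + ?b = pi" .
      then show ?thesis using False by (simp add: sum.delta)
    qed
    also have "(\<Sum>j<n. if int i - int j = 1 then korov n j else 0) = sin (real (Suc i) * ?b - ?b)"
    proof (cases i)
      case 0
      then have "(\<Sum>j<n. if int i - int j = 1 then korov n j else 0) = 0"
        by (intro sum.neutral) auto
      then show ?thesis using 0 by simp
    next
      case (Suc i')
      then have "(\<Sum>j<n. if int i - int j = 1 then korov n j else 0) = (\<Sum>j<n. if j = i' then korov n j else 0)"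
        by (intro sum.cong) auto
      moreover have "real (Suc i) * ?b - ?b = real (Suc i') * ?b"
        unfolding Suc of_nat_Suc[of "Suc i'"] by (simp only: distrib_right mult_1 add_diff_cancel_left'
            add_diff_cancel_right')
      ultimately show ?thesis using Suc that by (simp add: sum.delta korov_def del: of_nat_Suc)
    qed
    also have "korov n i * (sin (real (Suc i) * ?b - ?b) + sin (real (Suc i) * ?b + ?b)) = 2 * cos ?b * (korov n
        i)\<^sup>2"
      unfolding korov_def sin_add sin_diff by (simp add: power2_eq_square algebra_simps)
    finally show ?thesis .
  qed
  then show ?thesis by (simp add: sum_distrib_left)
qed

text \<open>Multiplication by the first cosine picks out the pairs of neighbouring indices. The
  strict bound \<open>n + 1 < M\<close> keeps pairs from becoming neighbours by wrapping
  around.\<close>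

lemma poskern_cos:
  assumes "0 < n" "real n + 1 < M"
  shows "(\<Sum>s\<in>rng. poskern n s * cos (lam * of_int s)) = cos (pi / real (Suc n))"
proof -
  let ?q = "\<Sum>j<n. (korov n j)\<^sup>2"
  have q: "0 < ?q" by (rule korov_sum_pos[OF assms(1)])
  have "(\<Sum>s\<in>rng. (cmod (trig (\<lambda>j. of_real (korov n j)) n s))\<^sup>2 * cos (lam * of_int s)) =
     (\<Sum>s\<in>rng. \<Sum>i<n. \<Sum>j<n. korov n i * korov n j * (cos (of_int (int i - int j) * lam * of_int s)
         * cos (lam * of_int s)))"
    unfolding cmod_trig_real by (simp add: sum_distrib_right mult.assoc)
  also have "\<dots> = (\<Sum>i<n. \<Sum>s\<in>rng. \<Sum>j<n. korov n i * korov n j * (cos (of_int (int i - int j)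
      * lam * of_int s) * cos (lam * of_int s)))"
    by (rule sum.swap)
  also have "\<dots> = (\<Sum>i<n. \<Sum>j<n. \<Sum>s\<in>rng. korov n i * korov n j * (cos (of_int (int i - int j)
      * lam * of_int s) * cos (lam * of_int s)))"
    by (intro sum.cong refl sum.swap)
  also have "\<dots> = (\<Sum>i<n. \<Sum>j<n. korov n i * korov n j * (M / 2 * ((if int i - int j = 1 then 1 else
      0) + (if int i - int j = -1 then 1 else 0))))"
  proof (intro sum.cong refl)
    fix i j assume "i \<in> {..<n}" "j \<in> {..<n}"
    then have "\<bar>real_of_int (int i - int j)\<bar> + \<bar>real_of_int 1\<bar> < M" using assms by auto
    from cos_cos_sum[OF this]
    show "(\<Sum>s\<in>rng. korov n i * korov n j * (cos (of_int (int i - int j) * lam * of_int s) * cos (lam *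
        of_int s))) =
      korov n i * korov n j * (M / 2 * ((if int i - int j = 1 then 1 else 0) + (if int i - int j = -1 then 1 else 0)))"
      by (simp add: sum_distrib_left[symmetric])
  qed
  also have "\<dots> = M / 2 * (\<Sum>i<n. \<Sum>j<n. korov n i * korov n j * ((if int i - int j = 1 then 1 else 0)
      + (if int i - int j = -1 then 1 else 0)))"
    unfolding sum_distrib_left by (intro sum.cong refl) (simp add: algebra_simps)
  also have "\<dots> = M * cos (pi / real (Suc n)) * ?q"
    unfolding korov_neighbours by simp
  finally show ?thesis
    unfolding poskern_def times_divide_eq_left sum_divide_distrib[symmetric]
    using q by (simp add: times_divide_eq_left)
qed

lemma pi4: "pi ^ 4 \<le> 100"
proof -
  have "pi \<le> 3.16" using pi_approx by simp
  then have "pi ^ 4 \<le> 3.16 ^ 4" by (intro power_mono) auto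
  also have "\<dots> \<le> (100::real)" by (simp add: power_divide)
  finally show ?thesis .
qed

lemma lam_rng: "s \<in> rng \<Longrightarrow> \<bar>lam * of_int s\<bar> \<le> pi"
proof -
  assume "s \<in> rng"
  then have "\<bar>real_of_int s\<bar> \<le> M / 2" by (auto simp: rng_def M_def)
  then have "lam * \<bar>real_of_int s\<bar> \<le> lam * (M / 2)" by (intro mult_left_mono) (auto simp: less_imp_le)
  then show ?thesis using lam_M by (simp add: abs_mult abs_of_pos[OF lam_pos])
qed

text \<open>Since the kernel is nonnegative, the squared angle may be replaced by
  \<open>pi^2 / 2 * (1 - cos)\<close>, and then only the mass and the first Fourier coefficient
  enter. The 25 rounds \<open>pi ^ 4 / 4\<close>.\<close>

lemma poskern_moment:
  assumes "0 < n" "real n + 1 < M"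
  shows "(\<Sum>s\<in>rng. poskern n s * (lam * of_int s)\<^sup>2) \<le> 25 / (real n + 1)\<^sup>2"
proof -
  have "(\<Sum>s\<in>rng. poskern n s * (lam * of_int s)\<^sup>2) \<le>
     (\<Sum>s\<in>rng. poskern n s * (pi\<^sup>2 / 2 * (1 - cos (lam * of_int s))))"
  proof (intro sum_mono mult_left_mono poskern_nonneg)
    fix s assume "s \<in> rng"
    from one_minus_cos_ge[OF lam_rng[OF this]]
    show "(lam * of_int s)\<^sup>2 \<le> pi\<^sup>2 / 2 * (1 - cos (lam * of_int s))"
      by (simp add: field_simps)
  qed
  also have "\<dots> = pi\<^sup>2 / 2 * ((\<Sum>s\<in>rng. poskern n s) - (\<Sum>s\<in>rng. poskern n s * cos (lam
      * of_int s)))"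
    unfolding sum_distrib_left sum_subtractf[symmetric]
    by (intro sum.cong refl) (simp add: field_simps)
  also have "\<dots> = pi\<^sup>2 / 2 * (1 - cos (pi / real (Suc n)))"
    using assms by (simp add: poskern_sum poskern_cos)
  also have "\<dots> \<le> pi\<^sup>2 / 2 * ((pi / real (Suc n))\<^sup>2 / 2)"
    by (intro mult_left_mono one_minus_cos_le) auto
  also have "\<dots> = pi ^ 4 / 4 / (real n + 1)\<^sup>2"
    by (simp add: power_divide add.commute)
  also have "\<dots> \<le> 25 / (real n + 1)\<^sup>2"
    using pi4 by (intro divide_right_mono) auto
  finally show ?thesis .
qed

text \<open>Cauchy-Schwarz for a probability weight, in the form \<open>2 a r <= a^2 + r^2\<close>
  with \<open>r\<close> the square root of the bound on the second moment.\<close>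

lemma poskern_abs_moment:
  assumes "0 < n" "real n + 1 < M"
  shows "(\<Sum>s\<in>rng. poskern n s * \<bar>lam * of_int s\<bar>) \<le> 5 / (real n + 1)"
proof -
  define r where "r = 5 / (real n + 1)"
  have r: "0 < r" by (simp add: r_def)
  have "(\<Sum>s\<in>rng. poskern n s * \<bar>lam * of_int s\<bar>) \<le>
     (\<Sum>s\<in>rng. poskern n s * (((lam * of_int s)\<^sup>2 / r + r) / 2))"
  proof (intro sum_mono mult_left_mono poskern_nonneg)
    fix s :: int
    have "0 \<le> (\<bar>lam * of_int s\<bar> - r)\<^sup>2" by simp
    then have "2 * \<bar>lam * of_int s\<bar> * r \<le> (lam * of_int s)\<^sup>2 + r\<^sup>2"
      by (simp only: power2_diff power2_abs)
    then have "2 * \<bar>lam * of_int s\<bar> \<le> ((lam * of_int s)\<^sup>2 + r\<^sup>2) / r"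
      using r by (simp only: pos_le_divide_eq)
    also have "\<dots> = (lam * of_int s)\<^sup>2 / r + r"
      using r by (simp add: add_divide_distrib power2_eq_square)
    finally show "\<bar>lam * of_int s\<bar> \<le> ((lam * of_int s)\<^sup>2 / r + r) / 2" by simp
  qed
  also have "\<dots> = ((\<Sum>s\<in>rng. poskern n s * (lam * of_int s)\<^sup>2) / r + r * (\<Sum>s\<in>rng.
      poskern n s)) / 2"
    unfolding sum_distrib_left sum_divide_distrib sum.distrib[symmetric]
    by (intro sum.cong refl) (simp add: field_simps)
  also have "\<dots> \<le> (25 / (real n + 1)\<^sup>2 / r + r * 1) / 2"
    using poskern_moment[OF assms] poskern_sum[of n] assms less_imp_le[OF r]
    by (intro divide_right_mono add_mono) auto
  also have "\<dots> = r"
  proof -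
    have e: "25 / (real n + 1)\<^sup>2 = r\<^sup>2" by (simp add: r_def power_divide)
    have "25 / (real n + 1)\<^sup>2 / r = r" unfolding e using r by (simp add: power2_eq_square)
    then show ?thesis by simp
  qed
  finally show ?thesis by (simp add: r_def)
qed

section \<open>Fejer and de la Vallee-Poussin kernels\<close>

definition fejer :: "nat \<Rightarrow> int \<Rightarrow> real" where
  "fejer n s = (cmod (trig (\<lambda>j. of_real 1) n s))\<^sup>2 / (M * real n)"

lemma fejer_nonneg: "0 \<le> fejer n s"
  unfolding fejer_def by (intro divide_nonneg_nonneg mult_nonneg_nonneg) (use M_pos in \<open>auto simp:
      less_imp_le\<close>)

lemma fejer_cospoly: "0 < n \<Longrightarrow> cospoly (n - 1) (fejer n)"
  using cospoly_cmult[OF cospoly_cmod_trig[of n "\<lambda>_. 1"], of "1 / (M * real n)"]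
  unfolding fejer_def[abs_def] by simp

lemma fejer_sum:
  assumes "0 < n" "real n \<le> M"
  shows "(\<Sum>s\<in>rng. fejer n s) = 1"
  using parseval_trig[OF assms(2), of "\<lambda>j. of_real 1"] assms(1)
  unfolding fejer_def sum_divide_distrib[symmetric] by simp

lemma pairs_diff:
  assumes "j \<le> n"
  shows "(\<Sum>a<n. \<Sum>b<n. if int a - int b = int j then 1 else 0 :: real) = real n - real j"
    and "(\<Sum>a<n. \<Sum>b<n. if int a - int b = - int j then 1 else 0 :: real) = real n - real j"
proof -
  have *: "(\<Sum>b<n. if int a - int b = - int j then 1 else 0 :: real) = (if a < n - j then 1 else 0)" if "a < n"
      for a
  proof -
    have "(\<Sum>b<n. if int a - int b = - int j then 1 else 0 :: real) = (\<Sum>b<n. if b = a + j then 1 else 0)"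
      by (intro sum.cong refl) auto
    then show ?thesis using that by (auto simp: sum.delta)
  qed
  have "(\<Sum>a<n. \<Sum>b<n. if int a - int b = - int j then 1 else 0 :: real) = (\<Sum>a<n. if a < n - j then 1
      else 0)"
    using * by (intro sum.cong refl) auto
  also have "\<dots> = (\<Sum>a\<in>{..<n} \<inter> {a. a < n - j}. 1)"
    by (simp add: sum.If_cases)
  also have "{..<n} \<inter> {a. a < n - j} = {..<n - j}" by auto
  also have "(\<Sum>a\<in>\<dots>. 1) = real n - real j" using assms by (simp add: of_nat_diff)
  finally show 2: "(\<Sum>a<n. \<Sum>b<n. if int a - int b = - int j then 1 else 0 :: real) = real n - real j" .
  have "(\<Sum>a<n. \<Sum>b<n. if int a - int b = int j then 1 else 0 :: real) = (\<Sum>a<n. \<Sum>b<n. if int b -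
      int a = int j then 1 else 0 :: real)"
    by (rule sum.swap)
  also have "\<dots> = (\<Sum>a<n. \<Sum>b<n. if int a - int b = - int j then 1 else 0 :: real)"
    by (intro sum.cong refl) auto
  finally show "(\<Sum>a<n. \<Sum>b<n. if int a - int b = int j then 1 else 0 :: real) = real n - real j"
    using 2 by simp
qed

lemma fejer_cos:
  assumes "0 < n" "2 * real n < M" "j \<le> n"
  shows "(\<Sum>s\<in>rng. fejer n s * cos (of_nat j * lam * of_int s)) = 1 - real j / real n"
proof -
  have "(\<Sum>s\<in>rng. (cmod (trig (\<lambda>j. of_real 1) n s))\<^sup>2 * cos (of_nat j * lam * of_int s)) =
     (\<Sum>s\<in>rng. \<Sum>a<n. \<Sum>b<n. (cos (of_int (int a - int b) * lam * of_int s) * cos (of_int (int j) *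
         lam * of_int s)))"
    unfolding cmod_trig_real by (simp add: sum_distrib_right mult.assoc)
  also have "\<dots> = (\<Sum>a<n. \<Sum>s\<in>rng. \<Sum>b<n. (cos (of_int (int a - int b) * lam * of_int s) * cos
      (of_int (int j) * lam * of_int s)))"
    by (rule sum.swap)
  also have "\<dots> = (\<Sum>a<n. \<Sum>b<n. \<Sum>s\<in>rng. (cos (of_int (int a - int b) * lam * of_int s) * cos
      (of_int (int j) * lam * of_int s)))"
    by (intro sum.cong refl sum.swap)
  also have "\<dots> = (\<Sum>a<n. \<Sum>b<n. M / 2 * ((if int a - int b = int j then 1 else 0) + (if int a - int b
      = - int j then 1 else 0)))"
  proof (intro sum.cong refl)
    fix a b assume "a \<in> {..<n}" "b \<in> {..<n}"
    then have "\<bar>real_of_int (int a - int b)\<bar> + \<bar>real_of_int (int j)\<bar> < M" using assms by auto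
    from cos_cos_sum[OF this]
    show "(\<Sum>s\<in>rng. (cos (of_int (int a - int b) * lam * of_int s) * cos (of_int (int j) * lam * of_int s))) =
      M / 2 * ((if int a - int b = int j then 1 else 0) + (if int a - int b = - int j then 1 else 0))" .
  qed
  also have "\<dots> = M / 2 * ((\<Sum>a<n. \<Sum>b<n. if int a - int b = int j then 1 else 0) + (\<Sum>a<n.
      \<Sum>b<n. if int a - int b = - int j then 1 else 0))"
    unfolding sum_distrib_left sum.distrib[symmetric] by (simp only:)
  also have "\<dots> = M * (real n - real j)"
    using pairs_diff[OF assms(3)] by simp
  finally show ?thesis
    unfolding fejer_def times_divide_eq_left sum_divide_distrib[symmetric]
    using assms(1) by (simp add: diff_divide_distrib)
qed

lemma trig_shift: "trig c n (s + t) = trig (\<lambda>j. c j * cis (of_nat j * lam * of_int t)) n s"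
  unfolding trig_def by (intro sum.cong refl) (simp add: cis_mult algebra_simps)

lemma trig_diff: "trig c n s - trig c' n s = trig (\<lambda>j. c j - c' j) n s"
  unfolding trig_def sum_subtractf[symmetric] by (simp add: algebra_simps)

lemma trig_add: "trig c n s + trig c' n s = trig (\<lambda>j. c j + c' j) n s"
  unfolding trig_def sum.distrib[symmetric] by (simp add: algebra_simps)

text \<open>Expanding around \<open>z\<close>, the second difference of \<open>|.|^2\<close> is the
  sum of two squared first differences and twice the real part of \<open>cnj z\<close> times the
  second difference. The last product is split with a free parameter \<open>c\<close>, to be
  balanced by the user.\<close>

lemma second_diff_cmod:
  fixes z p q :: complex and c :: real
  assumes "0 < c"
  shows "\<bar>(cmod p)\<^sup>2 + (cmod q)\<^sup>2 - 2 * (cmod z)\<^sup>2\<bar> \<le>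
    (cmod (p - z))\<^sup>2 + (cmod (q - z))\<^sup>2 + (c * (cmod z)\<^sup>2 + (cmod (p + q - 2 * z))\<^sup>2 / c)"
proof -
  define w where "w = p + q - 2 * z"
  have e: "(cmod p)\<^sup>2 + (cmod q)\<^sup>2 - 2 * (cmod z)\<^sup>2 = (cmod (p - z))\<^sup>2 + (cmod (q -
      z))\<^sup>2 + 2 * Re (cnj z * w)"
    unfolding cmod_power2 w_def by (simp add: power2_eq_square algebra_simps)
  have "\<bar>2 * Re (cnj z * w)\<bar> \<le> 2 * (cmod z * cmod w)"
    using abs_Re_le_cmod[of "cnj z * w"] by (simp add: norm_mult)
  also have "\<dots> \<le> c * (cmod z)\<^sup>2 + (cmod w)\<^sup>2 / c"
  proof -
    have "0 \<le> (c * cmod z - cmod w)\<^sup>2 / c" using assms by simp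
    also have "\<dots> = c * (cmod z)\<^sup>2 + (cmod w)\<^sup>2 / c - 2 * (cmod z * cmod w)"
      using assms by (simp add: power2_eq_square field_simps)
    finally show ?thesis by simp
  qed
  finally have b: "\<bar>2 * Re (cnj z * w)\<bar> \<le> c * (cmod z)\<^sup>2 + (cmod w)\<^sup>2 / c" .
  have "0 \<le> (cmod (p - z))\<^sup>2 + (cmod (q - z))\<^sup>2" by simp
  with b show ?thesis unfolding e w_def[symmetric] by linarith
qed

lemma cmod_cis_minus_one: "(cmod (cis x - 1))\<^sup>2 \<le> x\<^sup>2"
proof -
  have "(cmod (cis x - 1))\<^sup>2 = (cos x)\<^sup>2 + (sin x)\<^sup>2 + 1 - 2 * cos x"
    unfolding cmod_power2 by (simp add: power2_eq_square algebra_simps)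
  then have "(cmod (cis x - 1))\<^sup>2 = 2 * (1 - cos x)" by (simp only: sin_cos_squared_add2) simp
  also have "\<dots> \<le> x\<^sup>2" using one_minus_cos_le[of x] by simp
  finally show ?thesis .
qed

text \<open>By Parseval, applied to \<open>|D|\<^sup>2\<close> with \<open>D\<close> the Dirichlet sum; this replaces Bernstein's inequality.\<close>

lemma fejer_second_diff:
  assumes "0 < n" "real n \<le> M"
  shows "(\<Sum>s\<in>rng. \<bar>fejer n (s + h) + fejer n (s - h) - 2 * fejer n s\<bar>) \<le> 4 * (real
      n)\<^sup>2 * (lam * of_int h)\<^sup>2"
proof (cases "h = 0")
  case False
  let ?D = "trig (\<lambda>j. of_real 1) n"
  define x where "x = lam * of_int h"
  have x: "x \<noteq> 0" using False less_imp_neq[OF lam_pos] by (simp add: x_def)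
  \<comment> \<open>With this parameter the four sums produced by \<open>second_diff_cmod\<close>
    have the same bound, hence the 4 in the result.\<close>
  define c where "c = (real n * x)\<^sup>2"
  have c: "0 < c" using x assms by (simp add: c_def)
  have D1: "?D (s + h) - ?D s = trig (\<lambda>j. cis (of_nat j * x) - 1) n s" for s
    unfolding trig_shift trig_diff by (simp add: x_def mult.assoc)
  have D2: "?D (s - h) - ?D s = trig (\<lambda>j. cis (- (of_nat j * x)) - 1) n s" for s
    using trig_shift[of "\<lambda>j. of_real 1" n s "- h"] trig_diff by (simp add: x_def mult.assoc)
  have D3: "?D (s + h) + ?D (s - h) - 2 * ?D s = trig (\<lambda>j. of_real (- 2 * (1 - cos (of_nat j * x)))) n s" for s
  proof -
    have "?D (s + h) + ?D (s - h) - 2 * ?D s = (?D (s + h) - ?D s) + (?D (s - h) - ?D s)" by simp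
    also have "\<dots> = trig (\<lambda>j. (cis (of_nat j * x) - 1) + (cis (- (of_nat j * x)) - 1)) n s"
      unfolding D1 D2 trig_add ..
    also have "(\<lambda>j. (cis (of_nat j * x) - 1) + (cis (- (of_nat j * x)) - 1)) = (\<lambda>j. of_real (- 2 *
        (1 - cos (of_nat j * x))))"
      by (auto simp: complex_eq_iff)
    finally show ?thesis .
  qed
  have jn: "(real j * x)\<^sup>2 \<le> c" if "j < n" for j
    unfolding c_def power_mult_distrib using that by (intro mult_right_mono power_mono) auto
  have P1: "(\<Sum>s\<in>rng. (cmod (?D (s + h) - ?D s))\<^sup>2) \<le> M * (real n * c)"
  proof -
    have "(\<Sum>j<n. (cmod (cis (real j * x) - 1))\<^sup>2) \<le> (\<Sum>j<n. c)"
      using cmod_cis_minus_one jn by (intro sum_mono) (meson lessThan_iff order_trans)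
    then show ?thesis unfolding D1 parseval_trig[OF assms(2)] using M_pos by simp
  qed
  have P2: "(\<Sum>s\<in>rng. (cmod (?D (s - h) - ?D s))\<^sup>2) \<le> M * (real n * c)"
  proof -
    have "(\<Sum>j<n. (cmod (cis (- (real j * x)) - 1))\<^sup>2) \<le> (\<Sum>j<n. c)"
    proof (intro sum_mono)
      fix j assume "j \<in> {..<n}"
      then show "(cmod (cis (- (real j * x)) - 1))\<^sup>2 \<le> c"
        using cmod_cis_minus_one[of "- (real j * x)"] jn[of j] by simp
    qed
    then show ?thesis unfolding D2 parseval_trig[OF assms(2)] using M_pos by simp
  qed
  have P3: "(\<Sum>s\<in>rng. (cmod (?D (s + h) + ?D (s - h) - 2 * ?D s))\<^sup>2) \<le> M * (real n * c\<^sup>2)"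
  proof -
    have "(\<Sum>j<n. (cmod (of_real (- 2 * (1 - cos (real j * x)))))\<^sup>2) \<le> (\<Sum>j<n. c\<^sup>2)"
    proof (intro sum_mono)
      fix j assume "j \<in> {..<n}"
      have "0 \<le> 1 - cos (real j * x)" by simp
      moreover have "2 * (1 - cos (real j * x)) \<le> c"
        using one_minus_cos_le[of "real j * x"] jn[of j] \<open>j \<in> _\<close> by simp
      ultimately have "(2 * (1 - cos (real j * x)))\<^sup>2 \<le> c\<^sup>2" by (intro power_mono) auto
      then show "(cmod (of_real (- 2 * (1 - cos (real j * x)))))\<^sup>2 \<le> c\<^sup>2"
        unfolding norm_of_real power2_abs by (simp only: mult_minus_left power2_minus)
    qed
    then show ?thesis unfolding D3 parseval_trig[OF assms(2)] using M_pos by simp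
  qed
  have P0: "(\<Sum>s\<in>rng. (cmod (?D s))\<^sup>2) = M * real n"
    unfolding parseval_trig[OF assms(2)] by simp
  have "(\<Sum>s\<in>rng. \<bar>fejer n (s + h) + fejer n (s - h) - 2 * fejer n s\<bar>) =
    (\<Sum>s\<in>rng. \<bar>(cmod (?D (s + h)))\<^sup>2 + (cmod (?D (s - h)))\<^sup>2 - 2 * (cmod (?D
        s))\<^sup>2\<bar>) / (M * real n)"
    unfolding fejer_def sum_divide_distrib
  proof (intro sum.cong refl)
    fix s
    have "0 < M * real n" using assms by simp
    then show "\<bar>(cmod (?D (s + h)))\<^sup>2 / (M * real n) + (cmod (?D (s - h)))\<^sup>2 / (M * real n) - 2 *
        ((cmod (?D s))\<^sup>2 / (M * real n))\<bar> =
      \<bar>(cmod (?D (s + h)))\<^sup>2 + (cmod (?D (s - h)))\<^sup>2 - 2 * (cmod (?D s))\<^sup>2\<bar> / (M * real n)"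
      by (simp only: times_divide_eq_right add_divide_distrib[symmetric] diff_divide_distrib[symmetric] abs_divide
          abs_of_pos)
  qed
  also have "\<dots> \<le> (\<Sum>s\<in>rng. (cmod (?D (s + h) - ?D s))\<^sup>2 + (cmod (?D (s - h) - ?D s))\<^sup>2 +
       (c * (cmod (?D s))\<^sup>2 + (cmod (?D (s + h) + ?D (s - h) - 2 * ?D s))\<^sup>2 / c)) / (M * real n)"
    using assms by (intro divide_right_mono sum_mono second_diff_cmod c) auto
  also have "\<dots> = ((\<Sum>s\<in>rng. (cmod (?D (s + h) - ?D s))\<^sup>2) + (\<Sum>s\<in>rng. (cmod (?D (s - h)
      - ?D s))\<^sup>2) +
       (c * (\<Sum>s\<in>rng. (cmod (?D s))\<^sup>2) + (\<Sum>s\<in>rng. (cmod (?D (s + h) + ?D (s - h) - 2 * ?D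
           s))\<^sup>2) / c)) / (M * real n)"
    by (simp only: sum.distrib sum_distrib_left sum_divide_distrib)
  also have "\<dots> \<le> (M * (real n * c) + M * (real n * c) + (c * (M * real n) + M * (real n * c\<^sup>2) /
      c)) / (M * real n)"
    using assms c P0 by (intro divide_right_mono add_mono P1 P2 P3) auto
  also have "\<dots> = 4 * c"
    using assms c by (simp add: field_simps power2_eq_square)
  finally show ?thesis by (simp add: c_def x_def power_mult_distrib)
qed (simp add: fejer_nonneg)

text \<open>The de la Vallee-Poussin kernel. The triangular Fejer coefficients combine to
  \<open>2 (1 - j / (2n)) - (1 - j / n) = 1\<close> for \<open>j <= n\<close>, so low degrees are
  reproduced; the price is the norm 3 instead of 1.\<close>

definition vpk :: "nat \<Rightarrow> int \<Rightarrow> real" where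
  "vpk n s = 2 * fejer (2 * n) s - fejer n s"

lemma vpk_cospoly: "0 < n \<Longrightarrow> cospoly (2 * n - 1) (vpk n)"
proof -
  assume n: "0 < n"
  have "cospoly (2 * n - 1) (\<lambda>s. 2 * fejer (2 * n) s + (-1) * fejer n s)"
    using n by (intro cospoly_add cospoly_cmult cospoly_mono[OF fejer_cospoly]) auto
  then show ?thesis unfolding vpk_def[abs_def] by simp
qed

lemma vpk_abs_sum:
  assumes "0 < n" "2 * real n \<le> M"
  shows "(\<Sum>s\<in>rng. \<bar>vpk n s\<bar>) \<le> 3"
proof -
  have "(\<Sum>s\<in>rng. \<bar>vpk n s\<bar>) \<le> (\<Sum>s\<in>rng. 2 * fejer (2 * n) s + fejer n s)"
    unfolding vpk_def using fejer_nonneg by (intro sum_mono) (smt (verit))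
  also have "\<dots> = 3"
    using assms by (simp add: sum.distrib sum_distrib_left[symmetric] fejer_sum)
  finally show ?thesis .
qed

lemma vpk_cos:
  assumes "0 < n" "4 * real n < M" "j \<le> n"
  shows "(\<Sum>s\<in>rng. vpk n s * cos (of_nat j * lam * of_int s)) = 1"
proof -
  have "(\<Sum>s\<in>rng. vpk n s * cos (of_nat j * lam * of_int s)) =
    2 * (\<Sum>s\<in>rng. fejer (2 * n) s * cos (of_nat j * lam * of_int s)) - (\<Sum>s\<in>rng. fejer n s * cos
        (of_nat j * lam * of_int s))"
    unfolding vpk_def sum_distrib_left sum_subtractf[symmetric] by (simp add: algebra_simps)
  also have "\<dots> = 2 * (1 - real j / real (2 * n)) - (1 - real j / real n)"
    using assms by (subst (1 2) fejer_cos) auto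
  also have "\<dots> = 1" using assms by (simp add: field_simps)
  finally show ?thesis .
qed

lemma vpk_second_diff:
  assumes "0 < n" "2 * real n \<le> M"
  shows "(\<Sum>s\<in>rng. \<bar>vpk n (s + h) + vpk n (s - h) - 2 * vpk n s\<bar>) \<le> 36 * (real n)\<^sup>2 *
      (lam * of_int h)\<^sup>2"
proof -
  have "(\<Sum>s\<in>rng. \<bar>vpk n (s + h) + vpk n (s - h) - 2 * vpk n s\<bar>) \<le>
    (\<Sum>s\<in>rng. 2 * \<bar>fejer (2*n) (s + h) + fejer (2*n) (s - h) - 2 * fejer (2*n) s\<bar> +
       \<bar>fejer n (s + h) + fejer n (s - h) - 2 * fejer n s\<bar>)"
  proof (intro sum_mono)
    fix s
    have *: "\<bar>2 * p - q\<bar> \<le> 2 * \<bar>p\<bar> + \<bar>q\<bar>" for p q :: real by linarith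
    have "\<bar>2 * a1 - b1 + (2 * a2 - b2) - 2 * (2 * a3 - b3)\<bar> \<le> 2 * \<bar>a1 + a2 - 2 * a3\<bar> +
        \<bar>b1 + b2 - 2 * b3\<bar>"
      for a1 a2 a3 b1 b2 b3 :: real
      using *[of "a1 + a2 - 2 * a3" "b1 + b2 - 2 * b3"] by (simp add: algebra_simps)
    then show "\<bar>vpk n (s + h) + vpk n (s - h) - 2 * vpk n s\<bar> \<le>
      2 * \<bar>fejer (2*n) (s + h) + fejer (2*n) (s - h) - 2 * fejer (2*n) s\<bar> + \<bar>fejer n (s + h) + fejer
          n (s - h) - 2 * fejer n s\<bar>"
      unfolding vpk_def .
  qed
  also have "\<dots> \<le> 2 * (4 * (real (2*n))\<^sup>2 * (lam * of_int h)\<^sup>2) + 4 * (real n)\<^sup>2 * (lam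
      * of_int h)\<^sup>2"
    unfolding sum.distrib sum_distrib_left[symmetric] using assms
    by (intro add_mono mult_left_mono fejer_second_diff) auto
  also have "\<dots> = 36 * (real n)\<^sup>2 * (lam * of_int h)\<^sup>2" by (simp add: power_mult_distrib)
  finally show ?thesis .
qed

end

text \<open>Smoothness of order exactly \<open>j\<close>, measured by iterated differences with
  independent steps \<open>h\<close>. A bound on the \<open>j\<close>-th derivative implies it (see
  \<open>dbnd_deriv\<close>), and unlike derivatives these differences commute with finite averages
  over translates and can be read off on a grid.\<close>

primrec dbnd :: "nat \<Rightarrow> real \<Rightarrow> (real \<Rightarrow> real) \<Rightarrow> bool" where
  "dbnd 0 B u \<longleftrightarrow> (\<forall>x. \<bar>u x\<bar> \<le> B)"
| "dbnd (Suc j) B u \<longleftrightarrow> (\<forall>h. dbnd j (B * \<bar>h\<bar>) (\<lambda>x. u (x + h) - u x))"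

lemma dbnd_mono: "dbnd j B u \<Longrightarrow> B \<le> B' \<Longrightarrow> dbnd j B' u"
proof (induction j arbitrary: B B' u)
  case (Suc j)
  show ?case unfolding dbnd.simps
  proof
    fix h
    from Suc.prems(1) have "dbnd j (B * \<bar>h\<bar>) (\<lambda>x. u (x + h) - u x)" by simp
    then show "dbnd j (B' * \<bar>h\<bar>) (\<lambda>x. u (x + h) - u x)"
      by (rule Suc.IH) (use Suc.prems in \<open>auto intro: mult_right_mono\<close>)
  qed
qed (auto intro: order_trans)

lemma dbnd_add: "dbnd j B u \<Longrightarrow> dbnd j B' v \<Longrightarrow> dbnd j (B + B') (\<lambda>x. u x + v x)"
proof (induction j arbitrary: B B' u v)
  case 0
  then show ?case by (auto intro: order_trans[OF abs_triangle_ineq] add_mono)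
next
  case (Suc j)
  show ?case unfolding dbnd.simps
  proof
    fix h
    have "dbnd j (B * \<bar>h\<bar>) (\<lambda>x. u (x + h) - u x)" "dbnd j (B' * \<bar>h\<bar>) (\<lambda>x. v (x
        + h) - v x)"
      using Suc.prems by auto
    from Suc.IH[OF this] show "dbnd j ((B + B') * \<bar>h\<bar>) (\<lambda>x. u (x + h) + v (x + h) - (u x + v x))"
      by (simp add: algebra_simps)
  qed
qed

lemma dbnd_cmult: "dbnd j B u \<Longrightarrow> dbnd j (\<bar>c\<bar> * B) (\<lambda>x. c * u x)"
proof (induction j arbitrary: B u)
  case 0
  then show ?case by (auto simp: abs_mult intro: mult_left_mono)
next
  case (Suc j)
  show ?case unfolding dbnd.simps
  proof
    fix h
    have "dbnd j (B * \<bar>h\<bar>) (\<lambda>x. u (x + h) - u x)" using Suc.prems by auto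
    from Suc.IH[OF this] show "dbnd j (\<bar>c\<bar> * B * \<bar>h\<bar>) (\<lambda>x. c * u (x + h) - c * u x)"
      by (simp add: algebra_simps)
  qed
qed

lemma dbnd_shift: "dbnd j B u \<Longrightarrow> dbnd j B (\<lambda>x. u (x + c))"
proof (induction j arbitrary: B u)
  case (Suc j)
  show ?case unfolding dbnd.simps
  proof
    fix h
    have "dbnd j (B * \<bar>h\<bar>) (\<lambda>x. u (x + h) - u x)" using Suc.prems by auto
    from Suc.IH[OF this] show "dbnd j (B * \<bar>h\<bar>) (\<lambda>x. u (x + h + c) - u (x + c))"
      by (simp add: algebra_simps)
  qed
qed auto

lemma dbnd_zero: "0 \<le> B \<Longrightarrow> dbnd j B (\<lambda>x. 0)"
  by (induction j arbitrary: B) auto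

lemma dbnd_sum:
  "finite I \<Longrightarrow> (\<And>i. i \<in> I \<Longrightarrow> dbnd j (B i) (f i)) \<Longrightarrow> dbnd j
      (\<Sum>i\<in>I. B i) (\<lambda>x. \<Sum>i\<in>I. f i x)"
  by (induction I rule: finite_induct) (auto intro: dbnd_zero dbnd_add)

text \<open>The symmetric second difference is the iterated forward difference based at
  \<open>x - h\<close>.\<close>

lemma dbnd_second_diff:
  assumes "dbnd (Suc (Suc j)) B u"
  shows "dbnd j (B * h\<^sup>2) (\<lambda>x. u (x + h) + u (x - h) - 2 * u x)"
proof -
  have "dbnd j (B * \<bar>h\<bar> * \<bar>h\<bar>) (\<lambda>x. u (x + h + h) - u (x + h) - (u (x + h) - u x))"
    using assms unfolding dbnd.simps by blast
  from dbnd_shift[OF this, of "- h"] show ?thesis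
    by (simp add: power2_eq_square mult.assoc algebra_simps)
qed

definition per2 :: "(real \<Rightarrow> real) \<Rightarrow> bool" where
  "per2 u \<longleftrightarrow> (\<forall>x. u (x + 2 * pi) = u x)"

text \<open>The power of \<open>d\<close> is one short of the exponent in the theorem; the missing
  factor comes from adding up the errors of the \<open>d\<close> coordinates.\<close>

definition jerr :: "nat \<Rightarrow> nat \<Rightarrow> nat \<Rightarrow> real" where
  "jerr d k R = 20 * real d powr (max 1 (real k / 2) - 1) * (10 / (real R + 1)) ^ k"

section \<open>Averaging operators and Jackson estimates in one variable\<close>

context cyclic_grid
begin

lemma per2_periodic: "per2 u \<Longrightarrow> periodic (\<lambda>s. u (x + lam * of_int s))"
  unfolding periodic_def
proof
  fix s assume "per2 u"
  have "x + lam * of_int (s + (2 * int H + 1)) = (x + lam * of_int s) + lam * M"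
    by (simp add: M_def algebra_simps)
  then show "u (x + lam * of_int (s + (2 * int H + 1))) = u (x + lam * of_int s)"
    using \<open>per2 u\<close> by (simp only: lam_M per2_def)
qed

text \<open>The point \<open>x\<close> is an arbitrary real number, only the shifts lie on the grid.
  Hence \<open>Op\<close> preserves difference bounds on the whole line, while being a trigonometric
  polynomial only at the nodes.\<close>

definition Op :: "(int \<Rightarrow> real) \<Rightarrow> (real \<Rightarrow> real) \<Rightarrow> real \<Rightarrow>
    real" where
  "Op \<kappa> u x = (\<Sum>s\<in>rng. \<kappa> s * u (x + lam * of_int s))"

lemma per2_Op: "per2 u \<Longrightarrow> per2 (Op \<kappa> u)"
proof -
  assume u: "per2 u"
  have "u (x + 2 * pi + y) = u (x + y)" for x y
    using u[unfolded per2_def, rule_format, of "x + y"] by (simp add: add_ac)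
  then show ?thesis unfolding per2_def Op_def by simp
qed

lemma dbnd_Op: "dbnd j B u \<Longrightarrow> dbnd j ((\<Sum>s\<in>rng. \<bar>\<kappa> s\<bar>) * B) (Op \<kappa> u)"
  unfolding Op_def[abs_def] sum_distrib_right
  by (intro dbnd_sum finite_rng dbnd_cmult dbnd_shift)

lemma Op_diff: "Op \<kappa> (\<lambda>x. u x - v x) x = Op \<kappa> u x - Op \<kappa> v x"
  by (simp add: Op_def sum_subtractf algebra_simps)

lemma Op_shift: "Op \<kappa> (\<lambda>x. u (x + h)) x = Op \<kappa> u (x + h)"
  by (simp add: Op_def algebra_simps)

definition conv :: "(int \<Rightarrow> real) \<Rightarrow> (int \<Rightarrow> real) \<Rightarrow> int \<Rightarrow>
    real" where
  "conv \<kappa> \<kappa>' r = (\<Sum>s\<in>rng. \<kappa> s * \<kappa>' (r - s))"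

lemma Op_Op:
  assumes "per2 u" "periodic \<kappa>'"
  shows "Op \<kappa> (Op \<kappa>' u) x = Op (conv \<kappa> \<kappa>') u x"
proof -
  have "(\<Sum>r\<in>rng. \<kappa>' r * u (x + lam * of_int s + lam * of_int r)) =
     (\<Sum>r\<in>rng. \<kappa>' (r - s) * u (x + lam * of_int r))" for s
  proof -
    have "periodic (\<lambda>r. \<kappa>' r * u (x + lam * of_int s + lam * of_int r))"
      using per2_periodic[OF assms(1), of "x + lam * of_int s"] assms(2) by (simp add: periodic_def)
    from sum_rng_shift[OF this, of "- s"] show ?thesis by (simp add: algebra_simps)
  qed
  then have "Op \<kappa> (Op \<kappa>' u) x = (\<Sum>s\<in>rng. \<Sum>r\<in>rng. \<kappa> s * (\<kappa>' (r - s) *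
      u (x + lam * of_int r)))"
    by (simp add: Op_def sum_distrib_left)
  also have "\<dots> = (\<Sum>r\<in>rng. \<Sum>s\<in>rng. \<kappa> s * (\<kappa>' (r - s) * u (x + lam * of_int r)))"
    by (rule sum.swap)
  also have "\<dots> = Op (conv \<kappa> \<kappa>') u x"
    by (simp add: Op_def conv_def sum_distrib_right mult.assoc)
  finally show ?thesis .
qed

lemma sum_odd:
  assumes "\<And>s. f (- s) = - (f s :: real)"
  shows "(\<Sum>s\<in>rng. f s) = 0"
  using sum_rng_uminus[of f] by (simp add: assms sum_negf)

text \<open>By the addition theorem, convolution multiplies cosine coefficients. The sine part drops
  out because it pairs the even kernel with an odd function.\<close>

lemma conv_cos:
  assumes even: "\<And>s. \<kappa> (- s) = \<kappa> s"
    and m: "\<And>s. \<kappa>' s = (\<Sum>j\<le>R. m j * cos (of_nat j * lam * of_int s))"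
  shows "\<And>r. conv \<kappa> \<kappa>' r = (\<Sum>j\<le>R. m j * (\<Sum>s\<in>rng. \<kappa> s * cos (of_nat j *
      lam * of_int s)) * cos (of_nat j * lam * of_int r))"
proof -
  fix r
  have "conv \<kappa> \<kappa>' r = (\<Sum>s\<in>rng. \<Sum>j\<le>R. m j * (\<kappa> s * cos (of_nat j * lam *
      of_int (r - s))))"
    unfolding conv_def m by (simp add: sum_distrib_left mult_ac)
  also have "\<dots> = (\<Sum>j\<le>R. \<Sum>s\<in>rng. m j * (\<kappa> s * cos (of_nat j * lam * of_int (r - s))))"
    by (rule sum.swap)
  also have "\<dots> = (\<Sum>j\<le>R. m j * (\<Sum>s\<in>rng. \<kappa> s * cos (of_nat j * lam * of_int s)) * cos
      (of_nat j * lam * of_int r))"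
  proof (intro sum.cong refl)
    fix j
    have "(\<Sum>s\<in>rng. m j * (\<kappa> s * cos (of_nat j * lam * of_int (r - s)))) =
      m j * (cos (of_nat j * lam * of_int r) * (\<Sum>s\<in>rng. \<kappa> s * cos (of_nat j * lam * of_int s)) +
        sin (of_nat j * lam * of_int r) * (\<Sum>s\<in>rng. \<kappa> s * sin (of_nat j * lam * of_int s)))"
      unfolding sum_distrib_left sum.distrib[symmetric]
      by (intro sum.cong refl) (simp add: right_diff_distrib cos_diff algebra_simps)
    also have "(\<Sum>s\<in>rng. \<kappa> s * sin (of_nat j * lam * of_int s)) = 0"
      by (rule sum_odd) (simp add: even)
    finally show "(\<Sum>s\<in>rng. m j * (\<kappa> s * cos (of_nat j * lam * of_int (r - s)))) =
      m j * (\<Sum>s\<in>rng. \<kappa> s * cos (of_nat j * lam * of_int s)) * cos (of_nat j * lam * of_int r)"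
      by (simp add: mult_ac)
  qed
  finally show "conv \<kappa> \<kappa>' r = (\<Sum>j\<le>R. m j * (\<Sum>s\<in>rng. \<kappa> s * cos (of_nat j *
      lam * of_int s)) * cos (of_nat j * lam * of_int r))" .
qed

lemma conv_cospoly:
  assumes "\<And>s. \<kappa> (- s) = \<kappa> s" "cospoly R \<kappa>'"
  shows "cospoly R (conv \<kappa> \<kappa>')"
proof -
  obtain m where m: "\<kappa>' s = (\<Sum>j\<le>R. m j * cos (of_nat j * lam * of_int s))" for s
    using assms(2) unfolding cospoly_def by blast
  show ?thesis unfolding cospoly_def
    using conv_cos[where \<kappa> = \<kappa> and \<kappa>' = \<kappa>' and R = R and m = m, OF assms(1) m]
    by (intro exI[of _ "\<lambda>j. m j * (\<Sum>s\<in>rng. \<kappa> s * cos (of_nat j * lam * of_int s))"] allI)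
qed

text \<open>The cosine coefficients of \<open>vpk n\<close> up to \<open>n\<close> equal 1, so
  convolution with it fixes every kernel of degree at most \<open>n\<close>. This lets
  \<open>vpk_error\<close> subtract a preliminary approximation for free.\<close>

lemma vpk_reproduces:
  assumes "0 < n" "4 * real n < M" "cospoly n \<kappa>" "per2 u"
  shows "Op (vpk n) (Op \<kappa> u) x = Op \<kappa> u x"
proof -
  obtain m where m: "\<kappa> s = (\<Sum>j\<le>n. m j * cos (of_nat j * lam * of_int s))" for s
    using assms(3) unfolding cospoly_def by blast
  have "conv (vpk n) \<kappa> r = \<kappa> r" for r
    using conv_cos[where \<kappa> = "vpk n" and \<kappa>' = \<kappa> and R = n and m = m, OF cospoly_even[OF
        vpk_cospoly[OF assms(1)]] m] m assms by (simp add: vpk_cos)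
  then have "conv (vpk n) \<kappa> = \<kappa>" ..
  then show ?thesis using Op_Op[OF assms(4) cospoly_periodic[OF assms(3)]] by simp
qed

text \<open>As the kernel has mass 1, the error is an average of first differences with steps on the
  grid. One order of differences is traded for a factor \<open>5 / (n + 1)\<close>.\<close>

lemma poskern_diff1:
  assumes "0 < n" "real n + 1 < M" "0 \<le> B" "dbnd (Suc j) B u"
  shows "dbnd j (5 / (real n + 1) * B) (\<lambda>x. u x - Op (poskern n) u x)"
proof -
  have e: "u x - Op (poskern n) u x = (\<Sum>s\<in>rng. - poskern n s * (u (x + lam * of_int s) - u x))" for x
    using poskern_sum[of n] assms by (simp add: Op_def algebra_simps sum_subtractf sum_distrib_left[symmetric])
  have "dbnd j (\<Sum>s\<in>rng. \<bar>- poskern n s\<bar> * (B * \<bar>lam * of_int s\<bar>)) (\<lambda>x. u x -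
      Op (poskern n) u x)"
    unfolding e using assms(4) by (intro dbnd_sum dbnd_cmult) auto
  moreover have "(\<Sum>s\<in>rng. \<bar>- poskern n s\<bar> * (B * \<bar>lam * of_int s\<bar>)) = B *
      (\<Sum>s\<in>rng. poskern n s * \<bar>lam * of_int s\<bar>)"
    unfolding sum_distrib_left by (intro sum.cong refl) (simp add: poskern_nonneg)
  moreover have "\<dots> \<le> B * (5 / (real n + 1))"
    using poskern_abs_moment[OF assms(1,2)] assms(3) by (rule mult_left_mono)
  ultimately show ?thesis using dbnd_mono[of j _ _ "B * (5 / (real n + 1))"] by (simp only: mult.commute[of B])
qed

lemma poskern_even: "0 < n \<Longrightarrow> poskern n (- s) = poskern n s"
  using cospoly_even[OF poskern_cospoly] by blast

text \<open>Pairing \<open>s\<close> with \<open>- s\<close> turns an average of first differences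
  into one of symmetric second differences, which is what gives a positive even kernel its second
  order.\<close>

lemma symmetrize:
  assumes "\<And>s. \<kappa> (- s) = \<kappa> s" "(\<Sum>s\<in>rng. \<kappa> s) = 1"
  shows "f 0 - (\<Sum>s\<in>rng. \<kappa> s * f s) = (\<Sum>s\<in>rng. - (\<kappa> s / 2) * (f s + f (- s) - 2 * (f
      0 :: real)))"
proof -
  have "(\<Sum>s\<in>rng. \<kappa> s * f (- s)) = (\<Sum>s\<in>rng. \<kappa> s * f s)"
    using sum_rng_uminus[of "\<lambda>s. \<kappa> s * f s"] by (simp add: assms(1))
  moreover have "(\<Sum>s\<in>rng. - (\<kappa> s / 2) * (f s + f (- s) - 2 * f 0)) =
    f 0 * (\<Sum>s\<in>rng. \<kappa> s) - ((\<Sum>s\<in>rng. \<kappa> s * f s) + (\<Sum>s\<in>rng. \<kappa> s * f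
        (- s))) / 2"
    unfolding sum_distrib_left sum.distrib[symmetric] sum_divide_distrib sum_subtractf[symmetric]
    by (intro sum.cong refl) (simp add: field_simps)
  ultimately show ?thesis using assms(2) by simp
qed

lemma poskern_diff2:
  assumes "0 < n" "real n + 1 < M" "0 \<le> B" "dbnd (Suc (Suc j)) B u"
  shows "dbnd j (25 / (2 * (real n + 1)\<^sup>2) * B) (\<lambda>x. u x - Op (poskern n) u x)"
proof -
  have e: "u x - Op (poskern n) u x =
    (\<Sum>s\<in>rng. - (poskern n s / 2) * (u (x + lam * of_int s) + u (x - lam * of_int s) - 2 * u x))" for x
    using symmetrize[of "poskern n" "\<lambda>s. u (x + lam * of_int s)"] poskern_sum[of n] assms poskern_even
    by (simp add: Op_def)
  have "dbnd j (\<Sum>s\<in>rng. \<bar>- (poskern n s / 2)\<bar> * (B * (lam * of_int s)\<^sup>2)) (\<lambda>x. u x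
      - Op (poskern n) u x)"
    unfolding e using assms(4) by (intro dbnd_sum dbnd_cmult dbnd_second_diff) auto
  moreover have "(\<Sum>s\<in>rng. \<bar>- (poskern n s / 2)\<bar> * (B * (lam * of_int s)\<^sup>2)) =
      B / 2 * (\<Sum>s\<in>rng. poskern n s * (lam * of_int s)\<^sup>2)"
    unfolding sum_distrib_left by (intro sum.cong refl) (simp add: poskern_nonneg)
  moreover have "\<dots> \<le> B / 2 * (25 / (real n + 1)\<^sup>2)"
    using poskern_moment[OF assms(1,2)] assms(3) by (intro mult_left_mono) auto
  moreover have "B / 2 * (25 / (real n + 1)\<^sup>2) = 25 / (2 * (real n + 1)\<^sup>2) * B" by simp
  ultimately show ?thesis using dbnd_mono[of j _ "\<lambda>x. u x - Op (poskern n) u x"] by simp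
qed

text \<open>Since \<open>vpk n\<close> fixes the range of the averaging by \<open>poskern n\<close>,
  it has the same error on \<open>u\<close> as on \<open>u - Op (poskern n) u\<close>, which is
  smaller by \<open>5 / (n + 1)\<close>. Repeating this \<open>j\<close> times reaches every order
  from a first-order estimate; the initial 4 is \<open>1 + 3\<close>, with 3 the norm of the kernel.
  The remaining \<open>i\<close> orders are kept because the error commutes with
  differences.\<close>

lemma vpk_error:
  assumes n: "0 < n" "4 * real n < M" and "0 \<le> B" "dbnd (i + j) B u" "per2 u"
  shows "dbnd i (4 * (5 / (real n + 1)) ^ j * B) (\<lambda>x. u x - Op (vpk n) u x)"
  using assms(3-)
proof (induction i arbitrary: B u)
  case 0
  then have "dbnd j B u" by simp
  then show ?case using \<open>0 \<le> B\<close> \<open>per2 u\<close>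
  proof (induction j arbitrary: B u)
    case 0
    have "dbnd 0 (B + \<bar>-1\<bar> * ((\<Sum>s\<in>rng. \<bar>vpk n s\<bar>) * B)) (\<lambda>x. u x + (-1) * Op
        (vpk n) u x)"
      using 0 by (intro dbnd_add dbnd_cmult dbnd_Op)
    moreover have "B + \<bar>-1\<bar> * ((\<Sum>s\<in>rng. \<bar>vpk n s\<bar>) * B) \<le> 4 * B"
      using mult_right_mono[OF vpk_abs_sum[of n] \<open>0 \<le> B\<close>] n by simp
    ultimately have "dbnd 0 (4 * B) (\<lambda>x. u x + (-1) * Op (vpk n) u x)" by (rule dbnd_mono)
    then show ?case by simp
  next
    case (Suc j)
    define v where "v = (\<lambda>x. u x - Op (poskern n) u x)"
    have v: "dbnd j (5 / (real n + 1) * B) v" unfolding v_def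
      using n Suc.prems by (intro poskern_diff1) auto
    have pv: "per2 v" using Suc.prems per2_Op[of u "poskern n"] by (simp add: v_def per2_def)
    have c: "cospoly n (poskern n)" by (rule cospoly_mono[OF poskern_cospoly[OF n(1)]]) simp
    have "v x - Op (vpk n) v x = u x - Op (vpk n) u x" for x
      unfolding v_def Op_diff using vpk_reproduces[OF n c Suc.prems(3)] by simp
    then have "(\<lambda>x. u x - Op (vpk n) u x) = (\<lambda>x. v x - Op (vpk n) v x)" by simp
    then show ?case
      using Suc.IH[OF v _ pv] Suc.prems by (simp add: mult_ac)
  qed
next
  case (Suc i)
  show ?case unfolding dbnd.simps
  proof
    fix h
    let ?v = "\<lambda>x. u (x + h) - u x"
    have "per2 ?v"
      unfolding per2_def
    proof
      fix x
      show "u (x + 2 * pi + h) - u (x + 2 * pi) = u (x + h) - u x"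
        using Suc.prems(3)[unfolded per2_def, rule_format, of "x + h"] Suc.prems(3)[unfolded per2_def, rule_format,
            of x]
        by (simp add: add_ac)
    qed
    moreover have "dbnd (i + j) (B * \<bar>h\<bar>) ?v" using Suc.prems by simp
    ultimately have "dbnd i (4 * (5 / (real n + 1)) ^ j * (B * \<bar>h\<bar>)) (\<lambda>x. ?v x - Op (vpk n) ?v x)"
      using Suc.prems by (intro Suc.IH) auto
    moreover have "?v x - Op (vpk n) ?v x = u (x + h) - Op (vpk n) u (x + h) - (u x - Op (vpk n) u x)" for x
      by (simp add: Op_diff Op_shift)
    ultimately show "dbnd i (4 * (5 / (real n + 1)) ^ j * B * \<bar>h\<bar>) (\<lambda>x. u (x + h) - Op (vpk n) u
        (x + h) - (u x - Op (vpk n) u x))"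
      by (simp add: mult.assoc)
  qed
qed

text \<open>With \<open>S\<close> and \<open>T\<close> the averaging operators of \<open>poskern (R + 1)\<close> and \<open>vpk N\<close>, this is the kernel
  of \<open>S + T - S T\<close>: its error \<open>(1 - S) (1 - T)\<close> has order \<open>k\<close>, and since \<open>(1 - S) T\<close> is small the
  norm exceeds \<open>1\<close> by \<open>O(1/d)\<close> only, so that \<open>d\<close> coordinates can be treated one after the other.\<close>

definition jk :: "nat \<Rightarrow> nat \<Rightarrow> int \<Rightarrow> real" where
  "jk R N s = (if N = 0 then poskern (Suc R) s
     else poskern (Suc R) s + (vpk N s - conv (poskern (Suc R)) (vpk N) s))"

text \<open>The degree \<open>2 N - 1\<close> of \<open>vpk N\<close> has to fit under
  \<open>R\<close>. For \<open>N = 0\<close> the formula for \<open>vpk\<close> degenerates, and the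
  positive kernel is taken alone.\<close>

lemma jk_cospoly:
  assumes "2 * N \<le> Suc R"
  shows "cospoly R (jk R N)"
proof -
  have p: "cospoly R (poskern (Suc R))" using poskern_cospoly[of "Suc R"] by simp
  show ?thesis
  proof (cases "N = 0")
    case True
    then have "jk R N = poskern (Suc R)" by (auto simp: jk_def)
    with p show ?thesis by simp
  next
    case False
    have v: "cospoly R (vpk N)" using False assms by (intro cospoly_mono[OF vpk_cospoly]) auto
    have "cospoly R (\<lambda>s. poskern (Suc R) s + (vpk N s + (-1) * conv (poskern (Suc R)) (vpk N) s))"
      by (intro cospoly_add cospoly_cmult conv_cospoly p v poskern_even) auto
    moreover have "jk R N = (\<lambda>s. poskern (Suc R) s + (vpk N s + (-1) * conv (poskern (Suc R)) (vpk N) s))"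
      using False by (auto simp: jk_def)
    ultimately show ?thesis by simp
  qed
qed

text \<open>The positive part has norm 1 exactly. The correction averages second differences of
  \<open>vpk N\<close>, which are of order \<open>N^2\<close> times the squared step, over a kernel
  with second moment of order \<open>1 / R^2\<close>; here \<open>450 = 36 / 2 * 25\<close>.\<close>

lemma jk_abs_sum:
  assumes "real R + 2 < M" "2 * N \<le> Suc R"
  shows "(\<Sum>s\<in>rng. \<bar>jk R N s\<bar>) \<le> 1 + 450 * (real N)\<^sup>2 / (real R + 2)\<^sup>2"
proof -
  have a: "(\<Sum>s\<in>rng. \<bar>poskern (Suc R) s\<bar>) = 1"
    using poskern_sum[of "Suc R"] assms by (simp add: poskern_nonneg)
  show ?thesis
  proof (cases "N = 0")
    case True
    then show ?thesis using a by (simp add: jk_def)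
  next
    case False
    have N2: "2 * real N \<le> M" using assms by linarith
    have e: "vpk N s - conv (poskern (Suc R)) (vpk N) s =
       (\<Sum>t\<in>rng. - (poskern (Suc R) t / 2) * (vpk N (s + t) + vpk N (s - t) - 2 * vpk N s))" for s
      using symmetrize[of "poskern (Suc R)" "\<lambda>t. vpk N (s - t)"] poskern_sum[of "Suc R"] assms
          poskern_even[of "Suc R"]
      by (simp add: conv_def add.commute)
    have "(\<Sum>s\<in>rng. \<bar>vpk N s - conv (poskern (Suc R)) (vpk N) s\<bar>) \<le>
      (\<Sum>s\<in>rng. \<Sum>t\<in>rng. poskern (Suc R) t / 2 * \<bar>vpk N (s + t) + vpk N (s - t) - 2 * vpk N
          s\<bar>)"
      unfolding e by (intro sum_mono order_trans[OF sum_abs]) (simp add: abs_mult poskern_nonneg)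
    also have "\<dots> = (\<Sum>t\<in>rng. poskern (Suc R) t / 2 * (\<Sum>s\<in>rng. \<bar>vpk N (s + t) + vpk N (s
        - t) - 2 * vpk N s\<bar>))"
      unfolding sum_distrib_left by (rule sum.swap)
    also have "\<dots> \<le> (\<Sum>t\<in>rng. poskern (Suc R) t / 2 * (36 * (real N)\<^sup>2 * (lam * of_int
        t)\<^sup>2))"
      using False N2 by (intro sum_mono mult_left_mono vpk_second_diff) (auto simp: poskern_nonneg)
    also have "\<dots> = 18 * (real N)\<^sup>2 * (\<Sum>t\<in>rng. poskern (Suc R) t * (lam * of_int t)\<^sup>2)"
      unfolding sum_distrib_left by (intro sum.cong refl) simp
    also have "\<dots> \<le> 18 * (real N)\<^sup>2 * (25 / (real (Suc R) + 1)\<^sup>2)"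
      using assms by (intro mult_left_mono poskern_moment) auto
    also have "\<dots> = 450 * (real N)\<^sup>2 / (real R + 2)\<^sup>2" by (simp add: add.commute)
    finally have b: "(\<Sum>s\<in>rng. \<bar>vpk N s - conv (poskern (Suc R)) (vpk N) s\<bar>) \<le> 450 * (real
        N)\<^sup>2 / (real R + 2)\<^sup>2" .
    have "(\<Sum>s\<in>rng. \<bar>jk R N s\<bar>) \<le> (\<Sum>s\<in>rng. \<bar>poskern (Suc R) s\<bar> + \<bar>vpk
        N s - conv (poskern (Suc R)) (vpk N) s\<bar>)"
      using False by (intro sum_mono) (simp add: jk_def)
    then show ?thesis using a b by (simp add: sum.distrib)
  qed
qed

lemma Op_jk:
  assumes "per2 u" "0 < N"
  shows "u x - Op (jk R N) u x =
    (u x - Op (vpk N) u x) - Op (poskern (Suc R)) (\<lambda>x. u x - Op (vpk N) u x) x"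
proof -
  have "Op (jk R N) u x = Op (poskern (Suc R)) u x + (Op (vpk N) u x - Op (conv (poskern (Suc R)) (vpk N)) u x)"
    using assms(2) by (simp add: Op_def jk_def algebra_simps sum.distrib sum_subtractf)
  then show ?thesis
    unfolding Op_diff using Op_Op[OF assms(1) cospoly_periodic[OF vpk_cospoly[OF assms(2)]]] by simp
qed

text \<open>With a single order available, the positive kernel consumes it, and the other factor
  contributes only its bound 4.\<close>

lemma jk_error_1:
  assumes "real R + 2 < M" "2 * N \<le> Suc R" "4 * real N < M" "per2 u" "dbnd 1 B u" "0 \<le> B"
  shows "\<bar>u x - Op (jk R N) u x\<bar> \<le> 20 / (real R + 1) * B"
proof -
  have le: "5 / (real R + 2) \<le> 5 / (real R + 1)" by (simp add: field_simps)
  show ?thesis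
  proof (cases "N = 0")
    case True
    have "dbnd 0 (5 / (real (Suc R) + 1) * B) (\<lambda>x. u x - Op (poskern (Suc R)) u x)"
      using assms by (intro poskern_diff1) auto
    then have "\<bar>u x - Op (poskern (Suc R)) u x\<bar> \<le> 5 / (real R + 2) * B"
      by (simp add: add.commute)
    moreover have "jk R N = poskern (Suc R)" using True by (auto simp: jk_def)
    moreover have "5 / (real R + 2) * B \<le> 20 / (real R + 1) * B"
      using assms(6) by (intro mult_right_mono) (auto simp: field_simps)
    ultimately show ?thesis by simp
  next
    case False
    let ?w = "\<lambda>x. u x - Op (vpk N) u x"
    have w: "dbnd 1 (4 * B) ?w" using vpk_error[of N B 1 0 u] assms False by simp
    have "dbnd 0 (5 / (real (Suc R) + 1) * (4 * B)) (\<lambda>x. ?w x - Op (poskern (Suc R)) ?w x)"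
      using assms w by (intro poskern_diff1) auto
    then have "\<bar>?w x - Op (poskern (Suc R)) ?w x\<bar> \<le> 5 / (real R + 2) * (4 * B)"
      by (simp add: add.commute)
    also have "\<dots> \<le> 5 / (real R + 1) * (4 * B)" using assms(6) le by (intro mult_right_mono) auto
    finally show ?thesis using Op_jk[OF assms(4), of N x R] False by simp
  qed
qed

text \<open>Of the \<open>k + 2\<close> orders, \<open>k\<close> are spent on the de la
  Vallee-Poussin factor, at scale \<open>1 / N\<close>, and the last two on the positive kernel, at
  the finer scale \<open>1 / R\<close>. This split is what saves a factor \<open>d\<close> compared
  with using the scale \<open>1 / N\<close> throughout.\<close>

lemma jk_error_2:
  assumes "real R + 2 < M" "4 * real N < M" "per2 u" "dbnd (Suc (Suc k)) B u" "0 \<le> B" "0 < N"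
  shows "\<bar>u x - Op (jk R N) u x\<bar> \<le> 50 / (real R + 1)\<^sup>2 * (5 / (real N + 1)) ^ k * B"
proof -
  let ?w = "\<lambda>x. u x - Op (vpk N) u x"
  let ?B = "4 * (5 / (real N + 1)) ^ k * B"
  have B: "0 \<le> ?B" using assms by simp
  have w: "dbnd 2 ?B ?w" using vpk_error[of N B 2 k u] assms by simp
  have "dbnd 0 (25 / (2 * (real (Suc R) + 1)\<^sup>2) * ?B) (\<lambda>x. ?w x - Op (poskern (Suc R)) ?w x)"
    using assms w B by (intro poskern_diff2) (auto simp: numeral_2_eq_2)
  then have "\<bar>?w x - Op (poskern (Suc R)) ?w x\<bar> \<le> 25 / (2 * (real R + 2)\<^sup>2) * ?B"
    by (simp add: add.commute)
  also have "\<dots> \<le> 25 / (2 * (real R + 1)\<^sup>2) * ?B"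
    using B by (intro mult_right_mono divide_left_mono mult_left_mono power_mono mult_pos_pos) auto
  also have "\<dots> = 50 / (real R + 1)\<^sup>2 * (5 / (real N + 1)) ^ k * B" by (simp add: field_simps)
  finally show ?thesis unfolding Op_jk[OF assms(3,6)] .
qed

lemma jk_error_2_zero:
  assumes "real R + 2 < M" "dbnd 2 B u" "0 \<le> B"
  shows "\<bar>u x - Op (jk R 0) u x\<bar> \<le> 50 / (real R + 1)\<^sup>2 * B"
proof -
  have "dbnd 0 (25 / (2 * (real (Suc R) + 1)\<^sup>2) * B) (\<lambda>x. u x - Op (poskern (Suc R)) u x)"
    using assms by (intro poskern_diff2) (auto simp: numeral_2_eq_2)
  then have "\<bar>u x - Op (poskern (Suc R)) u x\<bar> \<le> 25 / (2 * (real R + 2)\<^sup>2) * B"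
    by (simp add: add.commute)
  also have "\<dots> \<le> 25 / (2 * (real R + 1)\<^sup>2) * B"
    using assms by (intro mult_right_mono divide_left_mono mult_left_mono power_mono mult_pos_pos) auto
  also have "\<dots> \<le> 50 / (real R + 1)\<^sup>2 * B"
    using assms by (intro mult_right_mono) (auto simp: field_simps)
  moreover have "jk R 0 = poskern (Suc R)" by (auto simp: jk_def)
  ultimately show ?thesis by simp
qed

text \<open>The scale of the de la Vallee-Poussin factor: larger than \<open>1/R\<close> by the factor \<open>\<surd>d\<close>.\<close>

definition vdeg :: "nat \<Rightarrow> nat \<Rightarrow> nat" where
  "vdeg d R = nat \<lfloor>(real R + 1) / (2 * sqrt (real d))\<rfloor>"

lemma vdeg_le: "0 < d \<Longrightarrow> real (vdeg d R) \<le> (real R + 1) / (2 * sqrt (real d))"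
  unfolding vdeg_def by simp

lemma vdeg_gt: "(real R + 1) / (2 * sqrt (real d)) < real (vdeg d R) + 1"
  unfolding vdeg_def by linarith

lemma vdeg_le': assumes "0 < d" shows "2 * vdeg d R \<le> Suc R"
proof -
  have "(real R + 1) / (2 * sqrt (real d)) \<le> (real R + 1) / 2"
    using assms by (intro divide_left_mono) auto
  then have "2 * real (vdeg d R) \<le> real R + 1" using order_trans[OF vdeg_le[OF assms, of R]] by fastforce
  then show ?thesis by linarith
qed

definition "jker d R = jk R (vdeg d R)"

lemma jker_cospoly: "0 < d \<Longrightarrow> cospoly R (jker d R)"
  unfolding jker_def by (rule jk_cospoly[OF vdeg_le'])

text \<open>The choice of \<open>vdeg\<close> makes \<open>N^2 / R^2\<close> at most about
  \<open>1 / (4 d)\<close>, and \<open>450 / 4\<close> is rounded up to 113. All later occurrences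
  of \<open>exp 113\<close> originate here.\<close>

lemma jker_abs_sum:
  assumes "0 < d" "2 * real R + 2 < M"
  shows "(\<Sum>s\<in>rng. \<bar>jker d R s\<bar>) \<le> 1 + 113 / real d"
proof -
  let ?N = "vdeg d R"
  have "(real ?N)\<^sup>2 \<le> ((real R + 1) / (2 * sqrt (real d)))\<^sup>2"
    using vdeg_le[OF assms(1)] by (intro power_mono) auto
  also have "\<dots> = (real R + 1)\<^sup>2 / (4 * real d)" using assms by (simp add: power_divide power_mult_distrib)
  also have "\<dots> \<le> (real R + 2)\<^sup>2 / (4 * real d)" by (intro divide_right_mono power_mono) auto
  finally have "450 * (real ?N)\<^sup>2 / (real R + 2)\<^sup>2 \<le> 450 * ((real R + 2)\<^sup>2 / (4 * real d)) /
      (real R + 2)\<^sup>2"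
    by (intro divide_right_mono mult_left_mono) auto
  also have "\<dots> = 112.5 / real d" by (simp add: field_simps)
  also have "\<dots> \<le> 113 / real d" by (intro divide_right_mono) auto
  finally show ?thesis
    using jk_abs_sum[of R ?N] vdeg_le'[OF assms(1), of R] assms unfolding jker_def by simp
qed

lemma jker_error:
  assumes d: "0 < d" and k: "1 \<le> k" and M: "2 * real R + 2 < M" and u: "per2 u"
    and b: "\<And>j. j \<le> k \<Longrightarrow> dbnd j (b j) u" "\<And>j. j \<le> k \<Longrightarrow> b j \<le> B"
        "0 \<le> B"
  shows "\<bar>u x - Op (jker d R) u x\<bar> \<le> jerr d k R * B"
proof -
  let ?N = "vdeg d R"
  have b': "dbnd j B u" if "j \<le> k" for j using b that dbnd_mono by blast
  have N: "2 * ?N \<le> Suc R" by (rule vdeg_le'[OF d])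
  then have N4: "4 * real ?N < M" using M by linarith
  show ?thesis
  proof (cases "k = 1")
    case True
    have "max 1 (real k / 2) - 1 = 0" using True by simp
    then have e: "jerr d k R = 200 / (real R + 1)" using True d by (simp add: jerr_def)
    have "\<bar>u x - Op (jk R ?N) u x\<bar> \<le> 20 / (real R + 1) * B"
      using M N N4 u b'[of 1] k b(3) by (intro jk_error_1) auto
    also have "\<dots> \<le> 200 / (real R + 1) * B" using b(3) by (intro mult_right_mono divide_right_mono) auto
    finally show ?thesis unfolding jker_def e .
  next
    case False
    define k' where "k' = k - 2"
    have k': "k = Suc (Suc k')" using False k by (simp add: k'_def)
    let ?q = "10 * sqrt (real d) / (real R + 1)"
    have q: "0 < ?q" using d by simp
    have e: "jerr d k R = 20 / real d * ?q ^ k"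
    proof -
      have "max 1 (real k / 2) = real k / 2" using k' by simp
      then have "real d powr (max 1 (real k / 2) - 1) = real d powr (real k / 2) / real d"
        using d by (simp add: powr_diff)
      also have "real d powr (real k / 2) = sqrt (real d) ^ k"
        using d by (simp add: powr_half_sqrt[symmetric] powr_powr powr_realpow[symmetric])
      finally show ?thesis
        by (simp add: jerr_def power_mult_distrib power_divide)
    qed
    have q3: "q\<^sup>2 / r / 2 * q ^ k' = 1 / 2 / r * q ^ Suc (Suc k')" for q r :: real
      by (simp add: power2_eq_square)
    have q2: "?q\<^sup>2 / real d = 100 / (real R + 1)\<^sup>2"
      using d by (simp add: power_mult_distrib power_divide)
    have main: "\<bar>u x - Op (jker d R) u x\<bar> \<le> 50 / (real R + 1)\<^sup>2 * ?q ^ k' * B"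
    proof (cases "?N = 0")
      case True
      \<comment> \<open>If \<open>vdeg\<close> vanishes, the degree is below the order of
        \<open>sqrt d\<close>. Then \<open>?q\<close> is at least 1, so the claimed bound is no
        stronger for the orders beyond the second, and the positive kernel alone suffices.\<close>
      have "(real R + 1) / (2 * sqrt (real d)) < 1" using vdeg_gt[of R d] True by simp
      then have "real R + 1 < 2 * sqrt (real d)" using d by simp
      then have "1 \<le> ?q" using d by simp
      then have q1: "1 \<le> ?q ^ k'" by (rule one_le_power)
      have "\<bar>u x - Op (jk R 0) u x\<bar> \<le> 50 / (real R + 1)\<^sup>2 * B"
        using M b'[of 2] k' b(3) by (intro jk_error_2_zero) auto
      also have "\<dots> \<le> 50 / (real R + 1)\<^sup>2 * B * ?q ^ k'"
        using mult_left_mono[OF q1, of "50 / (real R + 1)\<^sup>2 * B"] b(3) by simp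
      finally show ?thesis unfolding jker_def True by (simp add: mult_ac)
    next
      case False
      have "5 / (real ?N + 1) \<le> 5 / ((real R + 1) / (2 * sqrt (real d)))"
        using vdeg_gt[of R d] d by (intro divide_left_mono) auto
      also have "\<dots> = ?q" by simp
      finally have "(5 / (real ?N + 1)) ^ k' \<le> ?q ^ k'" by (intro power_mono) auto
      then have "50 / (real R + 1)\<^sup>2 * (5 / (real ?N + 1)) ^ k' * B \<le> 50 / (real R + 1)\<^sup>2 * ?q ^ k' * B"
        using b(3) by (intro mult_right_mono mult_left_mono) auto
      moreover have "\<bar>u x - Op (jker d R) u x\<bar> \<le> 50 / (real R + 1)\<^sup>2 * (5 / (real ?N + 1)) ^ k' * B"
        unfolding jker_def using M N4 u b'[of k] k' b(3) False by (intro jk_error_2) auto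
      ultimately show ?thesis by linarith
    qed
    also have "50 / (real R + 1)\<^sup>2 * ?q ^ k' * B \<le> jerr d k R * B"
    proof (intro mult_right_mono b(3))
      have "50 / (real R + 1)\<^sup>2 * ?q ^ k' = (?q\<^sup>2 / real d) / 2 * ?q ^ k'" unfolding q2 by simp
      also have "\<dots> = 1 / 2 / real d * ?q ^ k" unfolding k' by (rule q3)
      also have "\<dots> \<le> 20 / real d * ?q ^ k" using d by (intro mult_right_mono divide_right_mono) auto
      finally show "50 / (real R + 1)\<^sup>2 * ?q ^ k' \<le> jerr d k R" unfolding e .
    qed
    finally show ?thesis .
  qed
qed

end

section \<open>Approximation on the torus in several variables\<close>

text \<open>Coordinate \<open>i\<close> of the multi-index coded by \<open>J\<close>. With flat
  codes the same number indexes the sums of the analysis and addresses the arrays of the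
  program.\<close>

definition dig :: "nat \<Rightarrow> nat \<Rightarrow> nat \<Rightarrow> nat" where
  "dig b i J = (J div b ^ i) mod b"

lemma dig_less: "0 < b \<Longrightarrow> dig b i J < b"
  by (simp add: dig_def)

lemma dig_add_low:
  assumes "i < r"
  shows "dig b i (J + j * b ^ r) = dig b i J"
proof (cases "b = 0")
  case False
  have "b ^ r = b ^ i * (b * b ^ (r - Suc i))"
    using assms by (simp flip: power_add power_Suc)
  then have "J + j * b ^ r = J + b ^ i * (b * (j * b ^ (r - Suc i)))" by simp
  also have "\<dots> div b ^ i = b * (j * b ^ (r - Suc i)) + J div b ^ i"
    using False by (simp add: add.commute)
  finally show ?thesis unfolding dig_def by simp
qed (use assms in \<open>cases r; simp add: dig_def\<close>)

lemma dig_add_top: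
  assumes "J < b ^ r" "j < b"
  shows "dig b r (J + j * b ^ r) = j"
  using assms by (simp add: dig_def)

lemma sum_dig_Suc:
  fixes F :: "nat \<Rightarrow> 'a::comm_monoid_add"
  shows "(\<Sum>J<b ^ Suc r. F J) = (\<Sum>j<b. \<Sum>J<b ^ r. F (J + j * b ^ r))"
proof -
  have "(\<Sum>J<b ^ Suc r. F J) = (\<Sum>j<b. \<Sum>J\<in>{j * b ^ r..<j * b ^ r + b ^ r}. F J)"
    using sum.nat_group[of F "b ^ r" b] by (simp add: mult.commute)
  also have "\<dots> = (\<Sum>j<b. \<Sum>J<b ^ r. F (J + j * b ^ r))"
  proof (rule sum.cong[OF refl])
    fix j
    show "(\<Sum>J\<in>{j * b ^ r..<j * b ^ r + b ^ r}. F J) = (\<Sum>J<b ^ r. F (J + j * b ^ r))"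
      using sum.shift_bounds_nat_ivl[of F 0 "j * b ^ r" "b ^ r"] by (simp add: add.commute lessThan_atLeast0)
  qed
  finally show ?thesis .
qed

lemma sum_prod_dig:
  fixes F :: "nat \<Rightarrow> nat \<Rightarrow> 'a::comm_semiring_1"
  shows "(\<Sum>J<b ^ r. \<Prod>i<r. F i (dig b i J)) = (\<Prod>i<r. \<Sum>j<b. F i j)"
proof (induction r)
  case (Suc r)
  have "(\<Sum>J<b ^ Suc r. \<Prod>i<Suc r. F i (dig b i J)) =
     (\<Sum>j<b. \<Sum>J<b ^ r. (\<Prod>i<r. F i (dig b i J)) * F r j)"
    unfolding sum_dig_Suc
  proof (intro sum.cong refl)
    fix j J assume "j \<in> {..<b}" "J \<in> {..<b ^ r}"
    then have "dig b r (J + j * b ^ r) = j" by (intro dig_add_top) auto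
    moreover have "(\<Prod>i<r. F i (dig b i (J + j * b ^ r))) = (\<Prod>i<r. F i (dig b i J))"
      by (intro prod.cong refl) (simp add: dig_add_low)
    ultimately show "(\<Prod>i<Suc r. F i (dig b i (J + j * b ^ r))) = (\<Prod>i<r. F i (dig b i J)) * F r j"
      by simp
  qed
  also have "\<dots> = (\<Prod>i<Suc r. \<Sum>j<b. F i j)"
    unfolding sum_distrib_right[symmetric] sum_distrib_left[symmetric] Suc.IH by simp
  finally show ?case .
qed simp

lemma dig_zero [simp]: "dig b i 0 = 0" by (simp add: dig_def)

lemma dig_inj:
  assumes "J < b ^ r" "J' < b ^ r" "\<And>i. i < r \<Longrightarrow> dig b i J = dig b i J'"
  shows "J = J'"
  using assms
proof (induction r arbitrary: J J')
  case (Suc r)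
  have b: "0 < b" using Suc.prems(1) by (cases b) auto
  have d: "J = J mod b ^ r + dig b r J * b ^ r" if "J < b ^ Suc r" for J
  proof -
    have "J div b ^ r < b" using that by (simp add: less_mult_imp_div_less)
    then have "dig b r J = J div b ^ r" by (simp add: dig_def)
    then show ?thesis by (simp only: mod_div_mult_eq)
  qed
  have m: "dig b i (J mod b ^ r) = dig b i J" if "J < b ^ Suc r" "i < r" for i J
    using dig_add_low[OF that(2), of b "J mod b ^ r" "dig b r J"] d[OF that(1)] by simp
  have "J mod b ^ r = J' mod b ^ r"
  proof (rule Suc.IH)
    fix i assume "i < r"
    then have "dig b i J = dig b i J'" by (intro Suc.prems(3)) simp
    then show "dig b i (J mod b ^ r) = dig b i (J' mod b ^ r)"
      unfolding m[OF Suc.prems(1) \<open>i < r\<close>] m[OF Suc.prems(2) \<open>i < r\<close>] .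
  qed (use b in auto)
  then show ?case using d[OF Suc.prems(1)] d[OF Suc.prems(2)] Suc.prems(3)[of r] by (metis lessI)
qed auto

section \<open>Coordinatewise approximation and Parseval in several variables\<close>

context cyclic_grid
begin

lemma sum_nat_rng: "(\<Sum>l<2 * H + 1. f (int l - int H)) = (\<Sum>s\<in>rng. f s)"
  by (rule sum.reindex_bij_witness[where i = "\<lambda>s. nat (s + int H)" and j = "\<lambda>l. int l - int H"])
     (auto simp: rng_def)

definition opc :: "nat \<Rightarrow> (int \<Rightarrow> real) \<Rightarrow> ((nat \<Rightarrow> real) \<Rightarrow>
    real) \<Rightarrow> (nat \<Rightarrow> real) \<Rightarrow> real" where
  "opc r \<kappa> g \<theta> = Op \<kappa> (\<lambda>t. g (\<theta>(r := t))) (\<theta> r)"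

lemma opc_same: "opc r \<kappa> g (\<theta>(r := t)) = Op \<kappa> (\<lambda>t. g (\<theta>(r := t))) t"
  by (simp add: opc_def)

lemma opc_other: "i \<noteq> r \<Longrightarrow> opc r \<kappa> g (\<theta>(i := t)) = (\<Sum>s\<in>rng. \<kappa> s
    * g ((\<theta>(r := \<theta> r + lam * of_int s))(i := t)))"
  by (simp add: opc_def Op_def fun_upd_twist)

lemma dbnd_opc:
  assumes "\<And>\<theta>. dbnd j B (\<lambda>t. g (\<theta>(i := t)))" "(\<Sum>s\<in>rng. \<bar>\<kappa> s\<bar>)
      \<le> K" "0 \<le> B"
  shows "dbnd j (K * B) (\<lambda>t. opc r \<kappa> g (\<theta>(i := t)))"
proof -
  have "dbnd j ((\<Sum>s\<in>rng. \<bar>\<kappa> s\<bar>) * B) (\<lambda>t. opc r \<kappa> g (\<theta>(i := t)))"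
  proof (cases "i = r")
    case True
    then show ?thesis using dbnd_Op[OF assms(1)[of \<theta>]] by (simp add: opc_same)
  next
    case False
    show ?thesis unfolding opc_other[OF False] sum_distrib_right
      by (intro dbnd_sum dbnd_cmult assms finite_rng)
  qed
  then show ?thesis using assms by (elim dbnd_mono) (auto intro: mult_right_mono)
qed

text \<open>The symmetries of a function of the cosines of its arguments: periodicity makes
  translates of the grid harmless, and evenness removes all sine terms.\<close>

definition pe :: "((nat \<Rightarrow> real) \<Rightarrow> real) \<Rightarrow> bool" where
  "pe g \<longleftrightarrow> (\<forall>i \<theta>. per2 (\<lambda>t. g (\<theta>(i := t))) \<and> (\<forall>t. g
      (\<theta>(i := - t)) = g (\<theta>(i := t))))"

lemma Op_even:
  assumes "\<And>s. \<kappa> (- s) = \<kappa> s" "\<And>t. u (- t) = u t"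
  shows "Op \<kappa> u (- x) = Op \<kappa> u x"
proof -
  have "\<kappa> s * u (- x + lam * of_int s) = \<kappa> (- s) * u (x + lam * of_int (- s))" for s
    using assms(2)[of "x + lam * of_int (- s)"] by (simp add: assms(1))
  then show ?thesis unfolding Op_def using sum_rng_uminus[of "\<lambda>s. \<kappa> s * u (x + lam * of_int s)"] by simp
qed

lemma pe_opc:
  assumes "pe g" "\<And>s. \<kappa> (- s) = \<kappa> s"
  shows "pe (opc r \<kappa> g)"
  unfolding pe_def
proof (intro allI conjI)
  fix i \<theta>
  have g: "per2 (\<lambda>t. g (\<theta>(i := t)))" "g (\<theta>(i := - t)) = g (\<theta>(i := t))" for i \<theta> t
    using assms(1) by (auto simp: pe_def)
  show "per2 (\<lambda>t. opc r \<kappa> g (\<theta>(i := t)))"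
  proof (cases "i = r")
    case True
    then show ?thesis using per2_Op[OF g(1)] by (simp add: opc_same)
  next
    case False
    show ?thesis unfolding opc_other[OF False] per2_def
      using g(1)[unfolded per2_def] by simp
  qed
  fix t
  show "opc r \<kappa> g (\<theta>(i := - t)) = opc r \<kappa> g (\<theta>(i := t))"
  proof (cases "i = r")
    case True
    then show ?thesis unfolding True opc_same using assms(2) g(2) by (intro Op_even) auto
  next
    case False
    show ?thesis unfolding opc_other[OF False] g(2) ..
  qed
qed

primrec apx :: "nat \<Rightarrow> nat \<Rightarrow> ((nat \<Rightarrow> real) \<Rightarrow> real) \<Rightarrow> nat
    \<Rightarrow> (nat \<Rightarrow> real) \<Rightarrow> real" where
  "apx d R g 0 = g"
| "apx d R g (Suc r) = opc r (jker d R) (apx d R g r)"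

lemma jker_even: "0 < d \<Longrightarrow> jker d R (- s) = jker d R s"
  using cospoly_even[OF jker_cospoly] .

lemma pe_apx: "0 < d \<Longrightarrow> pe g \<Longrightarrow> pe (apx d R g r)"
  by (induction r) (auto intro: pe_opc jker_even)

definition "Kc d = 1 + 113 / real d"

lemma Kc_ge: "1 \<le> Kc d" by (simp add: Kc_def)

text \<open>This is the use of the norm \<open>1 + O(1/d)\<close>: all \<open>d\<close> averaging
  steps together cost a constant factor.\<close>

lemma Kc_power: "0 < d \<Longrightarrow> r \<le> d \<Longrightarrow> Kc d ^ r \<le> exp 113"
proof -
  assume "0 < d" "r \<le> d"
  have "Kc d ^ r \<le> Kc d ^ d" using Kc_ge \<open>r \<le> d\<close> by (rule power_increasing[rotated])
  also have "\<dots> \<le> exp (113 / real d) ^ d"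
    unfolding Kc_def by (intro power_mono exp_ge_add_one_self) auto
  also have "\<dots> = exp 113" using \<open>0 < d\<close> by (simp add: exp_of_nat_mult[symmetric])
  finally show ?thesis .
qed

lemma dbnd_apx:
  assumes "0 < d" "2 * real R + 2 < M" "\<And>\<theta>. dbnd j B (\<lambda>t. g (\<theta>(i := t)))" "0 \<le> B"
  shows "dbnd j (Kc d ^ r * B) (\<lambda>t. apx d R g r (\<theta>(i := t)))"
proof (induction r arbitrary: \<theta>)
  case (Suc r)
  have "dbnd j (Kc d * (Kc d ^ r * B)) (\<lambda>t. opc r (jker d R) (apx d R g r) (\<theta>(i := t)))"
    using jker_abs_sum[OF assms(1,2)] assms(4) Kc_ge[of d]
    by (intro dbnd_opc Suc.IH) (auto simp: Kc_def)
  then show ?case by (simp only: mult.assoc apx.simps power_Suc)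
qed (use assms in simp)

text \<open>Telescoping over the coordinates: each step is a one-dimensional approximation of a
  function already averaged in the earlier coordinates, whose difference bounds have grown by at
  most \<open>exp 113\<close>.\<close>

lemma apx_error:
  assumes d: "0 < d" and k: "1 \<le> k" and M: "2 * real R + 2 < M" and g: "pe g"
    and b: "\<And>i j \<theta>. i < d \<Longrightarrow> j \<le> k \<Longrightarrow> dbnd j (b j) (\<lambda>t. g
        (\<theta>(i := t)))"
      "\<And>j. j \<le> k \<Longrightarrow> 0 \<le> b j" "\<And>j. j \<le> k \<Longrightarrow> b j \<le> B" "0 \<le> B"
    and r: "r \<le> d"
  shows "\<bar>g \<theta> - apx d R g r \<theta>\<bar> \<le> real r * (exp 113 * (jerr d k R * B))"
  using r
proof (induction r)
  case (Suc r)
  let ?u = "\<lambda>t. apx d R g r (\<theta>(r := t))"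
  have K: "0 \<le> Kc d ^ r" using Kc_ge[of d] by simp
  have "\<bar>?u (\<theta> r) - Op (jker d R) ?u (\<theta> r)\<bar> \<le> jerr d k R * (Kc d ^ r * B)"
  proof (rule jker_error[OF d k M, where b = "\<lambda>j. Kc d ^ r * b j"])
    show "per2 ?u" using pe_apx[OF d g] by (simp add: pe_def)
    show "dbnd j (Kc d ^ r * b j) ?u" if "j \<le> k" for j
      using that Suc.prems b by (intro dbnd_apx d M) auto
    show "Kc d ^ r * b j \<le> Kc d ^ r * B" if "j \<le> k" for j
      using that b(3) K by (intro mult_left_mono) auto
  qed (use K b in auto)
  also have "\<dots> \<le> jerr d k R * (exp 113 * B)"
    using Kc_power[OF d, of r] Suc.prems b(4)
    by (intro mult_left_mono mult_right_mono) (auto simp: jerr_def)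
  finally have "\<bar>apx d R g r \<theta> - apx d R g (Suc r) \<theta>\<bar> \<le> exp 113 * (jerr d k R * B)"
    by (simp add: opc_def mult_ac)
  with Suc.IH Suc.prems show ?case by (simp add: algebra_simps)
qed simp

text \<open>At a node, a translation permutes the grid, so the shift can be moved from
  \<open>u\<close> to the kernel. The addition theorem then separates the node from the summation
  index, and evenness of \<open>u\<close> kills the sine part.\<close>

lemma Op_cos_rep:
  assumes m: "\<And>s. \<kappa> s = (\<Sum>j\<le>R. m j * cos (of_nat j * lam * of_int s))"
    and u: "per2 u" "\<And>t. u (- t) = u t"
  shows "Op \<kappa> u (lam * of_int l) =
    (\<Sum>j\<le>R. cos (of_nat j * (lam * of_int l)) * (\<Sum>s\<in>rng. m j * cos (of_nat j * lam * of_int s) * u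
        (lam * of_int s)))"
proof -
  have k: "cospoly R \<kappa>" unfolding cospoly_def using m by blast
  have "Op \<kappa> u (lam * of_int l) = (\<Sum>s\<in>rng. \<kappa> ((s + l) - l) * u (lam * of_int (s + l)))"
    by (simp add: Op_def algebra_simps)
  also have "\<dots> = (\<Sum>s\<in>rng. \<kappa> (s - l) * u (lam * of_int s))"
  proof (rule sum_rng_shift[where f = "\<lambda>s. \<kappa> (s - l) * u (lam * of_int s)"])
    show "periodic (\<lambda>s. \<kappa> (s - l) * u (lam * of_int s))"
      using periodic_shift[OF cospoly_periodic[OF k], of "- l"] per2_periodic[OF u(1), of 0]
      by (simp add: periodic_def)
  qed
  also have "\<dots> = (\<Sum>s\<in>rng. \<Sum>j\<le>R. m j * cos (of_nat j * lam * of_int (s - l)) * u (lam *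
      of_int s))"
    unfolding m by (simp add: sum_distrib_right)
  also have "\<dots> = (\<Sum>j\<le>R. \<Sum>s\<in>rng. m j * cos (of_nat j * lam * of_int (s - l)) * u (lam *
      of_int s))"
    by (rule sum.swap)
  also have "\<dots> = (\<Sum>j\<le>R. cos (of_nat j * (lam * of_int l)) * (\<Sum>s\<in>rng. m j * cos (of_nat j *
      lam * of_int s) * u (lam * of_int s)))"
  proof (intro sum.cong refl)
    fix j
    have "(\<Sum>s\<in>rng. m j * cos (of_nat j * lam * of_int (s - l)) * u (lam * of_int s)) =
      cos (of_nat j * (lam * of_int l)) * (\<Sum>s\<in>rng. m j * cos (of_nat j * lam * of_int s) * u (lam * of_int
          s)) +
      m j * sin (of_nat j * (lam * of_int l)) * (\<Sum>s\<in>rng. sin (of_nat j * lam * of_int s) * u (lam * of_int s))"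
      unfolding sum_distrib_left sum.distrib[symmetric]
      by (intro sum.cong refl) (simp add: right_diff_distrib cos_diff algebra_simps)
    also have "(\<Sum>s\<in>rng. sin (of_nat j * lam * of_int s) * u (lam * of_int s)) = 0"
      by (rule sum_odd) (use u(2) in simp)
    finally show "(\<Sum>s\<in>rng. m j * cos (of_nat j * lam * of_int (s - l)) * u (lam * of_int s)) =
      cos (of_nat j * (lam * of_int l)) * (\<Sum>s\<in>rng. m j * cos (of_nat j * lam * of_int s) * u (lam * of_int s))"
      by simp
  qed
  finally show ?thesis .
qed

definition ongrid :: "real \<Rightarrow> bool" where "ongrid t \<longleftrightarrow> (\<exists>l::int. t = lam *
    of_int l)"

text \<open>After \<open>r\<close> steps the coefficients are still functions of the coordinates not
  yet treated; the first conjunct records that they depend on nothing else. For \<open>r = d\<close>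
  they have become constants on the relevant points.\<close>

lemma apx_rep:
  assumes d: "0 < d" and g: "pe g"
  shows "\<exists>a. (\<forall>J \<theta> \<theta>'. (\<forall>i\<ge>r. \<theta> i = \<theta>' i) \<longrightarrow>
      a J \<theta> = a J \<theta>') \<and>
    (\<forall>\<theta>. (\<forall>i<r. ongrid (\<theta> i)) \<longrightarrow>
      apx d R g r \<theta> = (\<Sum>J<(R + 1) ^ r. (\<Prod>i<r. cos (of_nat (dig (R + 1) i J) * \<theta> i)) * a J
          \<theta>))"
proof (induction r)
  case 0
  show ?case
    by (rule exI[of _ "\<lambda>J. g"]) (auto intro: arg_cong[where f = g])
next
  case (Suc r)
  then obtain a where a1: "\<And>J \<theta> \<theta>'. (\<forall>i\<ge>r. \<theta> i = \<theta>' i)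
      \<Longrightarrow> a J \<theta> = a J \<theta>'"
    and a2: "\<And>\<theta>. (\<forall>i<r. ongrid (\<theta> i)) \<Longrightarrow>
      apx d R g r \<theta> = (\<Sum>J<(R + 1) ^ r. (\<Prod>i<r. cos (of_nat (dig (R + 1) i J) * \<theta> i)) * a J
          \<theta>)"
    by blast
  obtain m where m: "jker d R s = (\<Sum>j\<le>R. m j * cos (of_nat j * lam * of_int s))" for s
    using jker_cospoly[OF d, of R] unfolding cospoly_def by blast
  \<comment> \<open>The top digit \<open>J div (R + 1) ^ r\<close> is the frequency in the new
    coordinate \<open>r\<close>, and the remainder is the old multi-index.\<close>
  define a' where "a' J \<theta> = (\<Sum>s\<in>rng. m (J div (R + 1) ^ r) * cos (of_nat (J div (R + 1) ^ r) * lam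
      * of_int s) *
       a (J mod (R + 1) ^ r) (\<theta>(r := lam * of_int s)))" for J \<theta>
  show ?case
  proof (intro exI[of _ a'] conjI allI impI)
    fix J and \<theta> \<theta>' :: "nat \<Rightarrow> real" assume "\<forall>i\<ge>Suc r. \<theta> i = \<theta>' i"
    then have "\<forall>i\<ge>r. (\<theta>(r := t)) i = (\<theta>'(r := t)) i" for t by auto
    then have "a J (\<theta>(r := t)) = a J (\<theta>'(r := t))" for J t by (rule a1)
    then show "a' J \<theta> = a' J \<theta>'" unfolding a'_def by simp
  next
    fix \<theta> assume \<theta>: "\<forall>i<Suc r. ongrid (\<theta> i)"
    then obtain l :: int where l: "\<theta> r = lam * of_int l" by (auto simp: ongrid_def)
    let ?u = "\<lambda>t. apx d R g r (\<theta>(r := t))"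
    let ?P = "\<lambda>J. \<Prod>i<r. cos (of_nat (dig (R + 1) i J) * \<theta> i)"
    have u: "per2 ?u" "?u (- t) = ?u t" for t using pe_apx[OF d g] by (auto simp: pe_def)
    have ua: "?u t = (\<Sum>J<(R + 1) ^ r. ?P J * a J (\<theta>(r := t)))" for t
    proof -
      have "?u t = (\<Sum>J<(R + 1) ^ r. (\<Prod>i<r. cos (of_nat (dig (R + 1) i J) * (\<theta>(r := t)) i)) * a J
          (\<theta>(r := t)))"
        using \<theta> by (intro a2) auto
      then show ?thesis by simp
    qed
    have "apx d R g (Suc r) \<theta> = Op (jker d R) ?u (lam * of_int l)" by (simp add: opc_def l)
    also have "\<dots> = (\<Sum>j\<le>R. cos (of_nat j * \<theta> r) * (\<Sum>s\<in>rng. m j * cos (of_nat j * lam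
        * of_int s) * ?u (lam * of_int s)))"
      unfolding Op_cos_rep[OF m u] l ..
    also have "\<dots> = (\<Sum>j<R + 1. \<Sum>J<(R + 1) ^ r. (\<Prod>i<Suc r. cos (of_nat (dig (R + 1) i (J + j *
        (R + 1) ^ r)) * \<theta> i)) * a' (J + j * (R + 1) ^ r) \<theta>)"
    proof (intro sum.cong)
      fix j assume j: "j \<in> {..<R + 1}"
      have "(\<Sum>s\<in>rng. m j * cos (of_nat j * lam * of_int s) * ?u (lam * of_int s)) =
         (\<Sum>s\<in>rng. \<Sum>J<(R + 1) ^ r. ?P J * (m j * cos (of_nat j * lam * of_int s) * a J (\<theta>(r :=
             lam * of_int s))))"
        unfolding ua by (simp add: sum_distrib_left mult_ac)
      also have "\<dots> = (\<Sum>J<(R + 1) ^ r. \<Sum>s\<in>rng. ?P J * (m j * cos (of_nat j * lam * of_int s) * a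
          J (\<theta>(r := lam * of_int s))))"
        by (rule sum.swap)
      also have "\<dots> = (\<Sum>J<(R + 1) ^ r. ?P J * a' (J + j * (R + 1) ^ r) \<theta>)"
        by (intro sum.cong refl) (simp add: a'_def sum_distrib_left)
      finally have e: "(\<Sum>s\<in>rng. m j * cos (of_nat j * lam * of_int s) * ?u (lam * of_int s)) =
        (\<Sum>J<(R + 1) ^ r. ?P J * a' (J + j * (R + 1) ^ r) \<theta>)" .
      show "cos (of_nat j * \<theta> r) * (\<Sum>s\<in>rng. m j * cos (of_nat j * lam * of_int s) * ?u (lam *
          of_int s)) =
        (\<Sum>J<(R + 1) ^ r. (\<Prod>i<Suc r. cos (of_nat (dig (R + 1) i (J + j * (R + 1) ^ r)) * \<theta> i)) *
            a' (J + j * (R + 1) ^ r) \<theta>)"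
        unfolding e sum_distrib_left
      proof (intro sum.cong refl)
        fix J assume "J \<in> {..<(R + 1) ^ r}"
        then have "dig (R + 1) r (J + j * (R + 1) ^ r) = j" using j by (intro dig_add_top) auto
        moreover have "(\<Prod>i<r. cos (of_nat (dig (R + 1) i (J + j * (R + 1) ^ r)) * \<theta> i)) = ?P J"
          by (intro prod.cong refl) (simp only: dig_add_low lessThan_iff)
        ultimately show "cos (of_nat j * \<theta> r) * (?P J * a' (J + j * (R + 1) ^ r) \<theta>) =
          (\<Prod>i<Suc r. cos (of_nat (dig (R + 1) i (J + j * (R + 1) ^ r)) * \<theta> i)) * a' (J + j * (R + 1) ^
              r) \<theta>"
          by simp
      qed
    qed auto
    also have "\<dots> = (\<Sum>J<(R + 1) ^ Suc r. (\<Prod>i<Suc r. cos (of_nat (dig (R + 1) i J) * \<theta> i)) *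
        a' J \<theta>)"
      by (rule sum_dig_Suc[symmetric])
    finally show "apx d R g (Suc r) \<theta> = (\<Sum>J<(R + 1) ^ Suc r. (\<Prod>i<Suc r. cos (of_nat (dig (R + 1)
        i J) * \<theta> i)) * a' J \<theta>)" .
  qed
qed

text \<open>The step is the mesh itself, so that iterated differences at a node involve nodes only.
  It takes the part of differentiation in the Parseval argument.\<close>

definition fd :: "(real \<Rightarrow> real) \<Rightarrow> real \<Rightarrow> real" where
  "fd u x = u (x + lam) - u x"

lemma dbnd_fd: "dbnd k B u \<Longrightarrow> \<bar>(fd ^^ k) u x\<bar> \<le> B * lam ^ k"
proof (induction k arbitrary: B u)
  case (Suc k)
  have "dbnd k (B * \<bar>lam\<bar>) (\<lambda>x. u (x + lam) - u x)" using Suc.prems unfolding dbnd.simps by blast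
  then have "dbnd k (B * lam) (fd u)" unfolding fd_def[abs_def] abs_of_pos[OF lam_pos] .
  from Suc.IH[OF this] show ?case by (simp add: funpow_swap1 mult_ac)
qed simp

lemma fd_grid_cong:
  assumes "\<And>x. ongrid x \<Longrightarrow> u x = v x"
  shows "ongrid x \<Longrightarrow> (fd ^^ k) u x = (fd ^^ k) v x"
proof (induction k arbitrary: x)
  case (Suc k)
  from Suc.prems obtain l :: int where "x = lam * of_int l" by (auto simp: ongrid_def)
  then have "x + lam = lam * of_int (l + 1)" by (simp add: algebra_simps)
  then have "ongrid (x + lam)" by (auto simp: ongrid_def simp del: of_int_add)
  with Suc show ?case by (simp add: fd_def)
qed (use assms in auto)

lemma fd_sum: "(fd ^^ k) (\<lambda>x. \<Sum>J\<in>I. c J * f J x) = (\<lambda>x. \<Sum>J\<in>I. c J * (fd ^^ k) (f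
    J) x)"
proof (induction k)
  case (Suc k)
  have "(fd ^^ Suc k) (\<lambda>x. \<Sum>J\<in>I. c J * f J x) = fd ((fd ^^ k) (\<lambda>x. \<Sum>J\<in>I. c J * f
      J x))" by simp
  also have "\<dots> = fd (\<lambda>x. \<Sum>J\<in>I. c J * (fd ^^ k) (f J) x)" unfolding Suc.IH ..
  also have "\<dots> = (\<lambda>x. \<Sum>J\<in>I. c J * (fd ^^ Suc k) (f J) x)"
    by (rule ext) (simp add: fd_def sum_subtractf right_diff_distrib)
  finally show ?case .
qed simp

text \<open>Eigenfunctions of the discrete Laplacian. The class is closed under \<open>fd\<close>,
  which allows summation by parts to be iterated.\<close>

definition eig :: "real \<Rightarrow> (real \<Rightarrow> real) \<Rightarrow> bool" where
  "eig c v \<longleftrightarrow> per2 v \<and> (\<forall>x. v (x + lam) + v (x - lam) = 2 * c * v x)"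

lemma eig_fd: "eig c v \<Longrightarrow> eig c (fd v)"
  unfolding eig_def
proof (intro conjI allI)
  fix x assume v: "per2 v \<and> (\<forall>x. v (x + lam) + v (x - lam) = 2 * c * v x)"
  show "per2 (fd v)" unfolding per2_def fd_def
  proof
    fix x
    show "v (x + 2 * pi + lam) - v (x + 2 * pi) = v (x + lam) - v x"
      using v[unfolded per2_def, THEN conjunct1, rule_format, of "x + lam"] v[unfolded per2_def, THEN conjunct1,
          rule_format, of x]
      by (simp add: add_ac)
  qed
  show "fd v (x + lam) + fd v (x - lam) = 2 * c * fd v x"
    using v[THEN conjunct2, rule_format, of x] v[THEN conjunct2, rule_format, of "x + lam"]
    by (simp add: fd_def algebra_simps)
qed

text \<open>Summation by parts on the cyclic group, without boundary terms: the differences combine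
  to a negative Laplacian on \<open>v\<close>, which acts as \<open>2 - 2 * c\<close>.\<close>

lemma sum_fd_fd:
  assumes "eig c v" "per2 u"
  shows "(\<Sum>s\<in>rng. fd u (lam * of_int s) * fd v (lam * of_int s)) =
    (2 - 2 * c) * (\<Sum>s\<in>rng. u (lam * of_int s) * v (lam * of_int s))"
proof -
  let ?x = "\<lambda>s::int. lam * of_int s"
  have pv: "per2 v" using assms(1) by (simp add: eig_def)
  have xs: "?x (s + 1) = ?x s + lam" for s by (simp add: algebra_simps)
  have p1: "periodic (\<lambda>s. u (?x s) * v (?x s))"
    using per2_periodic[OF pv, of 0] per2_periodic[OF assms(2), of 0] by (simp add: periodic_def)
  have p2: "periodic (\<lambda>s. u (?x s) * v (?x s - lam))"
    using per2_periodic[OF pv, of "- lam"] per2_periodic[OF assms(2), of 0] by (simp add: periodic_def)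
  have 1: "(\<Sum>s\<in>rng. u (?x s + lam) * v (?x s + lam)) = (\<Sum>s\<in>rng. u (?x s) * v (?x s))"
    using sum_rng_shift1[OF p1] by (simp only: xs)
  have 2: "(\<Sum>s\<in>rng. u (?x s + lam) * v (?x s)) = (\<Sum>s\<in>rng. u (?x s) * v (?x s - lam))"
    using sum_rng_shift1[OF p2] by (simp only: xs add_diff_cancel_right')
  have "(\<Sum>s\<in>rng. fd u (?x s) * fd v (?x s)) =
    (\<Sum>s\<in>rng. u (?x s + lam) * v (?x s + lam)) + (\<Sum>s\<in>rng. u (?x s) * v (?x s))
     - (\<Sum>s\<in>rng. u (?x s + lam) * v (?x s)) - (\<Sum>s\<in>rng. u (?x s) * v (?x s + lam))"
    unfolding sum.distrib[symmetric] sum_subtractf[symmetric]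
    by (intro sum.cong refl) (simp add: fd_def algebra_simps)
  also have "\<dots> = 2 * (\<Sum>s\<in>rng. u (?x s) * v (?x s)) - (\<Sum>s\<in>rng. u (?x s) * (v (?x s + lam) +
      v (?x s - lam)))"
    unfolding 1 2 distrib_left sum.distrib by simp
  also have "(\<Sum>s\<in>rng. u (?x s) * (v (?x s + lam) + v (?x s - lam))) = 2 * c * (\<Sum>s\<in>rng. u (?x s) *
      v (?x s))"
    unfolding sum_distrib_left using assms(1) by (intro sum.cong refl) (simp add: eig_def)
  finally show ?thesis by (simp add: algebra_simps)
qed

lemma eig_fd_pow: "eig c v \<Longrightarrow> eig c ((fd ^^ k) v)"
  by (induction k) (auto intro: eig_fd)

lemma sum_fd_pow:
  assumes "eig c v" "eig c' u"
  shows "(\<Sum>s\<in>rng. (fd ^^ k) u (lam * of_int s) * (fd ^^ k) v (lam * of_int s)) =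
    (2 - 2 * c) ^ k * (\<Sum>s\<in>rng. u (lam * of_int s) * v (lam * of_int s))"
proof (induction k)
  case (Suc k)
  have "per2 ((fd ^^ k) u)" using eig_fd_pow[OF assms(2)] by (simp add: eig_def)
  from sum_fd_fd[OF eig_fd_pow[OF assms(1)] this] show ?case
    using Suc.IH by simp
qed simp

lemma eig_cos: "eig (cos (of_nat j * lam)) (\<lambda>x. cos (of_nat j * x))"
  unfolding eig_def per2_def
proof (intro conjI allI)
  fix x
  have "cos (of_nat j * (x + 2 * pi)) = cos (of_nat j * x + 2 * pi * of_nat j)" by (simp add: algebra_simps)
  also have "\<dots> = cos (of_nat j * x)"
    using cos.plus_of_nat[of "real j * x" j] by (simp add: mult_ac)
  finally show "cos (of_nat j * (x + 2 * pi)) = cos (of_nat j * x)" .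
  show "cos (of_nat j * (x + lam)) + cos (of_nat j * (x - lam)) = 2 * cos (of_nat j * lam) * cos (of_nat j * x)"
    by (simp add: algebra_simps cos_add cos_diff)
qed

text \<open>The sum over the product grid factors into coordinate sums, and two different
  multi-indices are orthogonal in some coordinate. The system \<open>E\<close> may vary with
  \<open>i\<close>, since later one coordinate carries differenced cosines.\<close>

lemma parseval_dig:
  fixes E :: "nat \<Rightarrow> nat \<Rightarrow> int \<Rightarrow> real"
  assumes orth: "\<And>i j j'. i < d \<Longrightarrow> j < b \<Longrightarrow> j' < b \<Longrightarrow> j \<noteq>
      j' \<Longrightarrow> (\<Sum>s\<in>rng. E i j s * E i j' s) = 0"
  shows "(\<Sum>L<(2 * H + 1) ^ d. (\<Sum>J<b ^ d. h J * (\<Prod>i<d. E i (dig b i J) (int (dig (2 * H + 1) i L) -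
      int H)))\<^sup>2)
    = (\<Sum>J<b ^ d. (h J)\<^sup>2 * (\<Prod>i<d. \<Sum>s\<in>rng. (E i (dig b i J) s)\<^sup>2))"
proof (cases "b = 0")
  case False
  let ?l = "\<lambda>i L. int (dig (2 * H + 1) i L) - int H"
  have "(\<Sum>L<(2 * H + 1) ^ d. (\<Sum>J<b ^ d. h J * (\<Prod>i<d. E i (dig b i J) (?l i L)))\<^sup>2)
    = (\<Sum>L<(2 * H + 1) ^ d. \<Sum>J<b ^ d. \<Sum>J'<b ^ d. h J * h J' * (\<Prod>i<d. E i (dig b i J) (?l i L) *
        E i (dig b i J') (?l i L)))"
    unfolding power2_eq_square sum_product by (intro sum.cong refl) (simp add: prod.distrib mult_ac)
  also have "\<dots> = (\<Sum>J<b ^ d. \<Sum>L<(2 * H + 1) ^ d. \<Sum>J'<b ^ d. h J * h J' * (\<Prod>i<d. E i (dig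
      b i J) (?l i L) * E i (dig b i J') (?l i L)))"
    by (rule sum.swap)
  also have "\<dots> = (\<Sum>J<b ^ d. \<Sum>J'<b ^ d. \<Sum>L<(2 * H + 1) ^ d. h J * h J' * (\<Prod>i<d. E i (dig
      b i J) (?l i L) * E i (dig b i J') (?l i L)))"
    by (intro sum.cong refl sum.swap)
  also have "\<dots> = (\<Sum>J<b ^ d. \<Sum>J'<b ^ d. h J * h J' * (\<Prod>i<d. \<Sum>s\<in>rng. E i (dig b i J) s
      * E i (dig b i J') s))"
  proof (intro sum.cong refl)
    fix J J'
    have "(\<Sum>L<(2 * H + 1) ^ d. \<Prod>i<d. E i (dig b i J) (?l i L) * E i (dig b i J') (?l i L)) =
      (\<Prod>i<d. \<Sum>l<2 * H + 1. E i (dig b i J) (int l - int H) * E i (dig b i J') (int l - int H))"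
      by (rule sum_prod_dig)
    also have "\<dots> = (\<Prod>i<d. \<Sum>s\<in>rng. E i (dig b i J) s * E i (dig b i J') s)"
      by (intro prod.cong refl sum_nat_rng)
    finally show "(\<Sum>L<(2 * H + 1) ^ d. h J * h J' * (\<Prod>i<d. E i (dig b i J) (?l i L) * E i (dig b i J')
        (?l i L))) =
      h J * h J' * (\<Prod>i<d. \<Sum>s\<in>rng. E i (dig b i J) s * E i (dig b i J') s)"
      by (simp only: sum_distrib_left[symmetric])
  qed
  also have "\<dots> = (\<Sum>J<b ^ d. \<Sum>J'<b ^ d. if J' = J then (h J)\<^sup>2 * (\<Prod>i<d. \<Sum>s\<in>rng.
      (E i (dig b i J) s)\<^sup>2) else 0)"
  proof (intro sum.cong refl)
    fix J J' assume J: "J \<in> {..<b ^ d}" "J' \<in> {..<b ^ d}"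
    show "h J * h J' * (\<Prod>i<d. \<Sum>s\<in>rng. E i (dig b i J) s * E i (dig b i J') s) =
      (if J' = J then (h J)\<^sup>2 * (\<Prod>i<d. \<Sum>s\<in>rng. (E i (dig b i J) s)\<^sup>2) else 0)"
    proof (cases "J' = J")
      case False
      then obtain i where i: "i < d" "dig b i J \<noteq> dig b i J'" using dig_inj[of J b d J'] J by auto
      have "(\<Sum>s\<in>rng. E i (dig b i J) s * E i (dig b i J') s) = 0"
        using i \<open>b \<noteq> 0\<close> by (intro orth dig_less) auto
      then have "(\<Prod>i<d. \<Sum>s\<in>rng. E i (dig b i J) s * E i (dig b i J') s) = 0"
        using i by (intro prod_zero) auto
      then show ?thesis using False by simp
    qed (simp add: power2_eq_square)
  qed
  also have "\<dots> = (\<Sum>J<b ^ d. (h J)\<^sup>2 * (\<Prod>i<d. \<Sum>s\<in>rng. (E i (dig b i J) s)\<^sup>2))"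
    by (simp add: sum.delta)
  finally show ?thesis .
qed (cases d; simp add: power2_eq_square)

text \<open>Parseval for the \<open>k\<close>-th difference in direction \<open>i0\<close>.
  Differencing multiplies the squared coefficient by at least
  \<open>(lam^2 / 4) ^ k * j ^ (2 * k)\<close>, and \<open>lam ^ (2 * k)\<close> cancels against the
  hypothesis, so no trace of the mesh remains. The \<open>2 ^ d\<close> compares the squared norms
  \<open>M / 2\<close> of the cosines with the number \<open>M\<close> of nodes per
  coordinate.\<close>

lemma coeff_bound:
  assumes d: "0 < d" "i0 < d" and M: "2 * real R + 2 < M" and C: "0 \<le> C"
    and bnd: "\<And>\<theta>. (\<forall>i<d. ongrid (\<theta> i)) \<Longrightarrow> (\<forall>i\<ge>d. \<theta> i =
        0) \<Longrightarrow>
      \<bar>(fd ^^ k) (\<lambda>t. \<Sum>J<(R + 1) ^ d. h J * (\<Prod>i<d. cos (of_nat (dig (R + 1) i J) *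
          (\<theta>(i0 := t)) i))) (\<theta> i0)\<bar> \<le> C * lam ^ k"
  shows "(\<Sum>J<(R + 1) ^ d. (h J)\<^sup>2 * real (dig (R + 1) i0 J) ^ (2 * k)) \<le> 2 ^ d * 4 ^ k * C\<^sup>2"
proof -
  let ?b = "R + 1"
  define E where "E i j s = (if i = i0 then (fd ^^ k) (\<lambda>x. cos (of_nat j * x)) (lam * of_int s)
      else cos (of_nat j * (lam * of_int s)))" for i j and s :: int
  let ?l = "\<lambda>i L. int (dig (2 * H + 1) i L) - int H"
  have cc: "(\<Sum>s\<in>rng. cos (of_nat j * (lam * of_int s)) * cos (of_nat j' * (lam * of_int s))) =
     M / 2 * ((if j = j' then 1 else 0) + (if j = 0 \<and> j' = 0 then 1 else 0))" if "j < ?b" "j' < ?b" for j j'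
  proof -
    have "\<bar>real_of_int (int j)\<bar> + \<bar>real_of_int (int j')\<bar> < M" using that M by auto
    from cos_cos_sum[OF this] show ?thesis by (simp add: mult.assoc)
  qed
  have EE: "(\<Sum>s\<in>rng. E i j s * E i j' s) = (if i = i0 then (2 - 2 * cos (of_nat j' * lam)) ^ k else 1) *
     (M / 2 * ((if j = j' then 1 else 0) + (if j = 0 \<and> j' = 0 then 1 else 0)))" if "j < ?b" "j' < ?b" for i j j'
  proof (cases "i = i0")
    case True
    then have "(\<Sum>s\<in>rng. E i j s * E i j' s) =
      (\<Sum>s\<in>rng. (fd ^^ k) (\<lambda>x. cos (of_nat j * x)) (lam * of_int s) * (fd ^^ k) (\<lambda>x. cos
          (of_nat j' * x)) (lam * of_int s))"
      by (simp add: E_def)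
    also have "\<dots> = (2 - 2 * cos (of_nat j' * lam)) ^ k * (\<Sum>s\<in>rng. cos (of_nat j * (lam * of_int s))
        * cos (of_nat j' * (lam * of_int s)))"
      by (rule sum_fd_pow[OF eig_cos eig_cos])
    finally show ?thesis using True cc[OF that] by simp
  next
    case False
    then show ?thesis using cc[OF that] by (simp add: E_def)
  qed
  have P: "(\<Sum>L<(2 * H + 1) ^ d. (\<Sum>J<?b ^ d. h J * (\<Prod>i<d. E i (dig ?b i J) (?l i L)))\<^sup>2)
    = (\<Sum>J<?b ^ d. (h J)\<^sup>2 * (\<Prod>i<d. \<Sum>s\<in>rng. (E i (dig ?b i J) s)\<^sup>2))"
    by (rule parseval_dig) (auto simp: EE)
  have up: "(\<Sum>J<?b ^ d. h J * (\<Prod>i<d. E i (dig ?b i J) (?l i L)))\<^sup>2 \<le> (C * lam ^ k)\<^sup>2" for L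
  proof -
    define \<theta> where "\<theta> i = (if i < d then lam * of_int (?l i L) else 0)" for i
    have "(\<Prod>i<d. cos (of_nat (dig ?b i J) * (\<theta>(i0 := t)) i)) =
      (\<Prod>i\<in>{..<d} - {i0}. cos (of_nat (dig ?b i J) * \<theta> i)) * cos (of_nat (dig ?b i0 J) * t)" for J t
    proof -
      have "(\<Prod>i<d. cos (of_nat (dig ?b i J) * (\<theta>(i0 := t)) i)) =
        cos (of_nat (dig ?b i0 J) * (\<theta>(i0 := t)) i0) * (\<Prod>i\<in>{..<d} - {i0}. cos (of_nat (dig ?b i J)
            * (\<theta>(i0 := t)) i))"
        using d by (intro prod.remove) auto
      moreover have "(\<Prod>i\<in>{..<d} - {i0}. cos (of_nat (dig ?b i J) * (\<theta>(i0 := t)) i)) =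
          (\<Prod>i\<in>{..<d} - {i0}. cos (of_nat (dig ?b i J) * \<theta> i))"
        by (intro prod.cong refl) auto
      ultimately show ?thesis by simp
    qed
    then have e1: "(\<lambda>t. \<Sum>J<?b ^ d. h J * (\<Prod>i<d. cos (of_nat (dig ?b i J) * (\<theta>(i0 := t)) i))) =
       (\<lambda>t. \<Sum>J<?b ^ d. (h J * (\<Prod>i\<in>{..<d} - {i0}. cos (of_nat (dig ?b i J) * \<theta> i))) *
           cos (of_nat (dig ?b i0 J) * t))"
      by (simp only: mult.assoc)
    have "(fd ^^ k) (\<lambda>t. \<Sum>J<?b ^ d. h J * (\<Prod>i<d. cos (of_nat (dig ?b i J) * (\<theta>(i0 := t))
        i))) (\<theta> i0) =
       (\<Sum>J<?b ^ d. (h J * (\<Prod>i\<in>{..<d} - {i0}. cos (of_nat (dig ?b i J) * \<theta> i))) * (fd ^^ k)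
           (\<lambda>t. cos (of_nat (dig ?b i0 J) * t)) (\<theta> i0))"
      unfolding e1 fd_sum ..
    also have "\<dots> = (\<Sum>J<?b ^ d. h J * (\<Prod>i<d. E i (dig ?b i J) (?l i L)))"
    proof (intro sum.cong refl)
      fix J
      have "(\<Prod>i<d. E i (dig ?b i J) (?l i L)) = E i0 (dig ?b i0 J) (?l i0 L) * (\<Prod>i\<in>{..<d} - {i0}. E
          i (dig ?b i J) (?l i L))"
        using d by (intro prod.remove) auto
      moreover have "(\<Prod>i\<in>{..<d} - {i0}. E i (dig ?b i J) (?l i L)) = (\<Prod>i\<in>{..<d} - {i0}. cos
          (of_nat (dig ?b i J) * \<theta> i))"
        by (intro prod.cong refl) (auto simp: E_def \<theta>_def)
      ultimately show "(h J * (\<Prod>i\<in>{..<d} - {i0}. cos (of_nat (dig ?b i J) * \<theta> i))) * (fd ^^ k)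
          (\<lambda>t. cos (of_nat (dig ?b i0 J) * t)) (\<theta> i0) =
        h J * (\<Prod>i<d. E i (dig ?b i J) (?l i L))"
        using d by (simp add: E_def \<theta>_def)
    qed
    finally have "\<bar>\<Sum>J<?b ^ d. h J * (\<Prod>i<d. E i (dig ?b i J) (?l i L))\<bar> \<le> C * lam ^ k"
      using bnd[of \<theta>] unfolding \<theta>_def ongrid_def by (metis (no_types, lifting) linorder_not_less)
    then show ?thesis using C by (intro abs_le_square_iff[THEN iffD1]) (simp add: less_imp_le)
  qed
  have low: "(M / 2) ^ d * ((lam\<^sup>2 / 4) ^ k * ((h J)\<^sup>2 * real (dig ?b i0 J) ^ (2 * k))) \<le>
      (h J)\<^sup>2 * (\<Prod>i<d. \<Sum>s\<in>rng. (E i (dig ?b i J) s)\<^sup>2)" for J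
  proof -
    let ?j = "dig ?b i0 J"
    have jR: "?j \<le> R" using dig_less[of ?b i0 J] by simp
    have x: "\<bar>real ?j * lam\<bar> \<le> pi"
    proof -
      have "real ?j * lam \<le> M / 2 * lam" using jR M by (intro mult_right_mono) (auto simp: less_imp_le)
      also have "\<dots> = pi" using lam_M by (simp add: mult.commute)
      finally show ?thesis by (simp add: abs_mult abs_of_pos[OF lam_pos])
    qed
    have "pi\<^sup>2 \<le> 16" using power_mono[of pi 4 2] pi_less_4 by simp
    then have "1 / 16 \<le> 1 / pi\<^sup>2" by (intro divide_left_mono) auto
    then have "(real ?j * lam)\<^sup>2 * (1 / 16) \<le> (real ?j * lam)\<^sup>2 * (1 / pi\<^sup>2)" by (intro
        mult_left_mono) auto
    with one_minus_cos_ge[OF x] have "(real ?j * lam)\<^sup>2 / 4 \<le> 2 - 2 * cos (real ?j * lam)"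
      unfolding times_divide_eq_left times_divide_eq_right by linarith
    then have "((real ?j * lam)\<^sup>2 / 4) ^ k \<le> (2 - 2 * cos (real ?j * lam)) ^ k" by (intro power_mono) auto
    moreover have "((real ?j * lam)\<^sup>2 / 4) ^ k = (lam\<^sup>2 / 4) ^ k * real ?j ^ (2 * k)"
      by (simp add: power_mult_distrib power_divide power_mult)
    ultimately have c: "(lam\<^sup>2 / 4) ^ k * real ?j ^ (2 * k) \<le> (2 - 2 * cos (real ?j * lam)) ^ k" by simp
    have "(\<Prod>i<d. (if i = i0 then (lam\<^sup>2 / 4) ^ k * real ?j ^ (2 * k) else 1) * (M / 2)) \<le>
       (\<Prod>i<d. \<Sum>s\<in>rng. (E i (dig ?b i J) s)\<^sup>2)"
    proof (intro prod_mono conjI)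
      fix i
      show "0 \<le> (if i = i0 then (lam\<^sup>2 / 4) ^ k * real ?j ^ (2 * k) else 1) * (M / 2)"
        using M_pos by (auto simp: less_imp_le)
      have lt: "dig ?b i J < ?b" by (rule dig_less) simp
      have "(\<Sum>s\<in>rng. (E i (dig ?b i J) s)\<^sup>2) = (if i = i0 then (2 - 2 * cos (of_nat (dig ?b i J) *
          lam)) ^ k else 1) *
         (M / 2 * (1 + (if dig ?b i J = 0 then 1 else 0)))"
        unfolding power2_eq_square using EE[OF lt lt, of i] by (simp only: simp_thms if_True)
      moreover have "(if i = i0 then (lam\<^sup>2 / 4) ^ k * real ?j ^ (2 * k) else 1) * (M / 2) \<le>
        (if i = i0 then (2 - 2 * cos (of_nat (dig ?b i J) * lam)) ^ k else 1) * (M / 2 * (1 + (if dig ?b i J = 0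
            then 1 else 0)))"
        using c M_pos by (intro mult_mono) (auto simp: less_imp_le)
      ultimately show "(if i = i0 then (lam\<^sup>2 / 4) ^ k * real ?j ^ (2 * k) else 1) * (M / 2) \<le>
          (\<Sum>s\<in>rng. (E i (dig ?b i J) s)\<^sup>2)"
        by simp
    qed
    also have "(\<Prod>i<d. (if i = i0 then (lam\<^sup>2 / 4) ^ k * real ?j ^ (2 * k) else 1) * (M / 2)) =
      ((lam\<^sup>2 / 4) ^ k * real ?j ^ (2 * k)) * (M / 2) ^ d"
      using d by (simp only: prod.distrib prod.delta finite_lessThan lessThan_iff if_True prod_constant card_lessThan)
    finally have "((lam\<^sup>2 / 4) ^ k * real ?j ^ (2 * k)) * (M / 2) ^ d \<le> (\<Prod>i<d. \<Sum>s\<in>rng. (E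
        i (dig ?b i J) s)\<^sup>2)" .
    then have "(h J)\<^sup>2 * (((lam\<^sup>2 / 4) ^ k * real ?j ^ (2 * k)) * (M / 2) ^ d) \<le> (h J)\<^sup>2 *
        (\<Prod>i<d. \<Sum>s\<in>rng. (E i (dig ?b i J) s)\<^sup>2)"
      by (intro mult_left_mono) auto
    then show ?thesis by (simp only: mult_ac)
  qed
  have "(M / 2) ^ d * ((lam\<^sup>2 / 4) ^ k * (\<Sum>J<?b ^ d. (h J)\<^sup>2 * real (dig ?b i0 J) ^ (2 * k))) \<le>
    (\<Sum>J<?b ^ d. (h J)\<^sup>2 * (\<Prod>i<d. \<Sum>s\<in>rng. (E i (dig ?b i J) s)\<^sup>2))"
    unfolding sum_distrib_left by (intro sum_mono low)
  also have "\<dots> \<le> (\<Sum>L<(2 * H + 1) ^ d. (C * lam ^ k)\<^sup>2)"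
    unfolding P[symmetric] by (intro sum_mono up)
  also have "\<dots> = M ^ d * (C * lam ^ k)\<^sup>2" by (simp add: M_def add.commute)
  also have "\<dots> = (M / 2) ^ d * ((lam\<^sup>2 / 4) ^ k * (2 ^ d * 4 ^ k * C\<^sup>2))"
    by (simp add: power_mult_distrib power_divide power_mult[symmetric] mult.commute)
  finally show ?thesis
    using M_pos lam_pos by (simp add: mult_le_cancel_left_pos zero_less_power)
qed

lemma grid_approx:
  assumes d: "0 < d" and k: "1 \<le> k" and M: "2 * real R + 2 < M" and g: "pe g"
    and b: "\<And>i j \<theta>. i < d \<Longrightarrow> j \<le> k \<Longrightarrow> dbnd j (b j) (\<lambda>t. g
        (\<theta>(i := t)))"
      "\<And>j. j \<le> k \<Longrightarrow> 0 \<le> b j" "\<And>j. j \<le> k \<Longrightarrow> b j \<le> B" "0 \<le> B"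
  shows "\<exists>h. (\<forall>\<theta>. (\<forall>i<d. ongrid (\<theta> i)) \<and> (\<forall>i\<ge>d. \<theta> i =
      0) \<longrightarrow>
      \<bar>g \<theta> - (\<Sum>J<(R + 1) ^ d. h J * (\<Prod>i<d. cos (of_nat (dig (R + 1) i J) * \<theta>
          i)))\<bar> \<le> real d * (exp 113 * (jerr d k R * B))) \<and>
    (\<forall>i<d. (\<Sum>J<(R + 1) ^ d. (h J)\<^sup>2 * real (dig (R + 1) i J) ^ (2 * k)) \<le> 2 ^ d * 4 ^ k *
        (exp 113 * B)\<^sup>2)"
proof -
  obtain a where a1: "\<And>J \<theta> \<theta>'. (\<forall>i\<ge>d. \<theta> i = \<theta>' i) \<Longrightarrow> a
      J \<theta> = a J \<theta>'"
    and a2: "\<And>\<theta>. (\<forall>i<d. ongrid (\<theta> i)) \<Longrightarrow>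
      apx d R g d \<theta> = (\<Sum>J<(R + 1) ^ d. (\<Prod>i<d. cos (of_nat (dig (R + 1) i J) * \<theta> i)) * a J
          \<theta>)"
    using apx_rep[OF d g, of d R] by blast
  \<comment> \<open>All \<open>d\<close> coordinates are treated, so the coefficients see only
    coordinates from \<open>d\<close> on; these vanish at the points considered, and 0 is a
    representative.\<close>
  define h where "h J = a J (\<lambda>_. 0)" for J
  let ?h = "\<lambda>\<theta>. \<Sum>J<(R + 1) ^ d. h J * (\<Prod>i<d. cos (of_nat (dig (R + 1) i J) * \<theta> i))"
  have h: "apx d R g d \<theta> = ?h \<theta>" if "\<forall>i<d. ongrid (\<theta> i)" "\<forall>i\<ge>d. \<theta> i
      = 0" for \<theta>
  proof -
    have "a J \<theta> = h J" for J unfolding h_def using that by (intro a1) auto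
    then show ?thesis using a2[OF that(1)] by (simp add: mult.commute)
  qed
  show ?thesis
  proof (intro exI[of _ h] conjI allI impI)
    fix \<theta> assume "(\<forall>i<d. ongrid (\<theta> i)) \<and> (\<forall>i\<ge>d. \<theta> i = 0)"
    then show "\<bar>g \<theta> - ?h \<theta>\<bar> \<le> real d * (exp 113 * (jerr d k R * B))"
      using apx_error[OF d k M g b, of d \<theta>] h[of \<theta>] by simp
  next
    fix i0 assume i0: "i0 < d"
    show "(\<Sum>J<(R + 1) ^ d. (h J)\<^sup>2 * real (dig (R + 1) i0 J) ^ (2 * k)) \<le> 2 ^ d * 4 ^ k * (exp 113 *
        B)\<^sup>2"
    proof (rule coeff_bound[OF d i0 M])
      fix \<theta> assume \<theta>: "\<forall>i<d. ongrid (\<theta> i)" "\<forall>i\<ge>d. \<theta> i = 0"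
      have "dbnd k (Kc d ^ d * b k) (\<lambda>t. apx d R g d (\<theta>(i0 := t)))"
        using b i0 by (intro dbnd_apx[OF d M]) auto
      moreover have "Kc d ^ d * b k \<le> exp 113 * B"
        using b(2,3)[of k] Kc_power[OF d, of d] by (intro mult_mono) auto
      ultimately have "dbnd k (exp 113 * B) (\<lambda>t. apx d R g d (\<theta>(i0 := t)))" by (rule dbnd_mono)
      then have "\<bar>(fd ^^ k) (\<lambda>t. apx d R g d (\<theta>(i0 := t))) (\<theta> i0)\<bar> \<le> exp 113 *
          B * lam ^ k"
        by (rule dbnd_fd)
      moreover have "(fd ^^ k) (\<lambda>t. apx d R g d (\<theta>(i0 := t))) (\<theta> i0) = (fd ^^ k) (\<lambda>t.
          ?h (\<theta>(i0 := t))) (\<theta> i0)"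
        using \<theta> i0 by (intro fd_grid_cong h) auto
      ultimately show "\<bar>(fd ^^ k) (\<lambda>t. ?h (\<theta>(i0 := t))) (\<theta> i0)\<bar> \<le> exp 113 * B *
          lam ^ k" by simp
    qed (use b in auto)
  qed
qed

end

section \<open>Chebyshev approximation on the cube\<close>

text \<open>Differencing commutes with differentiation, which reduces the claim to the mean value
  inequality.\<close>

lemma dbnd_deriv:
  assumes "\<And>x. (u has_real_derivative v x) (at x)" "dbnd j B v"
  shows "dbnd (Suc j) B u"
  using assms
proof (induction j arbitrary: u v B)
  case 0
  show ?case unfolding dbnd.simps
  proof (intro allI)
    fix h x
    have "norm (u (x + h) - u x) \<le> B * norm (x + h - x)"
    proof (rule field_differentiable_bound[OF convex_UNIV])
      show "(u has_real_derivative v z) (at z within UNIV)" for z using 0(1) by simp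
      show "norm (v z) \<le> B" for z using 0(2) by simp
    qed auto
    then show "\<bar>u (x + h) - u x\<bar> \<le> B * \<bar>h\<bar>" by simp
  qed
next
  case (Suc j)
  show ?case unfolding dbnd.simps(2)[of "Suc j"]
  proof
    fix h
    show "dbnd (Suc j) (B * \<bar>h\<bar>) (\<lambda>x. u (x + h) - u x)"
    proof (rule Suc.IH)
      show "((\<lambda>x. u (x + h) - u x) has_real_derivative v (x + h) - v x) (at x)" for x
        by (rule DERIV_diff[OF DERIV_shift[THEN iffD1, OF Suc.prems(1)] Suc.prems(1)])
      show "dbnd j (B * \<bar>h\<bar>) (\<lambda>x. v (x + h) - v x)"
        by (rule Suc.prems(2)[unfolded dbnd.simps, rule_format])
    qed
  qed
qed

text \<open>The rising factorial of length \<open>j\<close> starting at \<open>s + 1\<close>; for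
  \<open>s = 0\<close> it is \<open>fact j\<close>.\<close>

definition prising :: "nat \<Rightarrow> nat \<Rightarrow> real" where
  "prising j s = (\<Prod>i<j. real s + 1 + real i)"

lemma prising_Suc: "prising (Suc j) s = (real s + 1) * prising j (Suc s)"
  unfolding prising_def prod.lessThan_Suc_shift by (simp add: add_ac)

lemma prising_mono: "prising j s \<le> prising j (Suc s)"
  unfolding prising_def by (intro prod_mono) auto

lemma prising_fact: "prising j 0 = fact j"
  by (simp add: prising_def fact_prod_Suc lessThan_atLeast0 add.commute)

text \<open>Differentiating \<open>\<phi>\<^sub>r (cos \<theta>) cos\<^sup>a \<theta> sin\<^sup>b \<theta>\<close> produces \<open>1 + a + b\<close> terms of the same kind, of degree
  at most \<open>a + b + 1\<close>; hence the factorial.\<close>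

lemma dbnd_cos_term:
  fixes \<phi> :: "nat \<Rightarrow> real \<Rightarrow> real"
  assumes der: "\<And>r t. r < k \<Longrightarrow> t \<in> {-1..1} \<Longrightarrow> (\<phi> r has_real_derivative
      \<phi> (Suc r) t) (at t within {-1..1})"
    and bnd: "\<And>r t. r \<le> k \<Longrightarrow> t \<in> {-1..1} \<Longrightarrow> \<bar>\<phi> r t\<bar> \<le> 1"
  shows "r + j \<le> k \<Longrightarrow> dbnd j (prising j (a + b)) (\<lambda>\<theta>. \<phi> r (cos \<theta>) *
      cos \<theta> ^ a * sin \<theta> ^ b)"
proof (induction j arbitrary: r a b)
  case 0
  show ?case unfolding dbnd.simps
  proof
    fix \<theta>
    have "\<bar>\<phi> r (cos \<theta>)\<bar> * \<bar>cos \<theta>\<bar> ^ a * \<bar>sin \<theta>\<bar> ^ b \<le> 1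
        * 1 * 1"
      using bnd[of r "cos \<theta>"] 0 by (intro mult_mono power_le_one) (auto intro: power_le_one)
    then show "\<bar>\<phi> r (cos \<theta>) * cos \<theta> ^ a * sin \<theta> ^ b\<bar> \<le> prising 0 (a + b)"
      by (simp add: abs_mult power_abs prising_def)
  qed
next
  case (Suc j)
  define v where "v \<theta> = (-1) * (\<phi> (Suc r) (cos \<theta>) * cos \<theta> ^ a * sin \<theta> ^ Suc b) +
      ((- real a) * (\<phi> r (cos \<theta>) * cos \<theta> ^ (a - 1) * sin \<theta> ^ Suc b) +
       real b * (\<phi> r (cos \<theta>) * cos \<theta> ^ Suc a * sin \<theta> ^ (b - 1)))" for \<theta>
  have rk: "r < k" using Suc.prems by simp
  have d1: "((\<lambda>\<theta>. \<phi> r (cos \<theta>)) has_real_derivative \<phi> (Suc r) (cos \<theta>) * (-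
      sin \<theta>)) (at \<theta>)" for \<theta>
  proof -
    \<comment> \<open>On the faces of the cube the derivative is one-sided, so the chain rule is
      applied within the range of the cosine.\<close>
    have A: "(\<phi> r has_real_derivative \<phi> (Suc r) (cos \<theta>)) (at (cos \<theta>) within range cos)"
      by (rule DERIV_subset[OF der[OF rk]]) auto
    show ?thesis using DERIV_image_chain[OF A DERIV_cos] by (simp add: o_def)
  qed
  have der': "((\<lambda>\<theta>. \<phi> r (cos \<theta>) * cos \<theta> ^ a * sin \<theta> ^ b)
      has_real_derivative v \<theta>) (at \<theta>)" for \<theta>
  proof -
    have c: "((\<lambda>\<theta>. cos \<theta> ^ a) has_real_derivative real a * cos \<theta> ^ (a - 1) * (- sin
        \<theta>)) (at \<theta>)"
      by (auto intro!: derivative_eq_intros)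
    have s: "((\<lambda>\<theta>. sin \<theta> ^ b) has_real_derivative real b * sin \<theta> ^ (b - 1) * cos
        \<theta>) (at \<theta>)"
      by (auto intro!: derivative_eq_intros)
    show ?thesis
      by (rule DERIV_cong[OF DERIV_mult[OF DERIV_mult[OF d1 c] s]]) (simp add: v_def algebra_simps)
  qed
  have s: "prising j (a + Suc b) \<le> prising j (Suc (a + b))" by simp
  have "dbnd j (\<bar>-1\<bar> * prising j (Suc (a + b)) + (\<bar>- real a\<bar> * prising j (Suc (a + b)) +
      \<bar>real b\<bar> * prising j (Suc (a + b)))) v"
    unfolding v_def[abs_def]
  proof (intro dbnd_add)
    show "dbnd j (\<bar>-1\<bar> * prising j (Suc (a + b))) (\<lambda>\<theta>. (-1) * (\<phi> (Suc r) (cos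
        \<theta>) * cos \<theta> ^ a * sin \<theta> ^ Suc b))"
      using Suc.IH[of "Suc r" a "Suc b"] Suc.prems by (intro dbnd_cmult) auto
    show "dbnd j (\<bar>- real a\<bar> * prising j (Suc (a + b))) (\<lambda>\<theta>. (- real a) * (\<phi> r (cos
        \<theta>) * cos \<theta> ^ (a - 1) * sin \<theta> ^ Suc b))"
    \<comment> \<open>For \<open>a = 0\<close> the truncated exponent \<open>a - 1\<close> is
      harmless, as its coefficient is 0; likewise for \<open>b\<close> below.\<close>
    proof (cases a)
      case (Suc a')
      then show ?thesis
        using Suc.IH[of r "a - 1" "Suc b"] Suc.prems dbnd_mono[OF _ prising_mono[of j "a + b"]] by (intro
            dbnd_cmult) auto
    qed (simp add: dbnd_zero)
    show "dbnd j (\<bar>real b\<bar> * prising j (Suc (a + b))) (\<lambda>\<theta>. real b * (\<phi> r (cos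
        \<theta>) * cos \<theta> ^ Suc a * sin \<theta> ^ (b - 1)))"
    proof (cases b)
      case (Suc b')
      then show ?thesis
        using Suc.IH[of r "Suc a" "b - 1"] Suc.prems dbnd_mono[OF _ prising_mono[of j "a + b"]] by (intro
            dbnd_cmult) auto
    qed (simp add: dbnd_zero)
  qed
  moreover have "\<bar>-1\<bar> * prising j (Suc (a + b)) + (\<bar>- real a\<bar> * prising j (Suc (a + b)) +
      \<bar>real b\<bar> * prising j (Suc (a + b))) =
     prising (Suc j) (a + b)"
    by (simp add: prising_Suc algebra_simps)
  ultimately have "dbnd j (prising (Suc j) (a + b)) v" by metis
  then show ?case by (rule dbnd_deriv[OF der'])
qed

lemma fold_single:
  assumes "i < d"
  shows "fold (\<lambda>j. F j ^^ (if j = i then r else 0)) [0..<d] f = (F i ^^ r) f"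
proof -
  have id: "fold (\<lambda>j. F j ^^ (if j = i then r else 0)) xs = id" if "i \<notin> set xs" for xs
    using that by (induction xs) auto
  have "[0..<d] = [0..<i] @ i # [Suc i..<d]"
    using assms upt_conv_Cons[of i d] upt_add_eq_append[of 0 i "d - i"] by simp
  then show ?thesis by (simp add: id)
qed

lemma Ck_funpow: "Ck_on_cube d k f \<Longrightarrow> i < d \<Longrightarrow> r \<le> k \<Longrightarrow> Ck_on_cube
    d (k - r) ((pdiff i ^^ r) f)"
proof (induction r)
  case (Suc r)
  then obtain m where m: "k - r = Suc m" "m = k - Suc r" by (metis Suc_diff_Suc Suc_le_eq)
  have "Ck_on_cube d (Suc m) ((pdiff i ^^ r) f)" using Suc m by simp
  then have "Ck_on_cube d m (pdiff i ((pdiff i ^^ r) f))" using Suc.prems by simp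
  then show ?case by (simp add: m)
qed simp

lemma cube_mem: "x \<in> cube d \<Longrightarrow> i < d \<Longrightarrow> x i \<in> {-1..1}"
  using PiE_mem[of x "{..<d}" "\<lambda>_. {-1..1}" i] by (simp add: cube_def)

lemma cube_upd: "x \<in> cube d \<Longrightarrow> i < d \<Longrightarrow> t \<in> {-1..1} \<Longrightarrow> x(i :=
    t) \<in> cube d"
  unfolding cube_def by (auto simp: PiE_iff extensional_def)

text \<open>Only pure derivatives in one coordinate enter the argument. They come from multi-indices
  supported on \<open>i\<close>, for which the nested \<open>fold\<close> collapses.\<close>

lemma smooth_ball_slice:
  assumes f: "f \<in> smooth_ball d k" and i: "i < d" and x: "x \<in> cube d"
  shows "r < k \<Longrightarrow> t \<in> {-1..1} \<Longrightarrow> ((\<lambda>t. (pdiff i ^^ r) f (x(i := t)))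
      has_real_derivative
      (pdiff i ^^ Suc r) f (x(i := t))) (at t within {-1..1})"
    and "r \<le> k \<Longrightarrow> t \<in> {-1..1} \<Longrightarrow> \<bar>(pdiff i ^^ r) f (x(i := t))\<bar> \<le> 1"
proof -
  assume r: "r < k" and t: "t \<in> {-1..1}"
  then obtain m where m: "k - r = Suc m" by (metis Suc_diff_Suc)
  have "Ck_on_cube d (Suc m) ((pdiff i ^^ r) f)"
    using Ck_funpow[of d k f i r] f i r m by (simp add: smooth_ball_def)
  then have "(\<lambda>t'. (pdiff i ^^ r) f (x(i := t, i := t'))) differentiable (at ((x(i := t)) i) within {-1..1})"
    using i cube_upd[OF x i t] by (simp only: Ck_on_cube.simps)
  then have "((\<lambda>t'. (pdiff i ^^ r) f (x(i := t'))) has_vector_derivative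
      vector_derivative (\<lambda>t'. (pdiff i ^^ r) f (x(i := t'))) (at t within {-1..1})) (at t within {-1..1})"
    by (simp add: vector_derivative_works)
  then show "((\<lambda>t. (pdiff i ^^ r) f (x(i := t))) has_real_derivative
      (pdiff i ^^ Suc r) f (x(i := t))) (at t within {-1..1})"
    by (simp add: has_real_derivative_iff_has_vector_derivative pdiff_def)
next
  assume r: "r \<le> k" and t: "t \<in> {-1..1}"
  have "mdiff d (\<lambda>j. if j = i then r else 0) f = (pdiff i ^^ r) f"
    unfolding mdiff_def by (rule fold_single[OF i])
  moreover have "(\<Sum>j<d. if j = i then r else 0) \<le> k" using r i by (simp add: sum.delta)
  then have "\<forall>x\<in>cube d. \<bar>mdiff d (\<lambda>j. if j = i then r else 0) f x\<bar> \<le> 1"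
    using f unfolding smooth_ball_def by blast
  ultimately show "\<bar>(pdiff i ^^ r) f (x(i := t))\<bar> \<le> 1" using cube_upd[OF x i t] by simp
qed

text \<open>The substitution of cosines turns Chebyshev polynomials into cosines and smoothness up
  to the boundary into smoothness of a periodic even function.\<close>

definition cosf :: "nat \<Rightarrow> ((nat \<Rightarrow> real) \<Rightarrow> real) \<Rightarrow> (nat
    \<Rightarrow> real) \<Rightarrow> real" where
  "cosf d f \<theta> = f (\<lambda>j\<in>{..<d}. cos (\<theta> j))"

lemma cos_cube: "(\<lambda>j\<in>{..<d}. cos (\<theta> j)) \<in> cube d"
  by (auto simp: cube_def)

lemma cosf_upd: "i < d \<Longrightarrow> cosf d f (\<theta>(i := t)) = f ((\<lambda>j\<in>{..<d}. cos (\<theta>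
    j))(i := cos t))"
  unfolding cosf_def by (rule arg_cong[where f = f]) auto

lemma cosf_upd_out: "\<not> i < d \<Longrightarrow> cosf d f (\<theta>(i := t)) = cosf d f \<theta>"
  unfolding cosf_def by (rule arg_cong[where f = f]) auto

lemma dbnd_cosf:
  assumes "f \<in> smooth_ball d k" "i < d" "j \<le> k"
  shows "dbnd j (fact j) (\<lambda>t. cosf d f (\<theta>(i := t)))"
proof -
  let ?x = "\<lambda>j\<in>{..<d}. cos (\<theta> j)"
  have "dbnd j (prising j (0 + 0)) (\<lambda>t. (\<lambda>r s. (pdiff i ^^ r) f (?x(i := s))) 0 (cos t) * cos t ^ 0
      * sin t ^ 0)"
    by (rule dbnd_cos_term[where k = k and \<phi> = "\<lambda>r s. (pdiff i ^^ r) f (?x(i := s))"]) (use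
        smooth_ball_slice[OF assms(1,2) cos_cube] assms(3) in auto)
  then show ?thesis using assms by (simp add: cosf_upd prising_fact)
qed

lemma (in cyclic_grid) pe_cosf: "pe (cosf d f)"
  unfolding pe_def per2_def
proof (intro allI conjI)
  fix i \<theta> t
  show "cosf d f (\<theta>(i := t + 2 * pi)) = cosf d f (\<theta>(i := t))"
    by (cases "i < d") (simp_all add: cosf_upd cosf_upd_out)
  show "cosf d f (\<theta>(i := - t)) = cosf d f (\<theta>(i := t))"
    by (cases "i < d") (simp_all add: cosf_upd cosf_upd_out)
qed

fun cheb :: "nat \<Rightarrow> real \<Rightarrow> real" where
  "cheb 0 x = 1"
| "cheb (Suc 0) x = x"
| "cheb (Suc (Suc j)) x = 2 * x * cheb (Suc j) x - cheb j x"

lemma cheb_cos: "cheb j (cos t) = cos (real j * t)"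
proof (induction j "cos t" rule: cheb.induct)
  case (3 j)
  have "cos (real (Suc (Suc j)) * t) + cos (real j * t) = 2 * cos (real (Suc j) * t) * cos t"
    using cos_times_cos[of "real (Suc j) * t" t] by (simp add: algebra_simps)
  then show ?case using 3 by (simp add: algebra_simps)
qed auto

lemma cheb_abs_le: "x \<in> {-1..1} \<Longrightarrow> \<bar>cheb j x\<bar> \<le> 1"
  using cheb_cos[of j "arccos x"] by simp

lemma abs_sin_mult_le: "\<bar>sin (real j * x)\<bar> \<le> real j * \<bar>sin x\<bar>"
proof (induction j)
  case (Suc j)
  have "\<bar>sin (real (Suc j) * x)\<bar> = \<bar>sin (real j * x) * cos x + cos (real j * x) * sin x\<bar>"
  proof -
    have "real (Suc j) * x = real j * x + x" by (simp add: distrib_right)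
    then show ?thesis by (simp only: sin_add)
  qed
  also have "\<dots> \<le> \<bar>sin (real j * x)\<bar> * \<bar>cos x\<bar> + \<bar>cos (real j * x)\<bar> *
      \<bar>sin x\<bar>"
    using abs_triangle_ineq[of "sin (real j * x) * cos x" "cos (real j * x) * sin x"] by (simp add: abs_mult)
  also have "\<dots> \<le> \<bar>sin (real j * x)\<bar> * 1 + 1 * \<bar>sin x\<bar>"
    by (intro add_mono mult_mono) auto
  finally show ?case using Suc by (simp add: distrib_right)
qed simp

text \<open>The product formula for a difference of cosines gives one factor \<open>j\<close> from
  each sine. This is Markov's slope \<open>j^2\<close>; it controls the cost of rounding points to a
  grid.\<close>

lemma cheb_lipschitz:
  assumes "x \<in> {-1..1}" "y \<in> {-1..1}"
  shows "\<bar>cheb j x - cheb j y\<bar> \<le> (real j)\<^sup>2 * \<bar>x - y\<bar>"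
proof -
  define s t where "s = arccos x" and "t = arccos y"
  have x: "x = cos s" "y = cos t" using assms by (auto simp: s_def t_def)
  have dc: "\<bar>cos a - cos b\<bar> = 2 * \<bar>sin ((a + b) / 2)\<bar> * \<bar>sin ((b - a) / 2)\<bar>" for a b
      :: real
    by (simp add: cos_diff_cos abs_mult)
  have "\<bar>cheb j x - cheb j y\<bar> = 2 * \<bar>sin (real j * ((s + t) / 2))\<bar> * \<bar>sin (real j * ((t -
      s) / 2))\<bar>"
    unfolding x cheb_cos dc by (simp add: algebra_simps diff_divide_distrib)
  also have "\<dots> \<le> 2 * (real j * \<bar>sin ((s + t) / 2)\<bar>) * (real j * \<bar>sin ((t - s) / 2)\<bar>)"
    by (intro mult_mono abs_sin_mult_le mult_left_mono) auto
  also have "\<dots> = (real j)\<^sup>2 * \<bar>x - y\<bar>" unfolding x dc by (simp add: power2_eq_square)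
  finally show ?thesis .
qed

lemma coordinatewise_lipschitz:
  fixes g :: "(nat \<Rightarrow> real) \<Rightarrow> real"
  assumes "\<And>i \<theta> s t. i < d \<Longrightarrow> \<bar>g (\<theta>(i := s)) - g (\<theta>(i := t))\<bar>
      \<le> c * \<bar>s - t\<bar>"
    and "\<And>i. d \<le> i \<Longrightarrow> \<theta> i = \<theta>' i"
  shows "\<bar>g \<theta> - g \<theta>'\<bar> \<le> c * (\<Sum>i<d. \<bar>\<theta> i - \<theta>' i\<bar>)"
proof -
  define w where "w r = (\<lambda>i. if i < r then \<theta>' i else \<theta> i)" for r
  have "\<bar>g \<theta> - g (w r)\<bar> \<le> c * (\<Sum>i<r. \<bar>\<theta> i - \<theta>' i\<bar>)" if "r \<le>
      d" for r
    using that
  proof (induction r)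
    case 0
    have "w 0 = \<theta>" by (auto simp: w_def)
    then show ?case by simp
  next
    case (Suc r)
    have e: "(w r)(r := \<theta> r) = w r" "(w r)(r := \<theta>' r) = w (Suc r)" by (auto simp: w_def fun_eq_iff
        less_Suc_eq)
    have "\<bar>g (w r) - g (w (Suc r))\<bar> \<le> c * \<bar>\<theta> r - \<theta>' r\<bar>"
      using assms(1)[of r "w r" "\<theta> r" "\<theta>' r"] Suc.prems unfolding e by simp
    with Suc show ?case by (simp add: distrib_left)
  qed
  moreover have "w d = \<theta>'" using assms(2) by (auto simp: w_def)
  ultimately show ?thesis by auto
qed

lemma smooth_ball_lipschitz:
  assumes f: "f \<in> smooth_ball d k" and k: "1 \<le> k" and x: "x \<in> cube d" "y \<in> cube d"
  shows "\<bar>f x - f y\<bar> \<le> (\<Sum>i<d. \<bar>x i - y i\<bar>)"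
proof -
  define w where "w r = (\<lambda>i. if i < r then y i else x i)" for r
  have wc: "w r \<in> cube d" for r using x by (auto simp: w_def cube_def PiE_iff extensional_def)
  have "\<bar>f x - f (w r)\<bar> \<le> (\<Sum>i<r. \<bar>x i - y i\<bar>)" if "r \<le> d" for r
    using that
  proof (induction r)
    case 0
    have "w 0 = x" by (auto simp: w_def)
    then show ?case by simp
  next
    case (Suc r)
    have e: "(w r)(r := x r) = w r" "(w r)(r := y r) = w (Suc r)" by (auto simp: w_def fun_eq_iff less_Suc_eq)
    have xy: "x r \<in> {-1..1}" "y r \<in> {-1..1}" using cube_mem[OF x(1)] cube_mem[OF x(2)] Suc.prems by (meson
        Suc_le_eq)+
    have "norm (f ((w r)(r := x r)) - f ((w r)(r := y r))) \<le> 1 * norm (x r - y r)"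
    proof (rule field_differentiable_bound[where S = "{-1..1}" and f' = "\<lambda>t. pdiff r f ((w r)(r := t))"])
      show "((\<lambda>t. f ((w r)(r := t))) has_real_derivative pdiff r f ((w r)(r := t))) (at t within {-1..1})"
          if "t \<in> {-1..1}" for t
        using smooth_ball_slice(1)[OF f _ wc, of r 0 t] k that Suc.prems by simp
      show "norm (pdiff r f ((w r)(r := t))) \<le> 1" if "t \<in> {-1..1}" for t
        using smooth_ball_slice(2)[OF f _ wc, of r 1 t] k that Suc.prems by simp
    qed (use xy in auto)
    then have "\<bar>f (w r) - f (w (Suc r))\<bar> \<le> \<bar>x r - y r\<bar>" unfolding e by simp
    with Suc show ?case by simp
  qed
  moreover have "w d = y" using x by (auto simp: w_def cube_def PiE_iff extensional_def fun_eq_iff)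
  ultimately show ?thesis by auto
qed

lemma smooth_ball_bounded: "f \<in> smooth_ball d k \<Longrightarrow> x \<in> cube d \<Longrightarrow> \<bar>f
    x\<bar> \<le> 1"
proof -
  assume f: "f \<in> smooth_ball d k" "x \<in> cube d"
  have "fold (\<lambda>i. pdiff i ^^ (0::nat)) xs f = f" for xs :: "nat list" by (induction xs) auto
  then have "mdiff d (\<lambda>_. 0) f = f" by (simp add: mdiff_def)
  moreover have "\<forall>x\<in>cube d. \<bar>mdiff d (\<lambda>_. 0) f x\<bar> \<le> 1"
    using f(1) unfolding smooth_ball_def by simp
  ultimately show ?thesis using f(2) by simp
qed

text \<open>On the grid the approximation is already known. An arbitrary angle is rounded down to a
  node, which costs a Lipschitz constant times the mesh; because that constant is known before
  \<open>H\<close> is chosen, the cost can be pushed below \<open>\<eta>\<close>.\<close>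

theorem chebyshev_approx:
  assumes d: "0 < d" and k: "1 \<le> k" and f: "f \<in> smooth_ball d k" and \<eta>: "0 < \<eta>"
  shows "\<exists>h. (\<forall>x\<in>cube d. \<bar>f x - (\<Sum>J<(R + 1) ^ d. h J * (\<Prod>i<d. cheb (dig (R + 1)
      i J) (x i)))\<bar>
      \<le> real d * (exp 113 * (jerr d k R * fact k)) + \<eta>) \<and>
    (\<forall>i<d. (\<Sum>J<(R + 1) ^ d. (h J)\<^sup>2 * real (dig (R + 1) i J) ^ (2 * k)) \<le> 2 ^ d * 4 ^ k *
        (exp 113 * fact k)\<^sup>2)"
proof -
  \<comment> \<open>A bound for every single coefficient except \<open>h 0\<close>: a nonzero
    multi-index has a digit at least 1, so its weight in the square sum is at least 1.\<close>
  define \<beta> where "\<beta> = sqrt (2 ^ d * 4 ^ k * (exp 113 * fact k)\<^sup>2)"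
  \<comment> \<open>The sum of two Lipschitz constants: \<open>f\<close> after the cosine
    substitution has slope at most 1 in each coordinate, and each of the \<open>(R + 1) ^ d\<close>
    terms of the polynomial varies by at most \<open>\<beta> * (d * R)\<close> times the
    mesh.\<close>
  define c where "c = real d + real ((R + 1) ^ d) * (\<beta> * (real d * real R))"
  have \<beta>: "0 \<le> \<beta>" by (simp add: \<beta>_def)
  have c: "0 \<le> c" using \<beta> by (simp add: c_def)
  obtain H0 :: nat where H0: "2 * pi * c / \<eta> < real H0" using reals_Archimedean2 by blast
  define H where "H = H0 + R + 1"
  interpret cyclic_grid H .
  have M: "2 * real R + 2 < M" unfolding M_def by (simp add: H_def)
  have lamc: "c * lam \<le> \<eta>"
  proof -
    have "2 * pi * c < real H0 * \<eta>" using H0 \<eta> by (simp add: pos_divide_less_eq)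
    also have "\<dots> \<le> M * \<eta>"
    proof (rule mult_right_mono)
      show "real H0 \<le> M" unfolding M_def by (simp add: H_def)
    qed (use \<eta> in simp)
    finally show ?thesis by (simp add: lam_def pos_divide_le_eq mult_ac)
  qed
  have b: "(fact j :: real) \<le> fact k" if "j \<le> k" for j using that by (rule fact_mono)
  let ?E = "real d * (exp 113 * (jerr d k R * fact k))"
  obtain h where h1: "\<And>\<theta>. (\<forall>i<d. ongrid (\<theta> i)) \<Longrightarrow> (\<forall>i\<ge>d.
      \<theta> i = 0) \<Longrightarrow>
      \<bar>cosf d f \<theta> - (\<Sum>J<(R + 1) ^ d. h J * (\<Prod>i<d. cos (of_nat (dig (R + 1) i J) * \<theta>
          i)))\<bar> \<le> ?E"
    and h2: "\<And>i. i < d \<Longrightarrow> (\<Sum>J<(R + 1) ^ d. (h J)\<^sup>2 * real (dig (R + 1) i J) ^ (2 *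
        k)) \<le> 2 ^ d * 4 ^ k * (exp 113 * fact k)\<^sup>2"
    using grid_approx[OF d k M pe_cosf dbnd_cosf[OF f] _ b] by (auto simp: less_imp_le)
  have hb: "\<bar>h J\<bar> \<le> \<beta>" if J: "J < (R + 1) ^ d" "J \<noteq> 0" for J
  proof -
    obtain i where i: "i < d" "dig (R + 1) i J \<noteq> 0"
      using dig_inj[of J "R + 1" d 0] J by auto
    have "1 \<le> real (dig (R + 1) i J) ^ (2 * k)" using i by (intro one_le_power) auto
    then have "(h J)\<^sup>2 * 1 \<le> (h J)\<^sup>2 * real (dig (R + 1) i J) ^ (2 * k)" by (intro mult_left_mono) auto
    also have "\<dots> \<le> (\<Sum>J<(R + 1) ^ d. (h J)\<^sup>2 * real (dig (R + 1) i J) ^ (2 * k))"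
      using J by (intro member_le_sum) auto
    also have "\<dots> \<le> 2 ^ d * 4 ^ k * (exp 113 * fact k)\<^sup>2" by (rule h2[OF i(1)])
    finally show ?thesis unfolding \<beta>_def by (intro real_le_rsqrt) simp
  qed
  show ?thesis
  proof (intro exI[of _ h] conjI ballI allI impI h2)
    fix x assume x: "x \<in> cube d"
    then have xi: "x i \<in> {-1..1}" if "i < d" for i using that by (rule cube_mem)
    define \<theta> where "\<theta> i = (if i < d then arccos (x i) else 0)" for i
    define \<theta>' where "\<theta>' i = (if i < d then lam * of_int \<lfloor>arccos (x i) / lam\<rfloor> else 0)"
        for i
    have \<theta>\<theta>': "\<bar>\<theta> i - \<theta>' i\<bar> \<le> lam" if "i < d" for i
    proof -
      have "of_int \<lfloor>arccos (x i) / lam\<rfloor> \<le> arccos (x i) / lam" "arccos (x i) / lam \<le> of_int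
          \<lfloor>arccos (x i) / lam\<rfloor> + 1"
        by (rule of_int_floor_le, rule real_of_int_floor_add_one_ge)
      then have "of_int \<lfloor>arccos (x i) / lam\<rfloor> * lam \<le> arccos (x i)" "arccos (x i) \<le> (of_int
          \<lfloor>arccos (x i) / lam\<rfloor> + 1) * lam"
        by (simp_all only: pos_le_divide_eq[OF lam_pos] pos_divide_le_eq[OF lam_pos])
      then show ?thesis using that by (simp add: \<theta>_def \<theta>'_def algebra_simps)
    qed
    have s: "(\<Sum>i<d. \<bar>\<theta> i - \<theta>' i\<bar>) \<le> real d * lam"
      using sum_mono[of "{..<d}" "\<lambda>i. \<bar>\<theta> i - \<theta>' i\<bar>" "\<lambda>_. lam"]
          \<theta>\<theta>' by simp
    have cosx: "cos (\<theta> i) = x i" if "i < d" for i using that xi[OF that] by (simp add: \<theta>_def)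
    have fx: "f x = cosf d f \<theta>"
    proof -
      have "(\<lambda>j\<in>{..<d}. cos (\<theta> j)) = x"
        using x cosx by (auto simp: fun_eq_iff cube_def PiE_iff extensional_def)
      then show ?thesis by (simp add: cosf_def)
    qed
    have "\<bar>cosf d f \<theta> - cosf d f \<theta>'\<bar> \<le> 1 * (\<Sum>i<d. \<bar>\<theta> i - \<theta>'
        i\<bar>)"
    proof (rule coordinatewise_lipschitz)
      fix i \<theta> s t assume "i < d"
      then have "dbnd 1 1 (\<lambda>t. cosf d f (\<theta>(i := t)))" using dbnd_cosf[OF f, of i 1 \<theta>] k by simp
      then have "\<bar>cosf d f (\<theta>(i := t + (s - t))) - cosf d f (\<theta>(i := t))\<bar> \<le> 1 * \<bar>s
          - t\<bar>"
        unfolding One_nat_def dbnd.simps by blast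
      then show "\<bar>cosf d f (\<theta>(i := s)) - cosf d f (\<theta>(i := t))\<bar> \<le> 1 * \<bar>s - t\<bar>"
          by simp
    qed (auto simp: \<theta>_def \<theta>'_def)
    then have 1: "\<bar>cosf d f \<theta> - cosf d f \<theta>'\<bar> \<le> real d * lam" using s by simp
    have 2: "\<bar>cosf d f \<theta>' - (\<Sum>J<(R + 1) ^ d. h J * (\<Prod>i<d. cos (of_nat (dig (R + 1) i J) *
        \<theta>' i)))\<bar> \<le> ?E"
      by (rule h1) (auto simp: \<theta>'_def ongrid_def)
    have 3: "\<bar>(\<Sum>J<(R + 1) ^ d. h J * (\<Prod>i<d. cos (of_nat (dig (R + 1) i J) * \<theta>' i))) -
        (\<Sum>J<(R + 1) ^ d. h J * (\<Prod>i<d. cos (of_nat (dig (R + 1) i J) * \<theta> i)))\<bar> \<le> real ((R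
            + 1) ^ d) * (\<beta> * (real d * real R * lam))"
    proof -
      have "\<bar>(\<Sum>J<(R + 1) ^ d. h J * (\<Prod>i<d. cos (of_nat (dig (R + 1) i J) * \<theta>' i))) -
          (\<Sum>J<(R + 1) ^ d. h J * (\<Prod>i<d. cos (of_nat (dig (R + 1) i J) * \<theta> i)))\<bar> \<le>
        (\<Sum>J<(R + 1) ^ d. \<bar>h J * ((\<Prod>i<d. cos (of_nat (dig (R + 1) i J) * \<theta>' i)) -
            (\<Prod>i<d. cos (of_nat (dig (R + 1) i J) * \<theta> i)))\<bar>)"
        unfolding sum_subtractf[symmetric] right_diff_distrib by (rule sum_abs)
      also have "\<dots> \<le> (\<Sum>J<(R + 1) ^ d. \<beta> * (real d * real R * lam))"
      proof (intro sum_mono)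
        fix J assume J: "J \<in> {..<(R + 1) ^ d}"
        let ?j = "\<lambda>i. real (dig (R + 1) i J)"
        show "\<bar>h J * ((\<Prod>i<d. cos (?j i * \<theta>' i)) - (\<Prod>i<d. cos (?j i * \<theta> i)))\<bar>
            \<le> \<beta> * (real d * real R * lam)"
        \<comment> \<open>The constant term cancels in the difference, which is why
          \<open>h 0\<close> needs no bound.\<close>
        proof (cases "J = 0")
          case True
          have "0 \<le> \<beta> * (real d * real R * lam)"
            using \<beta> less_imp_le[OF lam_pos] by (intro mult_nonneg_nonneg) auto
          then show ?thesis using True by simp
        next
          case False
          have "norm ((\<Prod>i<d. cos (?j i * \<theta>' i)) - (\<Prod>i<d. cos (?j i * \<theta> i))) \<le>
              (\<Sum>i<d. norm (cos (?j i * \<theta>' i) - cos (?j i * \<theta> i)))"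
            by (rule norm_prod_diff) auto
          also have "\<dots> \<le> (\<Sum>i<d. real R * lam)"
          proof (intro sum_mono)
            fix i assume "i \<in> {..<d}"
            have jR: "dig (R + 1) i J \<le> R" using dig_less[of "R + 1" i J] by simp
            have lip: "\<bar>cos a - cos b\<bar> \<le> \<bar>a - b\<bar>" for a b :: real
            proof -
              have "norm (cos a - cos b) \<le> 1 * norm (a - b)"
                by (rule field_differentiable_bound[where S = UNIV and f' = "\<lambda>x. - sin x"]) (auto intro!:
                    derivative_eq_intros)
              then show ?thesis by simp
            qed
            have "\<bar>cos (?j i * \<theta>' i) - cos (?j i * \<theta> i)\<bar> \<le> \<bar>?j i * \<theta>' i -
                ?j i * \<theta> i\<bar>" by (rule lip)
            also have "\<dots> = ?j i * \<bar>\<theta> i - \<theta>' i\<bar>" unfolding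
                right_diff_distrib[symmetric] abs_mult by (simp add: abs_minus_commute)
            also have "\<dots> \<le> real R * lam" using jR \<theta>\<theta>' \<open>i \<in> {..<d}\<close> by
                (intro mult_mono) auto
            finally show "norm (cos (?j i * \<theta>' i) - cos (?j i * \<theta> i)) \<le> real R * lam" by simp
          qed
          finally have "\<bar>(\<Prod>i<d. cos (?j i * \<theta>' i)) - (\<Prod>i<d. cos (?j i * \<theta> i))\<bar>
              \<le> real d * real R * lam" by simp
          then show ?thesis unfolding abs_mult using hb[of J] J False \<beta> by (intro mult_mono) auto
        qed
      qed
      finally show ?thesis by simp
    qed
    have "\<bar>cosf d f \<theta> - (\<Sum>J<(R + 1) ^ d. h J * (\<Prod>i<d. cos (of_nat (dig (R + 1) i J) *
        \<theta> i)))\<bar> \<le>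
       real d * lam + ?E + real ((R + 1) ^ d) * (\<beta> * (real d * real R * lam))"
      using 1 2 3 by linarith
    also have "\<dots> = ?E + c * lam" by (simp add: c_def algebra_simps)
    also have "\<dots> \<le> ?E + \<eta>" using lamc by simp
    also have "(\<Sum>J<(R + 1) ^ d. h J * (\<Prod>i<d. cos (of_nat (dig (R + 1) i J) * \<theta> i))) =
       (\<Sum>J<(R + 1) ^ d. h J * (\<Prod>i<d. cheb (dig (R + 1) i J) (x i)))"
    proof -
      have "(\<Prod>i<d. cos (of_nat (dig (R + 1) i J) * \<theta> i)) = (\<Prod>i<d. cheb (dig (R + 1) i J) (x i))"
          for J
        by (intro prod.cong refl) (simp add: cheb_cos[symmetric] cosx)
      then show ?thesis by simp
    qed
    finally show "\<bar>f x - (\<Sum>J<(R + 1) ^ d. h J * (\<Prod>i<d. cheb (dig (R + 1) i J) (x i)))\<bar> \<le>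
        ?E + \<eta>"
      unfolding fx .
  qed
qed

section \<open>The Gaussian mechanism\<close>

definition gauss :: "real measure" where
  "gauss = density lborel std_normal_density"

definition gaussn :: "nat \<Rightarrow> (nat \<Rightarrow> real) measure" where
  "gaussn m = (\<Pi>\<^sub>M i\<in>{..<m}. gauss)"

lemma sets_gauss [measurable_cong, simp]: "sets gauss = sets borel"
  by (simp add: gauss_def)

lemma space_gauss [simp]: "space gauss = UNIV"
  by (simp add: gauss_def)

lemma prob_space_gauss: "prob_space gauss"
  unfolding gauss_def by (rule prob_space_normal_density) simp

interpretation gauss_product: product_sigma_finite "\<lambda>_::nat. gauss"
  by (intro product_sigma_finite.intro prob_space_imp_sigma_finite prob_space_gauss)

lemma prob_space_gaussn: "prob_space (gaussn m)"
  unfolding gaussn_def by (rule prob_space_PiM) (rule prob_space_gauss)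

text \<open>Completing the square in the density; the one-dimensional Cameron-Martin
  formula.\<close>

lemma gauss_shift:
  fixes f :: "real \<Rightarrow> ennreal"
  assumes [measurable]: "f \<in> borel_measurable borel"
  shows "(\<integral>\<^sup>+ y. f (y + a) \<partial>gauss) = (\<integral>\<^sup>+ y. f y * ennreal (exp (a * y -
      a\<^sup>2 / 2)) \<partial>gauss)"
proof -
  have "(\<integral>\<^sup>+ y. f (y + a) \<partial>gauss) = (\<integral>\<^sup>+ y. ennreal (std_normal_density y)
      * f (y + a) \<partial>lborel)"
    unfolding gauss_def by (subst nn_integral_density) auto
  also have "\<dots> = (\<integral>\<^sup>+ y. ennreal (std_normal_density (- a + 1 * y)) * f (- a + 1 * y + a)
      \<partial>lborel)"
    by (subst nn_integral_real_affine[where c = 1 and t = "- a"]) auto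
  also have "\<dots> = (\<integral>\<^sup>+ y. ennreal (std_normal_density y) * (f y * ennreal (exp (a * y -
      a\<^sup>2 / 2))) \<partial>lborel)"
  proof (intro nn_integral_cong)
    fix y :: real
    have "std_normal_density (- a + 1 * y) = std_normal_density y * exp (a * y - a\<^sup>2 / 2)"
    proof -
      have "- (y - a)\<^sup>2 / 2 = - y\<^sup>2 / 2 + (a * y - a\<^sup>2 / 2)"
        by (simp add: power2_eq_square field_simps)
      then show ?thesis by (simp add: std_normal_density_def exp_add[symmetric])
    qed
    then show "ennreal (std_normal_density (- a + 1 * y)) * f (- a + 1 * y + a) =
      ennreal (std_normal_density y) * (f y * ennreal (exp (a * y - a\<^sup>2 / 2)))"
      by (simp add: ennreal_mult mult_ac)
  qed
  also have "\<dots> = (\<integral>\<^sup>+ y. f y * ennreal (exp (a * y - a\<^sup>2 / 2)) \<partial>gauss)"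
    unfolding gauss_def by (subst nn_integral_density) auto
  finally show ?thesis .
qed

lemma gaussn_Suc: "gaussn (Suc m) = (\<Pi>\<^sub>M i\<in>insert m {..<m}. gauss)"
  by (simp add: gaussn_def lessThan_Suc)

lemma gaussn_shift:
  assumes "f \<in> borel_measurable (gaussn m)"
  shows "(\<integral>\<^sup>+ g. f (\<lambda>i\<in>{..<m}. g i + a i) \<partial>gaussn m) =
    (\<integral>\<^sup>+ g. f g * ennreal (exp (\<Sum>i<m. a i * g i - (a i)\<^sup>2 / 2)) \<partial>gaussn m)"
  using assms
proof (induction m arbitrary: f)
  case 0
  show ?case
    by (intro nn_integral_cong) (auto simp: gaussn_def space_PiM)
next
  case (Suc m)
  note [measurable] = Suc.prems[unfolded gaussn_Suc]
  let ?E = "\<lambda>g::nat \<Rightarrow> real. \<Sum>i<m. a i * g i - (a i)\<^sup>2 / 2"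
  let ?e = "\<lambda>y. a m * y - (a m)\<^sup>2 / 2"
  have upd: "(\<lambda>y. f (x(m := y))) \<in> borel_measurable borel" if "x \<in> space (gaussn m)" for x
  proof -
    have "(\<lambda>y. x(m := y)) \<in> measurable gauss (\<Pi>\<^sub>M i\<in>insert m {..<m}. gauss)"
      using that by (intro measurable_component_update) (auto simp: gaussn_def)
    from measurable_compose[OF this Suc.prems[unfolded gaussn_Suc]] show ?thesis
      by (simp only: measurable_cong_sets[OF sets_gauss refl])
  qed
  have "(\<integral>\<^sup>+ g. f (\<lambda>i\<in>{..<Suc m}. g i + a i) \<partial>gaussn (Suc m)) =
    (\<integral>\<^sup>+ x. (\<integral>\<^sup>+ y. f (\<lambda>i\<in>{..<Suc m}. (x(m := y)) i + a i)
        \<partial>gauss) \<partial>gaussn m)"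
    unfolding gaussn_Suc unfolding gaussn_def
    by (rule gauss_product.product_nn_integral_insert) (auto simp: lessThan_Suc)
  also have "\<dots> = (\<integral>\<^sup>+ x. (\<integral>\<^sup>+ y. f ((\<lambda>i\<in>{..<m}. x i + a i)(m :=
      y)) * ennreal (exp (?e y)) \<partial>gauss) \<partial>gaussn m)"
  proof (rule nn_integral_cong)
    fix x assume "x \<in> space (gaussn m)"
    have *: "(\<lambda>i\<in>{..<m}. x i + a i) \<in> space (gaussn m)" by (auto simp: gaussn_def space_PiM)
    have "(\<integral>\<^sup>+ y. f (\<lambda>i\<in>{..<Suc m}. (x(m := y)) i + a i) \<partial>gauss) =
       (\<integral>\<^sup>+ y. f ((\<lambda>i\<in>{..<m}. x i + a i)(m := y + a m)) \<partial>gauss)"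
      by (intro nn_integral_cong arg_cong[where f = f]) (auto simp: fun_eq_iff)
    also have "\<dots> = (\<integral>\<^sup>+ y. f ((\<lambda>i\<in>{..<m}. x i + a i)(m := y)) * ennreal (exp (?e
        y)) \<partial>gauss)"
      by (rule gauss_shift[OF upd[OF *]])
    finally show "(\<integral>\<^sup>+ y. f (\<lambda>i\<in>{..<Suc m}. (x(m := y)) i + a i) \<partial>gauss) =
      (\<integral>\<^sup>+ y. f ((\<lambda>i\<in>{..<m}. x i + a i)(m := y)) * ennreal (exp (?e y)) \<partial>gauss)" .
  qed
  also have "\<dots> = (\<integral>\<^sup>+ x. (\<integral>\<^sup>+ y. f (x(m := y)) * ennreal (exp (?e y))
      \<partial>gauss) * ennreal (exp (?E x)) \<partial>gaussn m)"
  proof (rule Suc.IH)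
    have [measurable]: "(\<lambda>(x, y). x(m := y)) \<in> gaussn m \<Otimes>\<^sub>M gauss \<rightarrow>\<^sub>M
        (\<Pi>\<^sub>M i\<in>insert m {..<m}. gauss)"
      unfolding gaussn_def by (rule measurable_add_dim)
    show "(\<lambda>x. \<integral>\<^sup>+ y. f (x(m := y)) * ennreal (exp (?e y)) \<partial>gauss) \<in>
        borel_measurable (gaussn m)"
    proof (rule sigma_finite_measure.borel_measurable_nn_integral[OF prob_space_imp_sigma_finite[OF prob_space_gauss]])
      have "(\<lambda>p. f ((\<lambda>(x, y). x(m := y)) p) * ennreal (exp (?e (snd p)))) \<in> borel_measurable
          (gaussn m \<Otimes>\<^sub>M gauss)"
        by measurable
      then show "(\<lambda>(x, y). f (x(m := y)) * ennreal (exp (?e y))) \<in> borel_measurable (gaussn m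
          \<Otimes>\<^sub>M gauss)"
        by (simp add: case_prod_beta')
    qed
  qed
  also have "\<dots> = (\<integral>\<^sup>+ x. (\<integral>\<^sup>+ y. f (x(m := y)) * ennreal (exp (\<Sum>i<Suc m.
      a i * (x(m := y)) i - (a i)\<^sup>2 / 2)) \<partial>gauss) \<partial>gaussn m)"
  proof (intro nn_integral_cong)
    fix x assume x: "x \<in> space (gaussn m)"
    have "(\<integral>\<^sup>+ y. f (x(m := y)) * ennreal (exp (?e y)) \<partial>gauss) * ennreal (exp (?E x)) =
      (\<integral>\<^sup>+ y. f (x(m := y)) * ennreal (exp (?e y)) * ennreal (exp (?E x)) \<partial>gauss)"
      using upd[OF x] by (subst nn_integral_multc) auto
    also have "\<dots> = (\<integral>\<^sup>+ y. f (x(m := y)) * ennreal (exp (\<Sum>i<Suc m. a i * (x(m := y)) i -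
        (a i)\<^sup>2 / 2)) \<partial>gauss)"
    proof (intro nn_integral_cong)
      fix y
      have "(\<Sum>i<Suc m. a i * (x(m := y)) i - (a i)\<^sup>2 / 2) = ?E x + ?e y" by simp
      then show "f (x(m := y)) * ennreal (exp (?e y)) * ennreal (exp (?E x)) =
         f (x(m := y)) * ennreal (exp (\<Sum>i<Suc m. a i * (x(m := y)) i - (a i)\<^sup>2 / 2))"
        by (simp only: exp_add ennreal_mult exp_ge_zero mult_ac)
    qed
    finally show "(\<integral>\<^sup>+ y. f (x(m := y)) * ennreal (exp (?e y)) \<partial>gauss) * ennreal (exp (?E x)) =
      (\<integral>\<^sup>+ y. f (x(m := y)) * ennreal (exp (\<Sum>i<Suc m. a i * (x(m := y)) i - (a i)\<^sup>2 /
          2)) \<partial>gauss)" .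
  qed
  also have "\<dots> = (\<integral>\<^sup>+ g. f g * ennreal (exp (\<Sum>i<Suc m. a i * g i - (a i)\<^sup>2 / 2))
      \<partial>gaussn (Suc m))"
    unfolding gaussn_Suc unfolding gaussn_def
    by (rule gauss_product.product_nn_integral_insert[symmetric]) (auto simp: lessThan_Suc)
  finally show ?case .
qed

text \<open>Apply the shift formula to the constant function 1: the likelihood ratio integrates to
  1.\<close>

lemma gaussn_exp_moment:
  "(\<integral>\<^sup>+ g. ennreal (exp (\<Sum>i<m. c i * g i)) \<partial>gaussn m) = ennreal (exp ((\<Sum>i<m. (c
      i)\<^sup>2) / 2))"
proof -
  interpret prob_space "gaussn m" by (rule prob_space_gaussn)
  have [measurable]: "(\<lambda>g. \<Sum>i<m. c i * g i - (c i)\<^sup>2 / 2) \<in> borel_measurable (gaussn m)"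
    unfolding gaussn_def by measurable
  have "(\<integral>\<^sup>+ g. ennreal (exp (\<Sum>i<m. c i * g i)) \<partial>gaussn m) =
    (\<integral>\<^sup>+ g. ennreal (exp ((\<Sum>i<m. (c i)\<^sup>2) / 2)) * ennreal (exp (\<Sum>i<m. c i * g i -
        (c i)\<^sup>2 / 2)) \<partial>gaussn m)"
    by (intro nn_integral_cong)
       (simp add: ennreal_mult[symmetric] exp_add[symmetric] sum_subtractf sum_divide_distrib[symmetric])
  also have "\<dots> = ennreal (exp ((\<Sum>i<m. (c i)\<^sup>2) / 2)) * (\<integral>\<^sup>+ g. 1 * ennreal (exp
      (\<Sum>i<m. c i * g i - (c i)\<^sup>2 / 2)) \<partial>gaussn m)"
    by (subst nn_integral_cmult) auto
  also have "(\<integral>\<^sup>+ g. 1 * ennreal (exp (\<Sum>i<m. c i * g i - (c i)\<^sup>2 / 2)) \<partial>gaussn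
      m) = (\<integral>\<^sup>+ g. 1 \<partial>gaussn m)"
    using gaussn_shift[of "\<lambda>_. 1" m c] by simp
  finally show ?thesis by (simp add: emeasure_space_1)
qed

lemma ln_five_quarters: "1 / 5 \<le> ln (1.25 :: real)"
proof -
  have "ln (0.8 :: real) \<le> 0.8 - 1" by (rule ln_le_minus_one) simp
  moreover have "ln (1.25 :: real) = - ln 0.8" using ln_inverse[of "0.8 :: real"] by simp
  ultimately show ?thesis by simp
qed

text \<open>Keeps the logarithm away from 0 for all \<open>\<delta>\<close> below 1, so that terms
  of order \<open>\<epsilon> < 1\<close> can be absorbed into it.\<close>

lemma ln_delta_ge: "0 < \<delta> \<Longrightarrow> \<delta> < 1 \<Longrightarrow> 1 / 5 \<le> ln (1.25 /
    (\<delta>::real))"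
proof -
  assume d: "0 < \<delta>" "\<delta> < 1"
  then have "ln (1.25 :: real) \<le> ln (1.25 / \<delta>)" by (simp add: ln_div)
  with ln_five_quarters show ?thesis by linarith
qed

text \<open>The likelihood ratio is \<open>e\<^sup>\<ell>\<close> with \<open>\<ell>\<close> Gaussian; the event \<open>\<ell> > \<epsilon>\<close> is controlled by an exponential
  moment of order \<open>lambda\<close>.\<close>

lemma gaussian_mechanism:
  assumes eps: "0 < \<epsilon>" "\<epsilon> < 1" and delta: "0 < \<delta>" "\<delta> < 1"
    and a: "(\<Sum>i<m. (a i)\<^sup>2) \<le> \<epsilon>\<^sup>2 / (16 * ln (1.25 / \<delta>))"
    and B: "B \<in> sets (gaussn m)"
  shows "measure (gaussn m) {g \<in> space (gaussn m). (\<lambda>i\<in>{..<m}. g i + a i) \<in> B} \<le> exp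
      \<epsilon> * measure (gaussn m) B + \<delta>"
proof -
  interpret prob_space "gaussn m" by (rule prob_space_gaussn)
  define v where "v = ln (1.25 / \<delta>)"
  have v: "1 / 5 \<le> v" unfolding v_def by (rule ln_delta_ge[OF delta])
  \<comment> \<open>With this order, \<open>l * \<epsilon> = 8 v\<close>, while the variance bound
    gives \<open>l^2 A / 2 <= 2 v\<close> and \<open>l A / 2 <= \<epsilon> / 4\<close>. The exponent
    is then at most \<open>- 6 v + \<epsilon> / 4\<close>, hence at most \<open>- v\<close>.\<close>
  define l where "l = 8 * v / \<epsilon>"
  have l: "0 < l" using v eps by (simp add: l_def)
  define A where "A = (\<Sum>i<m. (a i)\<^sup>2)"
  have A: "0 \<le> A" "A \<le> \<epsilon>\<^sup>2 / (16 * v)" using a by (auto simp: A_def v_def intro: sum_nonneg)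
  let ?L = "\<lambda>g::nat \<Rightarrow> real. \<Sum>i<m. a i * g i - (a i)\<^sup>2 / 2"
  let ?G = "\<lambda>g::nat \<Rightarrow> real. exp ((1 + l) * ?L g - l * \<epsilon>)"
  have [measurable]: "?L \<in> borel_measurable (gaussn m)" unfolding gaussn_def by measurable
  have [measurable]: "(\<lambda>g. \<lambda>i\<in>{..<m}. g i + a i) \<in> measurable (gaussn m) (gaussn m)"
    unfolding gaussn_def by measurable
  note [measurable] = B
  have "emeasure (gaussn m) {g \<in> space (gaussn m). (\<lambda>i\<in>{..<m}. g i + a i) \<in> B} =
    (\<integral>\<^sup>+ g. indicator B (\<lambda>i\<in>{..<m}. g i + a i) \<partial>gaussn m)"
  proof -
    let ?S = "{g \<in> space (gaussn m). (\<lambda>i\<in>{..<m}. g i + a i) \<in> B}"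
    have "(\<integral>\<^sup>+ g. indicator B (\<lambda>i\<in>{..<m}. g i + a i) \<partial>gaussn m) =
        (\<integral>\<^sup>+ g. indicator ?S g \<partial>gaussn m)"
      by (intro nn_integral_cong) (simp add: indicator_def)
    also have "\<dots> = emeasure (gaussn m) ?S" by (rule nn_integral_indicator) measurable
    finally show ?thesis ..
  qed
  also have "\<dots> = (\<integral>\<^sup>+ g. indicator B g * ennreal (exp (?L g)) \<partial>gaussn m)"
    by (rule gaussn_shift) simp
  also have "\<dots> \<le> (\<integral>\<^sup>+ g. ennreal (exp \<epsilon>) * indicator B g + ennreal (?G g)
      \<partial>gaussn m)"
  proof (intro nn_integral_mono)
    fix g
    show "indicator B g * ennreal (exp (?L g)) \<le> ennreal (exp \<epsilon>) * indicator B g + ennreal (?G g)"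
    proof (cases "?L g \<le> \<epsilon>")
      case True
      then have "indicator B g * ennreal (exp (?L g)) \<le> ennreal (exp \<epsilon>) * indicator B g"
        by (subst mult.commute) (intro mult_right_mono ennreal_leI, auto)
      then show ?thesis by (rule order_trans) simp
    next
      case False
      \<comment> \<open>Markov's inequality in pointwise form: beyond the threshold the likelihood
        ratio is dominated by its tilted power.\<close>
      then have "l * \<epsilon> \<le> l * ?L g" using l by (intro mult_left_mono) auto
      then have "exp (?L g) \<le> ?G g" by (simp add: distrib_right)
      then have "indicator B g * ennreal (exp (?L g)) \<le> 1 * ennreal (?G g)"
        by (intro mult_mono ennreal_leI) (auto simp: indicator_def)
      then show ?thesis by (rule order_trans) simp
    qed
  qed
  also have "\<dots> = ennreal (exp \<epsilon>) * emeasure (gaussn m) B + (\<integral>\<^sup>+ g. ennreal (?G g)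
      \<partial>gaussn m)"
    by (subst nn_integral_add) (auto simp: nn_integral_cmult)
  also have "(\<integral>\<^sup>+ g. ennreal (?G g) \<partial>gaussn m) \<le> ennreal \<delta>"
  proof -
    have "?G g = exp (- l * \<epsilon> - (1 + l) * A / 2) * exp (\<Sum>i<m. (1 + l) * a i * g i)" for g
      unfolding exp_add[symmetric] A_def
      by (simp add: sum_subtractf sum_divide_distrib[symmetric] sum_distrib_left right_diff_distrib mult.assoc)
    then have "(\<integral>\<^sup>+ g. ennreal (?G g) \<partial>gaussn m) =
      (\<integral>\<^sup>+ g. ennreal (exp (- l * \<epsilon> - (1 + l) * A / 2)) * ennreal (exp (\<Sum>i<m. (1 + l)
          * a i * g i)) \<partial>gaussn m)"
      by (intro nn_integral_cong) (simp only: ennreal_mult exp_ge_zero)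
    also have "\<dots> = ennreal (exp (- l * \<epsilon> - (1 + l) * A / 2)) * (\<integral>\<^sup>+ g. ennreal (exp
        (\<Sum>i<m. (1 + l) * a i * g i)) \<partial>gaussn m)"
      by (rule nn_integral_cmult) (simp add: gaussn_def)
    also have "\<dots> = ennreal (exp (- l * \<epsilon> - (1 + l) * A / 2 + (1 + l)\<^sup>2 * A / 2))"
      unfolding gaussn_exp_moment
      by (simp add: ennreal_mult[symmetric] exp_add[symmetric] power_mult_distrib sum_distrib_left[symmetric] A_def)
    also have "- l * \<epsilon> - (1 + l) * A / 2 + (1 + l)\<^sup>2 * A / 2 = - l * \<epsilon> + (l\<^sup>2 + l) *
        A / 2"
      by (simp add: power2_eq_square field_simps)
    also have "ennreal (exp (- l * \<epsilon> + (l\<^sup>2 + l) * A / 2)) \<le> ennreal \<delta>"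
    proof (rule ennreal_leI)
      have "(l\<^sup>2 + l) * A / 2 \<le> (l\<^sup>2 + l) * (\<epsilon>\<^sup>2 / (16 * v)) / 2"
        using A l by (intro divide_right_mono mult_left_mono) auto
      also have "\<dots> = 2 * v + \<epsilon> / 4" using eps v by (simp add: l_def power2_eq_square field_simps)
      finally have "- l * \<epsilon> + (l\<^sup>2 + l) * A / 2 \<le> - 6 * v + \<epsilon> / 4"
        using eps by (simp add: l_def)
      also have "\<dots> \<le> - v" using v eps by linarith
      finally have "exp (- l * \<epsilon> + (l\<^sup>2 + l) * A / 2) \<le> exp (- v)" by simp
      also have "exp (- v) = \<delta> / 1.25" using delta by (simp add: v_def exp_minus)
      also have "\<dots> \<le> \<delta>" using delta by simp
      finally show "exp (- l * \<epsilon> + (l\<^sup>2 + l) * A / 2) \<le> \<delta>" .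
    qed
    finally show ?thesis .
  qed
  finally have "ennreal (measure (gaussn m) {g \<in> space (gaussn m). (\<lambda>i\<in>{..<m}. g i + a i) \<in> B})
      \<le>
    ennreal (exp \<epsilon> * measure (gaussn m) B + \<delta>)"
    using delta by (simp add: emeasure_eq_measure ennreal_mult[symmetric] ennreal_plus[symmetric] del: ennreal_plus)
  then show ?thesis using delta by (subst (asm) ennreal_le_iff) auto
qed

lemma distr_pair_snd:
  assumes "prob_space P" "prob_space Q"
  shows "distr (P \<Otimes>\<^sub>M Q) Q snd = Q"
proof (rule measure_eqI)
  interpret P: prob_space P by fact
  interpret Q: prob_space Q by fact
  fix A assume "A \<in> sets (distr (P \<Otimes>\<^sub>M Q) Q snd)"
  then have A: "A \<in> sets Q" by simp
  have "snd -` A \<inter> space (P \<Otimes>\<^sub>M Q) = space P \<times> A"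
    using sets.sets_into_space[OF A] by (auto simp: space_pair_measure)
  then show "emeasure (distr (P \<Otimes>\<^sub>M Q) Q snd) A = emeasure Q A"
    using A by (simp add: emeasure_distr Q.emeasure_pair_measure_Times P.emeasure_space_1)
qed simp

definition draw :: "(real \<times> real) measure" where
  "draw = uniform_measure lborel {0..1} \<Otimes>\<^sub>M gauss"

lemma prob_space_uniform01: "prob_space (uniform_measure lborel {0..1::real})"
  by (rule prob_space_uniform_measure) auto

lemma prob_space_draw: "prob_space draw"
proof -
  interpret P: prob_space "uniform_measure lborel {0..1::real}" by (rule prob_space_uniform01)
  interpret Q: prob_space gauss by (rule prob_space_gauss)
  interpret PQ: pair_prob_space "uniform_measure lborel {0..1::real}" gauss ..
  show ?thesis unfolding draw_def by unfold_locales
qed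

lemma tape_def': "tape = (\<Pi>\<^sub>M i\<in>UNIV. draw)"
  by (simp add: tape_def draw_def gauss_def)

lemma prob_space_tape: "prob_space tape"
  unfolding tape_def' by (rule prob_space_PiM) (rule prob_space_draw)

definition normals :: "nat \<Rightarrow> (nat \<Rightarrow> real \<times> real) \<Rightarrow> nat \<Rightarrow>
    real" where
  "normals m \<omega> = (\<lambda>i\<in>{..<m}. snd (\<omega> i))"

lemma snd_draw [measurable]: "snd \<in> measurable draw gauss"
  unfolding draw_def by simp

lemma measurable_normals [measurable]: "normals m \<in> measurable tape (gaussn m)"
proof -
  have "(\<lambda>\<omega>. snd (\<omega> i)) \<in> measurable tape gauss" for i
  proof -
    have "(\<lambda>\<omega>. \<omega> i) \<in> measurable tape draw"
      unfolding tape_def' by (rule measurable_component_singleton) simp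
    from measurable_compose[OF this snd_draw] show ?thesis .
  qed
  then show ?thesis
    unfolding normals_def gaussn_def by (rule measurable_restrict)
qed

text \<open>Transfers the problem from the infinite tape to the finite product
  \<open>gaussn m\<close>, where likelihood ratios exist.\<close>

lemma distr_normals: "distr tape (gaussn m) (normals m) = gaussn m"
proof -
  let ?D = "\<Pi>\<^sub>M i\<in>{..<m}. draw"
  have 1: "distr tape ?D (\<lambda>\<omega>. \<lambda>i\<in>{..<m}. \<omega> i) = ?D"
    unfolding tape_def' by (rule distr_PiM_reindex[where f = "\<lambda>i. i"]) (auto intro: prob_space_draw)
  have 2: "distr ?D (gaussn m) (compose {..<m} snd) = (\<Pi>\<^sub>M i\<in>{..<m}. distr draw gauss snd)"
    unfolding gaussn_def by (rule distr_PiM_finite_prob_space') (auto intro: prob_space_draw prob_space_gauss)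
  have 3: "distr draw gauss snd = gauss"
    unfolding draw_def by (rule distr_pair_snd[OF prob_space_uniform01 prob_space_gauss])
  have m1: "(\<lambda>\<omega>. \<lambda>i\<in>{..<m}. \<omega> i) \<in> measurable tape ?D"
    unfolding tape_def' by measurable
  have m2: "compose {..<m} snd \<in> measurable ?D (gaussn m)"
    unfolding gaussn_def compose_def by measurable
  have "gaussn m = distr ?D (gaussn m) (compose {..<m} snd)" using 2 unfolding 3 by (simp only: gaussn_def)
  also have "\<dots> = distr (distr tape ?D (\<lambda>\<omega>. \<lambda>i\<in>{..<m}. \<omega> i)) (gaussn m)
      (compose {..<m} snd)" unfolding 1 ..
  also have "\<dots> = distr tape (gaussn m) (compose {..<m} snd \<circ> (\<lambda>\<omega>. \<lambda>i\<in>{..<m}.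
      \<omega> i))"
    by (rule distr_distr[OF m2 m1])
  also have "compose {..<m} snd \<circ> (\<lambda>\<omega>. \<lambda>i\<in>{..<m}. \<omega> i) = normals m"
    by (auto simp: fun_eq_iff compose_def normals_def)
  finally show ?thesis ..
qed

lemma gauss_second_moment: "integrable gauss (\<lambda>x. x\<^sup>2)" "(\<integral>x. x\<^sup>2 \<partial>gauss) = 1"
proof -
  have "has_bochner_integral lborel (\<lambda>x. std_normal_density x * x\<^sup>2) 1"
    using std_normal_moment_even[of 1] by (simp add: fact_numeral)
  then have "has_bochner_integral gauss (\<lambda>x. x\<^sup>2) 1"
    unfolding gauss_def by (intro has_bochner_integral_density) auto
  then show "integrable gauss (\<lambda>x. x\<^sup>2)" "(\<integral>x. x\<^sup>2 \<partial>gauss) = 1"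
    by (auto simp: has_bochner_integral_iff)
qed

lemma tape_second_moment:
  "integrable tape (\<lambda>\<omega>. (snd (\<omega> i))\<^sup>2)" "(\<integral>\<omega>. (snd (\<omega>
      i))\<^sup>2 \<partial>tape) = 1"
proof -
  have m: "(\<lambda>\<omega>. snd (\<omega> i)) \<in> measurable tape gauss"
  proof -
    have "(\<lambda>\<omega>. \<omega> i) \<in> measurable tape draw"
      unfolding tape_def' by (rule measurable_component_singleton) simp
    from measurable_compose[OF this snd_draw] show ?thesis .
  qed
  have "distr tape gauss (\<lambda>\<omega>. snd (\<omega> i)) = distr (distr tape draw (\<lambda>\<omega>.
      \<omega> i)) gauss snd"
    unfolding tape_def' by (subst distr_distr) (auto simp: comp_def)
  also have "distr tape draw (\<lambda>\<omega>. \<omega> i) = draw"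
    unfolding tape_def' by (rule distr_PiM_component) (auto intro: prob_space_draw)
  also have "distr draw gauss snd = gauss"
    unfolding draw_def by (rule distr_pair_snd[OF prob_space_uniform01 prob_space_gauss])
  finally have d: "distr tape gauss (\<lambda>\<omega>. snd (\<omega> i)) = gauss" .
  show "integrable tape (\<lambda>\<omega>. (snd (\<omega> i))\<^sup>2)"
    using integrable_distr[OF m, of "\<lambda>x. x\<^sup>2"] gauss_second_moment(1) unfolding d by simp
  show "(\<integral>\<omega>. (snd (\<omega> i))\<^sup>2 \<partial>tape) = 1"
    using integral_distr[OF m, of "\<lambda>x. x\<^sup>2"] gauss_second_moment(2) unfolding d by simp
qed

section \<open>Empirical measures and herding\<close>

definition avg :: "('a \<Rightarrow> real) \<Rightarrow> 'a list \<Rightarrow> real" where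
  "avg f xs = (\<Sum>i<length xs. f (xs ! i)) / real (length xs)"

lemma sum_list_map_count:
  fixes f :: "'a \<Rightarrow> real"
  shows "sum_list (map f xs) = (\<Sum>a\<in>set xs. real (count_list xs a) * f a)"
proof (induction xs)
  case (Cons x xs)
  have "(\<Sum>a\<in>set (x # xs). real (count_list (x # xs) a) * f a) =
    (\<Sum>a\<in>set (x # xs). (if a = x then f a else 0) + real (count_list xs a) * f a)"
    by (intro sum.cong refl) (simp add: algebra_simps)
  also have "\<dots> = f x + (\<Sum>a\<in>set (x # xs). real (count_list xs a) * f a)"
    unfolding sum.distrib by (simp add: sum.delta del: set_simps) simp
  also have "(\<Sum>a\<in>set (x # xs). real (count_list xs a) * f a) = (\<Sum>a\<in>set xs. real (count_list xs a)
      * f a)"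
    by (rule sum.mono_neutral_right) (auto simp: count_list_0_iff)
  finally show ?case using Cons by simp
qed simp

lemma integral_empirical:
  assumes "xs \<noteq> []"
  shows "(\<integral>x. f x \<partial>empirical (mset xs)) = avg f xs"
proof -
  have ne: "mset xs \<noteq> {#}" using assms by simp
  have "(\<integral>x. f x \<partial>empirical (mset xs)) = (\<Sum>a\<in>set xs. f a * pmf (pmf_of_multiset (mset
      xs)) a)"
    unfolding empirical_def using ne by (intro integral_measure_pmf_real) (auto simp: set_pmf_of_multiset)
  also have "\<dots> = (\<Sum>a\<in>set xs. real (count_list xs a) * f a) / real (length xs)"
    using ne by (simp add: pmf_of_multiset count_mset sum_divide_distrib mult.commute)
  also have "(\<Sum>a\<in>set xs. real (count_list xs a) * f a) = sum_list (map f xs)"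
    by (rule sum_list_map_count[symmetric])
  also have "sum_list (map f xs) = (\<Sum>i<length xs. f (xs ! i))"
    by (simp add: sum_list_sum_nth lessThan_atLeast0)
  finally show ?thesis unfolding avg_def .
qed

lemma avg_abs_le:
  assumes "xs \<noteq> []" "\<And>x. x \<in> set xs \<Longrightarrow> \<bar>f x\<bar> \<le> c"
  shows "\<bar>avg f xs\<bar> \<le> c"
proof -
  have "\<bar>\<Sum>i<length xs. f (xs ! i)\<bar> \<le> (\<Sum>i<length xs. c)"
    using assms(2) by (intro order_trans[OF sum_abs] sum_mono) auto
  then show ?thesis using assms(1) by (simp add: avg_def field_simps)
qed

lemma avg_diff: "avg (\<lambda>x. f x - g x) xs = avg f xs - avg g xs"
  by (simp add: avg_def sum_subtractf diff_divide_distrib)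

lemma avg_sum: "avg (\<lambda>x. \<Sum>J\<in>I. h J * f J x) xs = (\<Sum>J\<in>I. h J * avg (f J) xs)"
  unfolding avg_def sum_divide_distrib sum_distrib_left
  by (subst sum.swap) simp

lemma avg_const: "xs \<noteq> [] \<Longrightarrow> avg (\<lambda>_. c) xs = c"
  by (simp add: avg_def)

lemma pdiff_zero:
  assumes "\<forall>x\<in>cube d. F x = 0" "x \<in> cube d" "i < d"
  shows "((\<lambda>t. F (x(i := t))) has_vector_derivative 0) (at (x i) within {-1..1})" "pdiff i F x = 0"
proof -
  have xi: "x i \<in> {-1..1}" using assms cube_mem by blast
  show d: "((\<lambda>t. F (x(i := t))) has_vector_derivative 0) (at (x i) within {-1..1})"
  proof (rule has_vector_derivative_transform[OF xi])
    show "((\<lambda>_. 0) has_vector_derivative 0) (at (x i) within {-1..1})" by simp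
    show "F (x(i := t)) = 0" if "t \<in> {-1..1}" for t using assms cube_upd that by blast
  qed
  show "pdiff i F x = 0"
    unfolding pdiff_def using xi by (intro vector_derivative_within_cbox[of _ _ "x i" _ 0, unfolded cbox_interval]
        d) auto
qed

text \<open>Vanishing is assumed on the cube only, because the values of \<open>pdiff\<close>
  outside the cube are not controlled; this form survives the induction.\<close>

lemma Ck_zero: "\<forall>x\<in>cube d. F x = 0 \<Longrightarrow> Ck_on_cube d k F"
proof (induction k arbitrary: F)
  case 0
  then show ?case by (simp add: continuous_on_cong[where g = "\<lambda>_. 0"])
next
  case (Suc k)
  have "continuous_on (cube d) F" using Suc.prems by (simp add: continuous_on_cong[where g = "\<lambda>_. 0"])
  moreover have "Ck_on_cube d k (pdiff i F)" if "i < d" for i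
    using pdiff_zero(2)[OF Suc.prems _ that] by (intro Suc.IH) auto
  moreover have "(\<lambda>t. F (x(i := t))) differentiable (at (x i) within {-1..1})" if "i < d" "x \<in> cube d"
      for i x
    using pdiff_zero(1)[OF Suc.prems that(2,1)] by (rule differentiableI_vector)
  ultimately show ?case by simp
qed

text \<open>Shows that the supremum in \<open>dk\<close> is over a nonempty set, as required by the
  least-upper-bound rule for conditionally complete orders.\<close>

lemma zero_smooth_ball: "(\<lambda>_. 0) \<in> smooth_ball d k"
proof -
  have 1: "\<forall>x\<in>cube d. (pdiff i ^^ m) F x = 0" if "\<forall>x\<in>cube d. F x = 0" "i < d" for i m F
    using that by (induction m) (auto simp: pdiff_zero)
  have 2: "\<forall>x\<in>cube d. fold (\<lambda>i. pdiff i ^^ \<alpha> i) xs F x = 0" if "\<forall>x\<in>cube d. F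
      x = 0" "set xs \<subseteq> {..<d}" for \<alpha> xs F
    using that
  proof (induction xs arbitrary: F)
    case (Cons i xs)
    have "\<forall>x\<in>cube d. (pdiff i ^^ \<alpha> i) F x = 0" using Cons.prems by (intro 1) auto
    then show ?case using Cons.IH[of "(pdiff i ^^ \<alpha> i) F"] Cons.prems by simp
  qed simp
  have "\<bar>mdiff d \<alpha> (\<lambda>_. 0) x\<bar> \<le> 1" if "x \<in> cube d" for \<alpha> x
    using 2[of "\<lambda>_. 0" "[0..<d]" \<alpha>] that by (auto simp: mdiff_def atLeast0LessThan)
  then show ?thesis by (simp add: smooth_ball_def Ck_zero)
qed

definition "pts d xs \<longleftrightarrow> xs \<noteq> [] \<and> set xs \<subseteq> cube d"

lemma dk_eq: "pts d xs \<Longrightarrow> pts d ys \<Longrightarrow>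
    dk d k (empirical (mset xs)) (empirical (mset ys)) = (SUP f\<in>smooth_ball d k. \<bar>avg f xs - avg f ys\<bar>)"
  unfolding dk_def pts_def by (simp add: integral_empirical)

lemma avg_diff_le_2:
  assumes "pts d xs" "pts d ys" "f \<in> smooth_ball d k"
  shows "\<bar>avg f xs - avg f ys\<bar> \<le> 2"
proof -
  have "\<bar>avg f xs\<bar> \<le> 1" "\<bar>avg f ys\<bar> \<le> 1"
    using assms smooth_ball_bounded[OF assms(3)] unfolding pts_def by (auto intro!: avg_abs_le)
  then show ?thesis by linarith
qed

lemma dk_upper: "pts d xs \<Longrightarrow> pts d ys \<Longrightarrow> (\<And>f. f \<in> smooth_ball d k
    \<Longrightarrow> \<bar>avg f xs - avg f ys\<bar> \<le> c) \<Longrightarrow>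
    dk d k (empirical (mset xs)) (empirical (mset ys)) \<le> c"
  unfolding dk_eq using zero_smooth_ball by (intro cSUP_least) auto

lemma dk_lower: "pts d xs \<Longrightarrow> pts d ys \<Longrightarrow> f \<in> smooth_ball d k \<Longrightarrow>
    \<bar>avg f xs - avg f ys\<bar> \<le>
    dk d k (empirical (mset xs)) (empirical (mset ys))"
  unfolding dk_eq by (intro cSUP_upper bdd_aboveI2[where M = 2] avg_diff_le_2)

lemma dk_bounds:
  assumes "pts d xs" "pts d ys"
  shows "0 \<le> dk d k (empirical (mset xs)) (empirical (mset ys))" "dk d k (empirical (mset xs)) (empirical (mset
      ys)) \<le> 2"
  using order_trans[OF abs_ge_zero dk_lower[OF assms zero_smooth_ball]] dk_upper[OF assms avg_diff_le_2[OF assms]]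
      by auto

text \<open>\<open>dk\<close> is Lipschitz in the points of the second dataset; this yields measurability by
  approximation with rational points.\<close>

definition cdist :: "nat \<Rightarrow> nat \<Rightarrow> (nat \<Rightarrow> nat \<Rightarrow> real) \<Rightarrow>
    (nat \<Rightarrow> nat \<Rightarrow> real) \<Rightarrow> real" where
  "cdist d m x y = (\<Sum>j<m. \<Sum>i<d. \<bar>x j i - y j i\<bar>)"

lemma dk_lipschitz:
  assumes xs: "pts d xs" and m: "0 < m" and k: "1 \<le> k"
    and y: "\<And>j. j < m \<Longrightarrow> y j \<in> cube d" and z: "\<And>j. j < m \<Longrightarrow> z j \<in>
        cube d"
  shows "dk d k (empirical (mset xs)) (empirical (mset (map y [0..<m]))) \<le>
    dk d k (empirical (mset xs)) (empirical (mset (map z [0..<m]))) + cdist d m y z"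
proof -
  have py: "pts d (map y [0..<m])" and pz: "pts d (map z [0..<m])"
    using m y z by (auto simp: pts_def)
  show ?thesis
  proof (rule dk_upper[OF xs py])
    fix f assume f: "f \<in> smooth_ball d k"
    have "\<bar>avg f (map z [0..<m]) - avg f (map y [0..<m])\<bar> = \<bar>\<Sum>j<m. f (z j) - f (y j)\<bar> / real m"
      using m by (simp add: avg_def diff_divide_distrib[symmetric] sum_subtractf[symmetric] abs_divide)
    also have "\<dots> \<le> (\<Sum>j<m. \<Sum>i<d. \<bar>y j i - z j i\<bar>) / real m"
    proof (intro divide_right_mono order_trans[OF sum_abs] sum_mono)
      fix j assume "j \<in> {..<m}"
      then show "\<bar>f (z j) - f (y j)\<bar> \<le> (\<Sum>i<d. \<bar>y j i - z j i\<bar>)"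
        using smooth_ball_lipschitz[OF f k, of "y j" "z j"] y z by (simp add: abs_minus_commute)
    qed simp
    also have "\<dots> \<le> cdist d m y z / 1"
      unfolding cdist_def using m by (intro divide_left_mono sum_nonneg) auto
    finally have "\<bar>avg f (map z [0..<m]) - avg f (map y [0..<m])\<bar> \<le> cdist d m y z" by simp
    with dk_lower[OF xs pz f] show "\<bar>avg f xs - avg f (map y [0..<m])\<bar> \<le>
      dk d k (empirical (mset xs)) (empirical (mset (map z [0..<m]))) + cdist d m y z" by linarith
  qed
qed

lemma space_pm: "space (\<Pi>\<^sub>M j\<in>{..<m}. cube_space d) = ({..<m} \<rightarrow>\<^sub>E cube d)"
  by (simp add: space_PiM cube_space_space)

lemma dk_measurable_PiM:
  assumes xs: "pts d xs" and m: "0 < m" and k: "1 \<le> k"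
  shows "(\<lambda>x. dk d k (empirical (mset xs)) (empirical (mset (map x [0..<m])))) \<in> borel_measurable
      (\<Pi>\<^sub>M j\<in>{..<m}. cube_space d)"
proof (rule borel_measurableI_less)
  let ?P = "\<Pi>\<^sub>M j\<in>{..<m}. cube_space d"
  let ?G = "\<lambda>x. dk d k (empirical (mset xs)) (empirical (mset (map x [0..<m])))"
  define D where "D = ({..<m} \<rightarrow>\<^sub>E ({..<d} \<rightarrow>\<^sub>E (\<rat> \<inter> {-1..1::real})))"
  have D: "countable D" unfolding D_def by (intro countable_PiE) (auto intro: countable_subset[OF _ countable_rat])
  have Dc: "D \<subseteq> ({..<m} \<rightarrow>\<^sub>E cube d)" unfolding D_def cube_def by (intro PiE_mono) auto
  have pm: "x j \<in> cube d" if "x \<in> ({..<m} \<rightarrow>\<^sub>E cube d)" "j < m" for x j using that by auto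
  have meas: "(\<lambda>x. cdist d m x y) \<in> borel_measurable ?P" for y
  proof -
    have "(\<lambda>x. x j i) \<in> borel_measurable ?P" if "j < m" "i < d" for i j
    proof -
      have "(\<lambda>x. x j) \<in> measurable ?P (cube_space d)" using that by (intro
          measurable_component_singleton) auto
      moreover have "(\<lambda>x. x i) \<in> measurable (cube_space d) (restrict_space borel {-1..1})"
        unfolding cube_space_def using that by (intro measurable_component_singleton) auto
      moreover have "(\<lambda>t. t) \<in> measurable (restrict_space borel {-1..1::real}) borel"
        by (rule measurable_restrict_space1) simp
      ultimately show ?thesis by (auto intro: measurable_compose)
    qed
    then show ?thesis unfolding cdist_def by (intro borel_measurable_sum borel_measurable_abs
        borel_measurable_diff) auto
  qed
  fix c
  \<comment> \<open>A sublevel set of the Lipschitz function is a countable union of sublevel sets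
    of sums of a constant and a measurable distance.\<close>
  have "{x \<in> space ?P. ?G x < c} = (\<Union>y\<in>D. {x \<in> space ?P. ?G y + cdist d m x y < c})"
  proof (intro set_eqI iffI)
    fix x assume "x \<in> {x \<in> space ?P. ?G x < c}"
    then have x: "x \<in> ({..<m} \<rightarrow>\<^sub>E cube d)" "?G x < c" by (auto simp: space_pm)
    \<comment> \<open>The distance is paid twice, once inside \<open>?G y\<close> and once
      explicitly; the added 1 makes the resulting inequality strict.\<close>
    define K where "K = 2 * (real m * real d + 1)"
    have K: "0 < K" by (simp add: K_def add_nonneg_pos)
    define e where "e = (c - ?G x) / K"
    have e: "0 < e" unfolding e_def using x(2) K by (intro divide_pos_pos) (simp_all only: diff_gt_0_iff_gt)
    have "K * (u / K) = u" for u using K by simp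
    then have Ke: "K * e = c - ?G x" unfolding e_def .
    \<comment> \<open>The rational approximation is taken from the side of 0, so that it stays in
      the interval.\<close>
    have "\<exists>q\<in>\<rat> \<inter> {-1..1}. \<bar>t - q\<bar> \<le> e" if t: "t \<in> {-1..1}" for t :: real
    proof (cases "t < 0")
      case True
      obtain q where "q \<in> \<rat>" "t < q" "q < min 0 (t + e)" using Rats_dense_in_real[of t "min 0 (t + e)"]
          True e by auto
      then show ?thesis using t by (intro bexI[of _ q]) auto
    next
      case False
      show ?thesis
      proof (cases "t = 0")
        case True
        then show ?thesis using e by (intro bexI[of _ 0]) auto
      next
        case nz: False
        obtain q where "q \<in> \<rat>" "max 0 (t - e) < q" "q < t" using Rats_dense_in_real[of "max 0 (t - e)" t]
            False nz e by auto
        then show ?thesis using t by (intro bexI[of _ q]) auto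
      qed
    qed
    then obtain q where q: "\<And>t. t \<in> {-1..1} \<Longrightarrow> q t \<in> \<rat> \<inter> {-1..1} \<and>
        \<bar>t - q t\<bar> \<le> e" by metis
    define y where "y = (\<lambda>j\<in>{..<m}. \<lambda>i\<in>{..<d}. q (x j i))"
    have xj: "x j i \<in> {-1..1}" if "j < m" "i < d" for i j using cube_mem[OF pm[OF x(1) that(1)] that(2)] .
    have yD: "y \<in> D" unfolding D_def y_def by (intro PiE_I) (use q xj in auto)
    have "cdist d m x y \<le> (\<Sum>j<m. \<Sum>i<d. e)"
      unfolding cdist_def y_def by (intro sum_mono) (use q xj in auto)
    then have cd: "cdist d m x y \<le> real m * real d * e" by simp
    have sym: "cdist d m y x = cdist d m x y" by (simp add: cdist_def abs_minus_commute)
    have "?G y \<le> ?G x + cdist d m y x"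
      using pm x(1) Dc yD by (intro dk_lipschitz[OF xs m k]) blast+
    then have "?G y + cdist d m x y \<le> ?G x + 2 * (real m * real d * e)" using cd sym by simp
    also have "\<dots> < ?G x + K * e" using e by (simp add: K_def algebra_simps)
    also have "\<dots> = c" unfolding Ke by (simp only: add_diff_cancel_left' add_diff_eq add_diff_cancel)
    finally show "x \<in> (\<Union>y\<in>D. {x \<in> space ?P. ?G y + cdist d m x y < c})" using x yD by (auto
        simp: space_pm)
  next
    fix x assume "x \<in> (\<Union>y\<in>D. {x \<in> space ?P. ?G y + cdist d m x y < c})"
    then obtain y where y: "y \<in> D" "x \<in> space ?P" "?G y + cdist d m x y < c" by auto
    have "?G x \<le> ?G y + cdist d m x y"
      using pm y Dc by (intro dk_lipschitz[OF xs m k]) (auto simp: space_pm)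
    then show "x \<in> {x \<in> space ?P. ?G x < c}" using y by auto
  qed
  also have "\<dots> \<in> sets ?P"
    using meas D by (intro sets.countable_UN') (auto intro!: borel_measurable_add simp:
        borel_measurable_iff_less[symmetric])
  finally show "{x \<in> space ?P. ?G x < c} \<in> sets ?P" .
qed

text \<open>By construction of \<open>dataset_space\<close>, measurability is tested on tuples of
  each length \<open>m\<close> separately. Length 0 has empty preimage, since the empty multiset is
  excluded.\<close>

lemma dk_measurable:
  assumes xs: "pts d xs" and k: "1 \<le> k"
  shows "(\<lambda>Y. dk d k (empirical (mset xs)) (empirical Y)) \<in> borel_measurable (dataset_space d)"
proof (rule measurableI)
  fix B :: "real set" assume B: "B \<in> sets borel"
  let ?g = "\<lambda>Y. dk d k (empirical (mset xs)) (empirical Y)"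
  show "?g -` B \<inter> space (dataset_space d) \<in> sets (dataset_space d)"
    unfolding sets_dataset_space space_dataset_space
  proof (intro CollectI conjI allI)
    fix m :: nat
    let ?P = "\<Pi>\<^sub>M j\<in>{..<m}. cube_space d"
    let ?h = "\<lambda>x. mset (map x [0..<m])"
    show "?h -` (?g -` B \<inter> synthetic_datasets d) \<inter> space ?P \<in> sets ?P"
    proof (cases "m = 0")
      case True
      then have "?h -` (?g -` B \<inter> synthetic_datasets d) \<inter> space ?P = {}"
        by (auto simp: synthetic_datasets_def)
      then show ?thesis by (simp only: sets.empty_sets)
    next
      case False
      have "?h x \<in> synthetic_datasets d" if "x \<in> space ?P" for x
      proof -
        have "set (map x [0..<m]) \<subseteq> cube d" using that by (auto simp: space_pm PiE_iff)
        then show ?thesis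
          unfolding synthetic_datasets_def mem_Collect_eq set_mset_mset mset_zero_iff
          using False by (simp del: set_map)
      qed
      then have "?h -` (?g -` B \<inter> synthetic_datasets d) \<inter> space ?P = (\<lambda>x. ?g (?h x)) -` B
          \<inter> space ?P"
        by auto
      also have "\<dots> \<in> sets ?P"
        using False B by (intro measurable_sets[OF dk_measurable_PiM[OF xs _ k]]) auto
      finally show ?thesis .
    qed
  qed auto
qed simp

section \<open>Greedy herding in a weighted Euclidean norm\<close>

definition nrm :: "(nat \<Rightarrow> real) \<Rightarrow> nat \<Rightarrow> (nat \<Rightarrow> real) \<Rightarrow>
    real" where
  "nrm w N z = sqrt (\<Sum>J<N. w J * (z J)\<^sup>2)"

lemma nrm_L2: "\<forall>J<N. 0 \<le> w J \<Longrightarrow> nrm w N z = L2_set (\<lambda>J. sqrt (w J) * z J) {..<N}"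
  unfolding nrm_def L2_set_def by (intro arg_cong[where f = sqrt] sum.cong refl) (simp add: power_mult_distrib)

lemma nrm_ge_0: "\<forall>J<N. 0 \<le> w J \<Longrightarrow> 0 \<le> nrm w N z"
  unfolding nrm_def by (intro real_sqrt_ge_zero sum_nonneg) auto

lemma nrm_sq: "\<forall>J<N. 0 \<le> w J \<Longrightarrow> (nrm w N z)\<^sup>2 = (\<Sum>J<N. w J * (z J)\<^sup>2)"
  unfolding nrm_def by (intro real_sqrt_pow2 sum_nonneg) auto

lemma nrm_add:
  assumes "\<forall>J<N. 0 \<le> w J"
  shows "nrm w N (\<lambda>J. x J + y J) \<le> nrm w N x + nrm w N y"
  unfolding nrm_L2[OF assms] distrib_left by (rule L2_set_triangle_ineq)

lemma nrm_cmult: "\<forall>J<N. 0 \<le> w J \<Longrightarrow> nrm w N (\<lambda>J. c * x J) = \<bar>c\<bar> * nrm w N x"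
proof -
  have "(\<Sum>J<N. w J * (c * x J)\<^sup>2) = c\<^sup>2 * (\<Sum>J<N. w J * (x J)\<^sup>2)"
    unfolding sum_distrib_left by (intro sum.cong refl) (simp add: power_mult_distrib)
  then show ?thesis by (simp add: nrm_def real_sqrt_mult)
qed

lemma nrm_uminus: "nrm w N (\<lambda>J. - x J) = nrm w N x"
  by (simp add: nrm_def)

lemma nrm_le_const:
  assumes "\<And>J. J < N \<Longrightarrow> 0 \<le> w J \<and> w J \<le> 1" "\<And>J. J < N \<Longrightarrow>
      \<bar>z J\<bar> \<le> c" "0 \<le> c"
  shows "nrm w N z \<le> sqrt (real N) * c"
proof -
  have "(\<Sum>J<N. w J * (z J)\<^sup>2) \<le> (\<Sum>J<N. 1 * c\<^sup>2)"
  proof (intro sum_mono mult_mono)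
    fix J assume "J \<in> {..<N}"
    then show "(z J)\<^sup>2 \<le> c\<^sup>2" using assms(2)[of J] assms(3) by (intro abs_le_square_iff[THEN
        iffD1]) auto
  qed (use assms in auto)
  then have "nrm w N z \<le> sqrt (real N * c\<^sup>2)" unfolding nrm_def by (intro real_sqrt_le_mono) simp
  then show ?thesis using assms(3) by (simp add: real_sqrt_mult)
qed

lemma ip_le:
  assumes "\<forall>J<N. 0 \<le> w J"
  shows "(\<Sum>J<N. w J * x J * y J) \<le> nrm w N x * nrm w N y"
proof -
  have "(\<Sum>J<N. w J * x J * y J) = (\<Sum>J<N. (sqrt (w J) * x J) * (sqrt (w J) * y J))"
  proof (intro sum.cong refl)
    fix J assume "J \<in> {..<N}"
    then have "w J = sqrt (w J) * sqrt (w J)" using assms by simp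
    then have "w J * x J * y J = (sqrt (w J) * sqrt (w J)) * x J * y J" by simp
    then show "w J * x J * y J = (sqrt (w J) * x J) * (sqrt (w J) * y J)" by (simp only: mult_ac)
  qed
  also have "\<dots> \<le> (\<Sum>J<N. \<bar>sqrt (w J) * x J\<bar> * \<bar>sqrt (w J) * y J\<bar>)"
    by (intro sum_mono) (metis abs_ge_self abs_mult)
  also have "\<dots> \<le> nrm w N x * nrm w N y" unfolding nrm_L2[OF assms] by (rule L2_set_mult_ineq)
  finally show ?thesis .
qed

text \<open>Written as a left-to-right scan with strict comparison, so that it agrees step by step
  with the program loop; ties go to the smallest index.\<close>

primrec amin :: "(nat \<Rightarrow> real) \<Rightarrow> nat \<Rightarrow> nat" where
  "amin v 0 = 0"
| "amin v (Suc c) = (if v c < v (amin v c) then c else amin v c)"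

lemma amin_less: "0 < N \<Longrightarrow> amin v N < N"
proof (induction N)
  case (Suc N)
  then show ?case by (cases "N = 0") auto
qed simp

lemma amin_le: "c < N \<Longrightarrow> v (amin v N) \<le> v c"
  by (induction N) (auto simp: less_Suc_eq)

definition score :: "(nat \<Rightarrow> nat \<Rightarrow> real) \<Rightarrow> (nat \<Rightarrow> real)
    \<Rightarrow> nat \<Rightarrow> (nat \<Rightarrow> real) \<Rightarrow> nat \<Rightarrow> real" where
  "score \<phi> w N S c = (\<Sum>J<N. w J * S J * \<phi> c J)"

primrec hsum :: "(nat \<Rightarrow> nat \<Rightarrow> real) \<Rightarrow> (nat \<Rightarrow> real) \<Rightarrow>
    nat \<Rightarrow> nat \<Rightarrow> (nat \<Rightarrow> real) \<Rightarrow> nat \<Rightarrow> nat \<Rightarrow>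
    real" where
  "hsum \<phi> w N C v 0 = (\<lambda>J. 0)"
| "hsum \<phi> w N C v (Suc t) = (\<lambda>J. hsum \<phi> w N C v t J + (\<phi> (amin (score \<phi> w N (hsum
    \<phi> w N C v t)) C) J - v J))"

definition pick :: "(nat \<Rightarrow> nat \<Rightarrow> real) \<Rightarrow> (nat \<Rightarrow> real) \<Rightarrow>
    nat \<Rightarrow> nat \<Rightarrow> (nat \<Rightarrow> real) \<Rightarrow> nat \<Rightarrow> nat" where
  "pick \<phi> w N C v t = amin (score \<phi> w N (hsum \<phi> w N C v t)) C"

lemma hsum_eq: "hsum \<phi> w N C v t J = (\<Sum>i<t. \<phi> (pick \<phi> w N C v i) J) - real t * v J"
  by (induction t) (simp_all add: pick_def algebra_simps)

text \<open>Herding: the greedy choice makes the inner product of the accumulated error with the new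
  increment at most \<open>\<eta>\<close> times the norm of the former, since the minimum over the candidates is at
  most the average.\<close>

lemma herding:
  assumes w: "\<forall>J<N. 0 \<le> w J" and C: "0 < C" and m: "0 < m" and cs: "\<And>i. i < m \<Longrightarrow> cs
      i < C"
    and eta: "nrm w N (\<lambda>J. (\<Sum>i<m. \<phi> (cs i) J) / real m - v J) \<le> \<eta>"
    and D: "\<And>c. c < C \<Longrightarrow> nrm w N (\<lambda>J. \<phi> c J - v J) \<le> D"
  shows "nrm w N (hsum \<phi> w N C v t) \<le> \<eta> * real t + D * sqrt (real t)"
proof (induction t)
  case 0
  show ?case by (simp add: nrm_def)
next
  case (Suc t)
  let ?S = "hsum \<phi> w N C v t"
  let ?c = "amin (score \<phi> w N ?S) C"
  let ?b = "\<lambda>J. (\<Sum>i<m. \<phi> (cs i) J) / real m"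
  have \<eta>0: "0 \<le> \<eta>" using eta nrm_ge_0[OF w] order_trans by blast
  have D0: "0 \<le> D" by (rule order_trans[OF nrm_ge_0[OF w] D[OF C]])
  have "real m * score \<phi> w N ?S ?c = (\<Sum>i<m. score \<phi> w N ?S ?c)" by simp
  also have "\<dots> \<le> (\<Sum>i<m. score \<phi> w N ?S (cs i))"
    using cs by (intro sum_mono amin_le) auto
  also have "\<dots> = (\<Sum>J<N. \<Sum>i<m. w J * ?S J * \<phi> (cs i) J)" unfolding score_def by (rule sum.swap)
  also have "\<dots> = real m * (\<Sum>J<N. w J * ?S J * ?b J)"
    unfolding sum_distrib_left using m by (intro sum.cong refl) (simp add: sum_distrib_left[symmetric])
  finally have "score \<phi> w N ?S ?c \<le> (\<Sum>J<N. w J * ?S J * ?b J)" using m by simp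
  then have "(\<Sum>J<N. w J * ?S J * (\<phi> ?c J - v J)) \<le> (\<Sum>J<N. w J * ?S J * (?b J - v J))"
    unfolding score_def right_diff_distrib sum_subtractf by simp
  also have "\<dots> \<le> nrm w N ?S * nrm w N (\<lambda>J. ?b J - v J)" by (rule ip_le[OF w])
  also have "\<dots> \<le> nrm w N ?S * \<eta>" using eta nrm_ge_0[OF w] by (intro mult_left_mono) auto
  finally have ip: "(\<Sum>J<N. w J * ?S J * (\<phi> ?c J - v J)) \<le> nrm w N ?S * \<eta>" .
  have "(nrm w N (hsum \<phi> w N C v (Suc t)))\<^sup>2 = (\<Sum>J<N. w J * (?S J + (\<phi> ?c J - v J))\<^sup>2)"
    unfolding nrm_sq[OF w] by simp
  also have "\<dots> = (nrm w N ?S)\<^sup>2 + 2 * (\<Sum>J<N. w J * ?S J * (\<phi> ?c J - v J)) + (nrm w N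
      (\<lambda>J. \<phi> ?c J - v J))\<^sup>2"
    unfolding nrm_sq[OF w] sum_distrib_left sum.distrib[symmetric]
    by (intro sum.cong refl) (simp add: power2_eq_square algebra_simps)
  also have "\<dots> \<le> (nrm w N ?S)\<^sup>2 + 2 * (nrm w N ?S * \<eta>) + D\<^sup>2"
    using ip D[OF amin_less[OF C]] nrm_ge_0[OF w] by (intro add_mono power_mono mult_left_mono order_refl) auto
  \<comment> \<open>Adding \<open>\<eta>^2\<close> completes the square. It separates the drift
    \<open>\<eta>\<close> per step from the random-walk growth \<open>D * sqrt t\<close>.\<close>
  also have "\<dots> \<le> (nrm w N ?S + \<eta>)\<^sup>2 + D\<^sup>2" using \<eta>0 by (simp add: power2_sum)
  also have "\<dots> \<le> (\<eta> * real t + D * sqrt (real t) + \<eta>)\<^sup>2 + D\<^sup>2"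
    using Suc nrm_ge_0[OF w] \<eta>0 D0 by (intro add_mono power_mono) auto
  also have "\<dots> = (\<eta> * real (Suc t))\<^sup>2 + 2 * (\<eta> * real (Suc t)) * (D * sqrt (real t)) +
      D\<^sup>2 * real (Suc t)"
  proof -
    have "(D * sqrt (real t))\<^sup>2 = D\<^sup>2 * real t" by (simp add: power_mult_distrib)
    moreover have "\<eta> * real t + D * sqrt (real t) + \<eta> = \<eta> * real (Suc t) + D * sqrt (real t)" by
        (simp add: algebra_simps)
    ultimately show ?thesis by (simp add: power2_sum algebra_simps)
  qed
  also have "\<dots> \<le> (\<eta> * real (Suc t))\<^sup>2 + 2 * (\<eta> * real (Suc t)) * (D * sqrt (real (Suc
      t))) + D\<^sup>2 * real (Suc t)"
    using \<eta>0 D0 by (intro add_mono mult_left_mono order_refl) auto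
  also have "\<dots> = (\<eta> * real (Suc t) + D * sqrt (real (Suc t)))\<^sup>2"
    by (simp add: power2_sum power_mult_distrib)
  finally show ?case using \<eta>0 D0 by (elim power2_le_imp_le) (auto intro!: add_nonneg_nonneg mult_nonneg_nonneg)
qed

lemma measurable_amin:
  assumes "\<And>c. c < C \<Longrightarrow> (\<lambda>x. f x c) \<in> borel_measurable M" "0 < C"
  shows "(\<lambda>x. amin (f x) C) \<in> measurable M (count_space UNIV)"
proof -
  \<comment> \<open>Extension by 0 makes every index measurable, which the composition with a
    measurable choice of index requires.\<close>
  define f' where "f' c x = (if c < C then f x c else 0)" for c x
  have [measurable]: "f' c \<in> borel_measurable M" for c
    using assms(1)[of c] by (cases "c < C") (auto simp: f'_def[abs_def])
  have "(\<lambda>x. amin (\<lambda>c. f' c x) m) \<in> measurable M (count_space UNIV)" for m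
  proof (induction m)
    case (Suc m)
    note [measurable] = Suc
    have [measurable]: "(\<lambda>x. f' (amin (\<lambda>c. f' c x) m) x) \<in> borel_measurable M"
      by (rule measurable_compose_countable[OF _ Suc]) simp
    show ?case unfolding amin.simps by measurable
  qed simp
  moreover have "amin (\<lambda>c. f' c x) C = amin (f x) C" for x
  proof -
    have "m \<le> C \<Longrightarrow> amin (\<lambda>c. f' c x) m = amin (f x) m" for m
    proof (induction m)
      case (Suc m)
      have "amin (f x) m < C" using amin_less[of m "f x"] Suc.prems assms(2) by (cases m) auto
      then show ?case using Suc by (simp add: f'_def)
    qed simp
    then show ?thesis by simp
  qed
  then have "(\<lambda>x. amin (f x) C) = (\<lambda>x. amin (\<lambda>c. f' c x) C)" by simp
  ultimately show ?thesis by (simp only:)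
qed

lemma measurable_hsum:
  assumes v: "\<And>J. J < N \<Longrightarrow> (\<lambda>x. v x J) \<in> borel_measurable M" and C: "0 < C"
  shows "J < N \<Longrightarrow> (\<lambda>x. hsum \<phi> w N C (v x) t J) \<in> borel_measurable M"
    and "(\<lambda>x. pick \<phi> w N C (v x) t) \<in> measurable M (count_space UNIV)"
proof -
  have pick: "(\<lambda>x. pick \<phi> w N C (v x) t) \<in> measurable M (count_space UNIV)"
    if "\<And>J. J < N \<Longrightarrow> (\<lambda>x. hsum \<phi> w N C (v x) t J) \<in> borel_measurable M" for t
    unfolding pick_def score_def using that C
    by (intro measurable_amin borel_measurable_sum borel_measurable_times) auto
  have hs: "J < N \<Longrightarrow> (\<lambda>x. hsum \<phi> w N C (v x) t J) \<in> borel_measurable M" for J t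
  proof (induction t arbitrary: J)
    case (Suc t)
    have "(\<lambda>x. \<phi> (pick \<phi> w N C (v x) t) J) \<in> borel_measurable M"
      by (rule measurable_compose[OF pick[OF Suc.IH]]) auto
    then show ?case
      using Suc v by (auto simp: pick_def intro!: borel_measurable_add borel_measurable_diff)
  qed simp
  show "J < N \<Longrightarrow> (\<lambda>x. hsum \<phi> w N C (v x) t J) \<in> borel_measurable M" by (rule hs)
  show "(\<lambda>x. pick \<phi> w N C (v x) t) \<in> measurable M (count_space UNIV)" by (rule pick[OF hs])
qed

lemma measurable_map_picks:
  fixes f :: "nat \<Rightarrow> 'a \<Rightarrow> nat"
  assumes "\<And>t. f t \<in> measurable M (count_space UNIV)"
  shows "(\<lambda>x. map (\<lambda>t. f t x) [0..<T]) \<in> measurable M (count_space UNIV)"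
proof -
  have "(\<lambda>x. map (\<lambda>t. f t x) [0..<T]) -` {l} \<inter> space M \<in> sets M" for l
  proof -
    have e: "(map (\<lambda>t. f t x) [0..<T] = l) \<longleftrightarrow> length l = T \<and>
        (\<forall>t\<in>{..<T}. f t x = l ! t)" for x
      unfolding list_eq_iff_nth_eq by (auto simp del: upt_Suc)
    have "(\<lambda>x. map (\<lambda>t. f t x) [0..<T]) -` {l} \<inter> space M =
      (if length l = T then {x \<in> space M. \<forall>t\<in>{..<T}. f t x = l ! t} else {})"
      unfolding vimage_def mem_Collect_eq singleton_iff e by auto
    also have "\<dots> \<in> sets M"
    proof -
      have "{x \<in> space M. f t x = l ! t} \<in> sets M" for t
      proof -
        have "{x \<in> space M. f t x = l ! t} = f t -` {l ! t} \<inter> space M" by auto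
        also have "\<dots> \<in> sets M" by (rule measurable_sets[OF assms]) simp
        finally show ?thesis .
      qed
      then have "{x \<in> space M. \<forall>t\<in>{..<T}. f t x = l ! t} \<in> sets M"
        by (intro sets.sets_Collect_finite_All) auto
      then show ?thesis by simp
    qed
    finally show ?thesis .
  qed
  then show ?thesis
    by (intro measurable_count_space_eq_countable[THEN iffD2, OF countableI_type]) auto
qed

section \<open>Private Chebyshev moments\<close>

text \<open>The radius of a multi-index, with floor 1: the constant moment \<open>J = 0\<close> gets
  weight 1 instead of 0, so all reciprocal weights are finite.\<close>

primrec wtr :: "nat \<Rightarrow> nat \<Rightarrow> nat \<Rightarrow> nat" where
  "wtr b J 0 = 1"
| "wtr b J (Suc i) = max (wtr b J i) (dig b i J)"

lemma wtr_ge: "i < d \<Longrightarrow> dig b i J \<le> wtr b J d"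
  by (induction d) (auto simp: less_Suc_eq le_max_iff_disj)

lemma wtr_ge_1: "1 \<le> wtr b J d"
  by (induction d) auto

lemma wtr_attained: "wtr b J d = 1 \<or> (\<exists>i<d. dig b i J = wtr b J d)"
proof (induction d)
  case (Suc d)
  then show ?case by (auto simp: max_def less_Suc_eq)
qed simp

lemma wtr_less: "1 < b \<Longrightarrow> wtr b J d < b"
  by (induction d) (auto simp: dig_less)

text \<open>The successor of the largest \<open>r < n\<close> satisfying \<open>P\<close>, with 0 if
  there is none. A bounded search stands in for rounding a root, an operation the machine does not
  have.\<close>

primrec rsel :: "(nat \<Rightarrow> bool) \<Rightarrow> nat \<Rightarrow> nat" where
  "rsel P 0 = 0"
| "rsel P (Suc r) = (if P r then Suc r else rsel P r)"

lemma rsel_le: "rsel P n \<le> n"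
  by (induction n) auto

lemma rsel_holds: "rsel P n = Suc r \<Longrightarrow> P r"
  by (induction n) (auto split: if_splits)

lemma rsel_max: "rsel P n \<le> r \<Longrightarrow> r < n \<Longrightarrow> \<not> P r"
  by (induction n) (auto split: if_splits simp: less_Suc_eq)

lemma dig_surj:
  assumes "\<And>i. i < d \<Longrightarrow> gs i < b"
  shows "\<exists>J<b ^ d. \<forall>i<d. dig b i J = gs i"
  using assms
proof (induction d)
  case (Suc d)
  then obtain J where J: "J < b ^ d" "\<forall>i<d. dig b i J = gs i" by auto
  have g: "gs d < b" using Suc.prems by simp
  have "J + gs d * b ^ d < b ^ Suc d"
  proof -
    have "J + gs d * b ^ d < b ^ d + gs d * b ^ d" using J by simp
    also have "\<dots> = Suc (gs d) * b ^ d" by simp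
    also have "\<dots> \<le> b * b ^ d" using g by (intro mult_right_mono) auto
    finally show ?thesis by simp
  qed
  moreover have "dig b i (J + gs d * b ^ d) = gs i" if "i < Suc d" for i
    using that J g dig_add_low[of i d b J "gs d"] dig_add_top[of J b d "gs d"] by (cases "i = d") auto
  ultimately show ?case by blast
qed auto

text \<open>Summation of the weights over the shells \<open>max\<^sub>i j\<^sub>i = r\<close>.\<close>

lemma weight_sum:
  fixes k d R :: nat
  assumes d: "0 < d" and R: "0 < R"
  shows "(\<Sum>J<(R + 1) ^ d. 1 / real (wtr (R + 1) J d) ^ k) \<le>
    real d * 2 ^ d * (\<Sum>r\<in>{1..R}. real r ^ (d - 1) / real r ^ k)"
proof -
  let ?b = "R + 1"
  \<comment> \<open>For fixed \<open>r\<close> and \<open>i0\<close>, the product of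
    \<open>F r i0 i\<close> over \<open>i\<close> is the indicator that digit \<open>i0\<close>
    equals \<open>r\<close> and the others are at most \<open>r\<close>. Summing over
    \<open>i0\<close> covers the shell.\<close>
  define F where "F r i0 i j = (if i = i0 then (if j = r then 1 else 0) else if j \<le> r then 1 else (0::real))"
      for r i0 i j :: nat
  have Fge: "0 \<le> F r i0 i j" for r i0 i j by (simp add: F_def)
  have pw: "1 / real (wtr ?b J d) ^ k \<le> (if J = 0 then 1 else 0) +
      (\<Sum>r\<in>{1..R}. \<Sum>i0<d. (\<Prod>i<d. F r i0 i (dig ?b i J)) / real r ^ k)" if J: "J < ?b ^ d" for J
  proof -
    have nonneg: "0 \<le> (\<Sum>r\<in>{1..R}. \<Sum>i0<d. (\<Prod>i<d. F r i0 i (dig ?b i J)) / real r ^ k)"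
      by (intro sum_nonneg divide_nonneg_nonneg prod_nonneg) (auto simp: Fge)
    define r where "r = wtr ?b J d"
    have r: "1 \<le> r" "r \<le> R" using wtr_ge_1[of ?b J d] wtr_less[of ?b J d] R by (auto simp: r_def)
    show ?thesis
    proof (cases "\<exists>i<d. dig ?b i J = r")
      case True
      then obtain i0 where i0: "i0 < d" "dig ?b i0 J = r" by blast
      have "(\<Prod>i<d. F r i0 i (dig ?b i J)) = 1"
        using i0 wtr_ge[of _ d ?b J] by (intro prod.neutral) (auto simp: F_def r_def)
      then have "1 / real r ^ k = (\<Prod>i<d. F r i0 i (dig ?b i J)) / real r ^ k" by simp
      also have "\<dots> \<le> (\<Sum>i0<d. (\<Prod>i<d. F r i0 i (dig ?b i J)) / real r ^ k)"
        using i0 by (intro member_le_sum[of i0 "{..<d}"]) (auto intro!: divide_nonneg_nonneg prod_nonneg simp: Fge)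
      also have "\<dots> \<le> (\<Sum>r\<in>{1..R}. \<Sum>i0<d. (\<Prod>i<d. F r i0 i (dig ?b i J)) / real r ^ k)"
        using r by (intro member_le_sum[of r "{1..R}"]) (auto intro!: sum_nonneg divide_nonneg_nonneg prod_nonneg
            simp: Fge)
      finally show ?thesis unfolding r_def[symmetric] by (intro add_increasing) auto
    next
      case False
      with wtr_attained[of ?b J d] have r1: "r = 1" by (auto simp: r_def)
      show ?thesis
      \<comment> \<open>Because of the floor 1 in \<open>wtr\<close>, index 0 lies in the shell
        \<open>r = 1\<close> without a digit 1. It is the only such index and is paid for by the
        separate summand.\<close>
      proof (cases "J = 0")
        case True
        then show ?thesis using nonneg unfolding r_def[symmetric] r1 by simp
      next
        case nz: False
        show ?thesis
        proof -
          obtain i where i: "i < d" "dig ?b i J \<noteq> 0" using dig_inj[of J ?b d 0] nz J by auto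
          then have "dig ?b i J = 1" using wtr_ge[of i d ?b J] r1 unfolding r_def by simp
          then show ?thesis using False i r1 by auto
        qed
      qed
    qed
  qed
  have cnt: "(\<Sum>J<?b ^ d. \<Prod>i<d. F r i0 i (dig ?b i J)) \<le> (real r + 1) ^ (d - 1)" if "i0 < d" for r i0
  proof -
    have "(\<Sum>J<?b ^ d. \<Prod>i<d. F r i0 i (dig ?b i J)) = (\<Prod>i<d. \<Sum>j<?b. F r i0 i j)"
      by (rule sum_prod_dig)
    also have "\<dots> = (\<Sum>j<?b. F r i0 i0 j) * (\<Prod>i\<in>{..<d} - {i0}. \<Sum>j<?b. F r i0 i j)"
      using that by (intro prod.remove) auto
    also have "\<dots> \<le> 1 * (\<Prod>i\<in>{..<d} - {i0}. real r + 1)" (is "?A * ?B \<le> 1 * ?C")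
    proof -
      have nn: "0 \<le> (\<Sum>j<?b. F r i0 i j)" for i by (intro sum_nonneg) (simp add: Fge)
      have "(\<Sum>j<?b. F r i0 i0 j) = (\<Sum>j<?b. if j = r then 1 else 0)" by (simp add: F_def)
      also have "\<dots> \<le> 1" by (simp only: sum.delta finite_lessThan) simp
      finally have A: "?A \<le> 1" .
      have i: "(\<Sum>j<?b. F r i0 i j) \<le> real r + 1" if i: "i \<in> {..<d} - {i0}" for i
      proof -
      have "(\<Sum>j<?b. F r i0 i j) = (\<Sum>j<?b. if j \<in> {..r} then 1 else 0)"
        using i by (intro sum.cong) (auto simp: F_def)
      also have "\<dots> \<le> (\<Sum>j\<in>{..r}. 1)"
        unfolding sum.inter_restrict[OF finite_lessThan, symmetric] by (intro sum_mono2) auto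
      finally show ?thesis by simp
      qed
      have "?B \<le> ?C" using i nn by (intro prod_mono conjI)
      moreover have "0 \<le> ?B" using nn by (intro prod_nonneg)
      ultimately show ?thesis by (intro mult_mono A) simp_all
    qed
    finally show ?thesis using that by (simp add: card_Diff_singleton)
  qed
  have "(\<Sum>J<?b ^ d. 1 / real (wtr ?b J d) ^ k) \<le>
    (\<Sum>J<?b ^ d. (if J = 0 then 1 else 0) + (\<Sum>r\<in>{1..R}. \<Sum>i0<d. (\<Prod>i<d. F r i0 i (dig ?b i
        J)) / real r ^ k))"
    by (intro sum_mono pw) simp
  also have "\<dots> = 1 + (\<Sum>J<?b ^ d. \<Sum>r\<in>{1..R}. \<Sum>i0<d. (\<Prod>i<d. F r i0 i (dig ?b i J)) /
      real r ^ k)"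
    by (simp add: sum.distrib sum.delta)
  also have "(\<Sum>J<?b ^ d. \<Sum>r\<in>{1..R}. \<Sum>i0<d. (\<Prod>i<d. F r i0 i (dig ?b i J)) / real r ^ k) =
     (\<Sum>r\<in>{1..R}. \<Sum>J<?b ^ d. \<Sum>i0<d. (\<Prod>i<d. F r i0 i (dig ?b i J)) / real r ^ k)"
    by (rule sum.swap)
  also have "\<dots> = (\<Sum>r\<in>{1..R}. \<Sum>i0<d. \<Sum>J<?b ^ d. (\<Prod>i<d. F r i0 i (dig ?b i J)) / real
      r ^ k)"
    by (rule sum.cong[OF refl], rule sum.swap)
  also have "\<dots> \<le> (\<Sum>r\<in>{1..R}. \<Sum>i0<d. (real r + 1) ^ (d - 1) / real r ^ k)"
    unfolding sum_divide_distrib[symmetric] by (intro sum_mono divide_right_mono cnt) auto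
  also have "\<dots> \<le> (\<Sum>r\<in>{1..R}. real d * 2 ^ (d - 1) * (real r ^ (d - 1) / real r ^ k))"
  proof (rule sum_mono)
    fix r assume r: "r \<in> {1..R}"
    have "(real r + 1) ^ (d - 1) \<le> (2 * real r) ^ (d - 1)" using r by (intro power_mono) auto
    then have "(real r + 1) ^ (d - 1) / real r ^ k \<le> 2 ^ (d - 1) * real r ^ (d - 1) / real r ^ k"
      unfolding power_mult_distrib by (intro divide_right_mono) auto
    then have "real d * ((real r + 1) ^ (d - 1) / real r ^ k) \<le> real d * (2 ^ (d - 1) * real r ^ (d - 1) / real
        r ^ k)"
      by (intro mult_left_mono) auto
    then show "(\<Sum>i0<d. (real r + 1) ^ (d - 1) / real r ^ k) \<le> real d * 2 ^ (d - 1) * (real r ^ (d - 1) /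
        real r ^ k)"
      by (simp add: mult.assoc)
  qed
  also have "\<dots> = real d * 2 ^ (d - 1) * (\<Sum>r\<in>{1..R}. real r ^ (d - 1) / real r ^ k)"
    by (simp only: sum_distrib_left)
  \<comment> \<open>The term \<open>r = 1\<close> of the sum is 1, so the summand for index 0 is
    absorbed by doubling \<open>2 ^ (d - 1)\<close>.\<close>
  also have "1 + real d * 2 ^ (d - 1) * (\<Sum>r\<in>{1..R}. real r ^ (d - 1) / real r ^ k) \<le>
     real d * 2 ^ (d - 1) * (\<Sum>r\<in>{1..R}. real r ^ (d - 1) / real r ^ k) +
     real d * 2 ^ (d - 1) * (\<Sum>r\<in>{1..R}. real r ^ (d - 1) / real r ^ k)"
  proof (rule add_right_mono)
    have "1 = real 1 ^ (d - 1) / real 1 ^ k" by simp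
    also have "\<dots> \<le> (\<Sum>r\<in>{1..R}. real r ^ (d - 1) / real r ^ k)"
      using R by (intro member_le_sum) auto
    finally have a: "1 \<le> (\<Sum>r\<in>{1..R}. real r ^ (d - 1) / real r ^ k)" .
    have "1 * 1 \<le> real d * 2 ^ (d - 1)" using d by (intro mult_mono) auto
    with a have "1 * 1 \<le> real d * 2 ^ (d - 1) * (\<Sum>r\<in>{1..R}. real r ^ (d - 1) / real r ^ k)"
      by (intro mult_mono) auto
    then show "1 \<le> real d * 2 ^ (d - 1) * (\<Sum>r\<in>{1..R}. real r ^ (d - 1) / real r ^ k)" by simp
  qed
  also have "\<dots> = real d * 2 ^ d * (\<Sum>r\<in>{1..R}. real r ^ (d - 1) / real r ^ k)"
    using d by (cases d) simp_all
  finally show ?thesis by simp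
qed

locale synth =
  fixes d k n :: nat and eps del :: real
begin

text \<open>Multi-indices and grid points are coded by their digits in base \<open>bb\<close> and \<open>Q + 1\<close>. With \<open>n\<^sup>4\<close> output
  points and grid cells per coordinate, the discretization errors are dominated by the noise.\<close>

definition "Lg = sqrt (ln (5 / 4 / del))"
definition "Xr = eps * real n / Lg"
definition "R = rsel (\<lambda>r. (8 * real (Suc r)) ^ d \<le> Xr) n"
definition "bb = R + 1"
definition "NJ = bb ^ d"
definition "Q = n ^ 4"
definition "NC = (Q + 1) ^ d"
definition "wt J = wtr bb J d"
definition "wk J = real (wt J) ^ k"
definition "Sg = (\<Sum>J<NJ. 1 / wk J)"
text \<open>The factor 8 is calibrated to \<open>gaussian_mechanism\<close>: a moment changes by at
  most \<open>2 / n\<close>, and the sum of \<open>(2 / n)^2 / (sig^2 * wk J)\<close> equals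
  \<open>eps^2 / (16 * Lg^2)\<close> exactly.\<close>

definition "sig = 8 * Lg / (eps * real n) * sqrt Sg"
definition "feat x J = (\<Prod>i<d. cheb (dig bb i J) (x i))"
definition "pt c = (\<lambda>i\<in>{..<d}. - 1 + 2 * real (dig (Q + 1) i c) / real Q)"
definition "mom X J = avg (\<lambda>x. feat x J) X"
definition "noisy X g J = mom X J + sig * sqrt (wk J) * g J"
text \<open>The reciprocal of the weight \<open>r^(2k)\<close> in the coefficient bound:
  \<open>nrm ww\<close> is the dual norm in which moment errors are measured.\<close>

definition "ww J = 1 / (wk J)\<^sup>2"
definition "phi c = feat (pt c)"
definition "picks v = map (pick phi ww NJ NC v) [0..<Q]"
definition "out v = mset (map pt (picks v))"

lemma wk_ge_1: "1 \<le> wk J"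
  unfolding wk_def wt_def using wtr_ge_1[of bb J d] by (intro one_le_power) simp

lemma wk_pos: "0 < wk J" using wk_ge_1[of J] by linarith

lemma ww_01: "0 \<le> ww J" "ww J \<le> 1"
  using power_mono[OF wk_ge_1[of J], of 2] wk_pos[of J] unfolding ww_def by (auto simp: divide_le_eq)

lemma ww0: "\<forall>J<NJ. 0 \<le> ww J" using ww_01 by blast

lemma bb_pos: "0 < bb" by (simp add: bb_def)
lemma NJ_pos: "0 < NJ" by (simp add: NJ_def bb_def)
lemma NC_pos: "0 < NC" by (simp add: NC_def)

lemma Sg_pos: "0 < Sg"
  unfolding Sg_def using NJ_pos wk_pos by (intro sum_pos) auto

lemma feat_abs: "x \<in> cube d \<Longrightarrow> \<bar>feat x J\<bar> \<le> 1"
proof -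
  assume x: "x \<in> cube d"
  have "\<bar>feat x J\<bar> = (\<Prod>i<d. \<bar>cheb (dig bb i J) (x i)\<bar>)" by (simp add: feat_def abs_prod)
  also have "\<dots> \<le> 1"
    using cheb_abs_le cube_mem[OF x] by (intro prod_le_1) auto
  finally show ?thesis .
qed

lemma feat_0: "feat x 0 = 1" by (simp add: feat_def)

lemma feat_lipschitz:
  assumes x: "x \<in> cube d" and y: "y \<in> cube d" and xy: "\<And>i. i < d \<Longrightarrow> \<bar>x i - y
      i\<bar> \<le> c" and c: "0 \<le> c"
  shows "\<bar>feat x J - feat y J\<bar> \<le> real d * ((real R)\<^sup>2 * c)"
proof -
  have "norm (feat x J - feat y J) \<le> (\<Sum>i<d. norm (cheb (dig bb i J) (x i) - cheb (dig bb i J) (y i)))"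
    unfolding feat_def using cheb_abs_le cube_mem[OF x] cube_mem[OF y] by (intro norm_prod_diff) auto
  also have "\<dots> \<le> (\<Sum>i<d. (real R)\<^sup>2 * c)"
  proof (rule sum_mono)
    fix i assume i: "i \<in> {..<d}"
    have j: "dig bb i J \<le> R" using dig_less[OF bb_pos, of i J] by (simp add: bb_def)
    have "\<bar>cheb (dig bb i J) (x i) - cheb (dig bb i J) (y i)\<bar> \<le> (real (dig bb i J))\<^sup>2 * \<bar>x
        i - y i\<bar>"
      using i cube_mem[OF x] cube_mem[OF y] by (intro cheb_lipschitz) auto
    also have "\<dots> \<le> (real R)\<^sup>2 * c" using j i xy by (intro mult_mono power_mono) auto
    finally show "norm (cheb (dig bb i J) (x i) - cheb (dig bb i J) (y i)) \<le> (real R)\<^sup>2 * c" by simp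
  qed
  finally show ?thesis by simp
qed

lemma pt_cube: "0 < Q \<Longrightarrow> pt c \<in> cube d"
proof -
  assume Q: "0 < Q"
  have "2 * real (dig (Q + 1) i c) / real Q \<le> 2" for i
    using dig_less[of "Q + 1" i c] Q by (simp add: divide_le_eq)
  then have "- 1 + 2 * real (dig (Q + 1) i c) / real Q \<in> {-1..1}" for i by auto
  then show ?thesis unfolding pt_def cube_def by (intro restrict_PiE_iff[THEN iffD2] ballI)
qed

lemma grid_rounding:
  assumes x: "x \<in> cube d" and Q: "0 < Q"
  shows "\<exists>c<NC. \<forall>i<d. \<bar>pt c i - x i\<bar> \<le> 2 / real Q"
proof -
  define gs where "gs i = nat \<lfloor>(x i + 1) * real Q / 2\<rfloor>" for i
  have x0: "0 \<le> (x i + 1) * real Q / 2" "(x i + 1) * real Q / 2 \<le> real Q" if "i < d" for i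
    using cube_mem[OF x that] Q by (auto simp: mult_le_cancel_right1)
  have gs: "real (gs i) \<le> (x i + 1) * real Q / 2" "(x i + 1) * real Q / 2 \<le> real (gs i) + 1" if "i < d" for i
    using x0[OF that] unfolding gs_def by linarith+
  have "gs i < Q + 1" if "i < d" for i using gs(1)[OF that] x0(2)[OF that] by linarith
  then obtain c where c: "c < (Q + 1) ^ d" "\<forall>i<d. dig (Q + 1) i c = gs i" using dig_surj[of d gs "Q + 1"]
      by auto
  have "\<bar>pt c i - x i\<bar> \<le> 2 / real Q" if i: "i < d" for i
  proof -
    have "real (gs i) * (2 / real Q) \<le> (x i + 1) * real Q / 2 * (2 / real Q)"
      "(x i + 1) * real Q / 2 * (2 / real Q) \<le> (real (gs i) + 1) * (2 / real Q)"
      using gs[OF i] by (intro mult_right_mono; simp)+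
    moreover have "(x i + 1) * real Q / 2 * (2 / real Q) = x i + 1" using Q by simp
    ultimately have "2 * real (gs i) / real Q \<le> x i + 1" "x i + 1 \<le> 2 * real (gs i) / real Q + 2 / real Q"
      unfolding distrib_right by (simp_all only: times_divide_eq_right mult.commute mult_1)
    then show ?thesis using c(2) i by (simp add: pt_def)
  qed
  then show ?thesis using c(1) unfolding NC_def by blast
qed

definition "Eapp = real d * (exp 113 * (jerr d k R * fact k))"
definition "Bp = sqrt (real d * (2 ^ d * 4 ^ k)) * (exp 113 * fact k)"

text \<open>Integrating the approximating polynomial turns \<open>f\<close> into a pairing of its
  coefficients with the moment differences, to which Cauchy-Schwarz applies. The coefficient bounds
  are available per coordinate, and summing over the coordinates puts the \<open>d\<close> under the
  root in \<open>Bp\<close>.\<close>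

lemma moment_duality:
  assumes d: "1 \<le> d" and k: "1 \<le> k" and xs: "pts d xs" and ys: "pts d ys" and f: "f \<in> smooth_ball d k"
  shows "\<bar>avg f xs - avg f ys\<bar> \<le> 2 * Eapp + Bp * nrm ww NJ (\<lambda>J. mom xs J - mom ys J)"
proof (rule field_le_epsilon)
  fix e :: real assume e: "0 < e"
  obtain h where h1: "\<And>x. x \<in> cube d \<Longrightarrow> \<bar>f x - (\<Sum>J<NJ. h J * feat x J)\<bar>
      \<le> Eapp + e / 2"
    and h2: "\<And>i. i < d \<Longrightarrow> (\<Sum>J<NJ. (h J)\<^sup>2 * real (dig bb i J) ^ (2 * k)) \<le> 2 ^ d
        * 4 ^ k * (exp 113 * fact k)\<^sup>2"
    using chebyshev_approx[of d k f "e / 2" R] d k f e unfolding NJ_def bb_def feat_def Eapp_def by auto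
  let ?z = "\<lambda>J. mom xs J - mom ys J"
  let ?P = "\<lambda>x. \<Sum>J<NJ. h J * feat x J"
  have a: "\<bar>avg f zs - avg ?P zs\<bar> \<le> Eapp + e / 2" if "pts d zs" for zs
    unfolding avg_diff[symmetric] using that h1 by (intro avg_abs_le) (auto simp: pts_def)
  have z0: "?z 0 = 0" using xs ys by (simp add: mom_def feat_0 avg_const pts_def)
  \<comment> \<open>The factor \<open>(wk J)^2\<close> compensates \<open>ww\<close>. Index 0 may be
    dropped because the constant moment equals 1 for both datasets.\<close>
  define h' where "h' J = (if J = 0 then 0 else h J * (wk J)\<^sup>2)" for J
  have "avg ?P xs - avg ?P ys = (\<Sum>J<NJ. h J * ?z J)"
    unfolding avg_sum mom_def sum_subtractf[symmetric] by (simp add: right_diff_distrib)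
  also have "\<dots> = (\<Sum>J<NJ. ww J * h' J * ?z J)"
    using z0 wk_pos by (intro sum.cong refl) (auto simp: h'_def ww_def less_imp_neq[THEN not_sym])
  finally have eq: "avg ?P xs - avg ?P ys = (\<Sum>J<NJ. ww J * h' J * ?z J)" .
  have "(\<Sum>J<NJ. ww J * h' J * ?z J) \<le> nrm ww NJ h' * nrm ww NJ ?z"
    by (rule ip_le[OF ww0])
  moreover have "(\<Sum>J<NJ. ww J * h' J * (- ?z J)) \<le> nrm ww NJ h' * nrm ww NJ (\<lambda>J. - ?z J)"
    by (rule ip_le[OF ww0])
  ultimately have ip: "\<bar>\<Sum>J<NJ. ww J * h' J * ?z J\<bar> \<le> nrm ww NJ h' * nrm ww NJ ?z"
    unfolding nrm_uminus mult_minus_right sum_negf by (simp only: abs_le_iff)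
  have "(\<Sum>J<NJ. ww J * (h' J)\<^sup>2) \<le> (\<Sum>J<NJ. \<Sum>i<d. (h J)\<^sup>2 * real (dig bb i J) ^ (2 * k))"
  proof (rule sum_mono)
    fix J assume J: "J \<in> {..<NJ}"
    have nn: "0 \<le> (\<Sum>i<d. (h J)\<^sup>2 * real (dig bb i J) ^ (2 * k))" by (intro sum_nonneg) auto
    show "ww J * (h' J)\<^sup>2 \<le> (\<Sum>i<d. (h J)\<^sup>2 * real (dig bb i J) ^ (2 * k))"
    proof (cases "J = 0")
      case True
      then show ?thesis using nn by (simp add: h'_def)
    next
      case False
      obtain i where i: "i < d" "dig bb i J \<noteq> 0" using dig_inj[of J bb d 0] J False bb_pos unfolding NJ_def
          by auto
      \<comment> \<open>For a nonzero multi-index the radius is attained by a digit even when the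
        floor 1 is in force, so \<open>(wk J)^2\<close> is one of the weights of the coefficient
        bound.\<close>
      have "\<exists>i<d. dig bb i J = wt J"
      proof (cases "wt J = 1")
        case True
        then have "dig bb i J = 1" using i wtr_ge[of i d bb J] unfolding wt_def by simp
        then show ?thesis using i True by auto
      next
        case False
        then show ?thesis using wtr_attained[of bb J d] unfolding wt_def by auto
      qed
      then obtain i where i: "i < d" "dig bb i J = wt J" by blast
      have "ww J * (h' J)\<^sup>2 = (h J)\<^sup>2 * (wk J)\<^sup>2"
        using False wk_pos[of J] by (simp add: h'_def ww_def power2_eq_square)
      also have "\<dots> = (h J)\<^sup>2 * real (dig bb i J) ^ (2 * k)"
        unfolding i(2) wk_def by (simp add: power_mult[symmetric] mult.commute)
      also have "\<dots> \<le> (\<Sum>i<d. (h J)\<^sup>2 * real (dig bb i J) ^ (2 * k))"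
        using i by (intro member_le_sum[of i "{..<d}"]) auto
      finally show ?thesis .
    qed
  qed
  also have "\<dots> = (\<Sum>i<d. \<Sum>J<NJ. (h J)\<^sup>2 * real (dig bb i J) ^ (2 * k))" by (rule sum.swap)
  also have "\<dots> \<le> (\<Sum>i<d. 2 ^ d * 4 ^ k * (exp 113 * fact k)\<^sup>2)" by (rule sum_mono, rule h2) simp
  also have "\<dots> = (real d * (2 ^ d * 4 ^ k)) * (exp 113 * fact k)\<^sup>2" by simp
  finally have "nrm ww NJ h' \<le> sqrt ((real d * (2 ^ d * 4 ^ k)) * (exp 113 * fact k)\<^sup>2)"
    unfolding nrm_def by (rule real_sqrt_le_mono)
  then have "nrm ww NJ h' \<le> Bp" unfolding Bp_def real_sqrt_mult[of _ "(exp 113 * fact k)\<^sup>2"] real_sqrt_abs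
    by (simp add: abs_of_nonneg)
  then have "nrm ww NJ h' * nrm ww NJ ?z \<le> Bp * nrm ww NJ ?z"
    using nrm_ge_0[OF ww0] by (intro mult_right_mono) auto
  with ip eq have "\<bar>avg ?P xs - avg ?P ys\<bar> \<le> Bp * nrm ww NJ ?z" by simp
  with a[OF xs] a[OF ys] show "\<bar>avg f xs - avg f ys\<bar> \<le> 2 * Eapp + Bp * nrm ww NJ ?z + e" by linarith
qed

lemma Bp_nonneg: "0 \<le> Bp" by (simp add: Bp_def)

definition "gerr = sqrt (real NJ) * (real d * ((real R)\<^sup>2 * (2 / real Q)))"

lemma pts_out: "1 \<le> n \<Longrightarrow> pts d (map pt (picks v))"
  using pt_cube[of] by (auto simp: pts_def picks_def Q_def)

text \<open>The data rounded to the grid compete against the greedy choice. Their average feature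
  differs from the noisy target by rounding plus noise, which is the drift of the herding. The noise
  counts three times: once as the difference between target and true moments, once in the drift, and
  once in the increments.\<close>

lemma pathwise_error:
  assumes d: "1 \<le> d" and k: "1 \<le> k" and n: "1 \<le> n" and X: "pts d X"
  shows "dk d k (empirical (mset X)) (empirical (out v)) \<le>
    2 * Eapp + Bp * (3 * nrm ww NJ (\<lambda>J. v J - mom X J) + gerr + 2 * sqrt (real NJ) / sqrt (real Q))"
proof -
  let ?nz = "nrm ww NJ (\<lambda>J. v J - mom X J)"
  let ?m = "length X"
  have Q: "0 < Q" using n by (simp add: Q_def)
  have m: "0 < ?m" using X by (simp add: pts_def)
  have Xi: "X ! i \<in> cube d" if "i < ?m" for i using X that by (auto simp: pts_def)
  have "\<forall>i\<in>{..<?m}. \<exists>c. c < NC \<and> (\<forall>j<d. \<bar>pt c j - (X ! i) j\<bar> \<le> 2 /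
      real Q)"
    using grid_rounding[OF Xi Q] by blast
  then obtain cs where cs: "\<And>i. i < ?m \<Longrightarrow> cs i < NC" "\<And>i j. i < ?m \<Longrightarrow> j < d
      \<Longrightarrow> \<bar>pt (cs i) j - (X ! i) j\<bar> \<le> 2 / real Q"
    by (metis bchoice lessThan_iff)
  let ?b = "\<lambda>J. (\<Sum>i<?m. phi (cs i) J) / real ?m"
  have bm: "\<bar>?b J - mom X J\<bar> \<le> real d * ((real R)\<^sup>2 * (2 / real Q))" for J
  proof -
    have "\<bar>?b J - mom X J\<bar> = \<bar>\<Sum>i<?m. phi (cs i) J - feat (X ! i) J\<bar> / real ?m"
      by (simp add: mom_def avg_def diff_divide_distrib[symmetric] sum_subtractf[symmetric])
    also have "\<dots> \<le> (\<Sum>i<?m. real d * ((real R)\<^sup>2 * (2 / real Q))) / real ?m"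
    proof (intro divide_right_mono order_trans[OF sum_abs] sum_mono)
      fix i assume "i \<in> {..<?m}"
      then show "\<bar>phi (cs i) J - feat (X ! i) J\<bar> \<le> real d * ((real R)\<^sup>2 * (2 / real Q))"
        unfolding phi_def using cs(2) Xi pt_cube[OF Q] by (intro feat_lipschitz) auto
    qed simp
    also have "\<dots> = real d * ((real R)\<^sup>2 * (2 / real Q))" using m by simp
    finally show ?thesis .
  qed
  have split: "nrm ww NJ (\<lambda>J. a J - v J) \<le> nrm ww NJ (\<lambda>J. a J - mom X J) + ?nz" for a
  proof -
    have "nrm ww NJ (\<lambda>J. (a J - mom X J) + (- (v J - mom X J))) \<le> nrm ww NJ (\<lambda>J. a J - mom X J)
        + nrm ww NJ (\<lambda>J. - (v J - mom X J))"
      by (rule nrm_add[OF ww0])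
    then show ?thesis unfolding nrm_uminus by simp
  qed
  have ge: "nrm ww NJ (\<lambda>J. ?b J - mom X J) \<le> gerr"
    unfolding gerr_def using bm ww_01 by (intro nrm_le_const) auto
  have eta: "nrm ww NJ (\<lambda>J. ?b J - v J) \<le> gerr + ?nz" using split[of ?b] ge by linarith
  have Dm: "nrm ww NJ (\<lambda>J. phi c J - v J) \<le> sqrt (real NJ) * 2 + ?nz" for c
  proof -
    have "\<bar>phi c J - mom X J\<bar> \<le> 2" for J
    proof -
      have "\<bar>mom X J\<bar> \<le> 1" unfolding mom_def using X feat_abs by (intro avg_abs_le) (auto simp: pts_def)
      moreover have "\<bar>phi c J\<bar> \<le> 1" unfolding phi_def by (intro feat_abs pt_cube Q)
      ultimately show ?thesis by linarith
    qed
    then have "nrm ww NJ (\<lambda>J. phi c J - mom X J) \<le> sqrt (real NJ) * 2"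
      using ww_01 by (intro nrm_le_const) auto
    with split[of "phi c"] show ?thesis by linarith
  qed
  have "nrm ww NJ (hsum phi ww NJ NC v Q) \<le> (gerr + ?nz) * real Q + (sqrt (real NJ) * 2 + ?nz) * sqrt (real Q)"
    by (rule herding[where cs = cs, OF ww0 NC_pos m cs(1) eta Dm])
  then have h: "nrm ww NJ (hsum phi ww NJ NC v Q) / real Q \<le> gerr + ?nz + (sqrt (real NJ) * 2 + ?nz) / sqrt
      (real Q)"
  proof -
    have "sqrt (real Q) / real Q = 1 / sqrt (real Q)" using Q by (simp add: real_div_sqrt field_simps)
    then have "((gerr + ?nz) * real Q + (sqrt (real NJ) * 2 + ?nz) * sqrt (real Q)) / real Q =
       gerr + ?nz + (sqrt (real NJ) * 2 + ?nz) / sqrt (real Q)"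
      using Q by (simp only: add_divide_distrib times_divide_eq_right[symmetric]) (simp add: add_divide_distrib)
    then show ?thesis using divide_right_mono[OF \<open>nrm ww NJ (hsum phi ww NJ NC v Q) \<le> _\<close>, of "real
        Q"] by simp
  qed
  have nz: "0 \<le> ?nz" by (rule nrm_ge_0[OF ww0])
  \<comment> \<open>The gain \<open>1 / sqrt Q\<close> is given away on the noise, which is of
    leading order anyway, and kept only on the \<open>sqrt NJ\<close> part.\<close>
  have "?nz / sqrt (real Q) \<le> ?nz / 1" using Q nz by (intro divide_left_mono) auto
  with h have h': "nrm ww NJ (hsum phi ww NJ NC v Q) / real Q \<le> gerr + 2 * ?nz + 2 * sqrt (real NJ) / sqrt (real Q)"
    by (simp add: add_divide_distrib mult.commute)
  let ?ys = "map pt (picks v)"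
  have mo: "mom X J - mom ?ys J = - (v J - mom X J) + (- 1 / real Q) * hsum phi ww NJ NC v Q J" for J
  proof -
    have "mom ?ys J = (\<Sum>i<Q. phi (pick phi ww NJ NC v i) J) / real Q"
      by (simp add: mom_def avg_def picks_def phi_def)
    then show ?thesis using Q by (simp add: hsum_eq field_simps)
  qed
  have "nrm ww NJ (\<lambda>J. mom X J - mom ?ys J) \<le> ?nz + \<bar>- 1 / real Q\<bar> * nrm ww NJ (hsum phi ww
      NJ NC v Q)"
    unfolding mo using nrm_add[OF ww0, of "\<lambda>J. - (v J - mom X J)" "\<lambda>J. (- 1 / real Q) * hsum phi ww
        NJ NC v Q J"]
    unfolding nrm_uminus nrm_cmult[OF ww0] .
  also have "\<bar>- 1 / real Q\<bar> * nrm ww NJ (hsum phi ww NJ NC v Q) = nrm ww NJ (hsum phi ww NJ NC v Q) /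
      real Q" by simp
  finally have fin: "nrm ww NJ (\<lambda>J. mom X J - mom ?ys J) \<le> 3 * ?nz + gerr + 2 * sqrt (real NJ) / sqrt
      (real Q)"
    using h' by linarith
  show ?thesis
    unfolding out_def
  proof (rule dk_upper[OF X pts_out[OF n]])
    fix f assume "f \<in> smooth_ball d k"
    then have "\<bar>avg f X - avg f ?ys\<bar> \<le> 2 * Eapp + Bp * nrm ww NJ (\<lambda>J. mom X J - mom ?ys J)"
      by (rule moment_duality[OF d k X pts_out[OF n]])
    also have "\<dots> \<le> 2 * Eapp + Bp * (3 * ?nz + gerr + 2 * sqrt (real NJ) / sqrt (real Q))"
      using fin Bp_nonneg by (intro add_left_mono mult_left_mono)
    finally show "\<bar>avg f X - avg f ?ys\<bar> \<le> 2 * Eapp + Bp * (3 * ?nz + gerr + 2 * sqrt (real NJ) / sqrt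
        (real Q))" .
  qed
qed

lemma hsum_cong:
  assumes "\<And>J. J < N \<Longrightarrow> v J = v' J"
  shows "J < N \<Longrightarrow> hsum \<phi> w N C v t J = hsum \<phi> w N C v' t J"
    and "pick \<phi> w N C v t = pick \<phi> w N C v' t"
proof -
  have p: "pick \<phi> w N C v t = pick \<phi> w N C v' t" if "\<And>J. J < N \<Longrightarrow> hsum \<phi> w N C v
      t J = hsum \<phi> w N C v' t J" for t
  proof -
    have "score \<phi> w N (hsum \<phi> w N C v t) = score \<phi> w N (hsum \<phi> w N C v' t)"
      unfolding score_def[abs_def] using that by simp
    then show ?thesis by (simp add: pick_def)
  qed
  have h: "J < N \<Longrightarrow> hsum \<phi> w N C v t J = hsum \<phi> w N C v' t J" for J t
  proof (induction t arbitrary: J)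
    case (Suc t)
    then show ?case using p[of t] assms by (simp add: pick_def)
  qed simp
  show "J < N \<Longrightarrow> hsum \<phi> w N C v t J = hsum \<phi> w N C v' t J" by (rule h)
  show "pick \<phi> w N C v t = pick \<phi> w N C v' t" by (rule p[OF h])
qed

text \<open>Allows the infinite tape to be replaced by its first \<open>NJ\<close> normals, so that
  the finite Gaussian product applies.\<close>

lemma out_cong: "(\<And>J. J < NJ \<Longrightarrow> v J = v' J) \<Longrightarrow> out v = out v'"
proof -
  assume "\<And>J. J < NJ \<Longrightarrow> v J = v' J"
  from hsum_cong(2)[OF this] have "picks v = picks v'" unfolding picks_def by simp
  then show ?thesis by (simp only: out_def)
qed

lemma out_measurable:
  assumes "1 \<le> n" "\<And>J. J < NJ \<Longrightarrow> (\<lambda>x. v x J) \<in> borel_measurable M"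
  shows "(\<lambda>x. out (v x)) \<in> measurable M (dataset_space d)"
proof -
  have "(\<lambda>x. picks (v x)) \<in> measurable M (count_space UNIV)"
    unfolding picks_def using assms NC_pos by (intro measurable_map_picks measurable_hsum(2))
  \<comment> \<open>Lists of the wrong length are sent to a fixed dataset, so that the map takes
    values in \<open>synthetic_datasets\<close> on the whole discrete space of lists.\<close>
  moreover define F where "F l = (if length l = Q then mset (map pt l) else {#pt 0#})" for l
  have "F \<in> measurable (count_space UNIV) (dataset_space d)"
    using assms(1) pt_cube by (auto simp: F_def space_dataset_space synthetic_datasets_def Q_def split: if_splits)
  ultimately have "(\<lambda>x. F (picks (v x))) \<in> measurable M (dataset_space d)" by (rule measurable_compose)
  moreover have "F (picks v) = out v" for v by (simp add: F_def out_def picks_def)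
  ultimately show ?thesis by simp
qed

end

text \<open>Here \<open>32000 = 400 * 80\<close>: 400 dominates the numerical factors 84, 168 and
  336 of the three regimes, 80 is the 10 of \<open>jerr\<close> times the 8 in the degree, and
  \<open>exp 113\<close> is the norm of the iterated averaging.\<close>

definition "Cc = 32000 * exp (113::real)"

section \<open>Error bounds\<close>

locale synth_ok = synth +
  assumes d1: "1 \<le> d" and k1: "1 \<le> k" and n1: "1 \<le> n"
    and eps_n: "1 / real n < eps" and eps1: "eps < 1" and del0: "0 < del" and del1: "del < 1"
    and large: "(16 * real k) ^ max d k \<le> eps * real n / sqrt (ln (1.25 / del))"
begin

lemma eps0: "0 < eps"
proof -
  have "0 < 1 / real n" using n1 by simp
  then show ?thesis using eps_n by linarith
qed

lemma n0: "0 < real n" using n1 by simp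

lemma Lg_eq: "Lg = sqrt (ln (1.25 / del))"
  by (simp add: Lg_def)

lemma Lg_sq: "Lg\<^sup>2 = ln (1.25 / del)"
  using ln_delta_ge[OF del0 del1] by (simp add: Lg_eq)

lemma Lg_ge: "2 / 5 \<le> Lg"
  unfolding Lg_eq using ln_delta_ge[OF del0 del1] by (intro real_le_rsqrt) (simp add: power2_eq_square)

lemma Lg_pos: "0 < Lg" using Lg_ge by linarith

definition "s0 = Lg / (eps * real n)"

lemma s0_pos: "0 < s0" using Lg_pos eps0 n0 by (simp add: s0_def)

lemma Xr_s0: "Xr = 1 / s0" by (simp add: Xr_def s0_def)

lemma Xr_large: "(16 * real k) ^ max d k \<le> Xr"
  using large by (simp add: Xr_def Lg_eq)

lemma Xr_ge: "16 ^ d \<le> Xr" "16 \<le> Xr"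
proof -
  have "(16::real) ^ m \<le> (16 * real k) ^ max d k" if "m \<le> max d k" for m
  proof -
    have "(16::real) ^ m \<le> 16 ^ max d k" using that by (intro power_increasing) auto
    also have "\<dots> \<le> (16 * real k) ^ max d k" using k1 by (intro power_mono) auto
    finally show ?thesis .
  qed
  moreover have "1 \<le> max d k" using d1 by simp
  ultimately have "(16::real) ^ d \<le> (16 * real k) ^ max d k" "(16::real) ^ 1 \<le> (16 * real k) ^ max d k" by
      (blast intro: max.cobounded1)+
  with Xr_large show "16 ^ d \<le> Xr" "16 \<le> Xr" by auto
qed

lemma Xr_pos: "0 < Xr" using Xr_ge(2) by linarith

lemma Xr_le: "Xr \<le> 5 / 2 * real n"
proof -
  have "Xr \<le> 1 * real n / Lg" unfolding Xr_def using eps1 n0 Lg_pos by (intro divide_right_mono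
      mult_right_mono) auto
  also have "\<dots> \<le> 1 * real n / (2 / 5)" using Lg_ge n0 by (intro divide_left_mono) auto
  finally show ?thesis by simp
qed

lemma s0_le_1: "s0 \<le> 1"
  using Xr_ge(2) s0_pos unfolding Xr_s0 by (simp add: le_divide_eq)

lemma inv_n_le: "1 / real n \<le> 5 / 2 * s0"
proof -
  have "1 / s0 \<le> 5 / 2 * real n" using Xr_le unfolding Xr_s0 .
  then show ?thesis using s0_pos n0 by (simp add: field_simps)
qed

text \<open>The search for the degree is cut off at \<open>n\<close>. If the cutoff is reached the
  bound still holds, because \<open>Xr\<close> is at most \<open>5 / 2 * n\<close>.\<close>

lemma R_upper: "Xr < (8 * (real R + 1)) ^ d"
proof (cases "R < n")
  case True
  have "\<not> (8 * real (Suc R)) ^ d \<le> Xr"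
    using rsel_max[of "\<lambda>r. (8 * real (Suc r)) ^ d \<le> Xr" n R] True unfolding R_def by simp
  then show ?thesis by (simp add: add.commute)
next
  case False
  then have "R = n" using rsel_le[of _ n] unfolding R_def by (simp add: le_antisym)
  have "5 / 2 * real n \<le> 8 * real n" by simp
  then have "Xr < 8 * (real n + 1)" using Xr_le by (simp add: distrib_left)
  also have "\<dots> = (8 * (real n + 1)) ^ 1" by simp
  also have "\<dots> \<le> (8 * (real n + 1)) ^ d" using d1 by (intro power_increasing) auto
  finally show ?thesis using \<open>R = n\<close> by simp
qed

text \<open>The place where the 16 of the hypothesis is needed:
  \<open>16 ^ d <= Xr < (8 * (R + 1)) ^ d\<close>.\<close>

lemma R_pos: "1 \<le> R"
proof -
  have "(16::real) ^ d < (8 * (real R + 1)) ^ d" using R_upper Xr_ge(1) by linarith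
  then have "16 < 8 * (real R + 1)" by (rule power_less_imp_less_base) simp
  then show ?thesis by simp
qed

lemma R_lower: "(8 * real R) ^ d \<le> Xr"
proof -
  obtain r where r: "R = Suc r" using R_pos by (cases R) auto
  have "(8 * real (Suc r)) ^ d \<le> Xr" by (rule rsel_holds[of _ n]) (use r in \<open>simp add: R_def\<close>)
  then show ?thesis unfolding r .
qed

text \<open>The real number of which \<open>8 * R\<close> is the rounded version; all powers of the
  degree are compared with powers of \<open>y\<close>, and \<open>y ^ d * s0 = 1\<close>.\<close>

definition "y = Xr powr (1 / real d)"

lemma y_pos: "0 < y" using Xr_pos by (simp add: y_def)

lemma y_pow: "y ^ m = Xr powr (real m / real d)"
  using y_pos Xr_pos by (simp add: y_def powr_realpow[symmetric] powr_powr)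

lemma y_d: "y ^ d = Xr" using y_pow[of d] d1 Xr_pos by simp

lemma R_y: "8 * real R \<le> y" "y < 8 * (real R + 1)"
proof -
  show "8 * real R \<le> y"
    by (rule power_le_imp_le_base[of _ "d - 1"]) (use R_lower y_d y_pos d1 in auto)
  show "y < 8 * (real R + 1)"
    by (rule power_less_imp_less_base[of _ d]) (use R_upper y_d in auto)
qed

lemma s0_powr: "s0 powr (real k / real d) = 1 / y ^ k"
  using s0_pos unfolding y_pow Xr_s0 by (simp add: powr_divide)

lemma R_le_n: "R \<le> n" unfolding R_def by (rule rsel_le)

lemma R_le_Xr: "real R \<le> Xr"
proof -
  have "real R \<le> (8 * real R) ^ 1" by simp
  also have "\<dots> \<le> (8 * real R) ^ d" using R_pos d1 by (intro power_increasing) auto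
  finally show ?thesis using R_lower by linarith
qed

abbreviation "dm \<equiv> real d powr max 1 (real k / 2)"

lemma dm_ge: "real d \<le> dm"
proof -
  have "real d powr 1 \<le> dm" using d1 by (intro powr_mono) auto
  then show ?thesis using d1 by simp
qed

definition "G = exp 113 * (fact k :: real)"

lemma G_pos: "0 < G" by (simp add: G_def)

lemma term1: "2 * Eapp \<le> 40 * G * 80 ^ k * dm * (1 / y ^ k)"
proof -
  have "(10 / (real R + 1)) ^ k \<le> (80 / y) ^ k"
    using R_y(2) y_pos by (intro power_mono) (auto simp: field_simps)
  also have "\<dots> = 80 ^ k * (1 / y ^ k)" by (simp add: power_divide)
  finally have a: "(10 / (real R + 1)) ^ k \<le> 80 ^ k * (1 / y ^ k)" .
  have b: "real d * real d powr (max 1 (real k / 2) - 1) = dm" using d1 by (simp add: powr_diff)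
  have "2 * Eapp = 40 * G * (real d * real d powr (max 1 (real k / 2) - 1)) * (10 / (real R + 1)) ^ k"
    by (simp add: Eapp_def jerr_def G_def)
  also have "\<dots> \<le> 40 * G * dm * (80 ^ k * (1 / y ^ k))"
    unfolding b using a G_pos by (intro mult_left_mono) auto
  finally show ?thesis by (simp only: mult_ac)
qed

lemma d_le_pow2: "real d \<le> 2 ^ d"
  by (simp add: less_imp_le of_nat_less_two_power)

lemma Bp_le: "Bp \<le> 2 ^ d * 2 ^ k * G"
proof -
  have "real d * (2 ^ d * 4 ^ k) \<le> 2 ^ d * (2 ^ d * 4 ^ k)" using d_le_pow2 by (intro mult_right_mono) auto
  also have "\<dots> = (2 ^ d * 2 ^ k)\<^sup>2" by (simp add: power2_eq_square power_mult_distrib[symmetric])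
  finally have "sqrt (real d * (2 ^ d * 4 ^ k)) \<le> 2 ^ d * 2 ^ k" by (intro real_le_lsqrt) auto
  then show ?thesis unfolding Bp_def G_def[symmetric] using G_pos by (intro mult_right_mono) auto
qed

text \<open>The root mean square of the weighted noise norm: the squared norm has expectation
  \<open>sig^2\<close> times the sum of \<open>1 / wk J\<close>, that is,
  \<open>tau^2\<close>.\<close>

definition "tau = sig * sqrt Sg"

lemma tau_eq: "tau = 8 * s0 * Sg"
  using Sg_pos by (simp add: tau_def sig_def s0_def)

definition "HS = (\<Sum>r\<in>{1..R}. real r ^ (d - 1) / real r ^ k)"

lemma Sg_le: "Sg \<le> real d * 2 ^ d * HS"
  unfolding Sg_def wk_def wt_def NJ_def bb_def HS_def using weight_sum[of d R k] d1 R_pos by simp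

text \<open>The factor \<open>4 ^ d\<close> collects \<open>2 ^ d\<close> from the coefficient bound
  and \<open>2 ^ d\<close> from the shell count. Each regime has to dispose of it.\<close>

lemma term2': "Bp * (3 * tau) \<le> 24 * G * 2 ^ k * (real d * 4 ^ d * HS * s0)"
proof -
  have "Bp * (3 * tau) \<le> (2 ^ d * 2 ^ k * G) * (3 * (8 * s0 * (real d * 2 ^ d * HS)))"
    unfolding tau_eq using Bp_le Sg_le s0_pos Sg_pos G_pos
    by (intro mult_mono mult_left_mono) (auto intro!: mult_nonneg_nonneg)
  also have "\<dots> = 24 * G * 2 ^ k * (real d * (2 ^ d * 2 ^ d) * HS * s0)" by simp
  also have "(2::real) ^ d * 2 ^ d = 4 ^ d" by (simp add: power_mult_distrib[symmetric])
  finally show ?thesis .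
qed

text \<open>Since \<open>R + 1 <= 2 * R\<close>, there are at most \<open>(8 R) ^ d / 4 ^ d\<close>
  moments. The resulting \<open>1 / 2 ^ d\<close> cancels the \<open>2 ^ d\<close> of
  \<open>Bp\<close> in \<open>term3\<close>.\<close>

lemma sqrt_NJ: "sqrt (real NJ) \<le> 2 * real n / 2 ^ d"
proof -
  have "real NJ = (real R + 1) ^ d" by (simp add: NJ_def bb_def add.commute)
  also have "\<dots> \<le> (2 * real R) ^ d" using R_pos by (intro power_mono) auto
  also have "\<dots> = (8 * real R / 4) ^ d" by simp
  also have "\<dots> = (8 * real R) ^ d / 4 ^ d" by (simp only: power_divide)
  also have "\<dots> \<le> Xr / 4 ^ d" using R_lower by (intro divide_right_mono) auto
  also have "\<dots> \<le> (5 / 2 * real n) / 4 ^ d" using Xr_le by (intro divide_right_mono) auto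
  also have "\<dots> \<le> (2 * real n)\<^sup>2 / 4 ^ d"
  proof (intro divide_right_mono)
    have "real n * 1 \<le> real n * real n" using n1 by (intro mult_left_mono) auto
    then have "5 / 2 * real n \<le> 4 * (real n * real n)" using n0 by linarith
    then show "5 / 2 * real n \<le> (2 * real n)\<^sup>2" by (simp add: power2_eq_square)
  qed simp
  also have "\<dots> = (2 * real n / 2 ^ d)\<^sup>2"
  proof -
    have "(2::real) ^ d * 2 ^ d = (2 * 2) ^ d" by (rule power_mult_distrib[symmetric])
    then show ?thesis by (simp add: power2_eq_square)
  qed
  finally show ?thesis by (intro real_le_lsqrt) auto
qed

text \<open>With \<open>Q = n ^ 4\<close>, both rounding and herding cost \<open>sqrt NJ\<close>
  over \<open>n^2\<close> up to a factor \<open>d\<close>. By \<open>sqrt_NJ\<close> this is of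
  order \<open>1 / n\<close>, hence of order \<open>s0\<close>.\<close>

lemma term3: "Bp * (gerr + 2 * sqrt (real NJ) / sqrt (real Q)) \<le> 20 * G * 2 ^ k * dm * s0"
proof -
  have sQ: "sqrt (real Q) = (real n)\<^sup>2"
  proof -
    have "real Q = ((real n)\<^sup>2)\<^sup>2" by (simp add: Q_def)
    then show ?thesis by (simp only: real_sqrt_abs abs_power2)
  qed
  have RQ: "(real R)\<^sup>2 * (2 / real Q) \<le> 2 / (real n)\<^sup>2"
  proof -
    have "(real R)\<^sup>2 * (2 / real Q) \<le> (real n)\<^sup>2 * (2 / real Q)" using R_le_n by (intro
        mult_right_mono power_mono) auto
    also have "\<dots> = 2 / (real n)\<^sup>2" using n0 by (simp add: Q_def power2_eq_square power4_eq_xxxx)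
    finally show ?thesis .
  qed
  have "gerr + 2 * sqrt (real NJ) / sqrt (real Q) \<le> sqrt (real NJ) * (real d * (2 / (real n)\<^sup>2)) + real d
      * (2 * sqrt (real NJ) / (real n)\<^sup>2)"
    unfolding gerr_def sQ
  proof (intro add_mono mult_left_mono RQ)
    have "1 * (2 * sqrt (real NJ) / (real n)\<^sup>2) \<le> real d * (2 * sqrt (real NJ) / (real n)\<^sup>2)"
      using d1 by (intro mult_right_mono) auto
    then show "2 * sqrt (real NJ) / (real n)\<^sup>2 \<le> real d * (2 * sqrt (real NJ) / (real n)\<^sup>2)" by simp
  qed auto
  also have "\<dots> = real d * (4 / (real n)\<^sup>2) * sqrt (real NJ)" by simp
  also have "\<dots> \<le> real d * (4 / (real n)\<^sup>2) * (2 * real n / 2 ^ d)"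
    by (intro mult_left_mono sqrt_NJ) auto
  also have "\<dots> = 8 * real d / 2 ^ d * (1 / real n)" using n0 by (simp add: power2_eq_square)
  also have "\<dots> \<le> 8 * real d / 2 ^ d * (5 / 2 * s0)" by (intro mult_left_mono inv_n_le) auto
  finally have "Bp * (gerr + 2 * sqrt (real NJ) / sqrt (real Q)) \<le> (2 ^ d * 2 ^ k * G) * (8 * real d / 2 ^ d *
      (5 / 2 * s0))"
    using Bp_le G_pos by (intro mult_mono) (auto simp: gerr_def)
  also have "\<dots> = 20 * G * 2 ^ k * real d * s0" by simp
  also have "\<dots> \<le> 20 * G * 2 ^ k * dm * s0" using dm_ge G_pos s0_pos by (intro mult_right_mono
      mult_left_mono) auto
  finally show ?thesis .
qed

lemma Cc_bound:
  assumes "c \<le> 400"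
  shows "c * G * 80 ^ k * dm \<le> (Cc * real k) ^ k * dm"
proof (rule mult_right_mono)
  have f: "fact k \<le> real k ^ k"
    using fact_le_power[of k, where 'a = real] by simp
  have "c * G * 80 ^ k \<le> 400 * (exp 113 * real k ^ k) * 80 ^ k"
    unfolding G_def using assms f by (intro mult_mono) auto
  also have "\<dots> = (400 * exp 113) ^ 1 * real k ^ k * 80 ^ k" by simp
  also have "\<dots> \<le> (400 * exp 113) ^ k * real k ^ k * 80 ^ k"
  proof (intro mult_right_mono power_increasing)
    have "1 * 1 \<le> 400 * exp (113::real)" by (intro mult_mono) auto
    then show "1 \<le> 400 * exp (113::real)" by simp
  qed (use k1 in auto)
  also have "\<dots> = (Cc * real k) ^ k"
  proof -
    have "400 * exp 113 * real k * 80 = Cc * real k" by (simp add: Cc_def)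
    then show ?thesis unfolding power_mult_distrib[symmetric] by (simp only:)
  qed
  finally show "c * G * 80 ^ k \<le> (Cc * real k) ^ k" .
qed simp

abbreviation "Cdk \<equiv> (Cc * real k) ^ k * dm"

lemma pow_le_80: "(2::real) ^ k \<le> 80 ^ k" "(2::real) ^ k * 8 ^ k \<le> 80 ^ k"
  unfolding power_mult_distrib[symmetric] by (auto intro!: power_mono)

definition "toterr = 2 * Eapp + Bp * (3 * tau + gerr + 2 * sqrt (real NJ) / sqrt (real Q))"

lemma toterr_split: "toterr = 2 * Eapp + Bp * (3 * tau) + Bp * (gerr + 2 * sqrt (real NJ) / sqrt (real Q))"
  by (simp add: toterr_def algebra_simps)

text \<open>The shell sum is at most \<open>R ^ (d - k) <= (y / 8) ^ (d - k)\<close>, and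
  \<open>y ^ d * s0 = 1\<close>. This leaves \<open>8 ^ k / 8 ^ d / y ^ k\<close>: the
  \<open>8 ^ d\<close> absorbs the \<open>4 ^ d\<close> of \<open>term2'\<close>, and
  \<open>8 ^ k\<close> joins the constant.\<close>

lemma case_lt:
  assumes "k < d"
  shows "toterr \<le> Cdk * s0 powr (real k / real d)"
proof -
  let ?p = "1 / y ^ k"
  have p: "0 < ?p" using y_pos by simp
  have "HS \<le> (\<Sum>r\<in>{1..R}. real R ^ (d - 1 - k))"
    unfolding HS_def
  proof (rule sum_mono)
    fix r assume r: "r \<in> {1..R}"
    have "real r ^ (d - 1) / real r ^ k = real r ^ (d - 1 - k)"
      using r assms by (simp add: power_diff)
    also have "\<dots> \<le> real R ^ (d - 1 - k)" using r by (intro power_mono) auto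
    finally show "real r ^ (d - 1) / real r ^ k \<le> real R ^ (d - 1 - k)" .
  qed
  also have "\<dots> = real R ^ Suc (d - 1 - k)" by simp
  also have "Suc (d - 1 - k) = d - k" using assms by simp
  finally have HS: "HS \<le> real R ^ (d - k)" .
  have "real R ^ (d - k) \<le> (y / 8) ^ (d - k)" using R_y(1) by (intro power_mono) auto
  also have "\<dots> = (y ^ d / y ^ k) / (8 ^ d / 8 ^ k)" using assms y_pos by (simp add: power_divide power_diff)
  finally have "HS \<le> (y ^ d / y ^ k) / (8 ^ d / 8 ^ k)" using HS by linarith
  then have "HS * s0 \<le> (y ^ d / y ^ k) / (8 ^ d / 8 ^ k) * s0" using s0_pos by (intro mult_right_mono) auto
  also have "\<dots> = 8 ^ k / 8 ^ d * ?p" using s0_pos unfolding y_d Xr_s0 by simp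
  finally have hs: "HS * s0 \<le> 8 ^ k / 8 ^ d * ?p" .
  have "Bp * (3 * tau) \<le> 24 * G * 2 ^ k * (real d * 4 ^ d * (HS * s0))" using term2' by (simp only: mult.assoc)
  also have "\<dots> \<le> 24 * G * 2 ^ k * (real d * 4 ^ d * (8 ^ k / 8 ^ d * ?p))"
    using hs G_pos by (intro mult_left_mono) auto
  also have "\<dots> = 24 * G * (2 ^ k * 8 ^ k) * (real d * (4 ^ d / 8 ^ d)) * ?p" by simp
  also have "\<dots> \<le> 24 * G * 80 ^ k * dm * ?p"
  proof (intro mult_right_mono mult_mono mult_left_mono pow_le_80)
    have "(4::real) ^ d / 8 ^ d \<le> 1" unfolding power_divide[symmetric] by (intro power_le_one) auto
    then have "real d * (4 ^ d / 8 ^ d) \<le> real d * 1" by (intro mult_left_mono) auto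
    then show "real d * (4 ^ d / 8 ^ d) \<le> dm" using dm_ge by simp
  qed (use G_pos p in auto)
  finally have t2: "Bp * (3 * tau) \<le> 24 * G * 80 ^ k * dm * ?p" .
  have sp: "s0 \<le> ?p"
  proof -
    have "s0 powr 1 \<le> s0 powr (real k / real d)" using s0_pos s0_le_1 assms by (intro powr_mono') auto
    then show ?thesis using s0_powr s0_pos by simp
  qed
  have "20 * G * 2 ^ k * dm * s0 \<le> 20 * G * 80 ^ k * dm * ?p"
    using sp pow_le_80(1) G_pos s0_pos by (intro mult_mono mult_right_mono mult_left_mono) auto
  then have t3: "Bp * (gerr + 2 * sqrt (real NJ) / sqrt (real Q)) \<le> 20 * G * 80 ^ k * dm * ?p" using term3 by
      linarith
  have "toterr \<le> 40 * G * 80 ^ k * dm * ?p + 24 * G * 80 ^ k * dm * ?p + 20 * G * 80 ^ k * dm * ?p"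
    unfolding toterr_split by (intro add_mono term1 t2 t3)
  also have "\<dots> = 84 * G * 80 ^ k * dm * ?p" by (simp only: distrib_right[symmetric]) simp
  also have "\<dots> \<le> Cdk * ?p" using p by (intro mult_right_mono Cc_bound) auto
  finally show ?thesis unfolding s0_powr .
qed

lemma p_le_s0: "d \<le> k \<Longrightarrow> 1 / y ^ k \<le> s0"
proof -
  assume "d \<le> k"
  have "s0 powr (real k / real d) \<le> s0 powr 1" using s0_pos s0_le_1 \<open>d \<le> k\<close> d1 by (intro
      powr_mono') auto
  then show ?thesis using s0_powr s0_pos by simp
qed

text \<open>No power of 8 is gained from the shell sum here, but \<open>d <= k\<close> gives
  \<open>4 ^ d <= 8 ^ k\<close>, which the \<open>k\<close>-th power in the constant can
  carry.\<close>

lemma case_ge: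
  assumes "d \<le> k" "HS \<le> c" "1 \<le> c"
  shows "toterr \<le> 84 * G * 80 ^ k * dm * (s0 * c)"
proof -
  have HS0: "0 \<le> HS" by (auto simp: HS_def intro!: sum_nonneg)
  have "s0 * 1 \<le> s0 * c" using assms s0_pos by (intro mult_left_mono) auto
  then have sc: "s0 \<le> s0 * c" by simp
  have dk: "(2::real) ^ k * 4 ^ d \<le> 80 ^ k"
  proof -
    have "(4::real) ^ d \<le> 8 ^ d" by (intro power_mono) auto
    also have "\<dots> \<le> 8 ^ k" using assms by (intro power_increasing) auto
    finally have "(2::real) ^ k * 4 ^ d \<le> 2 ^ k * 8 ^ k" by (intro mult_left_mono) auto
    with pow_le_80(2) show ?thesis by linarith
  qed
  have "Bp * (3 * tau) \<le> 24 * G * 2 ^ k * (real d * 4 ^ d * HS * s0)" by (rule term2')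
  also have "\<dots> = 24 * G * (2 ^ k * 4 ^ d) * real d * (s0 * HS)" by simp
  also have "\<dots> \<le> 24 * G * 80 ^ k * dm * (s0 * c)"
    using dk dm_ge G_pos s0_pos assms HS0 by (intro mult_mono mult_left_mono) auto
  finally have t2: "Bp * (3 * tau) \<le> 24 * G * 80 ^ k * dm * (s0 * c)" .
  have "20 * G * 2 ^ k * dm * s0 \<le> 20 * G * 80 ^ k * dm * (s0 * c)"
    using sc pow_le_80(1) G_pos s0_pos by (intro mult_mono mult_right_mono mult_left_mono) auto
  then have t3: "Bp * (gerr + 2 * sqrt (real NJ) / sqrt (real Q)) \<le> 20 * G * 80 ^ k * dm * (s0 * c)" using
      term3 by linarith
  have "40 * G * 80 ^ k * dm * (1 / y ^ k) \<le> 40 * G * 80 ^ k * dm * (s0 * c)"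
    using p_le_s0[OF assms(1)] sc G_pos by (intro mult_left_mono) auto
  then have t1: "2 * Eapp \<le> 40 * G * 80 ^ k * dm * (s0 * c)" using term1 by linarith
  have "toterr \<le> 40 * G * 80 ^ k * dm * (s0 * c) + 24 * G * 80 ^ k * dm * (s0 * c) + 20 * G * 80 ^ k * dm * (s0
      * c)"
    unfolding toterr_split by (intro add_mono t1 t2 t3)
  also have "\<dots> = 84 * G * 80 ^ k * dm * (s0 * c)" by (simp only: distrib_right[symmetric]) simp
  finally show ?thesis .
qed

lemma sum_inverse_squares: "(\<Sum>r\<in>{1..m}. 1 / (real r)\<^sup>2) \<le> 2 - 1 / real m"
proof (induction m)
  case (Suc m)
  show ?case
  proof (cases "m = 0")
    case False
    have "1 / (real (Suc m))\<^sup>2 \<le> 1 / (real m * real (Suc m))"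
      unfolding power2_eq_square using False by (intro divide_left_mono mult_right_mono) auto
    also have "\<dots> = 1 / real m - 1 / real (Suc m)" using False by (simp add: field_simps)
    finally show ?thesis using Suc by simp
  qed simp
qed simp

lemma harmonic_le: "1 \<le> m \<Longrightarrow> (\<Sum>r\<in>{1..m}. 1 / real r) \<le> 1 + ln (real m)"
proof (induction m rule: dec_induct)
  case (step m)
  have "ln (real m / real (Suc m)) \<le> real m / real (Suc m) - 1" using step by (intro ln_le_minus_one) auto
  then have "1 / real (Suc m) \<le> ln (real (Suc m)) - ln (real m)" using step by (simp add: ln_div field_simps)
  with step show ?case by simp
qed simp

lemma case_gt:
  assumes "d < k"
  shows "toterr \<le> Cdk * s0"
proof -
  have "HS \<le> (\<Sum>r\<in>{1..R}. 1 / (real r)\<^sup>2)"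
    unfolding HS_def
  proof (rule sum_mono)
    fix r assume r: "r \<in> {1..R}"
    have "real r ^ (d - 1) * (real r)\<^sup>2 = real r ^ (d + 1)" using d1 by (simp add: power_add[symmetric])
    also have "\<dots> \<le> real r ^ k" using r assms by (intro power_increasing) auto
    finally show "real r ^ (d - 1) / real r ^ k \<le> 1 / (real r)\<^sup>2" using r by (simp add: field_simps)
  qed
  also have "\<dots> \<le> 2" using sum_inverse_squares[of R] by (rule order_trans) simp
  finally have "toterr \<le> 84 * G * 80 ^ k * dm * (s0 * 2)" using assms by (intro case_ge) auto
  also have "\<dots> = 168 * G * 80 ^ k * dm * s0" by simp
  also have "\<dots> \<le> Cdk * s0" using s0_pos by (intro mult_right_mono Cc_bound) auto
  finally show ?thesis .
qed

lemma case_eq: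
  assumes "k = d"
  shows "toterr \<le> Cdk * s0 * ln (eps * real n)"
proof -
  let ?l = "ln (eps * real n)"
  have en: "eps * real n = Xr * Lg" using Lg_pos by (simp add: Xr_def)
  \<comment> \<open>The logarithm has to be at least 1 to absorb additive constants. It is, since
    \<open>eps * n = Xr * Lg\<close> is at least \<open>16 * 2 / 5\<close>.\<close>
  have "exp 1 \<le> (3::real)" by (rule exp_le)
  also have "\<dots> \<le> 16 * (2 / 5)" by simp
  also have "\<dots> \<le> Xr * Lg" using Xr_ge(2) Lg_ge by (intro mult_mono) auto
  finally have l1: "1 \<le> ?l" unfolding en using Xr_pos Lg_pos by (subst ln_ge_iff) auto
  \<comment> \<open>The degree is controlled by \<open>Xr\<close>, not by \<open>eps * n\<close>. As
    \<open>Lg\<close> may be below 1, the passage costs \<open>ln (1 / Lg)\<close>, at most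
    \<open>3 / 2\<close>.\<close>
  have "ln (real R) \<le> ln Xr" using R_le_Xr R_pos by (intro ln_mono) auto
  also have "\<dots> = ?l + ln (1 / Lg)" unfolding en using Xr_pos Lg_pos by (simp add: ln_mult ln_div)
  also have "ln (1 / Lg) \<le> 1 / Lg - 1" using Lg_pos by (intro ln_le_minus_one) auto
  also have "1 / Lg \<le> 1 / (2 / 5)" using Lg_ge by (intro divide_left_mono) auto
  finally have lR: "1 + ln (real R) \<le> 4 * ?l" using l1 by simp
  have "HS = (\<Sum>r\<in>{1..R}. 1 / real r)"
    unfolding HS_def
  proof (rule sum.cong[OF refl])
    fix r assume r: "r \<in> {1..R}"
    have "real r ^ k = real r ^ (d - 1) * real r" using assms d1 by (simp add: power_Suc[symmetric] mult.commute
        del: power_Suc)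
    then show "real r ^ (d - 1) / real r ^ k = 1 / real r" using r by simp
  qed
  also have "\<dots> \<le> 4 * ?l" using harmonic_le[OF R_pos] lR by linarith
  finally have "toterr \<le> 84 * G * 80 ^ k * dm * (s0 * (4 * ?l))" using assms l1 by (intro case_ge) auto
  also have "\<dots> = 336 * G * 80 ^ k * dm * (s0 * ?l)" by simp
  also have "\<dots> \<le> Cdk * (s0 * ?l)" using s0_pos l1 by (intro mult_right_mono Cc_bound) auto
  finally show ?thesis by (simp only: mult.assoc)
qed

lemma sig_pos: "0 < sig"
  using Lg_pos eps0 n0 Sg_pos by (simp add: sig_def)

lemma mom_diff:
  assumes X: "X \<in> datasets n (cube d)" "X' \<in> datasets n (cube d)"
    and c: "card {i. i < n \<and> X ! i \<noteq> X' ! i} \<le> 1"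
  shows "\<bar>mom X J - mom X' J\<bar> \<le> 2 / real n"
proof -
  let ?D = "{i. i < n \<and> X ! i \<noteq> X' ! i}"
  have len: "length X = n" "length X' = n" and Xi: "\<And>i. i < n \<Longrightarrow> X ! i \<in> cube d" "\<And>i.
      i < n \<Longrightarrow> X' ! i \<in> cube d"
    using X by (auto simp: datasets_def subset_iff)
  have "\<bar>mom X J - mom X' J\<bar> = \<bar>\<Sum>i<n. feat (X ! i) J - feat (X' ! i) J\<bar> / real n"
    by (simp add: mom_def avg_def len sum_subtractf diff_divide_distrib[symmetric])
  moreover have e: "(\<Sum>i<n. feat (X ! i) J - feat (X' ! i) J) = (\<Sum>i\<in>?D. feat (X ! i) J - feat (X' ! i) J)"
    by (rule sum.mono_neutral_right) auto
  moreover have "\<bar>\<Sum>i\<in>?D. feat (X ! i) J - feat (X' ! i) J\<bar> \<le> (\<Sum>i\<in>?D. 2)"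
  proof (intro order_trans[OF sum_abs] sum_mono)
    fix i assume "i \<in> ?D"
    then have "\<bar>feat (X ! i) J\<bar> \<le> 1" "\<bar>feat (X' ! i) J\<bar> \<le> 1" using Xi feat_abs by auto
    then show "\<bar>feat (X ! i) J - feat (X' ! i) J\<bar> \<le> 2" by linarith
  qed
  moreover have "(\<Sum>i\<in>?D. 2::real) \<le> 2"
  proof -
    have "real (card ?D) \<le> 1" using c by (simp only: of_nat_le_1_iff)
    then show ?thesis unfolding sum_constant by linarith
  qed
  ultimately have "\<bar>mom X J - mom X' J\<bar> = \<bar>\<Sum>i\<in>?D. feat (X ! i) J - feat (X' ! i) J\<bar> /
      real n"
      "\<bar>\<Sum>i\<in>?D. feat (X ! i) J - feat (X' ! i) J\<bar> \<le> 2" using order_trans by (simp only:, blast)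
  then show ?thesis by (simp only: divide_right_mono of_nat_0_le_iff)
qed

abbreviation "sout X \<omega> \<equiv> out (noisy X (\<lambda>J. snd (\<omega> J)))"

lemma sout_normals: "sout X \<omega> = out (noisy X (normals NJ \<omega>))"
  by (rule out_cong) (simp add: noisy_def normals_def)

lemma out_noisy_measurable: "(\<lambda>g. out (noisy X g)) \<in> measurable (gaussn NJ) (dataset_space d)"
  unfolding noisy_def[abs_def]
  by (rule out_measurable[OF n1]) (auto simp: gaussn_def)

lemma sout_measurable: "sout X \<in> measurable tape (dataset_space d)"
  unfolding sout_normals using measurable_compose[OF measurable_normals out_noisy_measurable] .

lemma measure_sout:
  assumes S: "S \<in> sets (dataset_space d)"
  shows "measure (distr tape (dataset_space d) (sout X)) S = measure (gaussn NJ) {g \<in> space (gaussn NJ). out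
      (noisy X g) \<in> S}"
proof -
  let ?B = "{g \<in> space (gaussn NJ). out (noisy X g) \<in> S}"
  have B: "?B \<in> sets (gaussn NJ)" using measurable_sets[OF out_noisy_measurable S, of X] by (simp add:
      vimage_def Int_def conj_commute)
  have "measure (distr tape (dataset_space d) (sout X)) S = measure tape (sout X -` S \<inter> space tape)"
    by (rule measure_distr[OF sout_measurable S])
  also have "sout X -` S \<inter> space tape = normals NJ -` ?B \<inter> space tape"
    using measurable_space[OF measurable_normals] by (auto simp: sout_normals)
  also have "measure tape \<dots> = measure (distr tape (gaussn NJ) (normals NJ)) ?B"
    by (rule measure_distr[OF measurable_normals B, symmetric])
  finally show ?thesis unfolding distr_normals .
qed

text \<open>Exchanging the dataset amounts to translating the noise by \<open>a\<close>, because the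
  output is a fixed function of the noisy moments. Privacy of the output is thus a statement about a
  shifted Gaussian vector.\<close>

lemma mechanism_private:
  "differentially_private (cube d) n (dataset_space d) eps del (\<lambda>X. distr tape (dataset_space d) (sout X))"
  unfolding differentially_private_def
proof (intro conjI ballI impI)
  fix X X' S assume X: "X \<in> datasets n (cube d)" "X' \<in> datasets n (cube d)"
    and c: "card {i. i < n \<and> X ! i \<noteq> X' ! i} \<le> 1" and S: "S \<in> sets (dataset_space d)"
  define a where "a J = (mom X J - mom X' J) / (sig * sqrt (wk J))" for J
  let ?B = "\<lambda>X. {g \<in> space (gaussn NJ). out (noisy X g) \<in> S}"
  have B: "?B X' \<in> sets (gaussn NJ)" using measurable_sets[OF out_noisy_measurable S, of X'] by (simp add:
      vimage_def Int_def conj_commute)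
  have "(\<Sum>J<NJ. (a J)\<^sup>2) \<le> (\<Sum>J<NJ. (2 / real n)\<^sup>2 / sig\<^sup>2 * (1 / wk J))"
  proof (rule sum_mono)
    fix J
    have "(a J)\<^sup>2 = \<bar>mom X J - mom X' J\<bar>\<^sup>2 / (sig\<^sup>2 * wk J)"
      using wk_pos[of J] by (simp add: a_def power_divide power_mult_distrib)
    also have "\<dots> \<le> (2 / real n)\<^sup>2 / (sig\<^sup>2 * wk J)"
      using mom_diff[OF X c] wk_pos[of J] by (intro divide_right_mono power_mono) auto
    finally show "(a J)\<^sup>2 \<le> (2 / real n)\<^sup>2 / sig\<^sup>2 * (1 / wk J)" by simp
  qed
  also have "\<dots> = (2 / real n)\<^sup>2 / sig\<^sup>2 * Sg" by (simp only: Sg_def sum_distrib_left)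
  also have "\<dots> = eps\<^sup>2 / (16 * Lg\<^sup>2)"
  proof -
    have e: "sig\<^sup>2 = 64 * Lg\<^sup>2 / (eps\<^sup>2 * (real n)\<^sup>2) * Sg"
      using Sg_pos by (simp add: sig_def power_mult_distrib power_divide)
    show ?thesis unfolding e using Sg_pos Lg_pos eps0 n0 by (simp add: power_divide field_simps)
  qed
  finally have as: "(\<Sum>J<NJ. (a J)\<^sup>2) \<le> eps\<^sup>2 / (16 * ln (1.25 / del))" unfolding Lg_sq .
  have shift: "out (noisy X' (\<lambda>i\<in>{..<NJ}. g i + a i)) = out (noisy X g)" for g
  proof (rule out_cong)
    fix J assume "J < NJ"
    moreover have "sig * sqrt (wk J) \<noteq> 0" using sig_pos wk_pos[of J] by simp
    then have "sig * sqrt (wk J) * a J = mom X J - mom X' J" by (simp add: a_def)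
    ultimately show "noisy X' (\<lambda>i\<in>{..<NJ}. g i + a i) J = noisy X g J"
      by (simp add: noisy_def distrib_left)
  qed
  have sp: "(\<lambda>i\<in>{..<NJ}. g i + a i) \<in> space (gaussn NJ)" for g
    by (auto simp: gaussn_def space_PiM)
  have "{g \<in> space (gaussn NJ). (\<lambda>i\<in>{..<NJ}. g i + a i) \<in> ?B X'} = ?B X"
    using sp shift by auto
  then show "measure (distr tape (dataset_space d) (sout X)) S \<le>
    exp eps * measure (distr tape (dataset_space d) (sout X')) S + del"
    unfolding measure_sout[OF S] using gaussian_mechanism[OF eps0 eps1 del0 del1 as B] by simp
qed (auto intro: prob_space.prob_space_distr[OF prob_space_tape sout_measurable])

lemma dk_dataset_bounds:
  assumes "pts d xs" "Y \<in> synthetic_datasets d"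
  shows "\<bar>dk d k (empirical (mset xs)) (empirical Y)\<bar> \<le> 2"
proof -
  obtain ys where ys: "mset ys = Y" using ex_mset by blast
  then have "pts d ys" using assms(2) by (auto simp: pts_def synthetic_datasets_def)
  then show ?thesis using dk_bounds[OF assms(1), of ys k] unfolding ys by simp
qed

text \<open>The expectation of the norm is bounded through
  \<open>z <= (z^2 / tau + tau) / 2\<close>, which is linear in the second moments and sharp for
  \<open>z = tau\<close>. Integrability holds because \<open>dk\<close> is bounded by 2.\<close>

lemma expected_error:
  assumes X: "X \<in> datasets n (cube d)"
  shows "integrable (distr tape (dataset_space d) (sout X)) (\<lambda>Y. dk d k (empirical (mset X)) (empirical Y))"
    and "(\<integral>Y. dk d k (empirical (mset X)) (empirical Y) \<partial>distr tape (dataset_space d) (sout X))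
        \<le> toterr"
proof -
  let ?g = "\<lambda>Y. dk d k (empirical (mset X)) (empirical Y)"
  let ?D = "distr tape (dataset_space d) (sout X)"
  have pX: "pts d X" using X n1 by (auto simp: datasets_def pts_def)
  have gm: "?g \<in> borel_measurable (dataset_space d)" by (rule dk_measurable[OF pX k1])
  interpret D: prob_space ?D by (rule prob_space.prob_space_distr[OF prob_space_tape sout_measurable])
  interpret T: prob_space tape by (rule prob_space_tape)
  show i1: "integrable ?D ?g"
    by (rule D.integrable_const_bound[where B = 2])
       (use gm dk_dataset_bounds[OF pX] in \<open>auto simp: space_dataset_space\<close>)
  then have i2: "integrable tape (\<lambda>\<omega>. ?g (sout X \<omega>))" by (simp add: integrable_distr_eq[OF
      sout_measurable gm])
  have tau: "0 < tau" using sig_pos Sg_pos by (simp add: tau_def)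
  define S2 where "S2 \<omega> = (\<Sum>J<NJ. sig\<^sup>2 / wk J * (snd (\<omega> J))\<^sup>2)" for \<omega> ::
      "nat \<Rightarrow> real \<times> real"
  let ?b = "\<lambda>\<omega>. 2 * Eapp + Bp * (3 * ((S2 \<omega> / tau + tau) / 2) + gerr + 2 * sqrt (real NJ) /
      sqrt (real Q))"
  have S2i: "integrable tape S2" unfolding S2_def[abs_def] using tape_second_moment(1) by (intro
      Bochner_Integration.integrable_sum integrable_mult_right)
  have bi: "integrable tape ?b" using S2i
    by (intro Bochner_Integration.integrable_add integrable_mult_right integrable_divide T.integrable_const)
  have le: "?g (sout X \<omega>) \<le> ?b \<omega>" for \<omega>
  proof -
    let ?nz = "nrm ww NJ (\<lambda>J. noisy X (\<lambda>J. snd (\<omega> J)) J - mom X J)"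
    have "?nz\<^sup>2 = S2 \<omega>"
      unfolding nrm_sq[OF ww0] S2_def
    proof (rule sum.cong[OF refl])
      fix J
      have "ww J * (noisy X (\<lambda>J. snd (\<omega> J)) J - mom X J)\<^sup>2 = 1 / (wk J)\<^sup>2 * (sig\<^sup>2
          * wk J * (snd (\<omega> J))\<^sup>2)"
        using wk_pos[of J] by (simp add: ww_def noisy_def power_mult_distrib)
      also have "\<dots> = sig\<^sup>2 / wk J * (snd (\<omega> J))\<^sup>2" using wk_pos[of J] by (simp add:
          power2_eq_square)
      finally show "ww J * (noisy X (\<lambda>J. snd (\<omega> J)) J - mom X J)\<^sup>2 = sig\<^sup>2 / wk J * (snd
          (\<omega> J))\<^sup>2" .
    qed
    moreover have "?nz \<le> (?nz\<^sup>2 / tau + tau) / 2"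
    proof -
      have "0 \<le> (?nz - tau)\<^sup>2 / tau" using tau by simp
      also have "\<dots> = ?nz\<^sup>2 / tau + tau - 2 * ?nz" using tau by (simp add: power2_eq_square field_simps)
      finally show ?thesis by simp
    qed
    ultimately have "3 * ?nz \<le> 3 * ((S2 \<omega> / tau + tau) / 2)" by simp
    then have "Bp * (3 * ?nz + gerr + 2 * sqrt (real NJ) / sqrt (real Q)) \<le>
      Bp * (3 * ((S2 \<omega> / tau + tau) / 2) + gerr + 2 * sqrt (real NJ) / sqrt (real Q))"
      using Bp_nonneg by (intro mult_left_mono) auto
    with pathwise_error[OF d1 k1 n1 pX, of "noisy X (\<lambda>J. snd (\<omega> J))"] show ?thesis by linarith
  qed
  have "(\<integral>\<omega>. S2 \<omega> \<partial>tape) = (\<Sum>J<NJ. sig\<^sup>2 / wk J)"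
    unfolding S2_def using tape_second_moment by (subst Bochner_Integration.integral_sum) auto
  also have "\<dots> = tau\<^sup>2" using Sg_pos by (simp add: tau_def power_mult_distrib Sg_def sum_distrib_left)
  finally have S2: "(\<integral>\<omega>. S2 \<omega> \<partial>tape) = tau\<^sup>2" .
  have "(\<integral>Y. ?g Y \<partial>?D) = (\<integral>\<omega>. ?g (sout X \<omega>) \<partial>tape)" by (rule
      integral_distr[OF sout_measurable gm])
  also have "\<dots> \<le> (\<integral>\<omega>. ?b \<omega> \<partial>tape)" by (rule integral_mono[OF i2 bi le])
  also have "\<dots> = 2 * Eapp + Bp * (3 * (((\<integral>\<omega>. S2 \<omega> \<partial>tape) / tau + tau) / 2) +
      gerr + 2 * sqrt (real NJ) / sqrt (real Q))"
    using S2i by (simp add: T.prob_space)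
  also have "\<dots> = toterr" unfolding S2 toterr_def using tau by (simp add: power2_eq_square)
  finally show "(\<integral>Y. ?g Y \<partial>?D) \<le> toterr" .
qed

end

section \<open>Reasoning about programs\<close>

text \<open>A total-correctness statement with a time bound from one start state. The existential
  form suffices since \<open>exec\<close> is deterministic.\<close>

definition runs :: "(nat \<Rightarrow> real \<times> real) \<Rightarrow> com \<Rightarrow> state \<Rightarrow> nat
    \<Rightarrow> (state \<Rightarrow> bool) \<Rightarrow> bool" where
  "runs \<omega> c s T Q \<longleftrightarrow> (\<exists>t s'. t \<le> T \<and> exec \<omega> c s t s' \<and> Q s')"

lemma runs_mono: "runs \<omega> c s T Q \<Longrightarrow> T \<le> T' \<Longrightarrow> (\<And>s'. Q s'
    \<Longrightarrow> Q' s') \<Longrightarrow> runs \<omega> c s T' Q'"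
  unfolding runs_def by (meson le_trans)

primrec nwrites :: "com \<Rightarrow> string set" where
  "nwrites Skip = {}"
| "nwrites (NSet a e r) = {a}"
| "nwrites (RSet a e e' r) = {}"
| "nwrites (DrawUniform a e e') = {}"
| "nwrites (DrawNormal a e e') = {}"
| "nwrites (Seq c c') = nwrites c \<union> nwrites c'"
| "nwrites (Cond b c c') = nwrites c \<union> nwrites c'"
| "nwrites (While b c) = nwrites c"

primrec rwrites :: "com \<Rightarrow> string set" where
  "rwrites Skip = {}"
| "rwrites (NSet a e r) = {}"
| "rwrites (RSet a e e' r) = {a}"
| "rwrites (DrawUniform a e e') = {a}"
| "rwrites (DrawNormal a e e') = {a}"
| "rwrites (Seq c c') = rwrites c \<union> rwrites c'"
| "rwrites (Cond b c c') = rwrites c \<union> rwrites c'"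
| "rwrites (While b c) = rwrites c"

primrec random :: "com \<Rightarrow> bool" where
  "random Skip = False"
| "random (NSet a e r) = False"
| "random (RSet a e e' r) = False"
| "random (DrawUniform a e e') = True"
| "random (DrawNormal a e e') = True"
| "random (Seq c c') = (random c \<or> random c')"
| "random (Cond b c c') = (random c \<or> random c')"
| "random (While b c) = random c"

text \<open>What a command cannot change, judged from its syntax and array by array. With it, loop
  invariants mention only the arrays the loop writes.\<close>

definition frame :: "com \<Rightarrow> state \<Rightarrow> state \<Rightarrow> bool" where
  "frame c s s' \<longleftrightarrow> (\<forall>a. a \<notin> nwrites c \<longrightarrow> nmem s' a = nmem s a) \<and>
     (\<forall>a. a \<notin> rwrites c \<longrightarrow> rmem s' a = rmem s a) \<and> (\<not> random c
         \<longrightarrow> draws s' = draws s)"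

lemma frame_refl [simp]: "frame c s s"
  by (simp add: frame_def)

lemma frame_trans: "frame c s s1 \<Longrightarrow> frame c s1 s2 \<Longrightarrow> frame c s s2"
  by (simp add: frame_def)

lemma frame_exec: "exec \<omega> c s t s' \<Longrightarrow> frame c s s'"
  by (induction rule: exec.induct) (simp_all add: frame_def nset_def rset_def drawn_def)

abbreviation gv :: "string \<Rightarrow> nexp" where "gv a \<equiv> NGet a (NConst 0)"
abbreviation sv :: "string \<Rightarrow> nexp \<Rightarrow> com" where "sv a e \<equiv> NSet a (NConst 0) e"
abbreviation rv :: "string \<Rightarrow> rexp" where "rv a \<equiv> RGet a (NConst 0) (NConst 0)"
abbreviation rvec :: "string \<Rightarrow> nexp \<Rightarrow> rexp" where "rvec a e \<equiv> RGet a (NConst 0) e"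
abbreviation rnum :: "nat \<Rightarrow> rexp" where "rnum m \<equiv> ROf (NConst m)"

text \<open>The bound \<open>e\<close> is evaluated anew at every test, so the rules below require
  it to be constant along the loop.\<close>

definition For :: "string \<Rightarrow> nexp \<Rightarrow> com \<Rightarrow> com" where
  "For a e c = Seq (sv a (NConst 0)) (While (NLess (gv a) e) (Seq c (sv a (NAdd (gv a) (NConst 1)))))"

lemma state_nset [simp]:
  "nmem (nset a i v s) b j = (if b = a \<and> j = i then v else nmem s b j)"
  "rmem (nset a i v s) = rmem s" "draws (nset a i v s) = draws s"
  by (auto simp: nset_def)

lemma state_rset [simp]:
  "rmem (rset a i j v s) b p q = (if b = a \<and> p = i \<and> q = j then v else rmem s b p q)"
  "nmem (rset a i j v s) = nmem s" "draws (rset a i j v s) = draws s"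
  by (auto simp: rset_def)

lemma state_drawn [simp]:
  "nmem (drawn s) = nmem s" "rmem (drawn s) = rmem s" "draws (drawn s) = Suc (draws s)"
  by (auto simp: drawn_def)


lemma runs_Seq:
  assumes "runs \<omega> c s Ta Q1" "\<And>s'. Q1 s' \<Longrightarrow> frame c s s' \<Longrightarrow> runs \<omega>
      c' s' Tb Q" "Ta + Tb \<le> T"
  shows "runs \<omega> (Seq c c') s T Q"
proof -
  obtain t1 s1 where 1: "t1 \<le> Ta" "exec \<omega> c s t1 s1" "Q1 s1" using assms(1) unfolding runs_def by blast
  obtain t2 s2 where 2: "t2 \<le> Tb" "exec \<omega> c' s1 t2 s2" "Q s2"
    using assms(2)[OF 1(3) frame_exec[OF 1(2)]] unfolding runs_def by blast
  have "exec \<omega> (Seq c c') s (t1 + t2) s2" using 1(2) 2(2) by (rule exec.Seq)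
  moreover have "t1 + t2 \<le> T" using 1(1) 2(1) assms(3) by simp
  ultimately show ?thesis using 2(3) unfolding runs_def by blast
qed

primrec straight :: "com \<Rightarrow> bool" where
  "straight Skip = True"
| "straight (NSet a e r) = True"
| "straight (RSet a e e' r) = True"
| "straight (DrawUniform a e e') = True"
| "straight (DrawNormal a e e') = True"
| "straight (Seq c c') = (straight c \<and> straight c')"
| "straight (Cond b c c') = (straight c \<and> straight c')"
| "straight (While b c) = False"

primrec cost :: "com \<Rightarrow> nat" where
  "cost Skip = 1"
| "cost (NSet a e r) = 1"
| "cost (RSet a e e' r) = 1"
| "cost (DrawUniform a e e') = 1"
| "cost (DrawNormal a e e') = 1"
| "cost (Seq c c') = cost c + cost c'"
| "cost (Cond b c c') = Suc (cost c + cost c')"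
| "cost (While b c) = 0"

text \<open>Meaningful for loop-free commands only; the clause for \<open>While\<close> is a dummy.
  Likewise \<open>cost\<close> charges a conditional for both branches, being only an upper
  bound.\<close>

primrec result :: "(nat \<Rightarrow> real \<times> real) \<Rightarrow> com \<Rightarrow> state \<Rightarrow>
    state" where
  "result \<omega> Skip s = s"
| "result \<omega> (NSet a e r) s = nset a (nval e s) (nval r s) s"
| "result \<omega> (RSet a e e' r) s = rset a (nval e s) (nval e' s) (rval r s) s"
| "result \<omega> (DrawUniform a e e') s = drawn (rset a (nval e s) (nval e' s) (fst (\<omega> (draws s))) s)"
| "result \<omega> (DrawNormal a e e') s = drawn (rset a (nval e s) (nval e' s) (snd (\<omega> (draws s))) s)"
| "result \<omega> (Seq c c') s = result \<omega> c' (result \<omega> c s)"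
| "result \<omega> (Cond b c c') s = (if bval b s then result \<omega> c s else result \<omega> c' s)"
| "result \<omega> (While b c) s = s"

lemma exec_straight: "straight c \<Longrightarrow> \<exists>t\<le>cost c. exec \<omega> c s t (result \<omega> c s)"
proof (induction c arbitrary: s)
  case (Seq c c')
  obtain t where "t \<le> cost c" "exec \<omega> c s t (result \<omega> c s)" using Seq by auto
  moreover obtain t' where "t' \<le> cost c'" "exec \<omega> c' (result \<omega> c s) t' (result \<omega> c'
      (result \<omega> c s))"
    using Seq by auto
  ultimately have "exec \<omega> (Seq c c') s (t + t') (result \<omega> (Seq c c') s) \<and> t + t' \<le> cost (Seq
      c c')"
    by (auto intro: exec.Seq)
  then show ?case by blast
next
  case (Cond b c c')
  show ?case
  proof (cases "bval b s")
    case True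
    obtain t where "t \<le> cost c" "exec \<omega> c s t (result \<omega> c s)" using Cond by auto
    then have "exec \<omega> (Cond b c c') s (Suc t) (result \<omega> (Cond b c c') s) \<and> Suc t \<le> cost
        (Cond b c c')"
      using True by (auto intro: exec.CondTrue)
    then show ?thesis by blast
  next
    case False
    obtain t where "t \<le> cost c'" "exec \<omega> c' s t (result \<omega> c' s)" using Cond by auto
    then have "exec \<omega> (Cond b c c') s (Suc t) (result \<omega> (Cond b c c') s) \<and> Suc t \<le> cost
        (Cond b c c')"
      using False by (auto intro: exec.CondFalse)
    then show ?thesis by blast
  qed
next
  case Skip
  show ?case by (auto intro!: exI[of _ 1] exec.Skip[unfolded One_nat_def])
next
  case (NSet a e r)
  show ?case by (auto intro!: exI[of _ 1] exec.NSet[unfolded One_nat_def])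
next
  case (RSet a e e' r)
  show ?case by (auto intro!: exI[of _ 1] exec.RSet[unfolded One_nat_def])
next
  case (DrawUniform a e e')
  show ?case by (auto intro!: exI[of _ 1] exec.DrawUniform[unfolded One_nat_def])
next
  case (DrawNormal a e e')
  show ?case by (auto intro!: exI[of _ 1] exec.DrawNormal[unfolded One_nat_def])
qed simp

lemma runs_straight: "Q (result \<omega> c s) \<Longrightarrow> straight c \<Longrightarrow> cost c \<le> T
    \<Longrightarrow> runs \<omega> c s T Q"
  using exec_straight[of c \<omega> s] unfolding runs_def by (meson le_trans)

lemma for_commands [simp]:
  "nwrites (For a e c) = insert a (nwrites c)" "rwrites (For a e c) = rwrites c"
  "random (For a e c) = random c"
  by (auto simp: For_def)

text \<open>Induction on the number \<open>j\<close> of remaining iterations. The step is stated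
  after the increment of the counter, because the invariant may refer to it.\<close>

lemma runs_While:
  assumes step: "\<And>i s'. i < m \<Longrightarrow> I i s' \<Longrightarrow> nmem s' a 0 = i \<Longrightarrow>
      frame (For a e c) s s' \<Longrightarrow>
      runs \<omega> c s' Tb (\<lambda>s''. I (Suc i) (nset a 0 (Suc i) s''))"
    and bound: "\<And>s'. frame (For a e c) s s' \<Longrightarrow> nval e s' = m"
    and a: "a \<notin> nwrites c"
  shows "j \<le> m \<Longrightarrow> I (m - j) s' \<Longrightarrow> nmem s' a 0 = m - j \<Longrightarrow> frame
      (For a e c) s s' \<Longrightarrow>
    runs \<omega> (While (NLess (gv a) e) (Seq c (sv a (NAdd (gv a) (NConst 1))))) s' (j * (Tb + 1 + 1) + 1) (I m)"
proof (induction j arbitrary: s')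
  case 0
  then have "\<not> bval (NLess (gv a) e) s'" using bound[of s'] by simp
  from exec.WhileFalse[OF this] show ?case using 0 unfolding runs_def by auto
next
  case (Suc j)
  let ?i = "m - Suc j"
  let ?c = "Seq c (sv a (NAdd (gv a) (NConst 1)))"
  have i: "?i < m" "Suc ?i = m - j" using Suc.prems by auto
  have b: "bval (NLess (gv a) e) s'" using bound[OF Suc.prems(4)] Suc.prems i by simp
  have "runs \<omega> ?c s' (Tb + 1) (\<lambda>s''. I (m - j) s'' \<and> nmem s'' a 0 = m - j)"
  proof (rule runs_Seq[OF step[OF i(1) Suc.prems(2,3,4)]])
    fix s1 assume s1: "I (Suc ?i) (nset a 0 (Suc ?i) s1)" "frame c s' s1"
    have "nmem s1 a 0 = ?i" using s1(2) a Suc.prems(3) by (simp add: frame_def)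
    then show "runs \<omega> (sv a (NAdd (gv a) (NConst 1))) s1 1 (\<lambda>s''. I (m - j) s'' \<and> nmem s'' a 0
        = m - j)"
      using s1(1) i(2) by (intro runs_straight) auto
  qed simp
  then obtain t s1 where s1: "t \<le> Tb + 1" "exec \<omega> ?c s' t s1" "I (m - j) s1" "nmem s1 a 0 = m - j"
    unfolding runs_def by blast
  have "frame (For a e c) s' s1" using frame_exec[OF s1(2)] by (simp add: frame_def)
  then have "runs \<omega> (While (NLess (gv a) e) ?c) s1 (j * (Tb + 1 + 1) + 1) (I m)"
    using s1(3,4) Suc.prems(1,4) by (intro Suc.IH) (auto intro: frame_trans)
  then obtain t' s2 where s2: "t' \<le> j * (Tb + 1 + 1) + 1" "exec \<omega> (While (NLess (gv a) e) ?c) s1 t' s2"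
      "I m s2"
    unfolding runs_def by blast
  have "exec \<omega> (While (NLess (gv a) e) ?c) s' (Suc (t + t')) s2"
    by (rule exec.WhileTrue[OF b s1(2) s2(2)])
  moreover have "Suc (t + t') \<le> Suc j * (Tb + 1 + 1) + 1" using s1(1) s2(1) by simp
  ultimately show ?case using s2(3) unfolding runs_def by blast
qed

text \<open>Each iteration pays for the body, the test and the increment; the final 2 are the
  initialization and the last, failing test.\<close>

lemma runs_For:
  assumes "\<And>i s'. i < m \<Longrightarrow> I i s' \<Longrightarrow> nmem s' a 0 = i \<Longrightarrow> frame
      (For a e c) s s' \<Longrightarrow>
      runs \<omega> c s' Tb (\<lambda>s''. I (Suc i) (nset a 0 (Suc i) s''))"
    and "I 0 (nset a 0 0 s)"
    and "\<And>s'. frame (For a e c) s s' \<Longrightarrow> nval e s' = m"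
    and "a \<notin> nwrites c"
    and "m * (Tb + 2) + 2 \<le> T"
  shows "runs \<omega> (For a e c) s T (I m)"
  unfolding For_def
proof (rule runs_Seq[where Ta = 1 and Tb = "m * (Tb + 1 + 1) + 1"])
  show "runs \<omega> (sv a (NConst 0)) s 1 (\<lambda>s'. s' = nset a 0 0 s)" by (rule runs_straight) auto
  fix s' assume s': "s' = nset a 0 0 s"
  then have "frame (For a e c) s s'" by (simp add: frame_def nset_def)
  then show "runs \<omega> (While (NLess (gv a) e) (Seq c (sv a (NAdd (gv a) (NConst 1))))) s' (m * (Tb + 1 + 1) +
      1) (I m)"
    using assms(2) s' by (intro runs_While[where s = s, OF assms(1,3,4)]) auto
qed (use assms(5) in simp)

text \<open>Appends to an array, whose first \<open>len\<close> entries represent a table over \<open>i\<close> digits, the entries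
  for one more digit \<open>j\<close>; the entries with \<open>j = 0\<close> are overwritten in place.\<close>

definition kloop :: "nexp \<Rightarrow> com \<Rightarrow> com" where
  "kloop e body = For ''j'' e (For ''J'' (gv ''len'') (Seq body (sv ''cnt'' (NAdd (gv ''cnt'') (NConst 1)))))"

definition kron :: "nexp \<Rightarrow> com \<Rightarrow> com" where
  "kron e body = Seq (sv ''cnt'' (NConst 0)) (Seq (kloop e body) (sv ''len'' (gv ''cnt'')))"

lemma kloop_commands [simp]:
  "nwrites (kloop e c) = {''cnt'', ''j'', ''J''} \<union> nwrites c" "rwrites (kloop e c) = rwrites c"
  "random (kloop e c) = random c"
  by (auto simp: kloop_def)

lemma kron_commands [simp]:
  "nwrites (kron e c) = {''cnt'', ''j'', ''J'', ''len''} \<union> nwrites c" "rwrites (kron e c) = rwrites c"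
  "random (kron e c) = random c"
  by (auto simp: kron_def)

text \<open>The invariant is indexed by the number of entries written. Hypothesis
  \<open>cong\<close> says that it does not look at the bookkeeping registers, so that advancing
  these preserves it.\<close>

lemma runs_kron:
  assumes body: "\<And>j J s'. j < B \<Longrightarrow> J < len \<Longrightarrow> I (J + j * len) s'
      \<Longrightarrow> frame (kloop e body) s s' \<Longrightarrow>
       nmem s' ''cnt'' 0 = J + j * len \<Longrightarrow> nmem s' ''j'' 0 = j \<Longrightarrow> nmem s' ''J'' 0 = J
           \<Longrightarrow>
       runs \<omega> body s' Tb (I (Suc (J + j * len)))"
    and init: "I 0 s"
    and cong: "\<And>cnt s1 s2. I cnt s1 \<Longrightarrow> (\<And>a. a \<notin> {''cnt'', ''j'', ''J'', ''len''}
        \<Longrightarrow> nmem s2 a = nmem s1 a) \<Longrightarrow>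
       rmem s2 = rmem s1 \<Longrightarrow> I cnt s2"
    and len: "nmem s ''len'' 0 = len"
    and B: "\<And>s'. frame (kloop e body) s s' \<Longrightarrow> nval e s' = B"
    and W: "''cnt'' \<notin> nwrites body" "''len'' \<notin> nwrites body" "''j'' \<notin> nwrites body" "''J''
        \<notin> nwrites body"
    and T: "B * (len * (Tb + 3) + 4) + 4 \<le> T"
  shows "runs \<omega> (kron e body) s T (\<lambda>s'. I (B * len) s' \<and> nmem s' ''len'' 0 = B * len)"
proof -
  let ?inner = "Seq body (sv ''cnt'' (NAdd (gv ''cnt'') (NConst 1)))"
  let ?I = "\<lambda>c s'. I c s' \<and> nmem s' ''cnt'' 0 = c"
  have inner: "runs \<omega> (For ''J'' (gv ''len'') ?inner) s' (len * (Tb + 3) + 2) (\<lambda>s''. ?I (len + j *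
      len) s'' \<and> nmem s'' ''j'' 0 = j)"
    if j: "j < B" and I: "?I (j * len) s'" and f: "frame (kloop e body) s s'" and jj: "nmem s' ''j'' 0 = j" for j s'
  proof (rule runs_For[where m = len and Tb = "Tb + 1" and
        I = "\<lambda>J s''. ?I (J + j * len) s'' \<and> nmem s'' ''j'' 0 = j"])
    show "?I (0 + j * len) (nset ''J'' 0 0 s') \<and> nmem (nset ''J'' 0 0 s') ''j'' 0 = j"
      using I jj cong[of "j * len" s' "nset ''J'' 0 0 s'"] by (simp add: nset_def)
  next
    fix J s1 assume J: "J < len" and A: "?I (J + j * len) s1 \<and> nmem s1 ''j'' 0 = j" and JJ: "nmem s1 ''J'' 0 = J"
      and f1: "frame (For ''J'' (gv ''len'') ?inner) s' s1"
    have "frame (kloop e body) s s1" using f f1 by (auto simp: frame_def)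
    then have r: "runs \<omega> body s1 Tb (I (Suc (J + j * len)))" using body[OF j J] A JJ by auto
    show "runs \<omega> ?inner s1 (Tb + 1)
       (\<lambda>s''. ?I (Suc J + j * len) (nset ''J'' 0 (Suc J) s'') \<and> nmem (nset ''J'' 0 (Suc J) s'') ''j''
           0 = j)"
    proof (rule runs_Seq[OF r])
      fix s2 assume s2: "I (Suc (J + j * len)) s2" "frame body s1 s2"
      then have "nmem s2 ''cnt'' 0 = J + j * len" "nmem s2 ''j'' 0 = j"
        using A W by (auto simp: frame_def)
      moreover have "I (Suc (J + j * len)) (nset ''J'' 0 (Suc J) (nset ''cnt'' 0 (Suc (J + j * len)) s2))"
        by (rule cong[OF s2(1)]) (auto simp: nset_def)
      ultimately show "runs \<omega> (sv ''cnt'' (NAdd (gv ''cnt'') (NConst 1))) s2 1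
        (\<lambda>s''. ?I (Suc J + j * len) (nset ''J'' 0 (Suc J) s'') \<and> nmem (nset ''J'' 0 (Suc J) s'') ''j''
            0 = j)"
        by (intro runs_straight) auto
    qed simp
  next
    fix s1 assume "frame (For ''J'' (gv ''len'') ?inner) s' s1"
    then show "nval (gv ''len'') s1 = len" using f len W by (simp add: frame_def)
  qed (use W in \<open>auto simp: algebra_simps\<close>)
  have outer: "runs \<omega> (kloop e body) s' (B * (len * (Tb + 3) + 4) + 2) (?I (B * len))"
    if s': "s' = nset ''cnt'' 0 0 s" for s'
    unfolding kloop_def
  proof (rule runs_For[where m = B and Tb = "len * (Tb + 3) + 2" and I = "\<lambda>j. ?I (j * len)"])
    have "I 0 (nset ''j'' 0 0 s')" unfolding s' by (rule cong[OF init]) (auto simp: nset_def)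
    then show "?I (0 * len) (nset ''j'' 0 0 s')" by (simp add: s')
  next
    have f: "frame (kloop e body) s s'" by (simp add: s' frame_def nset_def)
    {
      fix s1 assume "frame (For ''j'' e (For ''J'' (gv ''len'') ?inner)) s' s1"
      then have "frame (kloop e body) s s1" using f unfolding kloop_def[symmetric] by (rule frame_trans[rotated])
    } note f1 = this
    then show "nval e s1 = B" if "frame (For ''j'' e (For ''J'' (gv ''len'') ?inner)) s' s1" for s1
      using B that by blast
    fix j s1 assume "j < B" "?I (j * len) s1" "nmem s1 ''j'' 0 = j" "frame (For ''j'' e (For ''J'' (gv ''len'')
        ?inner)) s' s1"
    from inner[OF this(1,2) f1[OF this(4)] this(3)]
    show "runs \<omega> (For ''J'' (gv ''len'') ?inner) s1 (len * (Tb + 3) + 2) (\<lambda>s''. ?I (Suc j * len)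
        (nset ''j'' 0 (Suc j) s''))"
    proof (rule runs_mono[OF _ order_refl])
      fix s2 assume A: "?I (len + j * len) s2 \<and> nmem s2 ''j'' 0 = j"
      have "I (len + j * len) (nset ''j'' 0 (Suc j) s2)" by (rule cong[of _ s2]) (use A in \<open>auto simp:
          nset_def\<close>)
      then show "?I (Suc j * len) (nset ''j'' 0 (Suc j) s2)" using A by simp
    qed
  qed (use W in \<open>auto simp: algebra_simps\<close>)
  have fin: "runs \<omega> (sv ''len'' (gv ''cnt'')) s' 1 (\<lambda>s'. I (B * len) s' \<and> nmem s' ''len'' 0 = B
      * len)"
    if "?I (B * len) s'" for s'
  proof -
    have "I (B * len) (nset ''len'' 0 (B * len) s')" by (rule cong[of _ s']) (use that in \<open>auto simp:
        nset_def\<close>)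
    then show ?thesis using that by (intro runs_straight) auto
  qed
  show ?thesis unfolding kron_def
  proof (rule runs_Seq[where Ta = 1])
    show "runs \<omega> (sv ''cnt'' (NConst 0)) s 1 (\<lambda>s'. s' = nset ''cnt'' 0 0 s)" by (rule runs_straight) auto
    fix s' assume s': "s' = nset ''cnt'' 0 0 s"
    show "runs \<omega> (Seq (kloop e body) (sv ''len'' (gv ''cnt''))) s' (B * (len * (Tb + 3) + 4) + 2 + 1)
       (\<lambda>s'. I (B * len) s' \<and> nmem s' ''len'' 0 = B * len)"
      by (rule runs_Seq[OF outer[OF s']]) (use fin in auto)
  qed (use T in simp)
qed

abbreviation seq :: "com \<Rightarrow> com \<Rightarrow> com" (infixr ";;" 60) where "c ;; c' \<equiv> Seq c c'"

lemma state_other [simp]: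
  "b \<noteq> a \<Longrightarrow> nmem (nset a i v s) b = nmem s b"
  "b \<noteq> a \<Longrightarrow> rmem (rset a i j w s) b = rmem s b"
  "p \<noteq> i \<Longrightarrow> rmem (rset a i j w s) b p = rmem s b p"
  by (auto simp: nset_def rset_def)

lemma runs_frame: "runs \<omega> c s T Q \<Longrightarrow> runs \<omega> c s T (\<lambda>s'. Q s' \<and> frame c s s')"
  unfolding runs_def using frame_exec by blast

lemma runs_result: "straight c \<Longrightarrow> runs \<omega> c s (cost c) (\<lambda>s'. s' = result \<omega> c s)"
  by (rule runs_straight) auto

lemma runs_fill:
  assumes val: "\<And>i s'. i < m \<Longrightarrow> frame (For a e (RSet v p (gv a) r)) s s' \<Longrightarrow> nmem
      s' a 0 = i \<Longrightarrow>
      rmem s' v q i = rmem s v q i \<Longrightarrow> (\<forall>q' i. q' \<noteq> q \<longrightarrow> rmem s' v q' i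
          = rmem s v q' i) \<Longrightarrow> rval r s' = f i"
    and e: "\<And>s'. frame (For a e (RSet v p (gv a) r)) s s' \<Longrightarrow> nval e s' = m"
    and p: "\<And>s'. frame (For a e (RSet v p (gv a) r)) s s' \<Longrightarrow> nval p s' = q"
    and T: "m * 3 + 2 \<le> T"
  shows "runs \<omega> (For a e (RSet v p (gv a) r)) s T (\<lambda>s'. (\<forall>i<m. rmem s' v q i = f i) \<and>
      (\<forall>q' i. q' \<noteq> q \<longrightarrow> rmem s' v q' i = rmem s v q' i))"
proof -
  let ?I = "\<lambda>j (s'::state). (\<forall>i<j. rmem s' v q i = f i) \<and> (\<forall>i\<ge>j. rmem s' v q i =
      rmem s v q i) \<and>
     (\<forall>q' i. q' \<noteq> q \<longrightarrow> rmem s' v q' i = rmem s v q' i)"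
  have "runs \<omega> (For a e (RSet v p (gv a) r)) s T (?I m)"
  proof (rule runs_For[where Tb = 1 and m = m and I = ?I])
    fix i s' assume A: "i < m" "?I i s'" "nmem s' a 0 = i" "frame (For a e (RSet v p (gv a) r)) s s'"
    have "nval p s' = q" "rval r s' = f i" using p[OF A(4)] val[OF A(1,4,3)] A(2) by auto
    then show "runs \<omega> (RSet v p (gv a) r) s' 1 (\<lambda>s''. ?I (Suc i) (nset a 0 (Suc i) s''))"
      using A by (intro runs_straight) (auto simp: less_Suc_eq)
  qed (use e T in auto)
  then show ?thesis by (rule runs_mono) auto
qed

lemma runs_accum:
  assumes val: "\<And>i s'. i < m \<Longrightarrow> frame (For a e (RSet v p p' (RAdd (RGet v p p') r))) s s'
      \<Longrightarrow> nmem s' a 0 = i \<Longrightarrow> rval r s' = f i"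
    and e: "\<And>s'. frame (For a e (RSet v p p' (RAdd (RGet v p p') r))) s s' \<Longrightarrow> nval e s' = m"
    and p: "\<And>s'. frame (For a e (RSet v p p' (RAdd (RGet v p p') r))) s s' \<Longrightarrow> nval p s' = q
        \<and> nval p' s' = q'"
    and T: "m * 3 + 2 \<le> T"
  shows "runs \<omega> (For a e (RSet v p p' (RAdd (RGet v p p') r))) s T (\<lambda>s'. rmem s' v q q' = rmem s v q
      q' + (\<Sum>i<m. f i) \<and>
      (\<forall>i j. \<not> (i = q \<and> j = q') \<longrightarrow> rmem s' v i j = rmem s v i j))"
proof -
  let ?I = "\<lambda>j (s'::state). rmem s' v q q' = rmem s v q q' + (\<Sum>i<j. f i) \<and>
      (\<forall>i j. \<not> (i = q \<and> j = q') \<longrightarrow> rmem s' v i j = rmem s v i j)"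
  show ?thesis
  proof (rule runs_For[where Tb = 1 and m = m and I = ?I])
    fix i s' assume A: "i < m" "?I i s'" "nmem s' a 0 = i" "frame (For a e (RSet v p p' (RAdd (RGet v p p') r))) s s'"
    have "nval p s' = q" "nval p' s' = q'" "rval r s' = f i" using p val A by auto
    then show "runs \<omega> (RSet v p p' (RAdd (RGet v p p') r)) s' 1 (\<lambda>s''. ?I (Suc i) (nset a 0 (Suc i)
        s''))"
      using A by (intro runs_straight) auto
  qed (use e T in auto)
qed

text \<open>For each coordinate, \<open>T\<close> receives the Chebyshev values by the three-term
  recurrence, and \<open>V\<close> is extended by a tensor factor in place. The order of the entries
  is the digit code of the multi-indices.\<close>

definition features :: "string \<Rightarrow> nexp \<Rightarrow> com" where
  "features a e = RSet ''V'' (NConst 0) (NConst 0) (rnum 1) ;; sv ''len'' (NConst 1) ;;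
     For ''i'' (gv ''d'')
       (RSet ''T'' (NConst 0) (NConst 0) (rnum 1) ;; RSet ''T'' (NConst 0) (NConst 1) (RGet a e (gv ''i'')) ;;
        For ''a'' (gv ''R'') (RSet ''T'' (NConst 0) (NAdd (gv ''a'') (NConst 2))
          (RSub (RMul (RMul (rnum 2) (rvec ''T'' (NConst 1))) (rvec ''T'' (NAdd (gv ''a'') (NConst 1)))) (rvec
              ''T'' (gv ''a'')))) ;;
        kron (gv ''b'') (RSet ''V'' (NConst 0) (gv ''cnt'') (RMul (rvec ''V'' (gv ''J'')) (rvec ''T'' (gv ''j'')))))"

lemma features_commands [simp]:
  "nwrites (features a e) = {''len'', ''i'', ''a'', ''cnt'', ''j'', ''J''}"
  "rwrites (features a e) = {''V'', ''T''}" "\<not> random (features a e)"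
  by (auto simp: features_def)

definition Tfeat :: "nat \<Rightarrow> nat \<Rightarrow> nat" where
  "Tfeat d R = 2 + (d * ((2 + (R * 3 + 2) + ((R + 1) * ((R + 1) ^ d * 4 + 4) + 4)) + 2) + 2)"

lemma dig_eq_0: "J < b ^ i \<Longrightarrow> dig b i J = 0"
  by (simp add: dig_def)

lemma runs_features:
  assumes n: "nmem s ''d'' 0 = d" "nmem s ''R'' 0 = R" "nmem s ''b'' 0 = R + 1"
    and e: "\<And>s'. frame (features a e) s s' \<Longrightarrow> nval e s' = u"
    and a: "a \<noteq> ''V''" "a \<noteq> ''T''" and x: "\<And>i. i < d \<Longrightarrow> rmem s a u i = x i"
  shows "runs \<omega> (features a e) s (Tfeat d R) (\<lambda>s'. \<forall>J<(R + 1) ^ d. rmem s' ''V'' 0 J =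
      (\<Prod>i<d. cheb (dig (R + 1) i J) (x i)))"
proof -
  let ?b = "R + 1"
  define g where "g i J = (\<Prod>i<i. cheb (dig ?b i J) (x i))" for i J
  let ?K = "kron (gv ''b'') (RSet ''V'' (NConst 0) (gv ''cnt'') (RMul (rvec ''V'' (gv ''J'')) (rvec ''T'' (gv ''j''))))"
  let ?t = "For ''a'' (gv ''R'') (RSet ''T'' (NConst 0) (NAdd (gv ''a'') (NConst 2))
          (RSub (RMul (RMul (rnum 2) (rvec ''T'' (NConst 1))) (rvec ''T'' (NAdd (gv ''a'') (NConst 1)))) (rvec
              ''T'' (gv ''a''))))"
  let ?u = "RSet ''T'' (NConst 0) (NConst 0) (rnum 1) ;; RSet ''T'' (NConst 0) (NConst 1) (RGet a e (gv ''i''))"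
  let ?Tk = "(R + 1) * ((R + 1) ^ d * 4 + 4) + 4"
  let ?I = "\<lambda>i (s'::state). nmem s' ''len'' 0 = ?b ^ i \<and> (\<forall>J<?b ^ i. rmem s' ''V'' 0 J = g i J)"
  let ?F = "For ''i'' (gv ''d'') (RSet ''T'' (NConst 0) (NConst 0) (rnum 1) ;; RSet ''T'' (NConst 0) (NConst 1)
      (RGet a e (gv ''i'')) ;; ?t ;; ?K)"
  have fF: "frame (features a e) s s'" if "frame ?F s0 s'" "s0 = nset ''len'' 0 1 (rset ''V'' 0 0 1 s)" for s0 s'
    using that unfolding frame_def by simp
  have step: "runs \<omega> (RSet ''T'' (NConst 0) (NConst 0) (rnum 1) ;; RSet ''T'' (NConst 0) (NConst 1) (RGet a
      e (gv ''i'')) ;; ?t ;; ?K) s1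
      (2 + (R * 3 + 2) + ?Tk) (\<lambda>s''. ?I (Suc i) (nset ''i'' 0 (Suc i) s''))"
    if i: "i < d" and I: "?I i s1" and ii: "nmem s1 ''i'' 0 = i" and f: "frame (features a e) s s1" for i s1
  proof (rule runs_Seq)
    show "runs \<omega> (RSet ''T'' (NConst 0) (NConst 0) (rnum 1)) s1 1 (\<lambda>s'. s' = rset ''T'' 0 0 1 s1)"
      by (rule runs_straight) auto
    fix s2 assume s2: "s2 = rset ''T'' 0 0 1 s1"
    have f2: "frame (features a e) s s2" using f unfolding s2 frame_def by simp
    have ra: "rmem s2 a = rmem s a" using f2 a by (simp add: frame_def)
    show "runs \<omega> (RSet ''T'' (NConst 0) (NConst 1) (RGet a e (gv ''i'')) ;; ?t ;; ?K) s2 (1 + ((R * 3 + 2) +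
        ?Tk))
      (\<lambda>s''. ?I (Suc i) (nset ''i'' 0 (Suc i) s''))"
    proof (rule runs_Seq)
      show "runs \<omega> (RSet ''T'' (NConst 0) (NConst 1) (RGet a e (gv ''i''))) s2 1 (\<lambda>s'. s' = rset
          ''T'' 0 1 (x i) s2)"
        using e[OF f2] ra x[OF i] ii by (intro runs_straight) (auto simp: s2)
      fix s3 assume s3: "s3 = rset ''T'' 0 1 (x i) s2"
      have f3: "frame (features a e) s s3" using f2 unfolding s3 frame_def by simp
      let ?J = "\<lambda>m (s'::state). \<forall>j<m + 2. rmem s' ''T'' 0 j = cheb j (x i)"
      have t: "runs \<omega> ?t s3 (R * 3 + 2) (?J R)"
      proof (rule runs_For[where m = R and Tb = 1 and I = ?J])
        fix m s' assume A: "m < R" "?J m s'" "nmem s' ''a'' 0 = m"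
        then have "rmem s' ''T'' 0 (Suc 0) = x i" "rmem s' ''T'' 0 (Suc m) = cheb (Suc m) (x i)" "rmem s' ''T'' 0 m
            = cheb m (x i)"
          by auto
        then show "runs \<omega> (RSet ''T'' (NConst 0) (NAdd (gv ''a'') (NConst 2))
          (RSub (RMul (RMul (rnum 2) (rvec ''T'' (NConst 1))) (rvec ''T'' (NAdd (gv ''a'') (NConst 1)))) (rvec
              ''T'' (gv ''a'')))) s' 1
           (\<lambda>s''. ?J (Suc m) (nset ''a'' 0 (Suc m) s''))"
          using A by (intro runs_straight) (auto simp: less_Suc_eq)
      next
        show "?J 0 (nset ''a'' 0 0 s3)" by (auto simp: s3 s2 less_Suc_eq numeral_2_eq_2)
      qed (use f3 n in \<open>auto simp: frame_def\<close>)
      show "runs \<omega> (?t ;; ?K) s3 ((R * 3 + 2) + ?Tk) (\<lambda>s''. ?I (Suc i) (nset ''i'' 0 (Suc i) s''))"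
      proof (rule runs_Seq[OF t])
        fix s4 assume T: "?J R s4" and f4: "frame ?t s3 s4"
        have len: "nmem s4 ''len'' 0 = ?b ^ i" using f4 I by (simp add: frame_def s3 s2)
        have V: "\<forall>J<?b ^ i. rmem s4 ''V'' 0 J = g i J" using f4 I by (simp add: frame_def s3 s2)
        have b4: "nmem s4 ''b'' 0 = ?b" using f4 f3 n by (simp add: frame_def)
        let ?H = "\<lambda>c (s'::state). (\<forall>J<?b ^ i. rmem s' ''V'' 0 J = g i J) \<and> (\<forall>J<c. rmem
            s' ''V'' 0 J = g (Suc i) J)"
        have "runs \<omega> ?K s4 ?Tk (\<lambda>s'. ?H (?b * ?b ^ i) s' \<and> nmem s' ''len'' 0 = ?b * ?b ^ i)"
        proof (rule runs_kron[where Tb = 1 and I = ?H])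
          fix j J s' assume A: "j < ?b" "J < ?b ^ i" "?H (J + j * ?b ^ i) s'" "nmem s' ''cnt'' 0 = J + j * ?b ^ i"
            "nmem s' ''j'' 0 = j" "nmem s' ''J'' 0 = J"
            "frame (kloop (gv ''b'') (RSet ''V'' (NConst 0) (gv ''cnt'') (RMul (rvec ''V'' (gv ''J'')) (rvec ''T''
                (gv ''j''))))) s4 s'"
          have Tj: "rmem s' ''T'' 0 j = cheb j (x i)" using A(1,7) T by (simp add: frame_def)
          have low: "g i (J + j * ?b ^ i) = g i J" unfolding g_def
            by (intro prod.cong refl) (simp add: dig_add_low)
          have top: "dig ?b i (J + j * ?b ^ i) = j" by (rule dig_add_top[OF A(2,1)])
          have new: "g i J * cheb j (x i) = g (Suc i) (J + j * ?b ^ i)"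
            using low top by (simp add: g_def)
          \<comment> \<open>Entries below \<open>len\<close> are written in the pass
            \<open>j = 0\<close> and read again in later passes. They keep their value since
            \<open>cheb 0\<close> is 1.\<close>
          have old: "g i J * cheb j (x i) = g i (J + j * ?b ^ i)" if "J + j * ?b ^ i < ?b ^ i"
            using low dig_eq_0[OF that] top by simp
          show "runs \<omega> (RSet ''V'' (NConst 0) (gv ''cnt'') (RMul (rvec ''V'' (gv ''J'')) (rvec ''T'' (gv
              ''j'')))) s' 1 (?H (Suc (J + j * ?b ^ i)))"
            using A Tj new old by (intro runs_straight) (auto simp: less_Suc_eq)
        next
          have "?b ^ i \<le> ?b ^ d" using i by (intro power_increasing) auto
          then show "?b * (?b ^ i * (1 + 3) + 4) + 4 \<le> ?Tk" by (intro add_mono mult_left_mono) auto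
        qed (use b4 V len in \<open>auto simp: frame_def\<close>)
        then show "runs \<omega> ?K s4 ?Tk (\<lambda>s''. ?I (Suc i) (nset ''i'' 0 (Suc i) s''))"
          by (rule runs_mono) auto
      qed simp
    qed simp
  qed simp
  have "runs \<omega> ?F s0 (d * ((2 + (R * 3 + 2) + ?Tk) + 2) + 2) (?I d)" if s0: "s0 = nset ''len'' 0 1 (rset
      ''V'' 0 0 1 s)" for s0
  proof (rule runs_For[where m = d and I = ?I and Tb = "2 + (R * 3 + 2) + ?Tk"])
    fix i s' assume A: "i < d" "?I i s'" "nmem s' ''i'' 0 = i" "frame ?F s0 s'"
    from step[OF A(1-3) fF[OF A(4) s0]] show "runs \<omega> (RSet ''T'' (NConst 0) (NConst 0) (rnum 1) ;; RSet
        ''T'' (NConst 0) (NConst 1) (RGet a e (gv ''i'')) ;; ?t ;; ?K) s'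
      (2 + (R * 3 + 2) + ?Tk) (\<lambda>s''. ?I (Suc i) (nset ''i'' 0 (Suc i) s''))" .
  next
    fix s' assume "frame ?F s0 s'"
    from fF[OF this s0] show "nval (gv ''d'') s' = d" using n by (simp add: frame_def)
  qed (auto simp: s0 g_def)
  note F = this
  show ?thesis unfolding features_def Tfeat_def
  proof (rule runs_Seq[where Ta = 1])
    show "runs \<omega> (RSet ''V'' (NConst 0) (NConst 0) (rnum 1)) s 1 (\<lambda>s'. s' = rset ''V'' 0 0 1 s)"
      by (rule runs_straight) auto
    fix s1 assume s1: "s1 = rset ''V'' 0 0 1 s"
    show "runs \<omega> (sv ''len'' (NConst 1) ;; ?F) s1 (1 + (d * ((2 + (R * 3 + 2) + ?Tk) + 2) + 2))
      (\<lambda>s'. \<forall>J<(R + 1) ^ d. rmem s' ''V'' 0 J = (\<Prod>i<d. cheb (dig (R + 1) i J) (x i)))"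
    proof (rule runs_Seq)
      show "runs \<omega> (sv ''len'' (NConst 1)) s1 1 (\<lambda>s'. s' = nset ''len'' 0 1 s1)" by (rule
          runs_straight) auto
      fix s2 assume "s2 = nset ''len'' 0 1 s1"
      then have "s2 = nset ''len'' 0 1 (rset ''V'' 0 0 1 s)" using s1 by simp
      from F[OF this] show "runs \<omega> ?F s2 (d * ((2 + (R * 3 + 2) + ?Tk) + 2) + 2) (\<lambda>s'. \<forall>J<(R
          + 1) ^ d. rmem s' ''V'' 0 J = (\<Prod>i<d. cheb (dig (R + 1) i J) (x i)))"
        by (rule runs_mono) (auto simp: g_def)
    qed simp
  qed simp
qed

section \<open>The program\<close>

definition setup_degree :: com where
  "setup_degree = (RSet ''L'' (NConst 0) (NConst 0) (RSqrt (RLn (RDiv (RDiv (rnum 5) (rnum 4)) (rv ''delta'')))) ;;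
     RSet ''Xr'' (NConst 0) (NConst 0) (RDiv (RMul (rv ''eps'') (ROf (gv ''n''))) (rv ''L'')) ;; sv ''R'' (NConst 0)) ;;
     For ''i'' (gv ''n'')
       (RSet ''rp'' (NConst 0) (NConst 0) (rnum 1) ;;
        For ''j'' (gv ''d'') (RSet ''rp'' (NConst 0) (NConst 0)
          (RMul (rv ''rp'') (RMul (rnum 8) (ROf (NAdd (gv ''i'') (NConst 1)))))) ;;
        Cond (RLess (rv ''Xr'') (rv ''rp'')) Skip (sv ''R'' (NAdd (gv ''i'') (NConst 1)))) ;;
     sv ''b'' (NAdd (gv ''R'') (NConst 1))"

text \<open>Natural numbers can only be added, so \<open>n ^ 4\<close> is built by four rounds of
  repeated addition.\<close>

definition setup_count :: com where
  "setup_count = sv ''Q'' (NConst 1) ;;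
     For ''i'' (NConst 4) (sv ''tmp'' (NConst 0) ;;
        For ''j'' (gv ''n'') (sv ''tmp'' (NAdd (gv ''tmp'') (gv ''Q''))) ;; sv ''Q'' (gv ''tmp'')) ;;
     sv ''Q1'' (NAdd (gv ''Q'') (NConst 1))"

text \<open>The tensor construction of \<open>features\<close>, with the maximum in place of the
  product and 1 as its start value.\<close>

definition setup_weights :: com where
  "setup_weights = (sv ''W'' (NConst 1) ;; sv ''len'' (NConst 1)) ;;
     For ''i'' (gv ''d'') (kron (gv ''b'')
       (Cond (NLess (NGet ''W'' (gv ''J'')) (gv ''j'')) (NSet ''W'' (gv ''cnt'') (gv ''j''))
          (NSet ''W'' (gv ''cnt'') (NGet ''W'' (gv ''J''))))) ;;
     sv ''NJ'' (gv ''len'')"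

definition setup_noise :: com where
  "setup_noise =
     For ''J'' (gv ''NJ'') (RSet ''wk'' (NConst 0) (gv ''J'') (rnum 1) ;;
       For ''a'' (gv ''k'') (RSet ''wk'' (NConst 0) (gv ''J'') (RMul (rvec ''wk'' (gv ''J'')) (ROf (NGet ''W'' (gv
           ''J'')))))) ;;
     For ''J'' (gv ''NJ'') (RSet ''Sg'' (NConst 0) (NConst 0) (RAdd (rv ''Sg'') (RDiv (rnum 1) (rvec ''wk'' (gv
         ''J''))))) ;;
     RSet ''sig'' (NConst 0) (NConst 0)
       (RMul (RDiv (RMul (rnum 8) (rv ''L'')) (RMul (rv ''eps'') (ROf (gv ''n'')))) (RSqrt (rv ''Sg'')))"

definition moments :: com where
  "moments = For ''x'' (gv ''n'') (features ''X'' (gv ''x'') ;;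
     For ''J'' (gv ''NJ'') (RSet ''m'' (NConst 0) (gv ''J'') (RAdd (rvec ''m'' (gv ''J'')) (rvec ''V'' (gv ''J'')))))"

text \<open>Exactly one normal is drawn per moment and none elsewhere, so moment \<open>J\<close> is
  perturbed by tape entry \<open>J\<close>.\<close>

definition perturb :: com where
  "perturb = For ''J'' (gv ''NJ'') (DrawNormal ''g'' (NConst 0) (NConst 0) ;;
     RSet ''m'' (NConst 0) (gv ''J'') (RAdd (RDiv (rvec ''m'' (gv ''J'')) (ROf (gv ''n'')))
       (RMul (RMul (rv ''sig'') (RSqrt (rvec ''wk'' (gv ''J'')))) (rv ''g''))))"

definition grid :: com where
  "grid = sv ''len'' (NConst 1) ;;
     For ''i'' (gv ''d'') (kron (gv ''Q1'')
       (For ''a'' (gv ''i'') (RSet ''P'' (gv ''cnt'') (gv ''a'') (RGet ''P'' (gv ''J'') (gv ''a''))) ;;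
        RSet ''P'' (gv ''cnt'') (gv ''i'')
          (RAdd (RSub (rnum 0) (rnum 1)) (RDiv (RMul (rnum 2) (ROf (gv ''j''))) (ROf (gv ''Q'')))))) ;;
     sv ''NC'' (gv ''len'')"

definition grid_features :: com where
  "grid_features = For ''c'' (gv ''NC'') (features ''P'' (gv ''c'') ;;
     For ''J'' (gv ''NJ'') (RSet ''Ph'' (gv ''c'') (gv ''J'') (rvec ''V'' (gv ''J''))))"

definition scores :: com where
  "scores = For ''c'' (gv ''NC'') (RSet ''sc'' (NConst 0) (gv ''c'') (rnum 0) ;;
     For ''J'' (gv ''NJ'') (RSet ''sc'' (NConst 0) (gv ''c'') (RAdd (rvec ''sc'' (gv ''c''))
       (RMul (RMul (RDiv (rnum 1) (RMul (rvec ''wk'' (gv ''J'')) (rvec ''wk'' (gv ''J'')))) (rvec ''S'' (gv ''J'')))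
          (RGet ''Ph'' (gv ''c'') (gv ''J''))))))"

definition select :: com where
  "select = sv ''best'' (NConst 0) ;;
     For ''c'' (gv ''NC'') (Cond (RLess (rvec ''sc'' (gv ''c'')) (rvec ''sc'' (gv ''best''))) (sv ''best'' (gv
         ''c'')) Skip)"

definition emit :: com where
  "emit = For ''J'' (gv ''NJ'') (RSet ''S'' (NConst 0) (gv ''J'') (RAdd (rvec ''S'' (gv ''J''))
       (RSub (RGet ''Ph'' (gv ''best'') (gv ''J'')) (rvec ''m'' (gv ''J''))))) ;;
     For ''i'' (gv ''d'') (RSet ''Y'' (gv ''t'') (gv ''i'') (RGet ''P'' (gv ''best'') (gv ''i'')))"

definition herd :: com where
  "herd = For ''t'' (gv ''Q'') (scores ;; select ;; emit)"

text \<open>The arrays \<open>''m''\<close>, \<open>''S''\<close> and \<open>''Sg''\<close> are never initialized: memory starts at \<open>0\<close>.\<close>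

definition synth_program :: com where
  "synth_program = setup_degree ;; setup_count ;; setup_weights ;; setup_noise ;; moments ;; perturb ;;
     grid ;; grid_features ;; herd ;; sv ''N'' (gv ''Q'')"

lemmas block_defs = setup_degree_def setup_count_def setup_weights_def setup_noise_def moments_def
  perturb_def grid_def grid_features_def scores_def select_def emit_def herd_def

section \<open>Correctness and running time of the blocks\<close>

context synth
begin

text \<open>The time bounds copy the nesting of the program text, so that the side conditions of
  \<open>runs_Seq\<close> and \<open>runs_For\<close> close by simplification.\<close>

definition "Tdeg = 3 + (n * ((1 + ((d * 3 + 2) + 3)) + 2) + 2 + 1)"
definition "Tcnt = 1 + ((4 * ((1 + ((n * 3 + 2) + 1)) + 2) + 2) + 1)"
definition "Twts = 2 + ((d * ((bb * (NJ * 6 + 4) + 4) + 2) + 2) + 1)"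
definition "Tnoi = (NJ * ((1 + (k * 3 + 2)) + 2) + 2) + ((NJ * 3 + 2) + 1)"
definition "Tmom = n * ((Tfeat d R + (NJ * 3 + 2)) + 2) + 2"
definition "Tper = NJ * (2 + 2) + 2"
definition "Tgrd = 1 + ((d * (((Q + 1) * (NC * (((d * 3 + 2) + 1) + 3) + 4) + 4) + 2) + 2) + 1)"
definition "Tgft = NC * ((Tfeat d R + (NJ * 3 + 2)) + 2) + 2"
definition "Tscr = NC * ((1 + (NJ * 3 + 2)) + 2) + 2"
definition "Tsel = 1 + (NC * (3 + 2) + 2)"
definition "Temi = (NJ * 3 + 2) + (d * 3 + 2)"
definition "Therd = Q * ((Tscr + (Tsel + Temi)) + 2) + 2"

lemma runs_setup_degree:
  assumes s: "nmem s ''n'' 0 = n" "nmem s ''d'' 0 = d" "rmem s ''eps'' 0 0 = eps" "rmem s ''delta'' 0 0 = del"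
  shows "runs \<omega> setup_degree s Tdeg (\<lambda>s'. rmem s' ''L'' 0 0 = Lg \<and> nmem s' ''R'' 0 = R \<and>
      nmem s' ''b'' 0 = bb)"
  unfolding setup_degree_def Tdeg_def
proof (rule runs_Seq[OF runs_result])
  let ?c = "RSet ''L'' (NConst 0) (NConst 0) (RSqrt (RLn (RDiv (RDiv (rnum 5) (rnum 4)) (rv ''delta'')))) ;;
     RSet ''Xr'' (NConst 0) (NConst 0) (RDiv (RMul (rv ''eps'') (ROf (gv ''n''))) (rv ''L'')) ;; sv ''R'' (NConst 0)"
  let ?p = "For ''j'' (gv ''d'') (RSet ''rp'' (NConst 0) (NConst 0)
          (RMul (rv ''rp'') (RMul (rnum 8) (ROf (NAdd (gv ''i'') (NConst 1))))))"
  let ?q = "Cond (RLess (rv ''Xr'') (rv ''rp'')) Skip (sv ''R'' (NAdd (gv ''i'') (NConst 1)))"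
  let ?r = "RSet ''rp'' (NConst 0) (NConst 0) (rnum 1)"
  let ?P = "\<lambda>r. (8 * real (Suc r)) ^ d \<le> Xr"
  fix s1 assume "s1 = result \<omega> ?c s"
  then have s1: "rmem s1 ''L'' 0 0 = Lg" "rmem s1 ''Xr'' 0 0 = Xr" "nmem s1 ''R'' 0 = 0" "nmem s1 ''n'' 0 = n"
      "nmem s1 ''d'' 0 = d"
    using s by (auto simp: Lg_def Xr_def)
  show "runs \<omega> (For ''i'' (gv ''n'') (?r ;; ?p ;; ?q) ;; sv ''b'' (NAdd (gv ''R'') (NConst 1))) s1
    (n * ((1 + ((d * 3 + 2) + 3)) + 2) + 2 + 1) (\<lambda>s'. rmem s' ''L'' 0 0 = Lg \<and> nmem s' ''R'' 0 = R
        \<and> nmem s' ''b'' 0 = bb)"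
  proof (rule runs_Seq)
    show "runs \<omega> (For ''i'' (gv ''n'') (?r ;; ?p ;; ?q)) s1 (n * ((1 + ((d * 3 + 2) + 3)) + 2) + 2)
        (\<lambda>s'. nmem s' ''R'' 0 = rsel ?P n)"
    proof (rule runs_For[where m = n and I = "\<lambda>i s'. nmem s' ''R'' 0 = rsel ?P i"])
      fix i s2 assume A: "i < n" "nmem s2 ''R'' 0 = rsel ?P i" "nmem s2 ''i'' 0 = i" "frame (For ''i'' (gv ''n'')
          (?r ;; ?p ;; ?q)) s1 s2"
      have f2: "nmem s2 ''d'' 0 = d" "rmem s2 ''Xr'' 0 0 = Xr" using A(4) s1 by (auto simp: frame_def)
      show "runs \<omega> (?r ;; ?p ;; ?q) s2 (1 + ((d * 3 + 2) + 3)) (\<lambda>s'. nmem (nset ''i'' 0 (Suc i) s')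
          ''R'' 0 = rsel ?P (Suc i))"
      proof (rule runs_Seq[OF runs_result])
        fix s3 assume s3: "s3 = result \<omega> ?r s2"
        have p: "runs \<omega> ?p s3 (d * 3 + 2) (\<lambda>s'. rmem s' ''rp'' 0 0 = (8 * real (Suc i)) ^ d)"
        proof (rule runs_For[where Tb = 1 and m = d and I = "\<lambda>j s'. rmem s' ''rp'' 0 0 = (8 * real (Suc i))
            ^ j"])
          fix j s' assume B: "rmem s' ''rp'' 0 0 = (8 * real (Suc i)) ^ j" "frame ?p s3 s'"
          have "nmem s' ''i'' 0 = i" using B(2) A(3) by (simp add: s3 frame_def)
          then show "runs \<omega> (RSet ''rp'' (NConst 0) (NConst 0) (RMul (rv ''rp'') (RMul (rnum 8) (ROf (NAdd
              (gv ''i'') (NConst 1)))))) s' 1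
             (\<lambda>s''. rmem (nset ''j'' 0 (Suc j) s'') ''rp'' 0 0 = (8 * real (Suc i)) ^ Suc j)"
            using B(1) by (intro runs_straight) (auto simp: algebra_simps)
        qed (use f2 in \<open>auto simp: s3 frame_def\<close>)
        show "runs \<omega> (?p ;; ?q) s3 ((d * 3 + 2) + 3) (\<lambda>s'. nmem (nset ''i'' 0 (Suc i) s') ''R'' 0 =
            rsel ?P (Suc i))"
        proof (rule runs_Seq[OF p])
          fix s4 assume B: "rmem s4 ''rp'' 0 0 = (8 * real (Suc i)) ^ d" "frame ?p s3 s4"
          have "nmem s4 ''i'' 0 = i" "rmem s4 ''Xr'' 0 0 = Xr" "nmem s4 ''R'' 0 = rsel ?P i"
            using B(2) A f2 by (simp_all add: s3 frame_def)
          then show "runs \<omega> ?q s4 3 (\<lambda>s'. nmem (nset ''i'' 0 (Suc i) s') ''R'' 0 = rsel ?P (Suc i))"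
            using B(1) by (intro runs_straight) (auto simp: not_less)
        qed simp
      qed auto
    qed (use s1 in \<open>auto simp: frame_def\<close>)
  next
    fix s2 assume A: "nmem s2 ''R'' 0 = rsel ?P n" "frame (For ''i'' (gv ''n'') (?r ;; ?p ;; ?q)) s1 s2"
    have "rmem s2 ''L'' 0 0 = Lg" using A(2) s1 by (simp add: frame_def)
    then show "runs \<omega> (sv ''b'' (NAdd (gv ''R'') (NConst 1))) s2 1
       (\<lambda>s'. rmem s' ''L'' 0 0 = Lg \<and> nmem s' ''R'' 0 = R \<and> nmem s' ''b'' 0 = bb)"
      using A(1) by (intro runs_straight) (auto simp: R_def bb_def)
  qed simp
qed auto

lemma runs_setup_count:
  assumes s: "nmem s ''n'' 0 = n"
  shows "runs \<omega> setup_count s Tcnt (\<lambda>s'. nmem s' ''Q'' 0 = Q \<and> nmem s' ''Q1'' 0 = Q + 1)"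
  unfolding setup_count_def Tcnt_def
proof (rule runs_Seq)
  let ?p = "For ''j'' (gv ''n'') (sv ''tmp'' (NAdd (gv ''tmp'') (gv ''Q'')))"
  show "runs \<omega> (sv ''Q'' (NConst 1)) s 1 (\<lambda>s'. s' = nset ''Q'' 0 1 s)" by (rule runs_straight) auto
  fix s1 assume s1: "s1 = nset ''Q'' 0 1 s"
  show "runs \<omega> (For ''i'' (NConst 4) (sv ''tmp'' (NConst 0) ;; ?p ;; sv ''Q'' (gv ''tmp'')) ;; sv ''Q1''
      (NAdd (gv ''Q'') (NConst 1))) s1
    ((4 * ((1 + ((n * 3 + 2) + 1)) + 2) + 2) + 1) (\<lambda>s'. nmem s' ''Q'' 0 = Q \<and> nmem s' ''Q1'' 0 = Q + 1)"
  proof (rule runs_Seq)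
    show "runs \<omega> (For ''i'' (NConst 4) (sv ''tmp'' (NConst 0) ;; ?p ;; sv ''Q'' (gv ''tmp''))) s1
      (4 * ((1 + ((n * 3 + 2) + 1)) + 2) + 2) (\<lambda>s'. nmem s' ''Q'' 0 = n ^ 4)"
    proof (rule runs_For[where m = 4 and I = "\<lambda>i s'. nmem s' ''Q'' 0 = n ^ i"])
      fix i s2 assume A: "nmem s2 ''Q'' 0 = n ^ i" "frame (For ''i'' (NConst 4) (sv ''tmp'' (NConst 0) ;; ?p ;; sv
          ''Q'' (gv ''tmp''))) s1 s2"
      have n2: "nmem s2 ''n'' 0 = n" using A(2) s by (simp add: frame_def s1)
      show "runs \<omega> (sv ''tmp'' (NConst 0) ;; ?p ;; sv ''Q'' (gv ''tmp'')) s2 (1 + ((n * 3 + 2) + 1))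
         (\<lambda>s'. nmem (nset ''i'' 0 (Suc i) s') ''Q'' 0 = n ^ Suc i)"
      proof (rule runs_Seq)
        show "runs \<omega> (sv ''tmp'' (NConst 0)) s2 1 (\<lambda>s'. s' = nset ''tmp'' 0 0 s2)" by (rule
            runs_straight) auto
        fix s3 assume s3: "s3 = nset ''tmp'' 0 0 s2"
        have "runs \<omega> ?p s3 (n * 3 + 2) (\<lambda>s'. nmem s' ''tmp'' 0 = n * n ^ i)"
        proof (rule runs_For[where Tb = 1 and m = n and I = "\<lambda>j s'. nmem s' ''tmp'' 0 = j * n ^ i"])
          fix j s' assume B: "nmem s' ''tmp'' 0 = j * n ^ i" "frame ?p s3 s'"
          have "nmem s' ''Q'' 0 = n ^ i" using B(2) A(1) by (simp add: frame_def s3)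
          then show "runs \<omega> (sv ''tmp'' (NAdd (gv ''tmp'') (gv ''Q''))) s' 1 (\<lambda>s''. nmem (nset ''j''
              0 (Suc j) s'') ''tmp'' 0 = Suc j * n ^ i)"
            using B(1) by (intro runs_straight) auto
        qed (use n2 in \<open>auto simp: frame_def s3\<close>)
        then show "runs \<omega> (?p ;; sv ''Q'' (gv ''tmp'')) s3 ((n * 3 + 2) + 1) (\<lambda>s'. nmem (nset ''i''
            0 (Suc i) s') ''Q'' 0 = n ^ Suc i)"
          by (rule runs_Seq) (auto intro!: runs_straight)
      qed auto
    qed (auto simp: s1)
  next
    fix s2 :: state assume "nmem s2 ''Q'' 0 = n ^ 4"
    then show "runs \<omega> (sv ''Q1'' (NAdd (gv ''Q'') (NConst 1))) s2 1 (\<lambda>s'. nmem s' ''Q'' 0 = Q \<and>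
        nmem s' ''Q1'' 0 = Q + 1)"
      by (intro runs_straight) (auto simp: Q_def)
  qed simp
qed auto

lemma runs_setup_weights:
  assumes s: "nmem s ''d'' 0 = d" "nmem s ''b'' 0 = bb"
  shows "runs \<omega> setup_weights s Twts (\<lambda>s'. (\<forall>J<NJ. nmem s' ''W'' J = wt J) \<and> nmem s'
      ''NJ'' 0 = NJ)"
  unfolding setup_weights_def Twts_def
proof (rule runs_Seq[OF runs_result])
  let ?body = "Cond (NLess (NGet ''W'' (gv ''J'')) (gv ''j'')) (NSet ''W'' (gv ''cnt'') (gv ''j''))
          (NSet ''W'' (gv ''cnt'') (NGet ''W'' (gv ''J'')))"
  let ?K = "kron (gv ''b'') ?body"
  let ?I = "\<lambda>i (s'::state). nmem s' ''len'' 0 = bb ^ i \<and> (\<forall>J<bb ^ i. nmem s' ''W'' J = wtr bb J i)"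
  fix s1 assume s1: "s1 = result \<omega> (sv ''W'' (NConst 1) ;; sv ''len'' (NConst 1)) s"
  show "runs \<omega> (For ''i'' (gv ''d'') ?K ;; sv ''NJ'' (gv ''len'')) s1 ((d * ((bb * (NJ * 6 + 4) + 4) + 2) +
      2) + 1)
    (\<lambda>s'. (\<forall>J<NJ. nmem s' ''W'' J = wt J) \<and> nmem s' ''NJ'' 0 = NJ)"
  proof (rule runs_Seq)
    show "runs \<omega> (For ''i'' (gv ''d'') ?K) s1 (d * ((bb * (NJ * 6 + 4) + 4) + 2) + 2) (?I d)"
    proof (rule runs_For[where m = d and I = ?I])
      fix i s2 assume A: "i < d" "?I i s2" "nmem s2 ''i'' 0 = i" "frame (For ''i'' (gv ''d'') ?K) s1 s2"
      let ?H = "\<lambda>c (s'::state). (\<forall>J<bb ^ i. nmem s' ''W'' J = wtr bb J i) \<and> (\<forall>J<c.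
          nmem s' ''W'' J = wtr bb J (Suc i))"
      have b2: "nmem s2 ''b'' 0 = bb" using A(4) s by (simp add: frame_def s1)
      have "runs \<omega> ?K s2 (bb * (NJ * 6 + 4) + 4) (\<lambda>s'. ?H (bb * bb ^ i) s' \<and> nmem s' ''len'' 0
          = bb * bb ^ i)"
      proof (rule runs_kron[where Tb = 3 and I = ?H])
        fix j J s' assume B: "j < bb" "J < bb ^ i" "?H (J + j * bb ^ i) s'" "nmem s' ''cnt'' 0 = J + j * bb ^ i"
            "nmem s' ''j'' 0 = j" "nmem s' ''J'' 0 = J"
        have low: "wtr bb (J + j * bb ^ i) l = wtr bb J l" if "l \<le> i" for l
          using that by (induction l) (auto simp: dig_add_low)
        have top: "dig bb i (J + j * bb ^ i) = j" by (rule dig_add_top[OF B(2,1)])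
        have new: "max (wtr bb J i) j = wtr bb (J + j * bb ^ i) (Suc i)" using low top by simp
        \<comment> \<open>The overwriting pass \<open>j = 0\<close> takes a maximum with 0 and
          therefore leaves the entries as they are.\<close>
        have old: "max (wtr bb J i) j = wtr bb (J + j * bb ^ i) i" if "J + j * bb ^ i < bb ^ i"
          using low[OF order_refl] dig_eq_0[OF that] top by simp
        have "?H (Suc (J + j * bb ^ i)) (nset ''W'' (J + j * bb ^ i) (max (wtr bb J i) j) s')"
          using B(3) new old by (auto simp: less_Suc_eq)
        moreover have "result \<omega> ?body s' = nset ''W'' (J + j * bb ^ i) (max (wtr bb J i) j) s'"
          using B by (auto simp: max_def)
        ultimately show "runs \<omega> ?body s' 3 (?H (Suc (J + j * bb ^ i)))"
          by (intro runs_straight) (simp_all del: result.simps)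
      next
        have "bb ^ i \<le> NJ" unfolding NJ_def using A(1) by (intro power_increasing) (auto simp: bb_def)
        then show "bb * (bb ^ i * (3 + 3) + 4) + 4 \<le> bb * (NJ * 6 + 4) + 4" by (intro add_mono mult_left_mono) auto
      next
        fix c and s3 s4 :: state assume "?H c s3" "\<And>a. a \<notin> {''cnt'', ''j'', ''J'', ''len''}
            \<Longrightarrow> nmem s4 a = nmem s3 a" "rmem s4 = rmem s3"
        then show "?H c s4" by simp
      qed (use b2 A(2) in \<open>auto simp: frame_def\<close>)
      then show "runs \<omega> ?K s2 (bb * (NJ * 6 + 4) + 4) (\<lambda>s'. ?I (Suc i) (nset ''i'' 0 (Suc i) s'))"
        by (rule runs_mono) auto
    qed (use s in \<open>auto simp: s1 frame_def\<close>)
  next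
    fix s2 assume "?I d s2"
    then show "runs \<omega> (sv ''NJ'' (gv ''len'')) s2 1 (\<lambda>s'. (\<forall>J<NJ. nmem s' ''W'' J = wt J)
        \<and> nmem s' ''NJ'' 0 = NJ)"
      by (intro runs_straight) (auto simp: NJ_def wt_def)
  qed simp
qed (auto simp: algebra_simps)

lemma runs_setup_noise:
  assumes s: "nmem s ''NJ'' 0 = NJ" "nmem s ''k'' 0 = k" "nmem s ''n'' 0 = n" "rmem s ''L'' 0 0 = Lg" "rmem s
      ''eps'' 0 0 = eps"
    "rmem s ''Sg'' 0 0 = 0" and W: "\<forall>J<NJ. nmem s ''W'' J = wt J"
  shows "runs \<omega> setup_noise s Tnoi (\<lambda>s'. (\<forall>J<NJ. rmem s' ''wk'' 0 J = wk J) \<and> rmem s'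
      ''sig'' 0 0 = sig)"
  unfolding setup_noise_def Tnoi_def
proof (rule runs_Seq)
  let ?r = "RSet ''wk'' (NConst 0) (gv ''J'') (rnum 1)"
  let ?p = "For ''a'' (gv ''k'') (RSet ''wk'' (NConst 0) (gv ''J'') (RMul (rvec ''wk'' (gv ''J'')) (ROf (NGet ''W''
      (gv ''J'')))))"
  let ?w = "For ''J'' (gv ''NJ'') (?r ;; ?p)"
  let ?I = "\<lambda>j (s'::state). \<forall>J<j. rmem s' ''wk'' 0 J = wk J"
  show "runs \<omega> ?w s (NJ * ((1 + (k * 3 + 2)) + 2) + 2) (?I NJ)"
  proof (rule runs_For[where m = NJ and I = ?I])
    fix J s1 assume A: "J < NJ" "?I J s1" "nmem s1 ''J'' 0 = J" "frame ?w s s1"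
    have f1: "nmem s1 ''W'' J = wt J" "nmem s1 ''k'' 0 = k" using A(1,4) s W by (auto simp: frame_def)
    show "runs \<omega> (?r ;; ?p) s1 (1 + (k * 3 + 2)) (\<lambda>s'. ?I (Suc J) (nset ''J'' 0 (Suc J) s'))"
    proof (rule runs_Seq[OF runs_result])
      fix s2 assume s2: "s2 = result \<omega> ?r s1"
      let ?H = "\<lambda>a (s'::state). (\<forall>I<J. rmem s' ''wk'' 0 I = wk I) \<and> rmem s' ''wk'' 0 J = real
          (wt J) ^ a"
      have "runs \<omega> ?p s2 (k * 3 + 2) (?H k)"
      proof (rule runs_For[where Tb = 1 and m = k and I = ?H])
        fix a s' assume B: "?H a s'" "frame ?p s2 s'"
        have "nmem s' ''J'' 0 = J" "nmem s' ''W'' J = wt J" using B(2) f1 A(3) by (simp_all add: frame_def s2)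
        then show "runs \<omega> (RSet ''wk'' (NConst 0) (gv ''J'') (RMul (rvec ''wk'' (gv ''J'')) (ROf (NGet ''W''
            (gv ''J''))))) s' 1
          (\<lambda>s''. ?H (Suc a) (nset ''a'' 0 (Suc a) s''))"
          using B(1) by (intro runs_straight) auto
      qed (use A f1 in \<open>auto simp: s2 frame_def\<close>)
      then show "runs \<omega> ?p s2 (k * 3 + 2) (\<lambda>s'. ?I (Suc J) (nset ''J'' 0 (Suc J) s'))"
        by (rule runs_mono) (auto simp: less_Suc_eq wk_def)
    qed auto
  qed (use s in \<open>auto simp: frame_def\<close>)
  fix s1 assume A: "?I NJ s1" "frame ?w s s1"
  have f1: "nmem s1 ''NJ'' 0 = NJ" "nmem s1 ''n'' 0 = n" "rmem s1 ''L'' 0 0 = Lg" "rmem s1 ''eps'' 0 0 = eps" "rmem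
      s1 ''Sg'' 0 0 = 0"
    using A(2) s by (simp_all add: frame_def)
  let ?g = "For ''J'' (gv ''NJ'') (RSet ''Sg'' (NConst 0) (NConst 0) (RAdd (rv ''Sg'') (RDiv (rnum 1) (rvec ''wk''
      (gv ''J'')))))"
  let ?z = "RSet ''sig'' (NConst 0) (NConst 0)
       (RMul (RDiv (RMul (rnum 8) (rv ''L'')) (RMul (rv ''eps'') (ROf (gv ''n'')))) (RSqrt (rv ''Sg'')))"
  show "runs \<omega> (?g ;; ?z) s1 ((NJ * 3 + 2) + 1) (\<lambda>s'. (\<forall>J<NJ. rmem s' ''wk'' 0 J = wk J)
      \<and> rmem s' ''sig'' 0 0 = sig)"
  proof (rule runs_Seq[OF runs_accum[where m = NJ and f = "\<lambda>J. 1 / wk J" and q = 0 and q' = 0]])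
    fix s2 assume B: "rmem s2 ''Sg'' 0 0 = rmem s1 ''Sg'' 0 0 + (\<Sum>J<NJ. 1 / wk J) \<and>
       (\<forall>i j. \<not> (i = 0 \<and> j = 0) \<longrightarrow> rmem s2 ''Sg'' i j = rmem s1 ''Sg'' i j)"
           "frame ?g s1 s2"
    have "rmem s2 ''Sg'' 0 0 = Sg" using B(1) f1 by (simp add: Sg_def)
    moreover have "rmem s2 ''L'' 0 0 = Lg" "rmem s2 ''eps'' 0 0 = eps" "nmem s2 ''n'' 0 = n" "rmem s2 ''wk'' = rmem
        s1 ''wk''"
      using B(2) f1 by (simp_all add: frame_def)
    ultimately show "runs \<omega> ?z s2 1 (\<lambda>s'. (\<forall>J<NJ. rmem s' ''wk'' 0 J = wk J) \<and> rmem s'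
        ''sig'' 0 0 = sig)"
      using A(1) by (intro runs_straight) (auto simp: sig_def)
  qed (use A f1 in \<open>auto simp: frame_def\<close>)
qed auto

lemma runs_moments:
  assumes s: "nmem s ''n'' 0 = n" "nmem s ''d'' 0 = d" "nmem s ''R'' 0 = R" "nmem s ''b'' 0 = bb" "nmem s ''NJ'' 0 = NJ"
    and X: "\<forall>x<n. \<forall>i<d. rmem s ''X'' x i = (X ! x) i" and m: "\<forall>J<NJ. rmem s ''m'' 0 J = 0"
  shows "runs \<omega> moments s Tmom (\<lambda>s'. \<forall>J<NJ. rmem s' ''m'' 0 J = (\<Sum>x<n. feat (X ! x) J))"
  unfolding moments_def Tmom_def
proof (rule runs_For[where m = n and I = "\<lambda>x s'. \<forall>J<NJ. rmem s' ''m'' 0 J = (\<Sum>x<x. feat (X !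
    x) J)"])
  let ?a = "For ''J'' (gv ''NJ'') (RSet ''m'' (NConst 0) (gv ''J'') (RAdd (rvec ''m'' (gv ''J'')) (rvec ''V'' (gv
      ''J''))))"
  fix x s1 assume A: "x < n" "\<forall>J<NJ. rmem s1 ''m'' 0 J = (\<Sum>x<x. feat (X ! x) J)" "nmem s1 ''x'' 0 = x"
    "frame (For ''x'' (gv ''n'') (features ''X'' (gv ''x'') ;; ?a)) s s1"
  have f1: "nmem s1 ''d'' 0 = d" "nmem s1 ''R'' 0 = R" "nmem s1 ''b'' 0 = R + 1" "nmem s1 ''NJ'' 0 = NJ"
    "\<And>i. i < d \<Longrightarrow> rmem s1 ''X'' x i = (X ! x) i"
    using A(1,4) s X by (auto simp: frame_def bb_def)
  have feat: "runs \<omega> (features ''X'' (gv ''x'')) s1 (Tfeat d R)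
     (\<lambda>s'. \<forall>J<(R + 1) ^ d. rmem s' ''V'' 0 J = (\<Prod>i<d. cheb (dig (R + 1) i J) ((X ! x) i)))"
    by (rule runs_features[OF f1(1-3)]) (use A(3) f1 in \<open>auto simp: frame_def\<close>)
  show "runs \<omega> (features ''X'' (gv ''x'') ;; ?a) s1 (Tfeat d R + (NJ * 3 + 2))
     (\<lambda>s'. \<forall>J<NJ. rmem (nset ''x'' 0 (Suc x) s') ''m'' 0 J = (\<Sum>x<Suc x. feat (X ! x) J))"
  proof (rule runs_Seq[OF feat])
    fix s2 assume B: "\<forall>J<(R + 1) ^ d. rmem s2 ''V'' 0 J = (\<Prod>i<d. cheb (dig (R + 1) i J) ((X ! x) i))"
      "frame (features ''X'' (gv ''x'')) s1 s2"
    have V: "rmem s2 ''V'' 0 J = feat (X ! x) J" if "J < NJ" for J using B(1) that by (simp add: feat_def bb_def NJ_def)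
    have f2: "nmem s2 ''NJ'' 0 = NJ" "rmem s2 ''m'' = rmem s1 ''m''" using B(2) f1 by (simp_all add: frame_def)
    have "runs \<omega> ?a s2 (NJ * 3 + 2) (\<lambda>s'. (\<forall>J<NJ. rmem s' ''m'' 0 J = (\<Sum>x<x. feat (X !
        x) J) + feat (X ! x) J) \<and>
      (\<forall>q' i. q' \<noteq> 0 \<longrightarrow> rmem s' ''m'' q' i = rmem s2 ''m'' q' i))"
      by (rule runs_fill) (use f2 V A(2) in \<open>auto simp: frame_def\<close>)
    then show "runs \<omega> ?a s2 (NJ * 3 + 2) (\<lambda>s'. \<forall>J<NJ. rmem (nset ''x'' 0 (Suc x) s') ''m'' 0
        J = (\<Sum>x<Suc x. feat (X ! x) J))"
      by (rule runs_mono) auto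
  qed simp
qed (use s m in \<open>auto simp: frame_def\<close>)

lemma runs_perturb:
  assumes s: "nmem s ''n'' 0 = n" "nmem s ''NJ'' 0 = NJ" "rmem s ''sig'' 0 0 = sig" "draws s = 0"
    and wk: "\<forall>J<NJ. rmem s ''wk'' 0 J = wk J" and m: "\<forall>J<NJ. rmem s ''m'' 0 J = (\<Sum>x<n. feat (X
        ! x) J)"
    and X: "length X = n"
  shows "runs \<omega> perturb s Tper (\<lambda>s'. \<forall>J<NJ. rmem s' ''m'' 0 J = noisy X (\<lambda>J. snd
      (\<omega> J)) J)"
  unfolding perturb_def Tper_def
\<comment> \<open>The draw counter belongs to the invariant: it identifies the noise of moment
  \<open>j\<close> with tape entry \<open>j\<close>. Entries from \<open>j\<close> on still hold the
  raw sums.\<close>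
proof (rule runs_mono[OF runs_For[where m = NJ and Tb = 2 and T = "NJ * (2 + 2) + 2" and I = "\<lambda>j s'. draws
    s' = j \<and>
    (\<forall>J<j. rmem s' ''m'' 0 J = noisy X (\<lambda>J. snd (\<omega> J)) J) \<and> (\<forall>J\<ge>j. rmem s'
        ''m'' 0 J = rmem s ''m'' 0 J)"]])
  let ?c = "DrawNormal ''g'' (NConst 0) (NConst 0) ;;
     RSet ''m'' (NConst 0) (gv ''J'') (RAdd (RDiv (rvec ''m'' (gv ''J'')) (ROf (gv ''n'')))
       (RMul (RMul (rv ''sig'') (RSqrt (rvec ''wk'' (gv ''J'')))) (rv ''g'')))"
  let ?I = "\<lambda>j (s'::state). draws s' = j \<and>
    (\<forall>J<j. rmem s' ''m'' 0 J = noisy X (\<lambda>J. snd (\<omega> J)) J) \<and> (\<forall>J\<ge>j. rmem s'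
        ''m'' 0 J = rmem s ''m'' 0 J)"
  fix j s' assume A: "j < NJ" "?I j s'" "nmem s' ''J'' 0 = j" "frame (For ''J'' (gv ''NJ'') ?c) s s'"
  have "rmem s' ''sig'' 0 0 = sig" "rmem s' ''wk'' 0 j = wk j" "nmem s' ''n'' 0 = n" "rmem s' ''m'' 0 j =
      (\<Sum>x<n. feat (X ! x) j)"
    using A s wk m by (auto simp: frame_def)
  moreover have "noisy X (\<lambda>J. snd (\<omega> J)) j = (\<Sum>x<n. feat (X ! x) j) / real n + sig * sqrt (wk
      j) * snd (\<omega> j)"
    by (simp add: noisy_def mom_def avg_def X)
  ultimately show "runs \<omega> ?c s' 2 (\<lambda>s''. ?I (Suc j) (nset ''J'' 0 (Suc j) s''))"
    using A(1-3) by (intro runs_straight) (auto simp: less_Suc_eq)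
qed (use s in \<open>auto simp: frame_def\<close>)

end

context synth
begin

lemma runs_grid:
  assumes s: "nmem s ''d'' 0 = d" "nmem s ''Q'' 0 = Q" "nmem s ''Q1'' 0 = Q + 1"
  shows "runs \<omega> grid s Tgrd (\<lambda>s'. (\<forall>c<NC. \<forall>i<d. rmem s' ''P'' c i = pt c i) \<and>
      nmem s' ''NC'' 0 = NC)"
  unfolding grid_def Tgrd_def
proof (rule runs_Seq[OF runs_result])
  define B where "B = Q + 1"
  define co where "co i c = - 1 + 2 * real (dig B i c) / real Q" for i c
  let ?cp = "For ''a'' (gv ''i'') (RSet ''P'' (gv ''cnt'') (gv ''a'') (RGet ''P'' (gv ''J'') (gv ''a'')))"
  let ?st = "RSet ''P'' (gv ''cnt'') (gv ''i'')
          (RAdd (RSub (rnum 0) (rnum 1)) (RDiv (RMul (rnum 2) (ROf (gv ''j''))) (ROf (gv ''Q''))))"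
  let ?K = "kron (gv ''Q1'') (?cp ;; ?st)"
  let ?Tk = "(Q + 1) * (NC * (((d * 3 + 2) + 1) + 3) + 4) + 4"
  let ?I = "\<lambda>i (s'::state). nmem s' ''len'' 0 = B ^ i \<and> (\<forall>J<B ^ i. \<forall>a<i. rmem s' ''P''
      J a = co a J)"
  fix s1 assume s1: "s1 = result \<omega> (sv ''len'' (NConst 1)) s"
  show "runs \<omega> (For ''i'' (gv ''d'') ?K ;; sv ''NC'' (gv ''len'')) s1 ((d * (?Tk + 2) + 2) + 1)
    (\<lambda>s'. (\<forall>c<NC. \<forall>i<d. rmem s' ''P'' c i = pt c i) \<and> nmem s' ''NC'' 0 = NC)"
  proof (rule runs_Seq)
    show "runs \<omega> (For ''i'' (gv ''d'') ?K) s1 (d * (?Tk + 2) + 2) (?I d)"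
    proof (rule runs_For[where m = d and I = ?I])
      fix i s2 assume A: "i < d" "?I i s2" "nmem s2 ''i'' 0 = i" "frame (For ''i'' (gv ''d'') ?K) s1 s2"
      let ?H = "\<lambda>c (s'::state). (\<forall>J<B ^ i. \<forall>a<i. rmem s' ''P'' J a = co a J) \<and>
          (\<forall>J<c. \<forall>a<Suc i. rmem s' ''P'' J a = co a J)"
      have b2: "nmem s2 ''Q1'' 0 = B" "nmem s2 ''Q'' 0 = Q" using A(4) s by (simp_all add: frame_def s1 B_def)
      have "runs \<omega> ?K s2 ?Tk (\<lambda>s'. ?H (B * B ^ i) s' \<and> nmem s' ''len'' 0 = B * B ^ i)"
      proof (rule runs_kron[where Tb = "(d * 3 + 2) + 1" and I = ?H])
        fix j J s' assume C: "j < B" "J < B ^ i" "?H (J + j * B ^ i) s'" "frame (kloop (gv ''Q1'') (?cp ;; ?st)) s2 s'"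
            "nmem s' ''cnt'' 0 = J + j * B ^ i" "nmem s' ''j'' 0 = j" "nmem s' ''J'' 0 = J"
        let ?c = "J + j * B ^ i"
        have i': "nmem s' ''i'' 0 = i" "nmem s' ''Q'' 0 = Q" using C(4) A(3) b2 by (simp_all add: frame_def)
        have low: "co a ?c = co a J" if "a < i" for a using that by (simp add: co_def dig_add_low)
        have top: "co i ?c = - 1 + 2 * real j / real Q" unfolding co_def by (simp only: dig_add_top[OF C(2,1)])
        have Pl: "rmem s' ''P'' J a = co a ?c" if "a < i" for a using C(2,3) that low by simp
        show "runs \<omega> (?cp ;; ?st) s' ((d * 3 + 2) + 1) (?H (Suc ?c))"
        proof (rule runs_Seq)
          show "runs \<omega> ?cp s' (d * 3 + 2) (\<lambda>s''. (\<forall>a<i. rmem s'' ''P'' ?c a = co a ?c) \<and>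
             (\<forall>q' a. q' \<noteq> ?c \<longrightarrow> rmem s'' ''P'' q' a = rmem s' ''P'' q' a))"
          proof (rule runs_fill)
            fix a s3 assume D: "a < i" "frame ?cp s' s3" "nmem s3 ''a'' 0 = a" "rmem s3 ''P'' ?c a = rmem s' ''P'' ?c a"
              "\<forall>q' a. q' \<noteq> ?c \<longrightarrow> rmem s3 ''P'' q' a = rmem s' ''P'' q' a"
            have "nmem s3 ''J'' 0 = J" using D(2) C(7) by (simp add: frame_def)
            \<comment> \<open>Source and target row coincide in the pass \<open>j = 0\<close>; entry
              \<open>a\<close> is then read before it is rewritten.\<close>
            moreover have "rmem s3 ''P'' J a = rmem s' ''P'' J a" using D(4,5) by (cases "J = ?c") auto
            ultimately show "rval (RGet ''P'' (gv ''J'') (gv ''a'')) s3 = co a ?c" using D(1,3) Pl by simp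
          qed (use i' C(5) A(1) in \<open>auto simp: frame_def\<close>)
          fix s3 assume D: "(\<forall>a<i. rmem s3 ''P'' ?c a = co a ?c) \<and>
             (\<forall>q' a. q' \<noteq> ?c \<longrightarrow> rmem s3 ''P'' q' a = rmem s' ''P'' q' a)" "frame ?cp
                 s' s3"
          have n3: "nmem s3 ''cnt'' 0 = ?c" "nmem s3 ''i'' 0 = i" "nmem s3 ''j'' 0 = j" "nmem s3 ''Q'' 0 = Q"
            using D(2) C i' by (simp_all add: frame_def)
          have res: "result \<omega> ?st s3 = rset ''P'' ?c i (co i ?c) s3" using n3 top by simp
          have "?H (Suc ?c) (rset ''P'' ?c i (co i ?c) s3)"
          proof (intro conjI allI impI)
            fix K a assume K: "K < B ^ i" "a < i"
            then show "rmem (rset ''P'' ?c i (co i ?c) s3) ''P'' K a = co a K"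
              using D(1) C(3) by (cases "K = ?c") auto
          next
            fix K a assume K: "K < Suc ?c" "a < Suc i"
            then show "rmem (rset ''P'' ?c i (co i ?c) s3) ''P'' K a = co a K"
              using D(1) C(3) by (cases "K = ?c"; cases "a = i") auto
          qed
          then show "runs \<omega> ?st s3 1 (?H (Suc ?c))"
            by (intro runs_straight) (simp_all only: res straight.simps cost.simps order_refl)
        qed simp
      next
        have "B ^ i \<le> NC" unfolding NC_def B_def[symmetric] using A(1) by (intro power_increasing) (auto simp:
            B_def)
        then show "B * (B ^ i * (((d * 3 + 2) + 1) + 3) + 4) + 4 \<le> ?Tk"
          unfolding B_def[symmetric] by (intro add_mono mult_left_mono mult_right_mono) auto
      next
        fix c and s3 s4 :: state assume "?H c s3" "\<And>a. a \<notin> {''cnt'', ''j'', ''J'', ''len''}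
            \<Longrightarrow> nmem s4 a = nmem s3 a" "rmem s4 = rmem s3"
        then show "?H c s4" by simp
      qed (use b2 A(2) in \<open>auto simp: frame_def\<close>)
      then show "runs \<omega> ?K s2 ?Tk (\<lambda>s'. ?I (Suc i) (nset ''i'' 0 (Suc i) s'))"
        by (rule runs_mono) auto
    qed (use s in \<open>auto simp: s1 frame_def\<close>)
  next
    fix s2 assume "?I d s2"
    then show "runs \<omega> (sv ''NC'' (gv ''len'')) s2 1 (\<lambda>s'. (\<forall>c<NC. \<forall>i<d. rmem s'
        ''P'' c i = pt c i) \<and> nmem s' ''NC'' 0 = NC)"
      by (intro runs_straight) (auto simp: NC_def B_def co_def pt_def)
  qed simp
qed auto

lemma runs_grid_features:
  assumes s: "nmem s ''d'' 0 = d" "nmem s ''R'' 0 = R" "nmem s ''b'' 0 = bb" "nmem s ''NJ'' 0 = NJ" "nmem s ''NC''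
      0 = NC"
    and P: "\<forall>c<NC. \<forall>i<d. rmem s ''P'' c i = pt c i"
  shows "runs \<omega> grid_features s Tgft (\<lambda>s'. \<forall>c<NC. \<forall>J<NJ. rmem s' ''Ph'' c J = phi c J)"
  unfolding grid_features_def Tgft_def
proof (rule runs_For[where m = NC and I = "\<lambda>c s'. \<forall>u<c. \<forall>J<NJ. rmem s' ''Ph'' u J = phi u J"])
  let ?a = "For ''J'' (gv ''NJ'') (RSet ''Ph'' (gv ''c'') (gv ''J'') (rvec ''V'' (gv ''J'')))"
  fix c s1 assume A: "c < NC" "\<forall>u<c. \<forall>J<NJ. rmem s1 ''Ph'' u J = phi u J" "nmem s1 ''c'' 0 = c"
    "frame (For ''c'' (gv ''NC'') (features ''P'' (gv ''c'') ;; ?a)) s s1"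
  have f1: "nmem s1 ''d'' 0 = d" "nmem s1 ''R'' 0 = R" "nmem s1 ''b'' 0 = R + 1" "nmem s1 ''NJ'' 0 = NJ"
    "\<And>i. i < d \<Longrightarrow> rmem s1 ''P'' c i = pt c i"
    using A(1,4) s P by (auto simp: frame_def bb_def)
  have feat: "runs \<omega> (features ''P'' (gv ''c'')) s1 (Tfeat d R)
     (\<lambda>s'. \<forall>J<(R + 1) ^ d. rmem s' ''V'' 0 J = (\<Prod>i<d. cheb (dig (R + 1) i J) (pt c i)))"
    by (rule runs_features[OF f1(1-3)]) (use A(3) f1 in \<open>auto simp: frame_def\<close>)
  show "runs \<omega> (features ''P'' (gv ''c'') ;; ?a) s1 (Tfeat d R + (NJ * 3 + 2))
     (\<lambda>s'. \<forall>u<Suc c. \<forall>J<NJ. rmem (nset ''c'' 0 (Suc c) s') ''Ph'' u J = phi u J)"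
  proof (rule runs_Seq[OF feat])
    fix s2 assume B: "\<forall>J<(R + 1) ^ d. rmem s2 ''V'' 0 J = (\<Prod>i<d. cheb (dig (R + 1) i J) (pt c i))"
      "frame (features ''P'' (gv ''c'')) s1 s2"
    have V: "rmem s2 ''V'' 0 J = phi c J" if "J < NJ" for J using B(1) that by (simp add: phi_def feat_def bb_def
        NJ_def)
    have f2: "nmem s2 ''NJ'' 0 = NJ" "nmem s2 ''c'' 0 = c" "rmem s2 ''Ph'' = rmem s1 ''Ph''" using B(2) f1 A(3) by
        (simp_all add: frame_def)
    have "runs \<omega> ?a s2 (NJ * 3 + 2) (\<lambda>s'. (\<forall>J<NJ. rmem s' ''Ph'' c J = phi c J) \<and>
      (\<forall>q' i. q' \<noteq> c \<longrightarrow> rmem s' ''Ph'' q' i = rmem s2 ''Ph'' q' i))"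
      by (rule runs_fill) (use f2 V in \<open>auto simp: frame_def\<close>)
    then show "runs \<omega> ?a s2 (NJ * 3 + 2) (\<lambda>s'. \<forall>u<Suc c. \<forall>J<NJ. rmem (nset ''c'' 0
        (Suc c) s') ''Ph'' u J = phi u J)"
      by (rule runs_mono) (use A(2) f2 in \<open>auto simp: less_Suc_eq\<close>)
  qed simp
qed (use s in \<open>auto simp: frame_def\<close>)

lemma runs_scores:
  assumes s: "nmem s ''NJ'' 0 = NJ" "nmem s ''NC'' 0 = NC" and wk: "\<forall>J<NJ. rmem s ''wk'' 0 J = wk J"
    and Ph: "\<forall>c<NC. \<forall>J<NJ. rmem s ''Ph'' c J = phi c J" and S: "\<forall>J<NJ. rmem s ''S'' 0 J = h J"
  shows "runs \<omega> scores s Tscr (\<lambda>s'. \<forall>c<NC. rmem s' ''sc'' 0 c = score phi ww NJ h c)"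
  unfolding scores_def Tscr_def
proof (rule runs_For[where m = NC and I = "\<lambda>c s'. \<forall>u<c. rmem s' ''sc'' 0 u = score phi ww NJ h u"])
  let ?r = "RMul (RMul (RDiv (rnum 1) (RMul (rvec ''wk'' (gv ''J'')) (rvec ''wk'' (gv ''J'')))) (rvec ''S'' (gv ''J'')))
          (RGet ''Ph'' (gv ''c'') (gv ''J''))"
  let ?z = "RSet ''sc'' (NConst 0) (gv ''c'') (rnum 0)"
  let ?a = "For ''J'' (gv ''NJ'') (RSet ''sc'' (NConst 0) (gv ''c'') (RAdd (rvec ''sc'' (gv ''c'')) ?r))"
  fix c s1 assume A: "c < NC" "\<forall>u<c. rmem s1 ''sc'' 0 u = score phi ww NJ h u" "nmem s1 ''c'' 0 = c"
    "frame (For ''c'' (gv ''NC'') (?z ;; ?a)) s s1"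
  show "runs \<omega> (?z ;; ?a) s1 (1 + (NJ * 3 + 2)) (\<lambda>s'. \<forall>u<Suc c. rmem (nset ''c'' 0 (Suc c)
      s') ''sc'' 0 u = score phi ww NJ h u)"
  proof (rule runs_Seq[OF runs_result])
    fix s2 assume s2: "s2 = result \<omega> ?z s1"
    have f2: "nmem s2 ''NJ'' 0 = NJ" "nmem s2 ''c'' 0 = c" "rmem s2 ''wk'' = rmem s ''wk''" "rmem s2 ''Ph'' = rmem
        s ''Ph''"
      "rmem s2 ''S'' = rmem s ''S''" "rmem s2 ''sc'' 0 c = 0" "\<forall>u<c. rmem s2 ''sc'' 0 u = score phi ww NJ h u"
      using A s by (simp_all add: frame_def s2)
    have "runs \<omega> ?a s2 (NJ * 3 + 2) (\<lambda>s'. rmem s' ''sc'' 0 c = rmem s2 ''sc'' 0 c + (\<Sum>J<NJ. ww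
        J * h J * phi c J) \<and>
      (\<forall>i j. \<not> (i = 0 \<and> j = c) \<longrightarrow> rmem s' ''sc'' i j = rmem s2 ''sc'' i j))"
    proof (rule runs_accum)
      fix J s' assume B: "J < NJ" "frame ?a s2 s'" "nmem s' ''J'' 0 = J"
      have "nmem s' ''c'' 0 = c" "rmem s' ''wk'' 0 J = wk J" "rmem s' ''S'' 0 J = h J" "rmem s' ''Ph'' c J = phi c J"
        using B f2 wk S Ph A(1) by (simp_all add: frame_def)
      then show "rval ?r s' = ww J * h J * phi c J" using B(3) by (simp add: ww_def power2_eq_square)
    qed (use f2 in \<open>auto simp: frame_def\<close>)
    then show "runs \<omega> ?a s2 (NJ * 3 + 2) (\<lambda>s'. \<forall>u<Suc c. rmem (nset ''c'' 0 (Suc c) s')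
        ''sc'' 0 u = score phi ww NJ h u)"
      by (rule runs_mono) (use f2 in \<open>auto simp: less_Suc_eq score_def\<close>)
  qed auto
qed (use s in \<open>auto simp: frame_def\<close>)

lemma runs_select:
  assumes s: "nmem s ''NC'' 0 = NC" and sc: "\<forall>c<NC. rmem s ''sc'' 0 c = v c"
  shows "runs \<omega> select s Tsel (\<lambda>s'. nmem s' ''best'' 0 = amin v NC)"
  unfolding select_def Tsel_def
proof (rule runs_Seq[OF runs_result])
  let ?c = "Cond (RLess (rvec ''sc'' (gv ''c'')) (rvec ''sc'' (gv ''best''))) (sv ''best'' (gv ''c'')) Skip"
  fix s1 assume s1: "s1 = result \<omega> (sv ''best'' (NConst 0)) s"
  show "runs \<omega> (For ''c'' (gv ''NC'') ?c) s1 (NC * (3 + 2) + 2) (\<lambda>s'. nmem s' ''best'' 0 = amin v NC)"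
  proof (rule runs_For[where m = NC and Tb = 3 and I = "\<lambda>c s'. nmem s' ''best'' 0 = amin v c"])
    fix c s' assume A: "c < NC" "nmem s' ''best'' 0 = amin v c" "nmem s' ''c'' 0 = c" "frame (For ''c'' (gv ''NC'')
        ?c) s1 s'"
    have "amin v c < NC" using amin_less[of c v] A(1) by (cases "c = 0") auto
    then have "rmem s' ''sc'' 0 c = v c" "rmem s' ''sc'' 0 (amin v c) = v (amin v c)" using A(1,4) sc by (simp_all
        add: s1 frame_def)
    then show "runs \<omega> ?c s' 3 (\<lambda>s''. nmem (nset ''c'' 0 (Suc c) s'') ''best'' 0 = amin v (Suc c))"
      using A by (intro runs_straight) auto
  qed (use s in \<open>auto simp: s1 frame_def\<close>)
qed auto

lemma runs_emit:
  assumes s: "nmem s ''NJ'' 0 = NJ" "nmem s ''d'' 0 = d" "nmem s ''best'' 0 = c" "nmem s ''t'' 0 = t" and c: "c < NC"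
    and Ph: "\<forall>c<NC. \<forall>J<NJ. rmem s ''Ph'' c J = phi c J" and S: "\<forall>J<NJ. rmem s ''S'' 0 J = h J"
    and m: "\<forall>J<NJ. rmem s ''m'' 0 J = v J" and P: "\<forall>c<NC. \<forall>i<d. rmem s ''P'' c i = pt c i"
  shows "runs \<omega> emit s Temi (\<lambda>s'. (\<forall>J<NJ. rmem s' ''S'' 0 J = h J + (phi c J - v J)) \<and>
    (\<forall>i<d. rmem s' ''Y'' t i = pt c i) \<and> (\<forall>u i. u \<noteq> t \<longrightarrow> rmem s' ''Y'' u
        i = rmem s ''Y'' u i))"
  unfolding emit_def Temi_def
proof (rule runs_Seq)
  let ?a = "For ''J'' (gv ''NJ'') (RSet ''S'' (NConst 0) (gv ''J'') (RAdd (rvec ''S'' (gv ''J''))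
       (RSub (RGet ''Ph'' (gv ''best'') (gv ''J'')) (rvec ''m'' (gv ''J'')))))"
  let ?y = "For ''i'' (gv ''d'') (RSet ''Y'' (gv ''t'') (gv ''i'') (RGet ''P'' (gv ''best'') (gv ''i'')))"
  show "runs \<omega> ?a s (NJ * 3 + 2) (\<lambda>s'. (\<forall>J<NJ. rmem s' ''S'' 0 J = h J + (phi c J - v J)) \<and>
      (\<forall>q' i. q' \<noteq> 0 \<longrightarrow> rmem s' ''S'' q' i = rmem s ''S'' q' i))"
    by (rule runs_fill) (use s c Ph S m in \<open>auto simp: frame_def\<close>)
  fix s1 assume A: "(\<forall>J<NJ. rmem s1 ''S'' 0 J = h J + (phi c J - v J)) \<and>
      (\<forall>q' i. q' \<noteq> 0 \<longrightarrow> rmem s1 ''S'' q' i = rmem s ''S'' q' i)" "frame ?a s s1"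
  have f1: "nmem s1 ''d'' 0 = d" "nmem s1 ''best'' 0 = c" "nmem s1 ''t'' 0 = t" "rmem s1 ''P'' = rmem s ''P''"
      "rmem s1 ''Y'' = rmem s ''Y''"
    using A(2) s by (simp_all add: frame_def)
  have "runs \<omega> ?y s1 (d * 3 + 2) (\<lambda>s'. (\<forall>i<d. rmem s' ''Y'' t i = pt c i) \<and>
      (\<forall>q' i. q' \<noteq> t \<longrightarrow> rmem s' ''Y'' q' i = rmem s1 ''Y'' q' i))"
    by (rule runs_fill) (use f1 P c in \<open>auto simp: frame_def\<close>)
  from runs_frame[OF this] show "runs \<omega> ?y s1 (d * 3 + 2) (\<lambda>s'. (\<forall>J<NJ. rmem s' ''S'' 0 J =
      h J + (phi c J - v J)) \<and>
    (\<forall>i<d. rmem s' ''Y'' t i = pt c i) \<and> (\<forall>u i. u \<noteq> t \<longrightarrow> rmem s' ''Y'' u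
        i = rmem s ''Y'' u i))"
    by (rule runs_mono) (use A f1 in \<open>auto simp: frame_def\<close>)
qed auto

lemma runs_herd:
  assumes s: "nmem s ''NJ'' 0 = NJ" "nmem s ''NC'' 0 = NC" "nmem s ''d'' 0 = d" "nmem s ''Q'' 0 = Q"
    and wk: "\<forall>J<NJ. rmem s ''wk'' 0 J = wk J" and Ph: "\<forall>c<NC. \<forall>J<NJ. rmem s ''Ph'' c J =
        phi c J"
    and m: "\<forall>J<NJ. rmem s ''m'' 0 J = v J" and P: "\<forall>c<NC. \<forall>i<d. rmem s ''P'' c i = pt c i"
    and S: "\<forall>J<NJ. rmem s ''S'' 0 J = 0"
  shows "runs \<omega> herd s Therd (\<lambda>s'. \<forall>u<Q. \<forall>i<d. rmem s' ''Y'' u i = pt (pick phi ww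
      NJ NC v u) i)"
proof -
  let ?h = "\<lambda>t. hsum phi ww NJ NC v t"
  let ?I = "\<lambda>t (s'::state). (\<forall>J<NJ. rmem s' ''S'' 0 J = ?h t J) \<and> (\<forall>u<t. \<forall>i<d.
      rmem s' ''Y'' u i = pt (pick phi ww NJ NC v u) i)"
  have "runs \<omega> herd s Therd (?I Q)"
    unfolding herd_def Therd_def
  proof (rule runs_For[where m = Q and I = ?I])
    fix t s1 assume A: "t < Q" "?I t s1" "nmem s1 ''t'' 0 = t" "frame (For ''t'' (gv ''Q'') (scores ;; select ;;
        emit)) s s1"
    define c where "c = pick phi ww NJ NC v t"
    have c: "c < NC" unfolding c_def pick_def by (rule amin_less[OF NC_pos])
    have f1: "nmem s1 ''NJ'' 0 = NJ" "nmem s1 ''NC'' 0 = NC" "nmem s1 ''d'' 0 = d"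
      "\<forall>J<NJ. rmem s1 ''wk'' 0 J = wk J" "\<forall>c<NC. \<forall>J<NJ. rmem s1 ''Ph'' c J = phi c J"
          "\<forall>J<NJ. rmem s1 ''m'' 0 J = v J"
      "\<forall>c<NC. \<forall>i<d. rmem s1 ''P'' c i = pt c i"
      using A(4) s wk Ph m P by (simp_all add: frame_def block_defs)
    have S1: "\<forall>J<NJ. rmem s1 ''S'' 0 J = ?h t J" using A(2) by blast
    show "runs \<omega> (scores ;; select ;; emit) s1 (Tscr + (Tsel + Temi)) (\<lambda>s'. ?I (Suc t) (nset ''t'' 0
        (Suc t) s'))"
    proof (rule runs_Seq[OF runs_scores[OF f1(1,2,4,5) S1]])
      fix s2 assume B: "\<forall>c<NC. rmem s2 ''sc'' 0 c = score phi ww NJ (?h t) c" "frame scores s1 s2"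
      have f2: "nmem s2 ''NJ'' 0 = NJ" "nmem s2 ''NC'' 0 = NC" "nmem s2 ''d'' 0 = d" "nmem s2 ''t'' 0 = t"
        "\<forall>c<NC. \<forall>J<NJ. rmem s2 ''Ph'' c J = phi c J" "\<forall>J<NJ. rmem s2 ''S'' 0 J = ?h t J"
            "\<forall>J<NJ. rmem s2 ''m'' 0 J = v J"
        "\<forall>c<NC. \<forall>i<d. rmem s2 ''P'' c i = pt c i" "rmem s2 ''Y'' = rmem s1 ''Y''"
        using B(2) f1 S1 A(3) by (simp_all add: frame_def block_defs)
      show "runs \<omega> (select ;; emit) s2 (Tsel + Temi) (\<lambda>s'. ?I (Suc t) (nset ''t'' 0 (Suc t) s'))"
      proof (rule runs_Seq[OF runs_select[OF f2(2) B(1)]])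
        fix s3 assume C: "nmem s3 ''best'' 0 = amin (score phi ww NJ (?h t)) NC" "frame select s2 s3"
        have best: "nmem s3 ''best'' 0 = c" using C(1) by (simp add: c_def pick_def)
        have f3: "nmem s3 ''NJ'' 0 = NJ" "nmem s3 ''d'' 0 = d" "nmem s3 ''t'' 0 = t"
          "\<forall>c<NC. \<forall>J<NJ. rmem s3 ''Ph'' c J = phi c J" "\<forall>J<NJ. rmem s3 ''S'' 0 J = ?h t J"
              "\<forall>J<NJ. rmem s3 ''m'' 0 J = v J"
          "\<forall>c<NC. \<forall>i<d. rmem s3 ''P'' c i = pt c i" "rmem s3 ''Y'' = rmem s1 ''Y''"
          using C(2) f2 by (simp_all add: frame_def block_defs)
        have new: "?h (Suc t) J = ?h t J + (phi c J - v J)" for J by (simp add: c_def pick_def)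
        show "runs \<omega> emit s3 Temi (\<lambda>s'. ?I (Suc t) (nset ''t'' 0 (Suc t) s'))"
          by (rule runs_mono[OF runs_emit[OF f3(1,2) best f3(3) c f3(4-7)]])
             (use f3(8) A(2) in \<open>auto simp: new less_Suc_eq c_def[symmetric] simp del: hsum.simps\<close>)
      qed simp
    qed simp
  qed (use s S in \<open>auto simp: frame_def block_defs\<close>)
  then show ?thesis by (rule runs_mono) auto
qed

end

section \<open>The complete program\<close>

context synth
begin

definition "Ttot = Tdeg + (Tcnt + (Twts + (Tnoi + (Tmom + (Tper + (Tgrd + (Tgft + (Therd + 1))))))))"

lemma runs_synth_program:
  assumes X: "length X = n"
  shows "runs \<omega> synth_program (init_state d k eps del X) Ttot
    (\<lambda>s'. output_dataset d s' = out (noisy X (\<lambda>J. snd (\<omega> J))))"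
proof -
  let ?s = "init_state d k eps del X"
  let ?v = "noisy X (\<lambda>J. snd (\<omega> J))"
  let ?G = "\<lambda>s'. output_dataset d s' = out ?v"
  have i: "nmem ?s ''n'' 0 = n" "nmem ?s ''d'' 0 = d" "nmem ?s ''k'' 0 = k" "rmem ?s ''eps'' 0 0 = eps" "rmem ?s
      ''delta'' 0 0 = del"
    "\<forall>x<n. \<forall>i<d. rmem ?s ''X'' x i = (X ! x) i" "rmem ?s ''m'' 0 J = 0" "rmem ?s ''S'' 0 J = 0"
        "rmem ?s ''Sg'' 0 0 = 0" "draws ?s = 0" for J
    by (simp_all add: init_state_def X)
  show ?thesis unfolding synth_program_def Ttot_def
  proof (rule runs_Seq[OF runs_setup_degree[OF i(1,2,4,5)]])
    fix s1 assume A: "rmem s1 ''L'' 0 0 = Lg \<and> nmem s1 ''R'' 0 = R \<and> nmem s1 ''b'' 0 = bb" "frame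
        setup_degree ?s s1"
    have f1: "nmem s1 ''n'' 0 = n" "nmem s1 ''d'' 0 = d" "nmem s1 ''k'' 0 = k" "rmem s1 ''eps'' 0 0 = eps"
      "rmem s1 ''X'' = rmem ?s ''X''" "rmem s1 ''m'' = rmem ?s ''m''" "rmem s1 ''S'' = rmem ?s ''S''" "rmem s1
          ''Sg'' = rmem ?s ''Sg''" "draws s1 = 0"
      using A(2) i by (simp_all add: frame_def block_defs)
    show "runs \<omega> (setup_count ;; setup_weights ;; setup_noise ;; moments ;; perturb ;; grid ;; grid_features
        ;; herd ;; sv ''N'' (gv ''Q'')) s1
      (Tcnt + (Twts + (Tnoi + (Tmom + (Tper + (Tgrd + (Tgft + (Therd + 1)))))))) ?G"
    proof (rule runs_Seq[OF runs_setup_count[OF f1(1)]])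
      fix s2 assume B: "nmem s2 ''Q'' 0 = Q \<and> nmem s2 ''Q1'' 0 = Q + 1" "frame setup_count s1 s2"
      have f2: "nmem s2 ''n'' 0 = n" "nmem s2 ''d'' 0 = d" "nmem s2 ''k'' 0 = k" "rmem s2 ''eps'' 0 0 = eps"
        "rmem s2 ''X'' = rmem ?s ''X''" "rmem s2 ''m'' = rmem ?s ''m''" "rmem s2 ''S'' = rmem ?s ''S''" "rmem s2
            ''Sg'' = rmem ?s ''Sg''" "draws s2 = 0"
        "rmem s2 ''L'' 0 0 = Lg" "nmem s2 ''R'' 0 = R" "nmem s2 ''b'' 0 = bb"
        using B(2) f1 A(1) by (simp_all add: frame_def block_defs)
      show "runs \<omega> (setup_weights ;; setup_noise ;; moments ;; perturb ;; grid ;; grid_features ;; herd ;;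
          sv ''N'' (gv ''Q'')) s2
        (Twts + (Tnoi + (Tmom + (Tper + (Tgrd + (Tgft + (Therd + 1))))))) ?G"
      proof (rule runs_Seq[OF runs_setup_weights[OF f2(2,12)]])
        fix s3 assume C: "(\<forall>J<NJ. nmem s3 ''W'' J = wt J) \<and> nmem s3 ''NJ'' 0 = NJ" "frame
            setup_weights s2 s3"
        have f3: "nmem s3 ''n'' 0 = n" "nmem s3 ''d'' 0 = d" "nmem s3 ''k'' 0 = k" "rmem s3 ''eps'' 0 0 = eps"
          "rmem s3 ''X'' = rmem ?s ''X''" "rmem s3 ''m'' = rmem ?s ''m''" "rmem s3 ''S'' = rmem ?s ''S''" "rmem s3
              ''Sg'' 0 0 = 0" "draws s3 = 0"
          "rmem s3 ''L'' 0 0 = Lg" "nmem s3 ''R'' 0 = R" "nmem s3 ''b'' 0 = bb" "nmem s3 ''Q'' 0 = Q" "nmem s3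
              ''Q1'' 0 = Q + 1" "nmem s3 ''NJ'' 0 = NJ"
          using C f2 B(1) i by (simp_all add: frame_def block_defs)
        show "runs \<omega> (setup_noise ;; moments ;; perturb ;; grid ;; grid_features ;; herd ;; sv ''N'' (gv
            ''Q'')) s3
          (Tnoi + (Tmom + (Tper + (Tgrd + (Tgft + (Therd + 1)))))) ?G"
        proof (rule runs_Seq[OF runs_setup_noise[OF f3(15,3,1,10,4,8) conjunct1[OF C(1)]]])
          fix s4 assume D: "(\<forall>J<NJ. rmem s4 ''wk'' 0 J = wk J) \<and> rmem s4 ''sig'' 0 0 = sig" "frame
              setup_noise s3 s4"
          have f4: "nmem s4 ''n'' 0 = n" "nmem s4 ''d'' 0 = d" "\<forall>x<n. \<forall>i<d. rmem s4 ''X'' x i = (X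
              ! x) i"
            "\<forall>J<NJ. rmem s4 ''m'' 0 J = 0" "rmem s4 ''S'' = rmem ?s ''S''" "draws s4 = 0"
            "nmem s4 ''R'' 0 = R" "nmem s4 ''b'' 0 = bb" "nmem s4 ''Q'' 0 = Q" "nmem s4 ''Q1'' 0 = Q + 1" "nmem s4
                ''NJ'' 0 = NJ"
            using D(2) f3 i by (simp_all add: frame_def block_defs)
          show "runs \<omega> (moments ;; perturb ;; grid ;; grid_features ;; herd ;; sv ''N'' (gv ''Q'')) s4
            (Tmom + (Tper + (Tgrd + (Tgft + (Therd + 1))))) ?G"
          proof (rule runs_Seq[OF runs_moments[OF f4(1,2,7,8,11,3,4)]])
            fix s5 assume E: "\<forall>J<NJ. rmem s5 ''m'' 0 J = (\<Sum>x<n. feat (X ! x) J)" "frame moments s4 s5"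
            have f5: "nmem s5 ''n'' 0 = n" "nmem s5 ''NJ'' 0 = NJ" "rmem s5 ''sig'' 0 0 = sig" "draws s5 = 0"
                "\<forall>J<NJ. rmem s5 ''wk'' 0 J = wk J"
              "nmem s5 ''d'' 0 = d" "nmem s5 ''R'' 0 = R" "nmem s5 ''b'' 0 = bb" "nmem s5 ''Q'' 0 = Q" "nmem s5
                  ''Q1'' 0 = Q + 1" "rmem s5 ''S'' = rmem ?s ''S''"
              using E(2) f4 D(1) by (simp_all add: frame_def block_defs)
            show "runs \<omega> (perturb ;; grid ;; grid_features ;; herd ;; sv ''N'' (gv ''Q'')) s5
              (Tper + (Tgrd + (Tgft + (Therd + 1)))) ?G"
            proof (rule runs_Seq[OF runs_perturb[OF f5(1-5) E(1) X]])
              fix s6 assume F: "\<forall>J<NJ. rmem s6 ''m'' 0 J = ?v J" "frame perturb s5 s6"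
              have f6: "nmem s6 ''d'' 0 = d" "nmem s6 ''Q'' 0 = Q" "nmem s6 ''Q1'' 0 = Q + 1" "nmem s6 ''NJ'' 0 =
                  NJ" "nmem s6 ''R'' 0 = R" "nmem s6 ''b'' 0 = bb"
                "\<forall>J<NJ. rmem s6 ''wk'' 0 J = wk J" "rmem s6 ''S'' = rmem ?s ''S''"
                using F(2) f5 by (simp_all add: frame_def block_defs)
              show "runs \<omega> (grid ;; grid_features ;; herd ;; sv ''N'' (gv ''Q'')) s6 (Tgrd + (Tgft + (Therd
                  + 1))) ?G"
              proof (rule runs_Seq[OF runs_grid[OF f6(1-3)]])
                fix s7 assume H: "(\<forall>c<NC. \<forall>i<d. rmem s7 ''P'' c i = pt c i) \<and> nmem s7 ''NC'' 0
                    = NC" "frame grid s6 s7"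
                have f7: "nmem s7 ''d'' 0 = d" "nmem s7 ''R'' 0 = R" "nmem s7 ''b'' 0 = bb" "nmem s7 ''NJ'' 0 = NJ"
                    "nmem s7 ''NC'' 0 = NC"
                  "\<forall>c<NC. \<forall>i<d. rmem s7 ''P'' c i = pt c i" "nmem s7 ''Q'' 0 = Q"
                  "\<forall>J<NJ. rmem s7 ''wk'' 0 J = wk J" "rmem s7 ''S'' = rmem ?s ''S''" "\<forall>J<NJ. rmem
                      s7 ''m'' 0 J = ?v J"
                  using H f6 F(1) by (simp_all add: frame_def block_defs)
                show "runs \<omega> (grid_features ;; herd ;; sv ''N'' (gv ''Q'')) s7 (Tgft + (Therd + 1)) ?G"
                proof (rule runs_Seq[OF runs_grid_features[OF f7(1-6)]])
                  fix s8 assume I: "\<forall>c<NC. \<forall>J<NJ. rmem s8 ''Ph'' c J = phi c J" "frame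
                      grid_features s7 s8"
                  have f8: "nmem s8 ''NJ'' 0 = NJ" "nmem s8 ''NC'' 0 = NC" "nmem s8 ''d'' 0 = d" "nmem s8 ''Q'' 0 = Q"
                    "\<forall>J<NJ. rmem s8 ''wk'' 0 J = wk J" "\<forall>J<NJ. rmem s8 ''m'' 0 J = ?v J"
                        "\<forall>c<NC. \<forall>i<d. rmem s8 ''P'' c i = pt c i"
                    "\<forall>J<NJ. rmem s8 ''S'' 0 J = 0"
                    using I(2) f7 i by (simp_all add: frame_def block_defs)
                  show "runs \<omega> (herd ;; sv ''N'' (gv ''Q'')) s8 (Therd + 1) ?G"
                  proof (rule runs_Seq[OF runs_herd[OF f8(1-5) I(1) f8(6-8)]])
                    fix s9 assume J: "\<forall>u<Q. \<forall>i<d. rmem s9 ''Y'' u i = pt (pick phi ww NJ NC ?v u)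
                        i" "frame herd s8 s9"
                    have Q9: "nmem s9 ''Q'' 0 = Q" using J(2) f8 by (simp add: frame_def block_defs)
                    have "restrict (rmem s9 ''Y'' u) {..<d} = pt (pick phi ww NJ NC ?v u)" if "u < Q" for u
                      using J(1) that by (auto simp: pt_def)
                    then have "map (\<lambda>u. restrict (rmem s9 ''Y'' u) {..<d}) [0..<Q] = map pt (picks ?v)"
                      by (auto simp: picks_def)
                    then show "runs \<omega> (sv ''N'' (gv ''Q'')) s9 1 ?G"
                      using Q9 by (intro runs_straight) (auto simp: output_dataset_def out_def)
                  qed simp
                qed simp
              qed simp
            qed simp
          qed simp
        qed simp
      qed simp
    qed simp
  qed simp
qed

end

text \<open>The bound is uniform in the last two arguments, which stand for the privacy parameters:
  the polynomial of the theorem is chosen before them.\<close>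

definition polyb :: "(nat \<Rightarrow> real \<Rightarrow> real \<Rightarrow> nat) \<Rightarrow> bool" where
  "polyb f \<longleftrightarrow> (\<exists>P. \<forall>n e u. f n e u \<le> poly P n)"

lemma polyb_const: "polyb (\<lambda>n e u. c)"
  unfolding polyb_def by (intro exI[of _ "[:c:]"]) simp

lemma polyb_n: "polyb (\<lambda>n e u. n)"
  unfolding polyb_def by (intro exI[of _ "[:0, 1:]"]) simp

lemma polyb_add:
  assumes "polyb f" "polyb g"
  shows "polyb (\<lambda>n e u. f n e u + g n e u)"
proof -
  obtain P P' where "\<And>n e u. f n e u \<le> poly P n" "\<And>n e u. g n e u \<le> poly P' n"
    using assms unfolding polyb_def by blast
  then have "\<forall>n e u. f n e u + g n e u \<le> poly (P + P') n" by (simp add: add_mono)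
  then show ?thesis unfolding polyb_def by blast
qed

lemma polyb_mult:
  assumes "polyb f" "polyb g"
  shows "polyb (\<lambda>n e u. f n e u * g n e u)"
proof -
  obtain P P' where "\<And>n e u. f n e u \<le> poly P n" "\<And>n e u. g n e u \<le> poly P' n"
    using assms unfolding polyb_def by blast
  then have "\<forall>n e u. f n e u * g n e u \<le> poly (P * P') n" by (simp add: mult_mono)
  then show ?thesis unfolding polyb_def by blast
qed

lemma polyb_power: "polyb f \<Longrightarrow> polyb (\<lambda>n e u. f n e u ^ m)"
  by (induction m) (auto intro: polyb_mult polyb_const)

text \<open>The cutoff of the degree search at \<open>n\<close> makes this bound hold for arbitrary
  privacy parameters.\<close>

lemma polyb_R: "polyb (\<lambda>n e u. synth.R d n e u)"
  unfolding polyb_def synth.R_def by (intro exI[of _ "[:0, 1:]"]) (simp add: rsel_le)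

lemma polyb_Ttot: "polyb (\<lambda>n e u. synth.Ttot d k n e u)"
  unfolding synth.Ttot_def synth.Tdeg_def synth.Tcnt_def synth.Twts_def synth.Tnoi_def synth.Tmom_def synth.Tper_def
    synth.Tgrd_def synth.Tgft_def synth.Therd_def synth.Tscr_def synth.Tsel_def synth.Temi_def Tfeat_def
    synth.NJ_def synth.bb_def synth.NC_def synth.Q_def
  by (intro polyb_const polyb_add polyb_mult polyb_power polyb_n polyb_R)

section \<open>Assembly of the theorem\<close>

context synth_ok
begin

lemma exec_synth_program:
  assumes "X \<in> datasets n (cube d)"
  shows "halts_within Ttot \<omega> synth_program (init_state d k eps del X)"
    "synthesize synth_program d k eps del X \<omega> = sout X \<omega>"
proof -
  have "length X = n" using assms by (simp add: datasets_def)
  from runs_synth_program[OF this, of \<omega>] obtain t s' where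
    t: "t \<le> Ttot" "exec \<omega> synth_program (init_state d k eps del X) t s'" "output_dataset d s' = sout X
        \<omega>"
    unfolding runs_def by blast
  then show "halts_within Ttot \<omega> synth_program (init_state d k eps del X)" unfolding halts_within_def by blast
  show "synthesize synth_program d k eps del X \<omega> = sout X \<omega>"
    unfolding synthesize_def final_state_eq[OF t(2)] by (rule t(3))
qed

lemma mechanism_eq:
  assumes "X \<in> datasets n (cube d)"
  shows "mechanism synth_program d k eps del X = distr tape (dataset_space d) (sout X)"
  unfolding mechanism_def using exec_synth_program(2)[OF assms] by (intro arg_cong[of _ _ "distr _ _"] ext) auto

lemma differentially_private_mechanism:
  "differentially_private (cube d) n (dataset_space d) eps del (mechanism synth_program d k eps del)"
  using mechanism_private unfolding differentially_private_def by (simp add: mechanism_eq)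

lemma error_bound:
  assumes "X \<in> datasets n (cube d)"
  shows "(\<integral>Y. dk d k (empirical (mset X)) (empirical Y) \<partial>mechanism synth_program d k eps del X) \<le>
    (if k < d then Cdk * (sqrt (ln (1.25 / del)) / (eps * real n)) powr (real k / real d)
     else if k = d then Cdk * sqrt (ln (1.25 / del)) * ln (eps * real n) / (eps * real n)
     else Cdk * sqrt (ln (1.25 / del)) / (eps * real n))"
proof -
  have "(\<integral>Y. dk d k (empirical (mset X)) (empirical Y) \<partial>mechanism synth_program d k eps del X)
      \<le> toterr"
    unfolding mechanism_eq[OF assms] by (rule expected_error(2)[OF assms])
  moreover have "Cdk * s0 * ln (eps * real n) = Cdk * sqrt (ln (1.25 / del)) * ln (eps * real n) / (eps * real n)"
    "Cdk * s0 = Cdk * sqrt (ln (1.25 / del)) / (eps * real n)"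
    by (simp_all add: s0_def Lg_eq)
  moreover have "s0 = sqrt (ln (1.25 / del)) / (eps * real n)" by (simp add: s0_def Lg_eq)
  ultimately show ?thesis
    using case_lt case_eq case_gt by (cases "k < d"; cases "k = d") auto
qed

end

theorem theorem2:
  shows "\<exists>c>1. \<exists>C>0. \<exists>A::com. \<forall>d\<ge>1. \<forall>k\<ge>1. \<exists>(Cdk::real)
      (P::nat poly).
    Cdk \<le> (C * real k) ^ k * real d powr max 1 (real k / 2) \<and>
    (\<forall>n\<ge>1. \<forall>\<epsilon> \<delta>::real.
       1 / real n < \<epsilon> \<and> \<epsilon> < 1 \<and> 0 < \<delta> \<and> \<delta> < 1 \<and>
       \<epsilon> * real n / sqrt (ln (1.25 / \<delta>)) \<ge> (c * real k) ^ max d k \<longrightarrow>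
       (\<forall>X\<in>datasets n (cube d). \<forall>\<omega>\<in>space tape.
          halts_within (poly P n) \<omega> A (init_state d k \<epsilon> \<delta> X)) \<and>
       (\<forall>X\<in>datasets n (cube d).
          synthesize A d k \<epsilon> \<delta> X \<in> measurable tape (dataset_space d)) \<and>
       differentially_private (cube d) n (dataset_space d) \<epsilon> \<delta> (mechanism A d k \<epsilon>
           \<delta>) \<and>
       (\<forall>X\<in>datasets n (cube d).
          integrable (mechanism A d k \<epsilon> \<delta> X) (\<lambda>Y. dk d k (empirical (mset X)) (empirical
              Y)) \<and>
          (\<integral>Y. dk d k (empirical (mset X)) (empirical Y) \<partial>mechanism A d k \<epsilon> \<delta> X)
              \<le>
            (if k < d then Cdk * (sqrt (ln (1.25 / \<delta>)) / (\<epsilon> * real n)) powr (real k / real d)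
             else if k = d then Cdk * sqrt (ln (1.25 / \<delta>)) * ln (\<epsilon> * real n) / (\<epsilon> * real n)
             else Cdk * sqrt (ln (1.25 / \<delta>)) / (\<epsilon> * real n))))"
proof (rule exI[of _ 16], intro conjI, simp, rule exI[of _ Cc], intro conjI, simp add: Cc_def,
    rule exI[of _ synth_program], intro allI impI)
  fix d k :: nat assume dk: "1 \<le> d" "1 \<le> k"
  obtain P where P: "\<And>n e u. synth.Ttot d k n e u \<le> poly P n"
    using polyb_Ttot[of d k] unfolding polyb_def by blast
  \<comment> \<open>The largest constant permitted by the first conjunct is taken, which leaves only
    the error bound to be checked.\<close>
  let ?C = "(Cc * real k) ^ k * real d powr max 1 (real k / 2)"
  show "\<exists>(Cdk::real) (P::nat poly).
    Cdk \<le> (Cc * real k) ^ k * real d powr max 1 (real k / 2) \<and>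
    (\<forall>n\<ge>1. \<forall>\<epsilon> \<delta>::real.
       1 / real n < \<epsilon> \<and> \<epsilon> < 1 \<and> 0 < \<delta> \<and> \<delta> < 1 \<and>
       \<epsilon> * real n / sqrt (ln (1.25 / \<delta>)) \<ge> (16 * real k) ^ max d k \<longrightarrow>
       (\<forall>X\<in>datasets n (cube d). \<forall>\<omega>\<in>space tape.
          halts_within (poly P n) \<omega> synth_program (init_state d k \<epsilon> \<delta> X)) \<and>
       (\<forall>X\<in>datasets n (cube d).
          synthesize synth_program d k \<epsilon> \<delta> X \<in> measurable tape (dataset_space d)) \<and>
       differentially_private (cube d) n (dataset_space d) \<epsilon> \<delta> (mechanism synth_program d k
           \<epsilon> \<delta>) \<and>
       (\<forall>X\<in>datasets n (cube d).
          integrable (mechanism synth_program d k \<epsilon> \<delta> X) (\<lambda>Y. dk d k (empirical (mset X))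
              (empirical Y)) \<and>
          (\<integral>Y. dk d k (empirical (mset X)) (empirical Y) \<partial>mechanism synth_program d k \<epsilon>
              \<delta> X) \<le>
            (if k < d then Cdk * (sqrt (ln (1.25 / \<delta>)) / (\<epsilon> * real n)) powr (real k / real d)
             else if k = d then Cdk * sqrt (ln (1.25 / \<delta>)) * ln (\<epsilon> * real n) / (\<epsilon> * real n)
             else Cdk * sqrt (ln (1.25 / \<delta>)) / (\<epsilon> * real n))))"
  proof (rule exI[of _ ?C], rule exI[of _ P], rule conjI, rule order_refl, intro allI impI)
    fix n :: nat and \<epsilon> \<delta> :: real
    assume "1 \<le> n" and "1 / real n < \<epsilon> \<and> \<epsilon> < 1 \<and> 0 < \<delta> \<and> \<delta> < 1 \<and>
       \<epsilon> * real n / sqrt (ln (1.25 / \<delta>)) \<ge> (16 * real k) ^ max d k"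
    with dk interpret synth_ok d k n \<epsilon> \<delta> by unfold_locales auto
    have "halts_within (poly P n) \<omega> synth_program (init_state d k \<epsilon> \<delta> X)" if "X \<in>
        datasets n (cube d)" for X \<omega>
      using exec_synth_program(1)[OF that, of \<omega>] P[of n \<epsilon> \<delta>] unfolding halts_within_def by
          (meson le_trans)
    moreover have "synthesize synth_program d k \<epsilon> \<delta> X \<in> measurable tape (dataset_space d)" if
        "X \<in> datasets n (cube d)" for X
    proof -
      have "synthesize synth_program d k \<epsilon> \<delta> X = sout X" using exec_synth_program(2)[OF that] by
          (rule ext)
      then show ?thesis using sout_measurable[of X] by simp
    qed
    moreover have "integrable (mechanism synth_program d k \<epsilon> \<delta> X) (\<lambda>Y. dk d k (empirical
        (mset X)) (empirical Y))"
      if "X \<in> datasets n (cube d)" for X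
      unfolding mechanism_eq[OF that] by (rule expected_error(1)[OF that])
    ultimately show "(\<forall>X\<in>datasets n (cube d). \<forall>\<omega>\<in>space tape.
          halts_within (poly P n) \<omega> synth_program (init_state d k \<epsilon> \<delta> X)) \<and>
       (\<forall>X\<in>datasets n (cube d).
          synthesize synth_program d k \<epsilon> \<delta> X \<in> measurable tape (dataset_space d)) \<and>
       differentially_private (cube d) n (dataset_space d) \<epsilon> \<delta> (mechanism synth_program d k
           \<epsilon> \<delta>) \<and>
       (\<forall>X\<in>datasets n (cube d).
          integrable (mechanism synth_program d k \<epsilon> \<delta> X) (\<lambda>Y. dk d k (empirical (mset X))
              (empirical Y)) \<and>
          (\<integral>Y. dk d k (empirical (mset X)) (empirical Y) \<partial>mechanism synth_program d k \<epsilon>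
              \<delta> X) \<le>
            (if k < d then ?C * (sqrt (ln (1.25 / \<delta>)) / (\<epsilon> * real n)) powr (real k / real d)
             else if k = d then ?C * sqrt (ln (1.25 / \<delta>)) * ln (\<epsilon> * real n) / (\<epsilon> * real n)
             else ?C * sqrt (ln (1.25 / \<delta>)) / (\<epsilon> * real n)))"
      using differentially_private_mechanism error_bound by blast
  qed
qed

end
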